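(* Let $\kappa$ be a kernel and let $G_n$ be one of: (a) $G_n=G(A_n)$ with $\kappa$ a kernel on a probability space and $(A_n)$ (possibly random) symmetric $n\times n$ non-negative matrices with $\delta_\square(A_n,\kappa)\to0$ in probability; (b) $G_n=G^{\mathcal V}(n,\kappa_n)$ with $\mathcal V$ a generalized vertex space and $(\kappa_n)$ graphical on $\mathcal V$ with limit $\kappa$; (c) $G_n=G^{\mathcal V}(n,\kappa_n)$ with $\mathcal V$ an i.i.d. vertex space on $(\mathcal S,\mu)$ and $\|\kappa_n-\kappa\|_{L^1(\mu\times\mu)}\to0$ (e.g. $\kappa_n=\kappa$). Then: (i) If $\chi(\kappa)=\infty$, then $\chi(G_n)\to\infty$ in probability and $\mathbb E\chi(G_n)\to\infty$. In particular this holds if $\kappa$ is critical and $T_\kappa$ is compact on $L^2(\mu)$, or if $\kappa$ is supercritical. (ii) If $\hat\chi(\kappa)=\infty$, then $\hat\chi(G_n)\to\infty$ in probability and $\mathbb E\hat\chi(G_n)\to\infty$.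
   Context: For a finite graph $G$ on $n$ vertices with components $\mathcal C_1,\mathcal C_2,\dots$ ordered by decreasing size: $\chi(G)=\frac1n\sum_i|\mathcal C_i|^2$, $\hat\chi(G)=\frac1n\sum_{i\ge2}|\mathcal C_i|^2$. Type space $(\mathcal S,\mu)$: measure space with $0<\mu(\mathcal S)<\infty$; kernel: symmetric measurable $\kappa:\mathcal S^2\to[0,\infty)$ with $\int\kappa<\infty$ (and $\int\kappa(x,y)d\mu(y)<\infty$ for all $x$). $T_\kappa f(x)=\int\kappa(x,y)f(y)d\mu(y)$; $\|T_\kappa\|=\sup\{\|T_\kappa f\|_{L^2(\mu)}:f\ge0,\|f\|_{L^2(\mu)}\le1\}$; $\kappa$ is critical if $\|T_\kappa\|=1$ and supercritical if $\|T_\kappa\|>1$. The branching process $\mathfrak X_\kappa(x)$: one initial particle of type $x$, each particle of type $y$ independently has children with types forming a Poisson process of intensity $\kappa(y,z)d\mu(z)$; $\chi(\kappa)=\mu(\mathcal S)^{-1}\int\mathbb E|\mathfrak X_\kappa(x)|d\mu(x)$, $\hat\chi(\kappa)=\mu(\mathcal S)^{-1}\int\mathbb E(|\mathfrak X_\kappa(x)|;|\mathfrak X_\kappa(x)|<\infty)d\mu(x)$. $G(A_n)$: edges $ij$ of $\{1,\dots,n\}$ independent with probability $\min(a_{ij}/n,1)$; $A_n$ identified with the step kernel on $[0,1]$ equal to $a_{ij}$ on $((i-1)/n,i/n]\times((j-1)/n,j/n]$; $\delta_\square(\kappa_1,\kappa_2)=\inf_\nu\sup_{\|f\|_\infty,\|g\|_\infty\le1}|\int\int(\kappa_1(x_1,y_1)-\kappa_2(x_2,y_2))f(x_1,x_2)g(y_1,y_2)d\nu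 d\nu|$ over couplings $\nu$ of the two probability spaces. Generalized vertex space: $\mathcal S$ separable metric, $\mu$ Borel with $0<\mu(\mathcal S)<\infty$, sequences $\mathbf x_n=(x_1,\dots,x_{v_n})$ with $\frac1n\sum\delta_{x_i}\to\mu$ weakly in probability; $G^{\mathcal V}(n,\kappa_n)$ on $\{1,\dots,v_n\}$ with edges independent with probability $\min(\kappa_n(x_i,x_j)/n,1)$ given $\mathbf x_n$. $\kappa$ graphical on $\mathcal V$: a.e. continuous, integrable, $\frac1n\mathbb E e(G^{\mathcal V}(n,\kappa))\to\frac12\int\kappa$; $(\kappa_n)$ graphical with limit $\kappa$: for a.e. $(y,z)$, $y_n\to y,z_n\to z\Rightarrow\kappa_n(y_n,z_n)\to\kappa(y,z)$, $\kappa$ graphical, and $\frac1n\mathbb Ee(G^{\mathcal V}(n,\kappa_n))\to\frac12\int\kappa$. i.i.d. vertex space: $(\mathcal S,\mu)$ a probability space, $x_1,\dots,x_n$ i.i.d. $\mu$. *)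

theory Defs
  imports "HOL-Probability.Probability"
begin

text \<open>A graph on N vertices is given by N and an edge set of pairs (vertex i is
  the (i+1)-st vertex of the paper).  Components are classes of the reflexive
  transitive closure of the symmetric adjacency relation restricted to {0..<N}.\<close>

type_synonym edges = "(nat \<times> nat) set"

definition adj :: "nat \<Rightarrow> edges \<Rightarrow> (nat \<times> nat) set" where
  "adj N E = {(i, j). i < N \<and> j < N \<and> ((i, j) \<in> E \<or> (j, i) \<in> E)}"

definition comp :: "nat \<Rightarrow> edges \<Rightarrow> nat \<Rightarrow> nat set" where
  "comp N E v = (adj N E)\<^sup>* `` {v}"

definition comps :: "nat \<Rightarrow> edges \<Rightarrow> nat set set" where
  "comps N E = comp N E ` {..<N}"

definition chi :: "nat \<Rightarrow> edges \<Rightarrow> real" where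
  "chi N E = (\<Sum>C\<in>comps N E. real (card C) ^ 2) / real N"

definition chi_hat :: "nat \<Rightarrow> edges \<Rightarrow> real" where
  "chi_hat N E = ((\<Sum>C\<in>comps N E. real (card C) ^ 2)
                   - real (Max (card ` comps N E)) ^ 2) / real N"

definition rg :: "nat \<Rightarrow> (nat \<Rightarrow> nat \<Rightarrow> real) \<Rightarrow> edges pmf" where
  "rg N p = map_pmf (\<lambda>f. {e. f e})
      (Pi_pmf {(i, j). i < j \<and> j < N} False (\<lambda>(i, j). bernoulli_pmf (p i j)))"

text \<open>A random graph sequence: on a probability space M, random vertex number N n
  and random edge probabilities p n; given omega, the graph G_n is rg (N n omega) (p n omega).
  gprob = P(G_n has property P), gexp = E F(G_n).\<close>
definition gprob :: "'w measure \<Rightarrow> (nat \<Rightarrow> 'w \<Rightarrow> nat) \<Rightarrow> (nat \<Rightarrow> 'w \<Rightarrow> nat \<Rightarrow> nat \<Rightarrow> real)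
    \<Rightarrow> (nat \<Rightarrow> edges \<Rightarrow> bool) \<Rightarrow> nat \<Rightarrow> ennreal" where
  "gprob M N p P n =
     (\<integral>\<^sup>+\<omega>. ennreal (measure_pmf.prob (rg (N n \<omega>) (p n \<omega>)) {E. P (N n \<omega>) E}) \<partial>M)"

definition gexp :: "'w measure \<Rightarrow> (nat \<Rightarrow> 'w \<Rightarrow> nat) \<Rightarrow> (nat \<Rightarrow> 'w \<Rightarrow> nat \<Rightarrow> nat \<Rightarrow> real)
    \<Rightarrow> (nat \<Rightarrow> edges \<Rightarrow> real) \<Rightarrow> nat \<Rightarrow> ennreal" where
  "gexp M N p F n =
     (\<integral>\<^sup>+\<omega>. (\<integral>\<^sup>+E. ennreal (F (N n \<omega>) E) \<partial>measure_pmf (rg (N n \<omega>) (p n \<omega>))) \<partial>M)"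

definition to_infty :: "'w measure \<Rightarrow> (nat \<Rightarrow> 'w \<Rightarrow> nat) \<Rightarrow> (nat \<Rightarrow> 'w \<Rightarrow> nat \<Rightarrow> nat \<Rightarrow> real)
    \<Rightarrow> (nat \<Rightarrow> edges \<Rightarrow> real) \<Rightarrow> bool" where
  "to_infty M N p F \<longleftrightarrow>
     (\<forall>K::real. (\<lambda>n. gprob M N p (\<lambda>m E. K < F m E) n) \<longlonglongrightarrow> 1) \<and>
     (\<lambda>n. gexp M N p F n) \<longlonglongrightarrow> top"

definition type_space :: "'s measure \<Rightarrow> bool" where
  "type_space \<mu> \<longleftrightarrow> 0 < emeasure \<mu> (space \<mu>) \<and> emeasure \<mu> (space \<mu>) < \<infinity>"

definition symker :: "'s measure \<Rightarrow> ('s \<Rightarrow> 's \<Rightarrow> real) \<Rightarrow> bool" where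
  "symker \<mu> \<kappa> \<longleftrightarrow> (\<lambda>z. \<kappa> (fst z) (snd z)) \<in> borel_measurable (\<mu> \<Otimes>\<^sub>M \<mu>) \<and>
     (\<forall>x\<in>space \<mu>. \<forall>y\<in>space \<mu>. \<kappa> x y = \<kappa> y x \<and> 0 \<le> \<kappa> x y)"

definition kernel :: "'s measure \<Rightarrow> ('s \<Rightarrow> 's \<Rightarrow> real) \<Rightarrow> bool" where
  "kernel \<mu> \<kappa> \<longleftrightarrow> type_space \<mu> \<and> symker \<mu> \<kappa> \<and>
     integrable (\<mu> \<Otimes>\<^sub>M \<mu>) (\<lambda>z. \<kappa> (fst z) (snd z)) \<and>
     (\<forall>x\<in>space \<mu>. (\<integral>\<^sup>+y. ennreal (\<kappa> x y) \<partial>\<mu>) < \<infinity>)"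

definition op_norm_sq :: "'s measure \<Rightarrow> ('s \<Rightarrow> 's \<Rightarrow> real) \<Rightarrow> ennreal" where
  "op_norm_sq \<mu> \<kappa> =
     (SUP f \<in> {f. f \<in> borel_measurable \<mu> \<and> (\<forall>x\<in>space \<mu>. 0 \<le> f x) \<and>
                  (\<integral>\<^sup>+x. ennreal ((f x)\<^sup>2) \<partial>\<mu>) \<le> 1}.
        \<integral>\<^sup>+x. (\<integral>\<^sup>+y. ennreal (\<kappa> x y * f y) \<partial>\<mu>) ^ 2 \<partial>\<mu>)"

definition critical :: "'s measure \<Rightarrow> ('s \<Rightarrow> 's \<Rightarrow> real) \<Rightarrow> bool" where
  "critical \<mu> \<kappa> \<longleftrightarrow> op_norm_sq \<mu> \<kappa> = 1"

definition supercritical :: "'s measure \<Rightarrow> ('s \<Rightarrow> 's \<Rightarrow> real) \<Rightarrow> bool" where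
  "supercritical \<mu> \<kappa> \<longleftrightarrow> 1 < op_norm_sq \<mu> \<kappa>"

definition L2 :: "'s measure \<Rightarrow> ('s \<Rightarrow> real) \<Rightarrow> bool" where
  "L2 \<mu> f \<longleftrightarrow> f \<in> borel_measurable \<mu> \<and> (\<integral>\<^sup>+x. ennreal ((f x)\<^sup>2) \<partial>\<mu>) < \<infinity>"

definition Top :: "'s measure \<Rightarrow> ('s \<Rightarrow> 's \<Rightarrow> real) \<Rightarrow> ('s \<Rightarrow> real) \<Rightarrow> 's \<Rightarrow> real" where
  "Top \<mu> \<kappa> f x = (\<integral>y. \<kappa> x y * f y \<partial>\<mu>)"

definition compact_T :: "'s measure \<Rightarrow> ('s \<Rightarrow> 's \<Rightarrow> real) \<Rightarrow> bool" where
  "compact_T \<mu> \<kappa> \<longleftrightarrow>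
     (\<forall>f. L2 \<mu> f \<longrightarrow> (AE x in \<mu>. integrable \<mu> (\<lambda>y. \<kappa> x y * f y)) \<and> L2 \<mu> (Top \<mu> \<kappa> f)) \<and>
     (\<forall>F::nat \<Rightarrow> 's \<Rightarrow> real. (\<forall>k. L2 \<mu> (F k) \<and> (\<integral>\<^sup>+x. ennreal ((F k x)\<^sup>2) \<partial>\<mu>) \<le> 1) \<longrightarrow>
        (\<exists>r g. strict_mono r \<and> L2 \<mu> g \<and>
           (\<lambda>k. \<integral>\<^sup>+x. ennreal ((Top \<mu> \<kappa> (F (r k)) x - g x)\<^sup>2) \<partial>\<mu>) \<longlonglongrightarrow> 0))"

text \<open>A particle of type x has Poisson(m(x)) children, m(x) = int kappa(x,z) dmu(z), with i.i.d.
  types of law kappa(x,z)dmu(z)/m(x) (this is the Poisson process of intensity kappa(x,z)dmu(z)).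
  bp_trunc d x is the law of the number of particles in generations 0..d of X_kappa(x);
  it is defined recursively: Z_{d+1}(x) = 1 + sum over children y of independent copies of
  Z_d(y).  The total size |X_kappa(x)| is the increasing limit of Z_d(x).\<close>

definition offmass :: "'s measure \<Rightarrow> ('s \<Rightarrow> 's \<Rightarrow> real) \<Rightarrow> 's \<Rightarrow> real" where
  "offmass \<mu> \<kappa> x = enn2real (\<integral>\<^sup>+y. ennreal (\<kappa> x y) \<partial>\<mu>)"

primrec iid_sum :: "nat pmf \<Rightarrow> nat \<Rightarrow> nat pmf" where
  "iid_sum q 0 = return_pmf 0"
| "iid_sum q (Suc N) = bind_pmf q (\<lambda>w. map_pmf (\<lambda>s. w + s) (iid_sum q N))"

text \<open>law of Z(y) for a child y of a type-x particle\<close>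
definition child_mix :: "'s measure \<Rightarrow> ('s \<Rightarrow> 's \<Rightarrow> real) \<Rightarrow> ('s \<Rightarrow> nat pmf) \<Rightarrow> 's \<Rightarrow> nat pmf" where
  "child_mix \<mu> \<kappa> q x = embed_pmf (\<lambda>k. (\<integral>y. \<kappa> x y * pmf (q y) k \<partial>\<mu>) / offmass \<mu> \<kappa> x)"

definition children_sum :: "'s measure \<Rightarrow> ('s \<Rightarrow> 's \<Rightarrow> real) \<Rightarrow> ('s \<Rightarrow> nat pmf) \<Rightarrow> 's \<Rightarrow> nat pmf" where
  "children_sum \<mu> \<kappa> q x =
     (if offmass \<mu> \<kappa> x = 0 then return_pmf 0
      else bind_pmf (poisson_pmf (offmass \<mu> \<kappa> x)) (iid_sum (child_mix \<mu> \<kappa> q x)))"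

primrec bp_trunc :: "'s measure \<Rightarrow> ('s \<Rightarrow> 's \<Rightarrow> real) \<Rightarrow> nat \<Rightarrow> 's \<Rightarrow> nat pmf" where
  "bp_trunc \<mu> \<kappa> 0 x = return_pmf 1"
| "bp_trunc \<mu> \<kappa> (Suc d) x = map_pmf Suc (children_sum \<mu> \<kappa> (bp_trunc \<mu> \<kappa> d) x)"

definition bp_mean :: "'s measure \<Rightarrow> ('s \<Rightarrow> 's \<Rightarrow> real) \<Rightarrow> 's \<Rightarrow> ennreal" where
  "bp_mean \<mu> \<kappa> x = (SUP d. \<integral>\<^sup>+k. ennreal (real k) \<partial>measure_pmf (bp_trunc \<mu> \<kappa> d x))"

text \<open>P(|X_kappa(x)| <= k) = lim_d P(Z_d(x) <= k) (decreasing limit)\<close>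
definition bp_cdf :: "'s measure \<Rightarrow> ('s \<Rightarrow> 's \<Rightarrow> real) \<Rightarrow> 's \<Rightarrow> nat \<Rightarrow> real" where
  "bp_cdf \<mu> \<kappa> x k = (INF d. measure_pmf.prob (bp_trunc \<mu> \<kappa> d x) {..k})"

definition bp_point :: "'s measure \<Rightarrow> ('s \<Rightarrow> 's \<Rightarrow> real) \<Rightarrow> 's \<Rightarrow> nat \<Rightarrow> real" where
  "bp_point \<mu> \<kappa> x k = bp_cdf \<mu> \<kappa> x k - (if k = 0 then 0 else bp_cdf \<mu> \<kappa> x (k - 1))"

definition bp_mean_fin :: "'s measure \<Rightarrow> ('s \<Rightarrow> 's \<Rightarrow> real) \<Rightarrow> 's \<Rightarrow> ennreal" where
  "bp_mean_fin \<mu> \<kappa> x = (\<integral>\<^sup>+k. ennreal (real k * bp_point \<mu> \<kappa> x k) \<partial>count_space UNIV)"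

definition chi_k :: "'s measure \<Rightarrow> ('s \<Rightarrow> 's \<Rightarrow> real) \<Rightarrow> ennreal" where
  "chi_k \<mu> \<kappa> = (\<integral>\<^sup>+x. bp_mean \<mu> \<kappa> x \<partial>\<mu>) / emeasure \<mu> (space \<mu>)"

definition chi_hat_k :: "'s measure \<Rightarrow> ('s \<Rightarrow> 's \<Rightarrow> real) \<Rightarrow> ennreal" where
  "chi_hat_k \<mu> \<kappa> = (\<integral>\<^sup>+x. bp_mean_fin \<mu> \<kappa> x \<partial>\<mu>) / emeasure \<mu> (space \<mu>)"

definition I01 :: "real measure" where
  "I01 = restrict_space lborel {0..1}"

text \<open>step kernel of a matrix: value a_{ij} on ((i-1)/n,i/n] x ((j-1)/n,j/n] (0-based indices)\<close>
definition step_kernel :: "nat \<Rightarrow> (nat \<Rightarrow> nat \<Rightarrow> real) \<Rightarrow> real \<Rightarrow> real \<Rightarrow> real" where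
  "step_kernel n a x y = a (nat \<lceil>real n * x\<rceil> - 1) (nat \<lceil>real n * y\<rceil> - 1)"

definition coupling :: "'a measure \<Rightarrow> 'b measure \<Rightarrow> ('a \<times> 'b) measure \<Rightarrow> bool" where
  "coupling P Q \<nu> \<longleftrightarrow> prob_space \<nu> \<and> sets \<nu> = sets (P \<Otimes>\<^sub>M Q) \<and>
     distr \<nu> P fst = P \<and> distr \<nu> Q snd = Q"

definition cut_dist :: "'a measure \<Rightarrow> ('a \<Rightarrow> 'a \<Rightarrow> real) \<Rightarrow> 'b measure \<Rightarrow> ('b \<Rightarrow> 'b \<Rightarrow> real) \<Rightarrow> real" where
  "cut_dist P k1 Q k2 =
     (INF \<nu> \<in> {\<nu>. coupling P Q \<nu>}.
        SUP fg \<in> {(f, g). f \<in> borel_measurable \<nu> \<and> g \<in> borel_measurable \<nu> \<and>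
                          (\<forall>z. \<bar>f z\<bar> \<le> 1) \<and> (\<forall>z. \<bar>g z\<bar> \<le> 1)}.
          \<bar>\<integral>uv. (k1 (fst (fst uv)) (fst (snd uv)) - k2 (snd (fst uv)) (snd (snd uv)))
                  * fst fg (fst uv) * snd fg (snd uv) \<partial>(\<nu> \<Otimes>\<^sub>M \<nu>)\<bar>)"

text \<open>Generalized vertex space: random v_n and x_n = (x_0,...,x_{v_n - 1}) on a probability space M,
  with (1/n) sum delta_{x_i} -> mu weakly in probability (tested against every bounded
  continuous f).\<close>
definition gen_vertex_space :: "'s::metric_space measure \<Rightarrow> 'w measure \<Rightarrow> (nat \<Rightarrow> 'w \<Rightarrow> nat)
    \<Rightarrow> (nat \<Rightarrow> 'w \<Rightarrow> nat \<Rightarrow> 's) \<Rightarrow> bool" where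
  "gen_vertex_space \<mu> M v x \<longleftrightarrow> sets \<mu> = sets borel \<and> type_space \<mu> \<and> prob_space M \<and>
     (\<forall>n. v n \<in> M \<rightarrow>\<^sub>M count_space UNIV) \<and> (\<forall>n i. (\<lambda>\<omega>. x n \<omega> i) \<in> M \<rightarrow>\<^sub>M borel) \<and>
     (\<forall>f::'s \<Rightarrow> real. continuous_on UNIV f \<and> bounded (range f) \<longrightarrow>
        (\<forall>\<epsilon>>0. (\<lambda>n. measure M {\<omega>\<in>space M.
            \<epsilon> < \<bar>(\<Sum>i<v n \<omega>. f (x n \<omega> i)) / real n - (\<integral>y. f y \<partial>\<mu>)\<bar>}) \<longlonglongrightarrow> 0))"

text \<open>E e(G^V(n,k)) (conditionally on x_n the edges are independent)\<close>
definition exp_edges :: "'w measure \<Rightarrow> (nat \<Rightarrow> 'w \<Rightarrow> nat) \<Rightarrow> (nat \<Rightarrow> 'w \<Rightarrow> nat \<Rightarrow> 's)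
    \<Rightarrow> ('s \<Rightarrow> 's \<Rightarrow> real) \<Rightarrow> nat \<Rightarrow> ennreal" where
  "exp_edges M v x k n =
     (\<integral>\<^sup>+\<omega>. ennreal (\<Sum>j<v n \<omega>. \<Sum>i<j. min (k (x n \<omega> i) (x n \<omega> j) / real n) 1) \<partial>M)"

definition graphical :: "'s::metric_space measure \<Rightarrow> 'w measure \<Rightarrow> (nat \<Rightarrow> 'w \<Rightarrow> nat)
    \<Rightarrow> (nat \<Rightarrow> 'w \<Rightarrow> nat \<Rightarrow> 's) \<Rightarrow> ('s \<Rightarrow> 's \<Rightarrow> real) \<Rightarrow> bool" where
  "graphical \<mu> M v x \<kappa> \<longleftrightarrow>
     (AE z in \<mu> \<Otimes>\<^sub>M \<mu>. isCont (\<lambda>z. \<kappa> (fst z) (snd z)) z) \<and>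
     integrable (\<mu> \<Otimes>\<^sub>M \<mu>) (\<lambda>z. \<kappa> (fst z) (snd z)) \<and>
     (\<lambda>n. exp_edges M v x \<kappa> n / ennreal (real n))
        \<longlonglongrightarrow> ennreal ((\<integral>z. \<kappa> (fst z) (snd z) \<partial>(\<mu> \<Otimes>\<^sub>M \<mu>)) / 2)"

definition graphical_seq :: "'s::metric_space measure \<Rightarrow> 'w measure \<Rightarrow> (nat \<Rightarrow> 'w \<Rightarrow> nat)
    \<Rightarrow> (nat \<Rightarrow> 'w \<Rightarrow> nat \<Rightarrow> 's) \<Rightarrow> (nat \<Rightarrow> 's \<Rightarrow> 's \<Rightarrow> real) \<Rightarrow> ('s \<Rightarrow> 's \<Rightarrow> real) \<Rightarrow> bool" where
  "graphical_seq \<mu> M v x \<kappa>s \<kappa> \<longleftrightarrow>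
     (AE z in \<mu> \<Otimes>\<^sub>M \<mu>. \<forall>ys zs. ys \<longlonglongrightarrow> fst z \<longrightarrow> zs \<longlonglongrightarrow> snd z \<longrightarrow>
          (\<lambda>n. \<kappa>s n (ys n) (zs n)) \<longlonglongrightarrow> \<kappa> (fst z) (snd z)) \<and>
     graphical \<mu> M v x \<kappa> \<and>
     (\<lambda>n. exp_edges M v x (\<kappa>s n) n / ennreal (real n))
        \<longlonglongrightarrow> ennreal ((\<integral>z. \<kappa> (fst z) (snd z) \<partial>(\<mu> \<Otimes>\<^sub>M \<mu>)) / 2)"

definition iid_vertex_space :: "'s measure \<Rightarrow> 'w measure \<Rightarrow> (nat \<Rightarrow> 'w \<Rightarrow> nat \<Rightarrow> 's) \<Rightarrow> bool" where
  "iid_vertex_space \<mu> M x \<longleftrightarrow> prob_space \<mu> \<and> prob_space M \<and>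
     (\<forall>n i. i < n \<longrightarrow> (\<lambda>\<omega>. x n \<omega> i) \<in> M \<rightarrow>\<^sub>M \<mu>) \<and>
     (\<forall>n. prob_space.indep_vars M (\<lambda>_. \<mu>) (\<lambda>i \<omega>. x n \<omega> i) {..<n}) \<and>
     (\<forall>n i. i < n \<longrightarrow> distr M \<mu> (\<lambda>\<omega>. x n \<omega> i) = \<mu>)"

definition suscept_concl :: "'s measure \<Rightarrow> ('s \<Rightarrow> 's \<Rightarrow> real) \<Rightarrow> 'w measure
    \<Rightarrow> (nat \<Rightarrow> 'w \<Rightarrow> nat) \<Rightarrow> (nat \<Rightarrow> 'w \<Rightarrow> nat \<Rightarrow> nat \<Rightarrow> real) \<Rightarrow> bool" where
  "suscept_concl \<mu> \<kappa> M N p \<longleftrightarrow>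
     ((chi_k \<mu> \<kappa> = top \<or> (critical \<mu> \<kappa> \<and> compact_T \<mu> \<kappa>) \<or> supercritical \<mu> \<kappa>)
        \<longrightarrow> to_infty M N p chi) \<and>
     (chi_hat_k \<mu> \<kappa> = top \<longrightarrow> to_infty M N p chi_hat)"

end

theory Submission
 imports Defs "HOL-Real_Asymp.Real_Asymp"
begin

text \<open>The susceptibilities are read off generating functions. For 0 < s < 1 the functions
 g_d(x) = E s^Z_d(x) of the branching process satisfy g_0 = s and
 g_(d+1)(x) = s exp(- int kappa(x,y) (1 - g_d(y)) dmu(y)), and if chi(kappa) or its finite part is infinite,
 the difference quotients in s of int g_d become arbitrarily large near s = 1.
 In a random graph with edge probabilities p_ij, the average of s^|B_d(v)| over the balls of radius d
 concentrates near the solution of the same recursion for the matrix p, as soon as the sum of p_ij^2 is o(n) and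
 the row sums are uniformly integrable; these averages bound chi(G_n) and its hat version from below.
 It remains to compare the two recursions. A Gronwall argument with truncated row sums shows that the recursion is
 continuous in the kernel, for the cut norm as well as for the L1 norm. In case (a) this suffices. In cases (b) and (c)
 kappa is first replaced by a bounded kernel (a Lipschitz minorant of the kernels kappa_n, or a truncation) for which a
 law of large numbers holds along the sampled vertices.
 If chi(kappa) is finite, the L2 norms of T^j 1 tend to 0, which excludes supercritical kernels and, by compactness,
 critical ones.\<close>

section \<open>Convergence in probability\<close>

text \<open>Susceptibilities are not continuous under the limits considered, since a few large
  components can dominate the sum of squares. As the claimed limit is infinite, lower bounds
  suffice, and these come from bounded functions of the component size k: (1 - s^k) / (1 - s) is at
  most k and increases to k as s tends to 1. For the version without the largest component the
  quotient (t^k - s^k) / (t - s) with t < 1 is used: k times it is at most 1 / ((1 - t) (t - s)) for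
  every k, so one giant component is invisible after division by n, just as infinite trees do not
  enter the finite part of the mean. The radius d stays fixed while n grows, so no uniformity in d
  is required. The obstacle is unbounded expected degrees: an error in one generation is multiplied
  by row sums in the next. Therefore errors are measured in mean, symmetry turns column sums into
  row sums, and row sums are cut at a level K whose excess is paid separately. The vertex data are
  frozen throughout, so that the graph has deterministic edge probabilities and independent
  edges.\<close>

lemmas B_integral_nonneg = Bochner_Integration.integral_nonneg
 and B_integral_cong = Bochner_Integration.integral_cong
 and B_integrable_diff = Bochner_Integration.integrable_diff
 and B_integrable_bound = Bochner_Integration.integrable_bound
 and B_integral_diff = Bochner_Integration.integral_diff
 and B_integral_sum = Bochner_Integration.integral_sum
 and B_integrable_add = Bochner_Integration.integrable_add
 and B_integral_add = Bochner_Integration.integral_add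
 and B_integrable_sum = Bochner_Integration.integrable_sum

abbreviation (input) sqm :: "'a measure => ('a \<times> 'a) measure" where "sqm \<mu> \<equiv> \<mu> \<Otimes>\<^sub>M \<mu>"

text \<open>Asks for a measurable set inside the event rather than for the probability of the event:
  later events speak about the existence of a coupling or about conditional probabilities, whose
  measurability is not established.\<close>

definition whp :: "'w measure => (nat => 'w => bool) => bool" where
 "whp M Q \<longleftrightarrow> (\<forall>e>0. \<forall>\<^sub>F n in sequentially.
  \<exists>S\<in>sets M. 1 - e \<le> measure M S \<and> (\<forall>w\<in>S. Q n w))"

abbreviation mdist :: "nat => nat => (nat => nat => real) => (nat => nat => real) => real" where
 "mdist n N p q \<equiv> (\<Sum>i<N. \<Sum>j<N. \<bar>p i j - q i j\<bar>) / n"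

text \<open>The mass of the expected degrees above level K. That it becomes small as K grows,
  uniformly in n, is the uniform integrability required of the row sums. The divisor is n and not N
  because the number of vertices may differ from the index n.\<close>

abbreviation row_excess :: "nat => nat => (nat => nat => real) => real => real" where
 "row_excess n N p K \<equiv> (\<Sum>i<N. max 0 ((\<Sum>j<N. p i j) - K)) / n"

lemma whp_mono:
 assumes "whp M Q" "\<forall>\<^sub>F n in sequentially. \<forall>w\<in>space M. Q n w \<longrightarrow> R n w"
 shows "whp M R"
 unfolding whp_def
proof (intro allI impI)
 fix e :: real assume "e > 0"
 then have "\<forall>\<^sub>F n in sequentially. \<exists>S\<in>sets M. 1 - e \<le> measure M S \<and> (\<forall>w\<in>S. Q n w)"
  using assms(1) by (auto simp: whp_def)
 with assms(2) show "\<forall>\<^sub>F n in sequentially. \<exists>S\<in>sets M. 1 - e \<le> measure M S \<and> (\<forall>w\<in>S. R n w)"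
  by eventually_elim (meson sets.sets_into_space subset_iff)
qed

lemma (in prob_space) prob_Int_ge:
 assumes S: "S \<in> events" "1 - e / 2 \<le> prob S" and T: "T \<in> events" "1 - e / 2 \<le> prob T"
 shows "1 - e \<le> prob (S \<inter> T)"
proof -
 have "prob (space M - (S \<inter> T)) \<le> prob ((space M - S) \<union> (space M - T))"
  using S T by (intro finite_measure_mono) auto
 also have "... \<le> prob (space M - S) + prob (space M - T)"
  using S T by (intro measure_Un_le) auto
 finally show ?thesis
  using S T prob_compl[of S] prob_compl[of T] prob_compl[of "S \<inter> T"] by auto
qed

lemma (in prob_space) whp_conj:
 assumes "whp M Q" "whp M R"
 shows "whp M (\<lambda>n w. Q n w \<and> R n w)"
 unfolding whp_def
proof (intro allI impI)
 fix e :: real assume "e > 0"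
 then have "e / 2 > 0" by simp
 then have "\<forall>\<^sub>F n in sequentially. \<exists>S\<in>sets M. 1 - e / 2 \<le> prob S \<and> (\<forall>w\<in>S. Q n w)"
  "\<forall>\<^sub>F n in sequentially. \<exists>S\<in>sets M. 1 - e / 2 \<le> prob S \<and> (\<forall>w\<in>S. R n w)"
  using assms unfolding whp_def by blast+
 then show "\<forall>\<^sub>F n in sequentially. \<exists>S\<in>sets M. 1 - e \<le> prob S \<and> (\<forall>w\<in>S. Q n w \<and> R n w)"
 proof eventually_elim
  case (elim n)
  then obtain S T where S: "S \<in> events" "1 - e / 2 \<le> prob S" "\<forall>w\<in>S. Q n w"
   and T: "T \<in> events" "1 - e / 2 \<le> prob T" "\<forall>w\<in>T. R n w" by blast
  have "1 - e \<le> prob (S \<inter> T)" using S T by (intro prob_Int_ge) auto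
  with S T show ?case by (intro bexI[of _ "S \<inter> T"]) auto
 qed
qed

lemma (in prob_space) whp_always:
 assumes "\<forall>\<^sub>F n in sequentially. \<forall>w\<in>space M. Q n w"
 shows "whp M Q"
proof -
 have "whp M (\<lambda>_ _. True)"
  unfolding whp_def by (auto intro!: bexI[of _ "space M"] simp: prob_space)
 then show ?thesis by (rule whp_mono) (use assms in simp)
qed

lemma (in prob_space) whp_measureI:
 assumes "\<forall>\<^sub>F n in sequentially. {w\<in>space M. \<not> Q n w} \<in> events"
  "(\<lambda>n. prob {w\<in>space M. \<not> Q n w}) \<longlonglongrightarrow> 0"
 shows "whp M Q"
 unfolding whp_def
proof (intro allI impI)
 fix e :: real assume "e > 0"
 with assms(2) have "\<forall>\<^sub>F n in sequentially. prob {w\<in>space M. \<not> Q n w} < e"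
  by (auto dest: order_tendstoD)
 with assms(1) show "\<forall>\<^sub>F n in sequentially. \<exists>S\<in>events. 1 - e \<le> prob S \<and> (\<forall>w\<in>S. Q n w)"
 proof eventually_elim
  case (elim n)
  then show ?case
   by (intro bexI[of _ "space M - {w\<in>space M. \<not> Q n w}"]) (auto simp: prob_compl)
 qed
qed

text \<open>Markov's inequality in the form that \<open>whp\<close> consumes: c is the level and e
  the allowed failure probability.\<close>

lemma (in prob_space) markov_set:
 fixes f :: "'a => real"
 assumes [measurable]: "f \<in> borel_measurable M"
  and "(\<integral>\<^sup>+w. ennreal (f w) \<partial>M) \<le> ennreal (c * e)" "c > 0" "e \<ge> 0"
 shows "\<exists>S\<in>events. 1 - e \<le> prob S \<and> (\<forall>w\<in>S. f w \<le> c)"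
proof (intro bexI[of _ "{w\<in>space M. f w \<le> c}"] conjI)
 let ?B = "{w\<in>space M. 1 \<le> ennreal (1 / c) * ennreal (f w)}"
 have "emeasure M ?B \<le> ennreal (1 / c) * (\<integral>\<^sup>+w. ennreal (f w) * indicator (space M) w \<partial>M)"
  using nn_integral_Markov_inequality[of "\<lambda>w. ennreal (f w)" "space M" M "ennreal (1 / c)"] by simp
 also have "(\<integral>\<^sup>+w. ennreal (f w) * indicator (space M) w \<partial>M) = (\<integral>\<^sup>+w. ennreal (f w) \<partial>M)"
  by (intro nn_integral_cong) auto
 also have "ennreal (1 / c) * ... \<le> ennreal (1 / c) * ennreal (c * e)"
  by (intro mult_left_mono assms) auto
 also have "... = ennreal e" using assms by (simp add: ennreal_mult[symmetric])
 finally have B: "prob ?B \<le> e" using assms by (simp add: emeasure_eq_measure)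
 have "space M - {w\<in>space M. f w \<le> c} \<subseteq> ?B"
 proof
  fix w assume "w \<in> space M - {w\<in>space M. f w \<le> c}"
  then have "w \<in> space M" "c < f w" by auto
  then have "1 \<le> 1 / c * f w" using assms by (simp add: field_simps)
  then have "1 \<le> ennreal (1 / c * f w)" by simp
  also have "... = ennreal (1 / c) * ennreal (f w)"
   using assms(3) \<open>c < f w\<close> by (subst ennreal_mult) auto
  finally show "w \<in> ?B" using \<open>w \<in> space M\<close> by auto
 qed
 then have "prob (space M - {w\<in>space M. f w \<le> c}) \<le> prob ?B"
  by (intro finite_measure_mono) auto
 with B show "1 - e \<le> prob {w\<in>space M. f w \<le> c}"
  by (subst (asm) prob_compl) auto
qed auto

text \<open>Only the upper half of convergence to 0 in probability; two-sided statements are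
  obtained by writing an absolute value into X.\<close>

definition conv0 :: "'w measure => (nat => 'w => real) => bool" where
 "conv0 M X \<longleftrightarrow> (\<forall>e>0. whp M (\<lambda>n w. X n w \<le> e))"

lemma conv0D: "conv0 M X ==> e > 0 ==> whp M (\<lambda>n w. X n w \<le> e)"
 by (simp add: conv0_def)

lemma conv0_mono:
 assumes "conv0 M Y" "\<forall>\<^sub>F n in sequentially. \<forall>w\<in>space M. X n w \<le> Y n w"
 shows "conv0 M X"
 unfolding conv0_def
proof (intro allI impI)
 fix e :: real assume "e > 0"
 show "whp M (\<lambda>n w. X n w \<le> e)"
  by (rule whp_mono[OF conv0D[OF assms(1) \<open>e > 0\<close>] eventually_mono[OF assms(2)]]) force
qed

lemma (in prob_space) conv0_add:
 assumes "conv0 M X" "conv0 M Y"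
 shows "conv0 M (\<lambda>n w. X n w + Y n w)"
 unfolding conv0_def
proof (intro allI impI)
 fix e :: real assume "e > 0"
 then have "e / 2 > 0" by simp
 show "whp M (\<lambda>n w. X n w + Y n w \<le> e)"
  by (rule whp_mono[OF whp_conj[OF conv0D[OF assms(1) \<open>e / 2 > 0\<close>] conv0D[OF assms(2) \<open>e / 2 > 0\<close>]]])
   (auto intro!: always_eventually)
qed

lemma conv0_cmult:
 assumes "conv0 M X" "c \<ge> 0"
 shows "conv0 M (\<lambda>n w. c * X n w)"
 unfolding conv0_def
proof (intro allI impI)
 fix e :: real assume "e > 0"
 then have "e / (c + 1) > 0" using assms by simp
 show "whp M (\<lambda>n w. c * X n w \<le> e)"
 proof (rule whp_mono[OF conv0D[OF assms(1) \<open>e / (c + 1) > 0\<close>]], intro always_eventually allI ballI impI)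
  fix n w assume "X n w \<le> e / (c + 1)"
  then have "c * X n w \<le> c * (e / (c + 1))" using assms by (intro mult_left_mono)
  also have "... \<le> e" using assms \<open>e > 0\<close> by (simp add: field_simps)
  finally show "c * X n w \<le> e" .
 qed
qed

lemma (in prob_space) conv0_sum:
 assumes "finite A" "\<And>a. a \<in> A ==> conv0 M (X a)"
 shows "conv0 M (\<lambda>n w. \<Sum>a\<in>A. X a n w)"
 using assms
proof (induction A)
 case empty
 show ?case unfolding conv0_def by (auto intro!: whp_always)
next
 case (insert a A)
 then show ?case by (simp add: conv0_add)
qed

lemma (in prob_space) conv0_const:
 assumes "c \<longlonglongrightarrow> 0"
 shows "conv0 M (\<lambda>n w. c n)"
 unfolding conv0_def
proof (intro allI impI)
 fix e :: real assume "e > 0"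
 with assms have "\<forall>\<^sub>F n in sequentially. c n < e" by (auto dest: order_tendstoD)
 then show "whp M (\<lambda>n w. c n \<le> e)"
  by (intro whp_always) (auto elim: eventually_mono)
qed

lemma (in prob_space) conv0_nn_integral:
 fixes f :: "nat => 'a => real"
 assumes "\<And>n. f n \<in> borel_measurable M"
  and "(\<lambda>n. \<integral>\<^sup>+w. ennreal (f n w) \<partial>M) \<longlonglongrightarrow> 0"
 shows "conv0 M f"
 unfolding conv0_def whp_def
proof (intro allI impI)
 fix c e :: real assume "c > 0" "e > 0"
 then have "ennreal (c * e) > 0" by simp
 with assms(2) have "\<forall>\<^sub>F n in sequentially. (\<integral>\<^sup>+w. ennreal (f n w) \<partial>M) < ennreal (c * e)"
  by (rule order_tendstoD(2))
 then show "\<forall>\<^sub>F n in sequentially. \<exists>S\<in>events. 1 - e \<le> prob S \<and> (\<forall>w\<in>S. f n w \<le> c)"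
  by eventually_elim (use assms \<open>c > 0\<close> \<open>e > 0\<close> in \<open>auto intro!: markov_set\<close>)
qed

text \<open>The parameter K trades the size of the unbounded part of a kernel against the growth factor.\<close>
lemma gronwall_truncated:
 fixes \<tau> :: "real => real"
 assumes \<tau>: "\<And>r. r > 0 ==> \<exists>K\<ge>0. \<tau> K \<le> r"
 shows "r > 0 ==> \<exists>\<eta>>0. \<forall>D e. D 0 \<le> (0::real) \<longrightarrow> e \<le> \<eta> \<longrightarrow>
     (\<forall>d (K::real). K \<ge> 0 \<longrightarrow> D (Suc d) \<le> e + K * D d + \<tau> K) \<longrightarrow> D d \<le> r"
proof (induction d arbitrary: r)
 case 0
 then show ?case by (intro exI[of _ 1]) auto
next
 case (Suc d)
 \<comment> \<open>r is split into three equal shares: the tail beyond K, the new error e, and K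
   times the previous error. The induction hypothesis is called with r / (3 (K + 1)) because its
   bound will be multiplied by K. The resulting \<eta> is the same for all sequences D.\<close>
 from \<tau>[of "r / 3"] Suc.prems obtain K where K: "K \<ge> 0" "\<tau> K \<le> r / 3" by auto
 have "r / (3 * (K + 1)) > 0" using K Suc.prems by simp
 from Suc.IH[OF this] obtain \<eta> where \<eta>: "\<eta> > 0"
  and IH: "\<And>D e. D 0 \<le> (0::real) ==> e \<le> \<eta> ==>
   (\<forall>d K. K \<ge> 0 \<longrightarrow> D (Suc d) \<le> e + K * D d + \<tau> K) ==> D d \<le> r / (3 * (K + 1))" by blast
 show ?case
 proof (intro exI[of _ "min \<eta> (r / 3)"] conjI allI impI)
  show "min \<eta> (r / 3) > 0" using \<eta> Suc.prems by auto
  fix D :: "nat => real" and e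
  assume a: "D 0 \<le> 0" "e \<le> min \<eta> (r / 3)" "\<forall>d K. K \<ge> 0 \<longrightarrow> D (Suc d) \<le> e + K * D d + \<tau> K"
  then have "D d \<le> r / (3 * (K + 1))" by (intro IH) auto
  then have "K * D d \<le> K * (r / (3 * (K + 1)))" using K by (intro mult_left_mono)
  also have "... \<le> r / 3" using K Suc.prems by (simp add: field_simps)
  finally have "K * D d \<le> r / 3" .
  moreover have "D (Suc d) \<le> e + K * D d + \<tau> K" using a K by auto
  moreover have "e \<le> r / 3" using a by auto
  ultimately show "D (Suc d) \<le> r" using K by linarith
 qed
qed

section \<open>Generating functions of the branching process\<close>

text \<open>The expectation of s^Z with Z the number of particles in generations 0 to d;
  \<open>nn_integral_bp_trunc_power\<close> proves this. It is introduced by its recursion because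
  that has the same shape as \<open>mgf\<close> for matrices.\<close>

primrec bp_pgf :: "'s measure => ('s => 's => real) => real => nat => 's => real" where
 "bp_pgf \<mu> \<kappa> s 0 x = s"
| "bp_pgf \<mu> \<kappa> s (Suc d) x = s * exp (- (\<integral>y. \<kappa> x y * (1 - bp_pgf \<mu> \<kappa> s d y) \<partial>\<mu>))"

lemma nn_integral_pmf_nat:
 "(\<integral>\<^sup>+k. f k \<partial>measure_pmf p) = (\<Sum>k. ennreal (pmf p k) * f k)" for p :: "nat pmf"
 by (simp add: nn_integral_measure_pmf nn_integral_count_space_nat)

lemma nn_integral_poisson_pgf:
 assumes "0 < l" "0 \<le> z"
 shows "(\<integral>\<^sup>+N. ennreal (z ^ N) \<partial>measure_pmf (poisson_pmf l)) = ennreal (exp (l * (z - 1)))"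
proof -
 have "(\<lambda>N. exp (- l) * ((l * z) ^ N /\<^sub>R fact N)) sums (exp (- l) * exp (l * z))"
  by (intro sums_mult exp_converges)
 then have *: "(\<lambda>N. pmf (poisson_pmf l) N * z ^ N) sums exp (l * (z - 1))"
  using assms by (simp add: exp_add[symmetric] algebra_simps power_mult_distrib divide_inverse)
 have "(\<integral>\<^sup>+N. ennreal (z ^ N) \<partial>measure_pmf (poisson_pmf l)) = (\<Sum>N. ennreal (pmf (poisson_pmf l) N * z ^ N))"
  unfolding nn_integral_pmf_nat using assms by (subst ennreal_mult) (auto simp del: pmf_poisson)
 also have "... = ennreal (exp (l * (z - 1)))"
  using * assms by (intro sums_unique[symmetric]) (auto simp: sums_ennreal)
 finally show ?thesis .
qed

lemma nn_integral_poisson_mean: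
 assumes "0 < l"
 shows "(\<integral>\<^sup>+N. of_nat N \<partial>measure_pmf (poisson_pmf l)) = ennreal l"
proof -
 have "(\<lambda>N. (l * exp (- l)) * (l ^ N /\<^sub>R fact N)) sums ((l * exp (- l)) * exp l)"
  by (intro sums_mult exp_converges)
 moreover have "(l * exp (- l)) * (l ^ N /\<^sub>R fact N) = pmf (poisson_pmf l) (Suc N) * real (Suc N)" for N
  using assms by (simp add: divide_simps del: of_nat_Suc)
 ultimately have "(\<lambda>N. pmf (poisson_pmf l) (Suc N) * real (Suc N)) sums l"
  by (simp add: exp_minus mult.assoc)
 then have *: "(\<lambda>N. pmf (poisson_pmf l) N * real N) sums l"
  by (subst (asm) sums_Suc_iff) simp
 have "(\<integral>\<^sup>+N. of_nat N \<partial>measure_pmf (poisson_pmf l)) = (\<Sum>N. ennreal (pmf (poisson_pmf l) N * real N))"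
  by (subst nn_integral_pmf_nat) (simp add: ennreal_mult ennreal_of_nat_eq_real_of_nat)
 also have "... = ennreal l"
  using * assms by (intro sums_unique[symmetric]) (auto simp: sums_ennreal simp del: pmf_poisson)
 finally show ?thesis .
qed

lemma nn_integral_iid_sum_power:
 fixes z :: real
 assumes "0 \<le> z"
 shows "(\<integral>\<^sup>+k. ennreal (z ^ k) \<partial>measure_pmf (iid_sum q N)) = (\<integral>\<^sup>+k. ennreal (z ^ k) \<partial>measure_pmf q) ^ N"
proof (induction N)
 case (Suc N)
 have "(\<integral>\<^sup>+k. ennreal (z ^ k) \<partial>measure_pmf (iid_sum q (Suc N))) =
   (\<integral>\<^sup>+w. (\<integral>\<^sup>+k. ennreal (z ^ w) * ennreal (z ^ k) \<partial>measure_pmf (iid_sum q N)) \<partial>measure_pmf q)"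
  using assms by (simp add: power_add ennreal_mult)
 also have "... = (\<integral>\<^sup>+k. ennreal (z ^ k) \<partial>measure_pmf q) * (\<integral>\<^sup>+k. ennreal (z ^ k) \<partial>measure_pmf (iid_sum q N))"
  by (simp add: nn_integral_cmult nn_integral_multc)
 finally show ?case by (simp add: Suc)
qed simp

lemma nn_integral_iid_sum_mean:
 "(\<integral>\<^sup>+k. of_nat k \<partial>measure_pmf (iid_sum q N)) = of_nat N * (\<integral>\<^sup>+k. of_nat k \<partial>measure_pmf q)"
proof (induction N)
 case (Suc N)
 have "(\<integral>\<^sup>+k. of_nat k \<partial>measure_pmf (iid_sum q (Suc N))) =
   (\<integral>\<^sup>+w. of_nat w + (\<integral>\<^sup>+k. of_nat k \<partial>measure_pmf (iid_sum q N)) \<partial>measure_pmf q)"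
  by (simp add: nn_integral_add)
 also have "... = (\<integral>\<^sup>+k. of_nat k \<partial>measure_pmf q) + (\<integral>\<^sup>+k. of_nat k \<partial>measure_pmf (iid_sum q N))"
  by (simp add: nn_integral_add measure_pmf.emeasure_space_1)
 finally show ?case by (simp add: Suc algebra_simps)
qed simp

lemma pmf_map_plus:
 "pmf (map_pmf (\<lambda>s. w + s) r) (k::nat) = (if w \<le> k then pmf r (k - w) else 0)"
proof (cases "w \<le> k")
 case True
 have "pmf (map_pmf ((+) w) r) (w + (k - w)) = pmf r (k - w)"
  by (rule pmf_map_inj') (auto simp: inj_def)
 with True show ?thesis by simp
next
 case False
 then have "k \<notin> set_pmf (map_pmf ((+) w) r)" by auto
 with False show ?thesis by (simp add: set_pmf_iff del: set_map_pmf)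
qed

text \<open>The convolution formula as a finite sum, which makes measurability in a parameter of q
  visible.\<close>

lemma pmf_iid_sum_Suc:
 "pmf (iid_sum q (Suc N)) k = (\<Sum>w\<le>k. pmf q w * pmf (iid_sum q N) (k - w))"
proof -
 have "pmf (iid_sum q (Suc N)) k = (\<integral>w. (if w \<le> k then pmf (iid_sum q N) (k - w) else 0) \<partial>measure_pmf q)"
  by (simp add: pmf_bind pmf_map_plus)
 also have "... = (\<Sum>w\<in>{..k}. pmf q w * (if w \<le> k then pmf (iid_sum q N) (k - w) else 0))"
  by (subst integral_measure_pmf[of "{..k}"]) (auto split: if_splits)
 finally show ?thesis by simp
qed

text \<open>Smaller expectations of all decreasing functions mean that q' stochastically dominates
  q. The domination passes to sums by replacing the law of the inner summands and then that of the
  outer one.\<close>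

lemma antimono_nn_integral_iid_sum:
 fixes q q' :: "nat pmf" and f :: "nat => ennreal"
 assumes "\<And>f::nat => ennreal. antimono f ==> (\<integral>\<^sup>+k. f k \<partial>measure_pmf q') \<le> (\<integral>\<^sup>+k. f k \<partial>measure_pmf q)"
  and "antimono f"
 shows "(\<integral>\<^sup>+k. f k \<partial>measure_pmf (iid_sum q' N)) \<le> (\<integral>\<^sup>+k. f k \<partial>measure_pmf (iid_sum q N))"
 using assms(2)
proof (induction N arbitrary: f)
 case (Suc N)
 have a: "antimono (\<lambda>k. f (w + k))" for w
  using Suc.prems by (auto simp: antimono_def)
 have "(\<integral>\<^sup>+k. f k \<partial>measure_pmf (iid_sum q' (Suc N))) =
  (\<integral>\<^sup>+w. (\<integral>\<^sup>+k. f (w + k) \<partial>measure_pmf (iid_sum q' N)) \<partial>measure_pmf q')" by simp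
 also have "... \<le> (\<integral>\<^sup>+w. (\<integral>\<^sup>+k. f (w + k) \<partial>measure_pmf (iid_sum q N)) \<partial>measure_pmf q')"
  by (intro nn_integral_mono Suc.IH a)
 also have "... \<le> (\<integral>\<^sup>+w. (\<integral>\<^sup>+k. f (w + k) \<partial>measure_pmf (iid_sum q N)) \<partial>measure_pmf q)"
  using Suc.prems by (intro assms(1)) (auto simp: antimono_def intro!: nn_integral_mono)
 finally show ?case by simp
qed simp

section \<open>The branching process of a fixed kernel\<close>

locale ker =
 fixes \<mu> :: "'s measure" and \<kappa> :: "'s => 's => real"
 assumes kernel: "kernel \<mu> \<kappa>"
begin

abbreviation excess :: "real => real" where
 "excess K \<equiv> \<integral>x. max 0 (offmass \<mu> \<kappa> x - K) \<partial>\<mu>"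

abbreviation mean_pgf :: "real => nat => real" where
 "mean_pgf s d \<equiv> \<integral>x. bp_pgf \<mu> \<kappa> s d x \<partial>\<mu>"

sublocale finite_measure \<mu>
proof
 have "type_space \<mu>" using kernel by (simp add: kernel_def)
 then show "emeasure \<mu> (space \<mu>) \<noteq> \<infinity>" by (simp add: type_space_def less_top)
qed

lemma kernel_measurable [measurable]: "(\<lambda>z. \<kappa> (fst z) (snd z)) \<in> borel_measurable (sqm \<mu>)"
 using kernel by (auto simp: kernel_def symker_def)

lemma kernel_measurable2 [measurable (raw)]:
 assumes [measurable]: "f \<in> M \<rightarrow>\<^sub>M \<mu>" "g \<in> M \<rightarrow>\<^sub>M \<mu>"
 shows "(\<lambda>x. \<kappa> (f x) (g x)) \<in> borel_measurable M"
proof -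
 have "(\<lambda>x. (f x, g x)) \<in> M \<rightarrow>\<^sub>M sqm \<mu>" by measurable
 from measurable_compose[OF this kernel_measurable] show ?thesis by simp
qed

lemma kernel_section [measurable]: "x \<in> space \<mu> ==> \<kappa> x \<in> borel_measurable \<mu>"
 by (rule kernel_measurable2) auto

lemma kernel_nonneg: "x \<in> space \<mu> ==> y \<in> space \<mu> ==> 0 \<le> \<kappa> x y"
 and kernel_sym: "x \<in> space \<mu> ==> y \<in> space \<mu> ==> \<kappa> x y = \<kappa> y x"
 using kernel by (auto simp: kernel_def symker_def)

lemma kernel_integrable2: "integrable (sqm \<mu>) (\<lambda>z. \<kappa> (fst z) (snd z))"
 using kernel by (auto simp: kernel_def)

lemma kernel_integrable: "x \<in> space \<mu> ==> integrable \<mu> (\<kappa> x)"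
 using kernel by (intro integrableI_nonneg) (auto simp: kernel_def kernel_nonneg)

lemma offmass_eq: "x \<in> space \<mu> ==> (\<integral>\<^sup>+y. ennreal (\<kappa> x y) \<partial>\<mu>) = ennreal (offmass \<mu> \<kappa> x)"
 using kernel unfolding offmass_def by (subst ennreal_enn2real) (auto simp: kernel_def)

lemma offmass_eq_integral: "x \<in> space \<mu> ==> offmass \<mu> \<kappa> x = (\<integral>y. \<kappa> x y \<partial>\<mu>)"
 unfolding offmass_def by (subst integral_eq_nn_integral) (auto simp: kernel_nonneg)

lemma offmass_nonneg: "0 \<le> offmass \<mu> \<kappa> x"
 by (simp add: offmass_def)

lemma offmass_measurable [measurable]: "offmass \<mu> \<kappa> \<in> borel_measurable \<mu>"
proof -
 have "(\<lambda>x. enn2real (\<integral>\<^sup>+y. ennreal (\<kappa> x y) \<partial>\<mu>)) \<in> borel_measurable \<mu>" by measurable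
 then show ?thesis by (simp add: offmass_def[abs_def])
qed

lemma offmass_integrable: "integrable \<mu> (offmass \<mu> \<kappa>)"
proof -
 interpret pair_sigma_finite \<mu> \<mu> by unfold_locales
 have "integrable \<mu> (\<lambda>x. \<integral>y. \<kappa> (fst (x, y)) (snd (x, y)) \<partial>\<mu>)"
  by (rule integrable_fst) (use kernel_integrable2 in \<open>simp add: case_prod_unfold\<close>)
 then show ?thesis
  by (subst Bochner_Integration.integrable_cong[OF refl]) (auto simp: offmass_eq_integral)
qed

lemma kernel_mult_integrable:
 assumes [measurable]: "f \<in> borel_measurable \<mu>" and "x \<in> space \<mu>" "\<And>y. y \<in> space \<mu> ==> \<bar>f y\<bar> \<le> (1::real)"
 shows "integrable \<mu> (\<lambda>y. \<kappa> x y * f y)"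
proof (rule B_integrable_bound[OF kernel_integrable[OF assms(2)]])
 show "(\<lambda>y. \<kappa> x y * f y) \<in> borel_measurable \<mu>" using assms by measurable
 show "AE y in \<mu>. norm (\<kappa> x y * f y) \<le> norm (\<kappa> x y)"
  using assms by (intro AE_I2) (auto simp: abs_mult mult_left_le)
qed

lemma bp_pgf_measurable [measurable]: "bp_pgf \<mu> \<kappa> s d \<in> borel_measurable \<mu>"
proof (induction d)
 case (Suc d)
 note [measurable] = Suc
 have "(\<lambda>x. s * exp (- (\<integral>y. \<kappa> x y * (1 - bp_pgf \<mu> \<kappa> s d y) \<partial>\<mu>))) \<in> borel_measurable \<mu>"
  by measurable
 then show ?case by (simp add: bp_pgf.simps(2)[abs_def])
qed (simp add: bp_pgf.simps(1)[abs_def])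

lemma bp_pgf_bounds:
 assumes "0 \<le> s" "s \<le> 1" "x \<in> space \<mu>"
 shows "0 \<le> bp_pgf \<mu> \<kappa> s d x \<and> bp_pgf \<mu> \<kappa> s d x \<le> s"
 using assms(3)
proof (induction d arbitrary: x)
 case (Suc d)
 have "0 \<le> \<kappa> x y * (1 - bp_pgf \<mu> \<kappa> s d y)" if "y \<in> space \<mu>" for y
  using Suc.IH[OF that] that assms Suc.prems by (auto intro!: mult_nonneg_nonneg kernel_nonneg)
 then have "0 \<le> (\<integral>y. \<kappa> x y * (1 - bp_pgf \<mu> \<kappa> s d y) \<partial>\<mu>)"
  by (rule B_integral_nonneg)
 then show ?case using assms by (auto simp: mult_left_le)
qed (use assms in auto)

context
 fixes q :: "'s => nat pmf"
 assumes q [measurable]: "\<And>k. (\<lambda>y. pmf (q y) k) \<in> borel_measurable \<mu>"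
begin

lemma nn_integral_family_measurable [measurable]:
 "(\<lambda>y. \<integral>\<^sup>+k. f k \<partial>measure_pmf (q y)) \<in> borel_measurable \<mu>"
 by (simp add: nn_integral_pmf_nat)

lemma ennreal_child_weight:
 assumes "x \<in> space \<mu>"
 shows "ennreal (\<integral>y. \<kappa> x y * pmf (q y) k \<partial>\<mu>) = (\<integral>\<^sup>+y. ennreal (\<kappa> x y) * ennreal (pmf (q y) k) \<partial>\<mu>)"
proof -
 have "ennreal (\<integral>y. \<kappa> x y * pmf (q y) k \<partial>\<mu>) = (\<integral>\<^sup>+y. ennreal (\<kappa> x y * pmf (q y) k) \<partial>\<mu>)"
  using assms
  by (intro nn_integral_eq_integral[symmetric] kernel_mult_integrable) (auto simp: pmf_le_1 kernel_nonneg)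
 also have "... = (\<integral>\<^sup>+y. ennreal (\<kappa> x y) * ennreal (pmf (q y) k) \<partial>\<mu>)"
  using assms by (intro nn_integral_cong) (auto simp: ennreal_mult kernel_nonneg)
 finally show ?thesis .
qed

text \<open>The weights given to \<open>embed_pmf\<close> sum to 1: each q y has total mass 1, so
  summing over k under the integral leaves the integral of \<kappa> x, which is the normalisation
  \<open>offmass\<close>.\<close>

lemma pmf_child_mix:
 assumes x: "x \<in> space \<mu>" and "offmass \<mu> \<kappa> x \<noteq> 0"
 shows "pmf (child_mix \<mu> \<kappa> q x) k = (\<integral>y. \<kappa> x y * pmf (q y) k \<partial>\<mu>) / offmass \<mu> \<kappa> x"
proof -
 let ?I = "\<lambda>k. \<integral>y. \<kappa> x y * pmf (q y) k \<partial>\<mu>"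
 let ?w = "\<lambda>k. (?I k) / offmass \<mu> \<kappa> x"
 have pos: "offmass \<mu> \<kappa> x > 0" using assms offmass_nonneg[of x] by simp
 have nn: "0 \<le> (?I k)" for k
  using x by (intro B_integral_nonneg) (auto intro!: mult_nonneg_nonneg kernel_nonneg)
 have "(\<Sum>k. ennreal (?I k)) = (\<Sum>k. \<integral>\<^sup>+y. ennreal (\<kappa> x y) * ennreal (pmf (q y) k) \<partial>\<mu>)"
  using x by (simp add: ennreal_child_weight)
 also have "... = (\<integral>\<^sup>+y. (\<Sum>k. ennreal (\<kappa> x y) * ennreal (pmf (q y) k)) \<partial>\<mu>)"
  using x by (intro nn_integral_suminf[symmetric]) measurable
 also have "... = (\<integral>\<^sup>+y. ennreal (\<kappa> x y) * (\<integral>\<^sup>+k. 1 \<partial>measure_pmf (q y)) \<partial>\<mu>)"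
  unfolding nn_integral_pmf_nat by (intro nn_integral_cong) simp
 also have "... = ennreal (offmass \<mu> \<kappa> x)"
  using x by (simp add: measure_pmf.emeasure_space_1 offmass_eq)
 finally have *: "(\<Sum>k. ennreal (?I k)) = ennreal (offmass \<mu> \<kappa> x)" .
 have "(\<integral>\<^sup>+k. ennreal (?w k) \<partial>count_space UNIV) = (\<Sum>k. ennreal (?I k) / ennreal (offmass \<mu> \<kappa> x))"
  using pos nn by (simp add: nn_integral_count_space_nat divide_ennreal)
 also have "... = 1"
  using pos by (simp add: divide_ennreal_def * ennreal_divide_self[unfolded divide_ennreal_def])
 finally have "(\<integral>\<^sup>+k. ennreal (?w k) \<partial>count_space UNIV) = 1" .
 then show ?thesis unfolding child_mix_def
  by (subst pmf_embed_pmf) (use nn pos in auto)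
qed

lemma nn_integral_child_mix:
 assumes x: "x \<in> space \<mu>" and "offmass \<mu> \<kappa> x \<noteq> 0"
 shows "(\<integral>\<^sup>+k. f k \<partial>measure_pmf (child_mix \<mu> \<kappa> q x)) =
  (\<integral>\<^sup>+y. ennreal (\<kappa> x y) * (\<integral>\<^sup>+k. f k \<partial>measure_pmf (q y)) \<partial>\<mu>) / ennreal (offmass \<mu> \<kappa> x)"
proof -
 have pos: "offmass \<mu> \<kappa> x > 0" using assms offmass_nonneg[of x] by simp
 have nn: "0 \<le> (\<integral>y. \<kappa> x y * pmf (q y) k \<partial>\<mu>)" for k
  using x by (intro B_integral_nonneg) (auto intro!: mult_nonneg_nonneg kernel_nonneg)
 have "(\<integral>\<^sup>+k. f k \<partial>measure_pmf (child_mix \<mu> \<kappa> q x)) =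
  (\<Sum>k. ennreal (\<integral>y. \<kappa> x y * pmf (q y) k \<partial>\<mu>) / ennreal (offmass \<mu> \<kappa> x) * f k)"
  using assms pos nn by (simp add: nn_integral_pmf_nat pmf_child_mix divide_ennreal)
 also have "... = (\<Sum>k. (\<integral>\<^sup>+y. ennreal (\<kappa> x y) * ennreal (pmf (q y) k) \<partial>\<mu>) * f k) / ennreal (offmass \<mu> \<kappa> x)"
  using x by (simp add: divide_ennreal_def ennreal_child_weight flip: ennreal_suminf_multc) (simp add: mult_ac)
 also have "(\<Sum>k. (\<integral>\<^sup>+y. ennreal (\<kappa> x y) * ennreal (pmf (q y) k) \<partial>\<mu>) * f k) =
  (\<Sum>k. (\<integral>\<^sup>+y. ennreal (\<kappa> x y) * (ennreal (pmf (q y) k) * f k) \<partial>\<mu>))"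
  using x by (subst nn_integral_multc[symmetric]) (auto simp: mult.assoc)
 also have "... = (\<integral>\<^sup>+y. (\<Sum>k. ennreal (\<kappa> x y) * (ennreal (pmf (q y) k) * f k)) \<partial>\<mu>)"
  using x by (intro nn_integral_suminf[symmetric]) measurable
 also have "... = (\<integral>\<^sup>+y. ennreal (\<kappa> x y) * (\<integral>\<^sup>+k. f k \<partial>measure_pmf (q y)) \<partial>\<mu>)"
  unfolding nn_integral_pmf_nat by simp
 finally show ?thesis .
qed

lemma child_mix_measurable [measurable]: "(\<lambda>x. pmf (child_mix \<mu> \<kappa> q x) k) \<in> borel_measurable \<mu>"
proof -
 \<comment> \<open>Where \<open>offmass\<close> vanishes, division by zero turns the weights into 0,
   so \<open>embed_pmf\<close> takes one fixed unspecified value there.\<close>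
 have "(\<lambda>x. if offmass \<mu> \<kappa> x = 0 then pmf (embed_pmf (\<lambda>_. 0)) k
   else (\<integral>y. \<kappa> x y * pmf (q y) k \<partial>\<mu>) / offmass \<mu> \<kappa> x) \<in> borel_measurable \<mu>"
  by measurable
 then show ?thesis
  by (rule measurable_cong[THEN iffD1, rotated]) (auto simp: pmf_child_mix, simp add: child_mix_def)
qed

lemma iid_child_mix_measurable [measurable]:
 "(\<lambda>x. pmf (iid_sum (child_mix \<mu> \<kappa> q x) N) k) \<in> borel_measurable \<mu>"
proof (induction N arbitrary: k)
 case (Suc N)
 note [measurable] = Suc
 show ?case unfolding pmf_iid_sum_Suc by measurable
qed simp

lemma children_sum_measurable:
 "(\<lambda>x. pmf (children_sum \<mu> \<kappa> q x) k) \<in> borel_measurable \<mu>"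
proof -
 let ?P = "\<lambda>x N. offmass \<mu> \<kappa> x ^ N / fact N * exp (- offmass \<mu> \<kappa> x)"
 have "(\<lambda>x. if offmass \<mu> \<kappa> x = 0 then (if k = 0 then 1 else 0)
   else enn2real (\<Sum>N. ennreal (?P x N) * ennreal (pmf (iid_sum (child_mix \<mu> \<kappa> q x) N) k))) \<in> borel_measurable \<mu>"
  by measurable
 moreover have "(if offmass \<mu> \<kappa> x = 0 then (if k = 0 then 1 else 0)
   else enn2real (\<Sum>N. ennreal (?P x N) * ennreal (pmf (iid_sum (child_mix \<mu> \<kappa> q x) N) k))) =
   pmf (children_sum \<mu> \<kappa> q x) k" for x
 proof (cases "offmass \<mu> \<kappa> x = 0")
  case False
  then have "offmass \<mu> \<kappa> x > 0" using offmass_nonneg[of x] by simp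
  then have "ennreal (pmf (children_sum \<mu> \<kappa> q x) k) =
   (\<Sum>N. ennreal (?P x N) * ennreal (pmf (iid_sum (child_mix \<mu> \<kappa> q x) N) k))"
   by (simp add: children_sum_def ennreal_pmf_bind nn_integral_pmf_nat)
  from this[symmetric] show ?thesis using False by simp
 qed (simp add: children_sum_def indicator_def)
 ultimately show ?thesis by simp
qed

text \<open>The generating function of a compound Poisson variable is exp (m (z - 1)), where z is
  the generating function of one child. As z is an integral against \<kappa> x divided by m =
  \<open>offmass\<close>, the normalisation cancels. If m = 0, then \<kappa> x vanishes almost
  everywhere and both sides are 1.\<close>

lemma nn_integral_children_sum_power:
 fixes s :: real and G :: "'s => real"
 assumes x: "x \<in> space \<mu>" and s: "0 \<le> s" "s \<le> 1" and [measurable]: "G \<in> borel_measurable \<mu>"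
  and G: "\<And>y. y \<in> space \<mu> ==> (\<integral>\<^sup>+k. ennreal (s ^ k) \<partial>measure_pmf (q y)) = ennreal (G y)"
   "\<And>y. y \<in> space \<mu> ==> 0 \<le> G y \<and> G y \<le> 1"
 shows "(\<integral>\<^sup>+k. ennreal (s ^ k) \<partial>measure_pmf (children_sum \<mu> \<kappa> q x)) =
  ennreal (exp (- (\<integral>y. \<kappa> x y * (1 - G y) \<partial>\<mu>)))"
proof (cases "offmass \<mu> \<kappa> x = 0")
 case True
 then have "(\<integral>\<^sup>+y. ennreal (\<kappa> x y) \<partial>\<mu>) = 0" using offmass_eq[OF x] by simp
 then have "AE y in \<mu>. ennreal (\<kappa> x y) = 0" using x by (subst (asm) nn_integral_0_iff_AE) auto
 then have "AE y in \<mu>. \<kappa> x y * (1 - G y) = 0"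
  using AE_space by eventually_elim (use x in \<open>auto simp: ennreal_eq_0_iff intro: antisym kernel_nonneg\<close>)
 then have "(\<integral>y. \<kappa> x y * (1 - G y) \<partial>\<mu>) = 0" by (rule integral_eq_zero_AE)
 with True show ?thesis by (simp add: children_sum_def)
next
 case False
 then have pos: "offmass \<mu> \<kappa> x > 0" using offmass_nonneg[of x] by simp
 have int: "integrable \<mu> (\<lambda>y. \<kappa> x y * G y)"
  using x G(2) by (intro kernel_mult_integrable) force+
 define z where "z = (\<integral>y. \<kappa> x y * G y \<partial>\<mu>) / offmass \<mu> \<kappa> x"
 have I: "0 \<le> (\<integral>y. \<kappa> x y * G y \<partial>\<mu>)"
  using x G(2) by (intro B_integral_nonneg) (auto intro!: mult_nonneg_nonneg kernel_nonneg)
 then have z0: "0 \<le> z" using pos by (simp add: z_def)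
 have "(\<integral>\<^sup>+y. ennreal (\<kappa> x y) * (\<integral>\<^sup>+k. ennreal (s ^ k) \<partial>measure_pmf (q y)) \<partial>\<mu>) = (\<integral>\<^sup>+y. ennreal (\<kappa> x y * G y) \<partial>\<mu>)"
  using x G by (intro nn_integral_cong) (auto simp: ennreal_mult kernel_nonneg)
 also have "... = ennreal (\<integral>y. \<kappa> x y * G y \<partial>\<mu>)"
  using x G(2) by (intro nn_integral_eq_integral int) (auto intro!: mult_nonneg_nonneg kernel_nonneg)
 finally have child: "(\<integral>\<^sup>+k. ennreal (s ^ k) \<partial>measure_pmf (child_mix \<mu> \<kappa> q x)) = ennreal z"
  using pos x I by (simp add: nn_integral_child_mix divide_ennreal z_def)
 have "(\<integral>\<^sup>+k. ennreal (s ^ k) \<partial>measure_pmf (children_sum \<mu> \<kappa> q x)) =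
  (\<integral>\<^sup>+N. ennreal z ^ N \<partial>measure_pmf (poisson_pmf (offmass \<mu> \<kappa> x)))"
  using False s by (simp add: children_sum_def nn_integral_iid_sum_power child)
 also have "... = ennreal (exp (offmass \<mu> \<kappa> x * (z - 1)))"
  using nn_integral_poisson_pgf[OF pos z0] z0 by (simp add: ennreal_power)
 also have "offmass \<mu> \<kappa> x * (z - 1) = - (\<integral>y. \<kappa> x y * (1 - G y) \<partial>\<mu>)"
  using pos x int kernel_integrable[OF x]
  by (simp add: z_def right_diff_distrib offmass_eq_integral)
 finally show ?thesis .
qed

text \<open>Wald's identity: the Poisson mean \<open>offmass\<close> times the mean of one child,
  and the normalisation of the child law cancels.\<close>

lemma nn_integral_children_sum_mean:
 assumes x: "x \<in> space \<mu>"
 shows "(\<integral>\<^sup>+k. of_nat k \<partial>measure_pmf (children_sum \<mu> \<kappa> q x)) =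
  (\<integral>\<^sup>+y. ennreal (\<kappa> x y) * (\<integral>\<^sup>+k. of_nat k \<partial>measure_pmf (q y)) \<partial>\<mu>)"
proof (cases "offmass \<mu> \<kappa> x = 0")
 case True
 then have "(\<integral>\<^sup>+y. ennreal (\<kappa> x y) \<partial>\<mu>) = 0" using offmass_eq[OF x] by simp
 then have "AE y in \<mu>. ennreal (\<kappa> x y) = 0" using x by (subst (asm) nn_integral_0_iff_AE) auto
 then have "(\<integral>\<^sup>+y. ennreal (\<kappa> x y) * (\<integral>\<^sup>+k. of_nat k \<partial>measure_pmf (q y)) \<partial>\<mu>) = (\<integral>\<^sup>+y. 0 \<partial>\<mu>)"
  by (intro nn_integral_cong_AE) auto
 with True show ?thesis by (simp add: children_sum_def)
next
 case False
 then have pos: "offmass \<mu> \<kappa> x > 0" using offmass_nonneg[of x] by simp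
 have "(\<integral>\<^sup>+k. of_nat k \<partial>measure_pmf (children_sum \<mu> \<kappa> q x)) =
  ennreal (offmass \<mu> \<kappa> x) * (\<integral>\<^sup>+k. of_nat k \<partial>measure_pmf (child_mix \<mu> \<kappa> q x))"
  using False pos by (simp add: children_sum_def nn_integral_iid_sum_mean nn_integral_multc nn_integral_poisson_mean)
 also have "... = (\<integral>\<^sup>+y. ennreal (\<kappa> x y) * (\<integral>\<^sup>+k. of_nat k \<partial>measure_pmf (q y)) \<partial>\<mu>)"
  using pos x by (simp add: nn_integral_child_mix ennreal_times_divide)
   (simp add: mult.commute[of "ennreal (offmass \<mu> \<kappa> x)"] mult_divide_eq_ennreal)
 finally show ?thesis .
qed

end

section \<open>Generating functions, means and growth of the truncated process\<close>

lemma bp_trunc_measurable [measurable]: "(\<lambda>x. pmf (bp_trunc \<mu> \<kappa> d x) k) \<in> borel_measurable \<mu>"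
proof (induction d arbitrary: k)
 case (Suc d)
 have "pmf (bp_trunc \<mu> \<kappa> (Suc d) x) k = (if 1 \<le> k then pmf (children_sum \<mu> \<kappa> (bp_trunc \<mu> \<kappa> d) x) (k - 1) else 0)" for x
  using pmf_map_plus[of 1 "children_sum \<mu> \<kappa> (bp_trunc \<mu> \<kappa> d) x" k] by simp
 moreover have "(\<lambda>x. if 1 \<le> k then pmf (children_sum \<mu> \<kappa> (bp_trunc \<mu> \<kappa> d) x) (k - 1) else 0) \<in> borel_measurable \<mu>"
  using children_sum_measurable[of "bp_trunc \<mu> \<kappa> d" "k - 1"] Suc by (cases "1 \<le> k") auto
 ultimately show ?case by presburger
qed simp

lemma nn_integral_bp_trunc_power:
 assumes "0 \<le> s" "s \<le> 1" "x \<in> space \<mu>"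
 shows "(\<integral>\<^sup>+k. ennreal (s ^ k) \<partial>measure_pmf (bp_trunc \<mu> \<kappa> d x)) = ennreal (bp_pgf \<mu> \<kappa> s d x)"
 using assms(3)
proof (induction d arbitrary: x)
 case (Suc d)
 have "(\<integral>\<^sup>+k. ennreal (s ^ k) \<partial>measure_pmf (bp_trunc \<mu> \<kappa> (Suc d) x)) =
   (\<integral>\<^sup>+k. ennreal s * ennreal (s ^ k) \<partial>measure_pmf (children_sum \<mu> \<kappa> (bp_trunc \<mu> \<kappa> d) x))"
  using assms(1) by (simp flip: ennreal_mult)
 also have "... = ennreal s * (\<integral>\<^sup>+k. ennreal (s ^ k) \<partial>measure_pmf (children_sum \<mu> \<kappa> (bp_trunc \<mu> \<kappa> d) x))"
  by (rule nn_integral_cmult) simp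
 also have "... = ennreal s * ennreal (exp (- (\<integral>y. \<kappa> x y * (1 - bp_pgf \<mu> \<kappa> s d y) \<partial>\<mu>)))"
 proof (subst nn_integral_children_sum_power[where G = "bp_pgf \<mu> \<kappa> s d"])
  show "0 \<le> bp_pgf \<mu> \<kappa> s d y \<and> bp_pgf \<mu> \<kappa> s d y \<le> 1" if "y \<in> space \<mu>" for y
   using bp_pgf_bounds[OF assms(1,2) that, of d] assms by linarith
 qed (use assms Suc in auto)
 finally show ?case using assms(1) by (simp flip: ennreal_mult)
qed (use assms in simp)

abbreviation bp_trunc_mean :: "nat => 's => ennreal" where
 "bp_trunc_mean d x \<equiv> (\<integral>\<^sup>+k. of_nat k \<partial>measure_pmf (bp_trunc \<mu> \<kappa> d x))"

lemma bp_trunc_mean_Suc: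
 "x \<in> space \<mu> ==> bp_trunc_mean (Suc d) x = 1 + (\<integral>\<^sup>+y. ennreal (\<kappa> x y) * bp_trunc_mean d y \<partial>\<mu>)"
 by (simp add: nn_integral_add measure_pmf.emeasure_space_1 nn_integral_children_sum_mean)

lemma bp_trunc_mean_mono: "x \<in> space \<mu> ==> bp_trunc_mean d x \<le> bp_trunc_mean (Suc d) x"
proof (induction d arbitrary: x)
 case 0
 then show ?case by (subst bp_trunc_mean_Suc) auto
next
 case (Suc d)
 show ?case unfolding bp_trunc_mean_Suc[OF Suc.prems]
  by (intro add_left_mono nn_integral_mono mult_left_mono Suc.IH) auto
qed

text \<open>The truncated processes are given by their laws only, not on one probability space, so
  growth in d is expressed as stochastic domination. It turns the infimum in \<open>bp_cdf\<close>
  into a limit.\<close>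

lemma bp_trunc_antimono:
 fixes f :: "nat => ennreal"
 assumes "x \<in> space \<mu>" "antimono f"
 shows "(\<integral>\<^sup>+k. f k \<partial>measure_pmf (bp_trunc \<mu> \<kappa> (Suc d) x)) \<le> (\<integral>\<^sup>+k. f k \<partial>measure_pmf (bp_trunc \<mu> \<kappa> d x))"
 using assms
proof (induction d arbitrary: x f)
 case 0
 let ?p = "children_sum \<mu> \<kappa> (bp_trunc \<mu> \<kappa> 0) x"
 have "(\<integral>\<^sup>+k. f (Suc k) \<partial>measure_pmf ?p) \<le> (\<integral>\<^sup>+k. f 1 \<partial>measure_pmf ?p)"
  using 0 by (intro nn_integral_mono) (auto simp: antimono_def)
 then show ?case by (simp add: measure_pmf.emeasure_space_1)
next
 case (Suc d)
 let ?q = "bp_trunc \<mu> \<kappa> d" and ?q' = "bp_trunc \<mu> \<kappa> (Suc d)"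
 define g where "g k = f (Suc k)" for k
 have g: "antimono g" using Suc.prems by (auto simp: g_def antimono_def)
 have "(\<integral>\<^sup>+k. g k \<partial>measure_pmf (children_sum \<mu> \<kappa> ?q' x)) \<le> (\<integral>\<^sup>+k. g k \<partial>measure_pmf (children_sum \<mu> \<kappa> ?q x))"
 proof (cases "offmass \<mu> \<kappa> x = 0")
  case False
  have c: "(\<integral>\<^sup>+k. h k \<partial>measure_pmf (child_mix \<mu> \<kappa> ?q' x)) \<le> (\<integral>\<^sup>+k. h k \<partial>measure_pmf (child_mix \<mu> \<kappa> ?q x))"
   if "antimono h" for h :: "nat => ennreal"
   using False Suc.prems(1)
   by (simp add: nn_integral_child_mix del: bp_trunc.simps)
    (intro divide_right_mono_ennreal nn_integral_mono mult_left_mono Suc.IH that, auto)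
  show ?thesis using False unfolding children_sum_def
   by (simp del: bp_trunc.simps) (intro nn_integral_mono antimono_nn_integral_iid_sum c g)
 qed (simp add: children_sum_def)
 then show ?case by (simp add: g_def bp_trunc.simps(2)[of _ _ d] bp_trunc.simps(2)[of _ _ "Suc d"] del: bp_trunc.simps)
qed

end

section \<open>Neighbourhoods in the random graph\<close>

definition joined :: "edges => nat => nat => bool" where
 "joined E i j \<longleftrightarrow> (i, j) \<in> E \<or> (j, i) \<in> E"

lemma joined_commute: "joined E i j = joined E j i"
 by (auto simp: joined_def)

text \<open>The vertices reachable from v by at most d edges with all vertices after v in W; v
  itself may lie outside W. Recursion on the first edge matches the recursion of the branching
  process.\<close>

fun gball :: "edges => nat set => nat => nat => nat set" where
 "gball E W 0 v = {v}"
| "gball E W (Suc d) v = insert v (\<Union>w\<in>{w\<in>W. joined E v w}. gball E W d w)"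

lemma gball_refl [simp]: "v \<in> gball E W d v"
 by (cases d) auto

lemma gball_subset: "gball E W d v \<subseteq> insert v W"
proof (induction d arbitrary: v)
 case (Suc d)
 then show ?case by fastforce
qed simp

lemma finite_gball [simp]: "finite W ==> finite (gball E W d v)"
 by (rule finite_subset[OF gball_subset]) simp

lemma gball_mono_radius: "d \<le> e ==> gball E W d v \<subseteq> gball E W e v"
proof (induction d arbitrary: e v)
 case (Suc d)
 then obtain e' where "e = Suc e'" "d \<le> e'" by (cases e) auto
 with Suc.IH[of e'] show ?case by fastforce
qed auto

lemma gball_trans: "u \<in> gball E W d v ==> x \<in> gball E W e u ==> x \<in> gball E W (d + e) v"
proof (induction d arbitrary: v)
 case (Suc d)
 show ?case
 proof (cases "u = v")
  case True
  with Suc.prems gball_mono_radius[of e "Suc d + e" E W v] show ?thesis by auto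
 next
  case False
  with Suc.prems Suc.IH show ?thesis by auto
 qed
qed simp

lemma gball_sym: "u \<in> gball E W d v ==> v \<in> W ==> v \<in> gball E W d u"
proof (induction d arbitrary: v)
 case (Suc d)
 show ?case
 proof (cases "u = v")
  case False
  with Suc.prems obtain w where w: "w \<in> W" "joined E v w" "u \<in> gball E W d w" by auto
  then have "w \<in> gball E W d u" using Suc.IH by blast
  moreover have "v \<in> gball E W (Suc 0) w" using w Suc.prems by (auto simp: joined_commute)
  ultimately have "v \<in> gball E W (d + Suc 0) u" by (rule gball_trans)
  then show ?thesis by simp
 qed simp
qed auto

lemma gball_avoid:
 "gball E W d v \<inter> S = {} ==> gball E (W - S) d v = gball E W d v"
proof (induction d arbitrary: v)
 case (Suc d)
 have *: "gball E W d w \<inter> S = {}" if "w \<in> W" "joined E v w" for w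
  using Suc.prems that by auto
 then have "w \<notin> S" if "w \<in> W" "joined E v w" for w
  using that gball_refl by fastforce
 then have "{w \<in> W - S. joined E v w} = {w \<in> W. joined E v w}" by auto
 with Suc.IH[OF *] show ?case by simp
qed simp

lemma gball_mono: "W \<subseteq> W' ==> gball E W d v \<subseteq> gball E W' d v"
proof (induction d arbitrary: v)
 case (Suc d)
 then show ?case by fastforce
qed simp

lemma gball_cong_edges:
 assumes "\<And>a b. a \<in> insert v W ==> b \<in> W ==> joined E a b = joined E' a b"
 shows "gball E W d v = gball E' W d v"
 using assms
proof (induction d arbitrary: v)
 case (Suc d)
 have "{w \<in> W. joined E v w} = {w \<in> W. joined E' v w}"
  using Suc.prems by auto
 moreover have "gball E W d w = gball E' W d w" if "w \<in> W" for w
  using that Suc.prems by (intro Suc.IH) auto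
 ultimately show ?case by simp
qed simp

text \<open>Exploring a ball that stays inside S inspects only pairs with an endpoint in S. Hence
  the event that the ball equals S is determined by the edges touching S.\<close>

lemma gball_cong_inside:
 assumes "\<And>a b. a \<in> S ==> joined E a b = joined E' a b"
  and "gball E W d v \<subseteq> S"
 shows "gball E' W d v = gball E W d v"
 using assms(2)
proof (induction d arbitrary: v)
 case (Suc d)
 have "v \<in> S" using Suc.prems by auto
 then have "{w \<in> W. joined E' v w} = {w \<in> W. joined E v w}"
  using assms(1) by auto
 moreover have "gball E' W d w = gball E W d w" if "w \<in> W" "joined E v w" for w
  using that Suc.prems by (intro Suc.IH) auto
 ultimately show ?case by auto
qed simp

text \<open>A path from w to u either avoids v or passes through it; in the second case its part
  after v shows that u is within distance d of v.\<close>

lemma gball_remove_or_hit: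
 "u \<in> gball E W d w ==> u \<in> gball E (W - {v}) d w \<or> u \<in> gball E W d v"
proof (induction d arbitrary: w)
 case (Suc d)
 show ?case
 proof (cases "u = w")
  case False
  then obtain x where x: "x \<in> W" "joined E w x" "u \<in> gball E W d x"
   using Suc.prems by auto
  from Suc.IH[OF x(3)] show ?thesis
  proof
   assume "u \<in> gball E W d v"
   then show ?thesis using gball_mono_radius[of d "Suc d" E W v] by auto
  next
   assume a: "u \<in> gball E (W - {v}) d x"
   show ?thesis
   proof (cases "x = v")
    case True
    with a have "u \<in> gball E W d v" using gball_mono[of "W - {v}" W E d x] by auto
    then show ?thesis using gball_mono_radius[of d "Suc d" E W v] by auto
   qed (use a x in auto)
  qed
 qed simp
qed simp

text \<open>A shortest path does not return to its starting point.\<close>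
lemma gball_Suc_remove:
 "gball E W (Suc d) v = insert v (\<Union>w\<in>{w\<in>W - {v}. joined E v w}. gball E (W - {v}) d w)"
proof
 define R where "R d = insert v (\<Union>w\<in>{w\<in>W - {v}. joined E v w}. gball E (W - {v}) d w)" for d
 have "R d \<subseteq> gball E W (Suc d) v"
  unfolding R_def using gball_mono[of "W - {v}" W E d] by auto
 then show "insert v (\<Union>w\<in>{w\<in>W - {v}. joined E v w}. gball E (W - {v}) d w) \<subseteq> gball E W (Suc d) v"
  by (simp add: R_def)
 have mono: "R d \<subseteq> R (Suc d)" for d
  using gball_mono_radius[of d "Suc d" E "W - {v}"] by (auto simp: R_def simp del: gball.simps)
 have "gball E W (Suc d) v \<subseteq> R d"
 proof (induction d)
  case (Suc d)
  show ?case
  proof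
   fix u assume u: "u \<in> gball E W (Suc (Suc d)) v"
   \<comment> \<open>A path that returns to v puts u already into the ball of radius
     \<open>Suc d\<close>, where the induction hypothesis and the monotonicity of \<open>R\<close>
     apply.\<close>
   have hit: "u \<in> R (Suc d)" if "u \<in> gball E W (Suc d) v"
    using that Suc.IH mono[of d] by (meson subsetD)
   show "u \<in> R (Suc d)"
   proof (cases "u = v")
    case False
    then obtain w where w: "w \<in> W" "joined E v w" "u \<in> gball E W (Suc d) w"
     using u by (subst (asm) gball.simps(2)) (auto simp del: gball.simps)
    from gball_remove_or_hit[OF w(3), of v] show ?thesis
    proof
     assume a: "u \<in> gball E (W - {v}) (Suc d) w"
     show ?thesis
     proof (cases "w = v")
      case True
      with w(3) show ?thesis by (intro hit) (simp del: gball.simps)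
     qed (use a w in \<open>auto simp: R_def simp del: gball.simps\<close>)
    qed (rule hit)
   qed (simp add: R_def)
  qed
 qed (auto simp: R_def)
 then show "gball E W (Suc d) v \<subseteq> insert v (\<Union>w\<in>{w\<in>W - {v}. joined E v w}. gball E (W - {v}) d w)"
  by (simp add: R_def)
qed

lemma gball_meet:
 assumes "u \<in> gball E W d w" "u \<in> gball E W d w'" "w' \<in> W"
 shows "w' \<in> gball E W (2 * d) w"
 using gball_trans[OF assms(1) gball_sym[OF assms(2,3)]] by (simp add: mult_2)

text \<open>Poisson approximation: replacing the factors one at a time costs at most the square of a
  i each, because all other factors lie in [0, 1].\<close>

lemma abs_prod_one_minus_exp:
 fixes a :: "'i => real"
 assumes "finite A" "\<And>i. i \<in> A ==> 0 \<le> a i \<and> a i \<le> 1"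
 shows "\<bar>(\<Prod>i\<in>A. 1 - a i) - exp (- (\<Sum>i\<in>A. a i))\<bar> \<le> (\<Sum>i\<in>A. (a i)\<^sup>2)"
 using assms
proof (induction A)
 case (insert i A)
 have P: "0 \<le> (\<Prod>i\<in>A. 1 - a i)" "(\<Prod>i\<in>A. 1 - a i) \<le> 1"
  using insert.prems by (auto intro!: prod_nonneg prod_le_1)
 have i: "0 \<le> a i" "a i \<le> 1" using insert.prems by auto
 have "1 - a i \<le> exp (- a i)" using exp_ge_add_one_self[of "- a i"] by simp
 moreover have "exp (- a i) \<le> 1 - a i + (a i)\<^sup>2"
 proof -
  have "exp (- a i) \<le> 1 / (1 + a i)"
   using i exp_ge_add_one_self[of "a i"] by (simp add: exp_minus divide_simps)
  also have "... \<le> 1 - a i + (a i)\<^sup>2"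
   using i by (simp add: divide_simps power2_eq_square algebra_simps)
  finally show ?thesis .
 qed
 ultimately have 1: "\<bar>(1 - a i) - exp (- a i)\<bar> \<le> (a i)\<^sup>2" by linarith
 have e: "exp (- a i) \<le> 1" using i by simp
 let ?P = "\<Prod>i\<in>A. 1 - a i" and ?S = "\<Sum>i\<in>A. a i"
 have "(1 - a i) * ?P - exp (- a i) * exp (- ?S) = ((1 - a i) - exp (- a i)) * ?P + exp (- a i) * (?P - exp (- ?S))"
  by (simp add: algebra_simps)
 then have "\<bar>(1 - a i) * ?P - exp (- a i) * exp (- ?S)\<bar> \<le> \<bar>(1 - a i) - exp (- a i)\<bar> * ?P + exp (- a i) * \<bar>?P - exp (- ?S)\<bar>"
  using P by (simp only:) (metis abs_exp_cancel abs_mult abs_of_nonneg abs_triangle_ineq)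
 also have "... \<le> (a i)\<^sup>2 * 1 + 1 * (\<Sum>i\<in>A. (a i)\<^sup>2)"
  using 1 e P insert by (intro add_mono mult_mono) auto
 finally show ?case using insert.hyps by (simp add: exp_add[symmetric])
qed simp

lemma exp_minus_Lipschitz:
 fixes a b :: real
 assumes "0 \<le> a" "0 \<le> b"
 shows "\<bar>exp (- a) - exp (- b)\<bar> \<le> \<bar>a - b\<bar>"
proof -
 have *: "exp (- a) - exp (- b) \<le> b - a" if "0 \<le> a" "a \<le> b" for a b :: real
 proof -
  have "exp (- a) - exp (- b) = exp (- a) * (1 - exp (- (b - a)))"
   by (simp add: right_diff_distrib exp_add[symmetric])
  also have "... \<le> 1 * (b - a)"
  proof (intro mult_mono)
   show "1 - exp (- (b - a)) \<le> b - a" using exp_ge_add_one_self[of "- (b - a)"] by linarith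
  qed (use that in auto)
  finally show ?thesis by simp
 qed
 show ?thesis using *[of a b] *[of b a] assms by (cases "a \<le> b") auto
qed

text \<open>The linear term is kept on the left since it vanishes in expectation when y is random
  with mean m. What remains is a variance, which is much smaller than the mean absolute deviation
  would be.\<close>

lemma exp_minus_second_order:
 fixes m y :: real
 assumes "0 \<le> m" "0 \<le> y"
 shows "\<bar>exp (- y) - exp (- m) + exp (- m) * (y - m)\<bar> \<le> (y - m)\<^sup>2"
proof -
 have "exp (- y) - exp (- m) + exp (- m) * (y - m) = exp (- m) * (exp (- (y - m)) - 1 + (y - m))"
  by (simp add: algebra_simps exp_add[symmetric])
 moreover have "0 \<le> exp (- (y - m)) - 1 + (y - m)"
  using exp_ge_add_one_self[of "- (y - m)"] by linarith
 moreover have "exp (- y) - exp (- m) + exp (- m) * (y - m) \<le> (y - m)\<^sup>2"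
 proof -
  have "exp (- y) - exp (- m) \<le> - (y - m) * exp (- y)"
  proof -
   have "exp (- y) * (1 + (y - m)) \<le> exp (- y) * exp (y - m)"
    by (intro mult_left_mono exp_ge_add_one_self) auto
   then show ?thesis by (simp add: algebra_simps exp_add[symmetric])
  qed
  then have "exp (- y) - exp (- m) + exp (- m) * (y - m) \<le> (y - m) * (exp (- m) - exp (- y))"
   by (simp add: algebra_simps)
  also have "... \<le> \<bar>y - m\<bar> * \<bar>exp (- m) - exp (- y)\<bar>"
   by (metis abs_ge_self abs_mult)
  also have "... \<le> \<bar>y - m\<bar> * \<bar>m - y\<bar>"
   using exp_minus_Lipschitz assms by (intro mult_left_mono) auto
  finally show ?thesis by (simp add: abs_minus_commute[of m] power2_eq_square flip: abs_mult)
 qed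
 ultimately show ?thesis by (simp add: abs_mult)
qed

text \<open>The total weight of walks of length k from v to u with all vertices after v in W, that
  is, an entry of a power of the matrix p restricted to W when v is in W.\<close>

primrec pw :: "(nat => nat => real) => nat set => nat => nat => nat => real" where
 "pw p W 0 v u = (if u = v then 1 else 0)"
| "pw p W (Suc k) v u = (\<Sum>w\<in>W. p v w * pw p W k w u)"

text \<open>A fixed matrix of edge probabilities. The diagonal, which \<open>rg\<close> never reads,
  is 0 so that sums over all vertices count genuine pairs only.\<close>

locale edge_prob =
 fixes N :: nat and p :: "nat => nat => real"
 assumes p_nonneg: "i < N ==> j < N ==> 0 \<le> p i j"
  and p_le1: "i < N ==> j < N ==> p i j \<le> 1"
  and p_sym: "i < N ==> j < N ==> p i j = p j i"
  and p_diag: "i < N ==> p i i = 0"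
begin

abbreviation G :: "edges pmf" where "G \<equiv> rg N p"

abbreviation mean :: "(edges => real) => real" where "mean \<equiv> measure_pmf.expectation G"

lemma finite_set_G: "finite (set_pmf G)"
proof (rule finite_subset)
 show "finite (Pow {(i, j). i < j \<and> j < N})"
  by (rule finite_subset[of _ "Pow ({..<N} \<times> {..<N})"]) auto
 have "finite {(i, j). i < j \<and> j < N}"
  by (rule finite_subset[of _ "{..<N} \<times> {..<N}"]) auto
 from set_Pi_pmf_subset[OF this]
 show "set_pmf G \<subseteq> Pow {(i, j). i < j \<and> j < N}" unfolding rg_def by force
qed

lemma G_integrable [simp]: "integrable (measure_pmf G) (f :: edges => real)"
 by (rule integrable_measure_pmf_finite[OF finite_set_G])

lemma mean_mono: "(\<And>E. f E \<le> g E) ==> mean f \<le> mean g"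
 by (intro integral_mono) auto

lemma mean_diff_abs: "\<bar>mean f - mean g\<bar> \<le> mean (\<lambda>E. \<bar>f E - g E\<bar>)"
proof -
 have "mean f - mean g = mean (\<lambda>E. f E - g E)" by simp
 also have "\<bar>...\<bar> \<le> mean (\<lambda>E. \<bar>f E - g E\<bar>)" by (rule integral_abs_bound)
 finally show ?thesis .
qed

lemma mean_const [simp]: "mean (\<lambda>E. c) = c"
 by simp

text \<open>Functions of disjoint sets of edges are independent. The product law over all pairs
  splits into the pairs inside and outside A, and as both factors have finite support the
  expectations are finite sums.\<close>

lemma mean_indep:
 assumes "\<And>E. F E = F (E \<inter> A)" "\<And>E. H E = H (E - A)"
 shows "mean (\<lambda>E. F E * H E) = mean F * mean H"
proof -
 define I where "I = {(i, j). i < j \<and> j < N}"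
 define b where "b = (\<lambda>(i, j). bernoulli_pmf (p i j))"
 have fin: "finite I" unfolding I_def by (rule finite_subset[of _ "{..<N} \<times> {..<N}"]) auto
 have rg_eq: "G = map_pmf (\<lambda>f. {e. f e}) (Pi_pmf I False b)"
  by (simp add: rg_def I_def b_def)
 define P where "P = Pi_pmf (I \<inter> A) False b"
 define Q where "Q = Pi_pmf (I - A) False b"
 have *: "Pi_pmf I False b = map_pmf (\<lambda>(f, g) x. if x \<in> I \<inter> A then f x else g x) (pair_pmf P Q)"
  unfolding P_def Q_def using fin
  by (subst Pi_pmf_union[symmetric]) (auto simp: Int_Diff_Un Un_commute intro: arg_cong2)
 have finP: "finite (set_pmf P)" "finite (set_pmf Q)"
  unfolding P_def Q_def using fin by (auto simp: set_Pi_pmf intro!: finite_PiE_dflt)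
 have sP: "f x = False" if "f \<in> set_pmf P" "x \<notin> I \<inter> A" for f x
  using that set_Pi_pmf_subset[of "I \<inter> A" False b] fin unfolding P_def by blast
 have sQ: "g x = False" if "g \<in> set_pmf Q" "x \<notin> I - A" for g x
  using that set_Pi_pmf_subset[of "I - A" False b] fin unfolding Q_def by blast
 define mg where "mg f g = {e. if e \<in> I \<inter> A then f e else g e}" for f g :: "nat \<times> nat => bool"
 have FE: "F (mg f g) = F {e. f e}"
  if "f \<in> set_pmf P" "g \<in> set_pmf Q" for f g
 proof -
  have "mg f g \<inter> A = {e. f e} \<inter> A"
   unfolding mg_def using sP[OF that(1)] sQ[OF that(2)] by auto
  then have "F (mg f g \<inter> A) = F ({e. f e} \<inter> A)" by (rule arg_cong)
  then show ?thesis by (simp only: assms(1)[symmetric])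
 qed
 have HE: "H (mg f g) = H {e. g e}"
  if "f \<in> set_pmf P" "g \<in> set_pmf Q" for f g
 proof -
  have "mg f g - A = {e. g e} - A"
   unfolding mg_def using sP[OF that(1)] sQ[OF that(2)] by auto
  then have "H (mg f g - A) = H ({e. g e} - A)" by (rule arg_cong)
  then show ?thesis by (simp only: assms(2)[symmetric])
 qed
 have mean_eq: "mean K = measure_pmf.expectation (pair_pmf P Q) (\<lambda>(f, g). K (mg f g))" for K
  unfolding rg_eq * mg_def by (simp add: case_prod_unfold)
 have mean_sum: "measure_pmf.expectation (pair_pmf P Q) K =
   (\<Sum>f\<in>set_pmf P. \<Sum>g\<in>set_pmf Q. pmf P f * pmf Q g * K (f, g))" for K :: "_ => real"
  using finP by (subst integral_measure_pmf[of "set_pmf P \<times> set_pmf Q"])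
   (auto simp: sum.cartesian_product pmf_pair intro!: sum.cong)
 have sum1: "(\<Sum>f\<in>set_pmf P. pmf P f) = 1" "(\<Sum>g\<in>set_pmf Q. pmf Q g) = 1"
  using finP by (auto intro!: sum_pmf_eq_1)
 have "mean F = (\<Sum>f\<in>set_pmf P. \<Sum>g\<in>set_pmf Q. pmf P f * pmf Q g * F {e. f e})"
  unfolding mean_eq mean_sum by (intro sum.cong refl) (simp add: FE)
 also have "... = (\<Sum>f\<in>set_pmf P. pmf P f * F {e. f e})"
  by (intro sum.cong refl) (simp add: sum_distrib_left[symmetric] sum_distrib_right[symmetric] sum1)
 finally have 1: "mean F = (\<Sum>f\<in>set_pmf P. pmf P f * F {e. f e})" .
 have "mean H = (\<Sum>f\<in>set_pmf P. \<Sum>g\<in>set_pmf Q. pmf P f * (pmf Q g * H {e. g e}))"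
  unfolding mean_eq mean_sum by (intro sum.cong refl) (simp add: HE mult.assoc)
 also have "... = (\<Sum>g\<in>set_pmf Q. pmf Q g * H {e. g e})"
  by (simp add: sum_distrib_left[symmetric] sum_distrib_right[symmetric] sum1)
 finally have 2: "mean H = (\<Sum>g\<in>set_pmf Q. pmf Q g * H {e. g e})" .
 have "mean (\<lambda>E. F E * H E) = (\<Sum>f\<in>set_pmf P. \<Sum>g\<in>set_pmf Q. (pmf P f * F {e. f e}) * (pmf Q g * H {e. g e}))"
  unfolding mean_eq mean_sum by (intro sum.cong refl) (simp add: FE HE mult_ac)
 also have "... = mean F * mean H" unfolding 1 2 by (simp add: sum_product)
 finally show ?thesis .
qed

lemma mean_edge:
 assumes "i < N" "j < N" "i \<noteq> j"
 shows "mean (\<lambda>E. of_bool (joined E i j)) = p i j"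
proof -
 have main: "mean (\<lambda>E. of_bool (joined E i j)) = p i j" if ij: "i < j" "j < N" for i j
 proof -
  let ?I = "{(i, j). i < j \<and> j < N}" and ?b = "\<lambda>(i, j). bernoulli_pmf (p i j)"
  have fin: "finite ?I" by (rule finite_subset[of _ "{..<N} \<times> {..<N}"]) auto
  have "mean (\<lambda>E. of_bool (joined E i j)) = measure_pmf.expectation (Pi_pmf ?I False ?b) (\<lambda>f. of_bool (f (i, j) \<or> f (j, i)))"
   unfolding rg_def joined_def by simp
  also have "... = measure_pmf.expectation (Pi_pmf ?I False ?b) (\<lambda>f. of_bool (f (i, j)))"
   using set_Pi_pmf_subset[OF fin, of False ?b] ij
   by (intro integral_cong_AE) (auto simp: AE_measure_pmf_iff subset_iff)
  also have "... = measure_pmf.expectation (map_pmf (\<lambda>f. f (i, j)) (Pi_pmf ?I False ?b)) of_bool"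
   by simp
  also have "map_pmf (\<lambda>f. f (i, j)) (Pi_pmf ?I False ?b) = bernoulli_pmf (p i j)"
   using ij fin by (subst Pi_pmf_component) auto
  also have "measure_pmf.expectation (bernoulli_pmf (p i j)) of_bool = p i j"
   using ij p_nonneg[of i j] p_le1[of i j] by simp
  finally show ?thesis .
 qed
 show ?thesis
 proof (cases "i < j")
  case False
  with assms have "mean (\<lambda>E. of_bool (joined E j i)) = p j i" by (intro main) auto
  then show ?thesis using p_sym[OF assms(1,2)] by (simp add: joined_commute[of _ i j])
 qed (use main assms in auto)
qed

definition touch :: "nat set => edges" where
 "touch S = {e. fst e \<in> S \<or> snd e \<in> S}"

lemma gball_touch:
 assumes "insert w W \<inter> S = {}"
 shows "gball (E - touch S) W d w = gball E W d w"
 by (rule gball_cong_edges) (use assms in \<open>auto simp: touch_def joined_def\<close>)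

lemma joined_touch: "joined (E \<inter> touch {v}) v w = joined E v w"
 by (auto simp: touch_def joined_def)

section \<open>Weighted walks and reachability\<close>

lemma pw_nonneg:
 assumes "W \<subseteq> {..<N}" "v < N"
 shows "0 \<le> pw p W k v u"
 using assms(2)
proof (induction k arbitrary: v)
 case (Suc k)
 then show ?case using assms(1)
  by (auto intro!: sum_nonneg mult_nonneg_nonneg p_nonneg)
qed simp

lemma pw_mono:
 assumes "W \<subseteq> W'" "W' \<subseteq> {..<N}" "v < N"
 shows "pw p W k v u \<le> pw p W' k v u"
 using assms(3)
proof (induction k arbitrary: v)
 case (Suc k)
 have "(\<Sum>w\<in>W. p v w * pw p W k w u) \<le> (\<Sum>w\<in>W. p v w * pw p W' k w u)"
  using assms Suc by (intro sum_mono mult_left_mono) (auto intro!: p_nonneg)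
 also have "... \<le> (\<Sum>w\<in>W'. p v w * pw p W' k w u)"
  using assms Suc finite_subset[OF assms(2)]
  by (intro sum_mono2) (auto intro!: mult_nonneg_nonneg p_nonneg pw_nonneg)
 finally show ?case by simp
qed simp

lemma pw_add:
 assumes "finite W" "v \<in> W"
 shows "pw p W (k + l) v u = (\<Sum>w\<in>W. pw p W k v w * pw p W l w u)"
 using assms(2)
proof (induction k arbitrary: v)
 case 0
 have "(\<Sum>w\<in>W. pw p W 0 v w * pw p W l w u) = (\<Sum>w\<in>W. if w = v then pw p W l w u else 0)"
  by (intro sum.cong) auto
 then show ?case using 0 assms by simp
next
 case (Suc k)
 have "pw p W (Suc k + l) v u = (\<Sum>x\<in>W. p v x * (\<Sum>w\<in>W. pw p W k x w * pw p W l w u))"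
  using Suc by simp
 also have "... = (\<Sum>w\<in>W. pw p W (Suc k) v w * pw p W l w u)"
  by (simp add: sum_distrib_left sum_distrib_right mult.assoc) (rule sum.swap)
 finally show ?case .
qed

lemma pw_Suc_right:
 assumes "finite W" "v \<in> W" "u \<in> W"
 shows "pw p W (Suc k) v u = (\<Sum>w\<in>W. pw p W k v w * p w u)"
proof -
 have "pw p W (Suc 0) w u = p w u" for w
  using assms by (simp add: sum.delta' if_distrib[of "(*) _"] cong: if_cong)
 then show ?thesis using pw_add[OF assms(1,2), of k "Suc 0" u] by simp
qed

lemma pw_sym:
 assumes "W \<subseteq> {..<N}" "v \<in> W" "u \<in> W"
 shows "pw p W k v u = pw p W k u v"
 using assms(2,3)
proof (induction k arbitrary: v u)
 case (Suc k)
 have fin: "finite W" using assms finite_subset by blast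
 have "pw p W (Suc k) v u = (\<Sum>w\<in>W. p v w * pw p W k w u)" by simp
 also have "... = (\<Sum>w\<in>W. pw p W k u w * p w v)"
  using Suc assms by (intro sum.cong refl) (auto simp: p_sym subset_iff mult.commute)
 also have "... = pw p W (Suc k) u v"
  using pw_Suc_right[OF fin Suc.prems(2,1)] by simp
 finally show ?case .
qed auto

lemma pw_row_sum:
 assumes "W \<subseteq> {..<N}" "\<And>v. v \<in> W ==> (\<Sum>w\<in>W. p v w) \<le> K" "v \<in> W"
 shows "(\<Sum>u\<in>W. pw p W k v u) \<le> K ^ k"
 using assms(3)
proof (induction k arbitrary: v)
 case 0
 then show ?case using finite_subset[OF assms(1)] by (simp add: sum.delta')
next
 case (Suc k)
 have "0 \<le> (\<Sum>w\<in>W. p v w)" using assms Suc by (auto intro!: sum_nonneg p_nonneg)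
 then have K: "0 \<le> K" using assms(2)[OF Suc.prems] by linarith
 have "(\<Sum>u\<in>W. pw p W (Suc k) v u) = (\<Sum>w\<in>W. p v w * (\<Sum>u\<in>W. pw p W k w u))"
  by (simp add: sum_distrib_left) (rule sum.swap)
 also have "... \<le> (\<Sum>w\<in>W. p v w * K ^ k)"
  using assms Suc by (intro sum_mono mult_left_mono) (auto intro!: p_nonneg)
 also have "... \<le> K * K ^ k"
  unfolding sum_distrib_right[symmetric] using assms(2)[OF Suc.prems] K by (intro mult_right_mono) auto
 finally show ?case by simp
qed

text \<open>Opens a closed walk at v: the first step goes to w, the last one comes from x, and
  symmetry writes both as entries of row v. In this form the walk is the error of one exploration
  step, two neighbours w and x of v being joined by a short path.\<close>

lemma pw_walk:
 assumes W: "W \<subseteq> {..<N}" and v: "v \<in> W"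
 shows "pw p W (Suc (Suc k)) v v = (\<Sum>w\<in>W. \<Sum>x\<in>W. p v w * p v x * pw p W k w x)"
proof -
 have fin: "finite W" using W finite_subset by blast
 have "pw p W (Suc (Suc k)) v v = (\<Sum>w\<in>W. p v w * pw p W (Suc k) w v)" by simp
 also have "... = (\<Sum>w\<in>W. p v w * (\<Sum>x\<in>W. pw p W k w x * p v x))"
  using v W by (intro sum.cong refl)
   (auto simp: pw_Suc_right[OF fin] p_sym subset_iff simp del: pw.simps intro!: sum.cong)
 finally show ?thesis by (simp add: sum_distrib_left mult_ac)
qed

text \<open>After opening the closed walk, the product of its first and last weight is at most half
  the sum of their squares, and the inner walk of length k costs K^k. Thus short cycles are
  controlled by the sum of the squares of p.\<close>

lemma pw_closed_walks:
 assumes W: "W \<subseteq> {..<N}" and K: "\<And>v. v \<in> W ==> (\<Sum>w\<in>W. p v w) \<le> K"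
 shows "(\<Sum>v\<in>W. pw p W (Suc (Suc k)) v v) \<le> K ^ k * (\<Sum>v\<in>W. \<Sum>w\<in>W. (p v w)\<^sup>2)"
proof -
 have walk: "pw p W (Suc (Suc k)) v v = (\<Sum>w\<in>W. \<Sum>x\<in>W. pw p W k w x * (p v w * p v x))" if v: "v \<in> W" for v
  using pw_walk[OF W v] by (simp add: mult.commute)
 have "(\<Sum>v\<in>W. pw p W (Suc (Suc k)) v v) \<le>
   (\<Sum>v\<in>W. \<Sum>w\<in>W. \<Sum>x\<in>W. pw p W k w x * (p v w)\<^sup>2 / 2 + pw p W k w x * (p v x)\<^sup>2 / 2)"
 proof (subst sum.cong[OF refl walk], assumption, intro sum_mono)
  fix v w x assume "v \<in> W" "w \<in> W" "x \<in> W"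
  have "p v w * p v x \<le> (p v w)\<^sup>2 / 2 + (p v x)\<^sup>2 / 2"
   using sum_squares_bound[of "p v w" "p v x"] by simp
  then have "pw p W k w x * (p v w * p v x) \<le> pw p W k w x * ((p v w)\<^sup>2 / 2 + (p v x)\<^sup>2 / 2)"
   using W \<open>w \<in> W\<close> by (intro mult_left_mono pw_nonneg) auto
  then show "pw p W k w x * (p v w * p v x) \<le> pw p W k w x * (p v w)\<^sup>2 / 2 + pw p W k w x * (p v x)\<^sup>2 / 2"
   by (simp add: algebra_simps)
 qed
 also have "... = (\<Sum>v\<in>W. \<Sum>w\<in>W. \<Sum>x\<in>W. pw p W k w x * (p v w)\<^sup>2)"
 proof -
  have "(\<Sum>w\<in>W. \<Sum>x\<in>W. pw p W k w x * (p v x)\<^sup>2 / 2) = (\<Sum>w\<in>W. \<Sum>x\<in>W. pw p W k w x * (p v w)\<^sup>2 / 2)" for v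
   by (subst sum.swap) (auto intro!: sum.cong simp: pw_sym[OF W])
  then show ?thesis
   by (simp add: sum.distrib flip: sum_divide_distrib)
 qed
 also have "... = (\<Sum>v\<in>W. \<Sum>w\<in>W. (p v w)\<^sup>2 * (\<Sum>x\<in>W. pw p W k w x))"
  by (intro sum.cong refl) (subst sum_distrib_left, simp add: mult.commute)
 also have "... \<le> (\<Sum>v\<in>W. \<Sum>w\<in>W. (p v w)\<^sup>2 * K ^ k)"
  by (intro sum_mono mult_left_mono pw_row_sum[OF W K]) auto
 finally show ?thesis by (simp add: sum_distrib_left mult_ac)
qed

text \<open>A union bound over paths. Once v is deleted, the rest of the path is independent of the
  edges at v, so the first edge contributes its probability as a factor.\<close>

lemma mean_reach:
 assumes "W \<subseteq> {..<N}" "v < N"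
 shows "mean (\<lambda>E. of_bool (u \<in> gball E W d v)) \<le> (\<Sum>k\<le>d. pw p W k v u)"
 using assms
proof (induction d arbitrary: v W)
 case (Suc d)
 have fin: "finite W" using Suc.prems finite_subset by blast
 let ?H = "\<lambda>w E. of_bool (u \<in> gball E (W - {v}) d w) :: real"
 let ?B = "\<lambda>w. \<lambda>E. of_bool (joined E v w) * ?H w E"
 let ?T = "\<lambda>E. \<Sum>w\<in>W - {v}. of_bool (joined E v w) * ?H w E"
 have "mean (\<lambda>E. of_bool (u \<in> gball E W (Suc d) v)) \<le>
   mean (\<lambda>E. of_bool (u = v) + (?T E))"
 proof (rule mean_mono)
  fix E
  have nn: "0 \<le> (?T E)" by (intro sum_nonneg) auto
  show "of_bool (u \<in> gball E W (Suc d) v) \<le> of_bool (u = v) + (?T E)"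
  proof (cases "u \<in> gball E W (Suc d) v \<and> u \<noteq> v")
   case True
   then obtain w where w: "w \<in> W - {v}" "joined E v w" "u \<in> gball E (W - {v}) d w"
    unfolding gball_Suc_remove by blast
   have "of_bool (joined E v w) * ?H w E \<le> (?T E)"
    using w fin by (intro member_le_sum) auto
   with w have "1 \<le> (?T E)" by simp
   with True show ?thesis by (simp del: gball.simps)
  qed (use nn in \<open>auto simp del: gball.simps\<close>)
 qed
 also have "... = of_bool (u = v) + (\<Sum>w\<in>W - {v}. mean (?B w))"
  by simp
 also have "(\<Sum>w\<in>W - {v}. mean (?B w)) =
   (\<Sum>w\<in>W - {v}. p v w * mean (?H w))"
 proof (intro sum.cong refl)
  fix w assume w: "w \<in> W - {v}"
  have "mean (?B w) = mean (\<lambda>E. of_bool (joined E v w)) * mean (?H w)"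
  proof (rule mean_indep[where A = "touch {v}"])
   show "of_bool (joined E v w) = of_bool (joined (E \<inter> touch {v}) v w)" for E by (simp only: joined_touch)
   show "?H w E = ?H w (E - touch {v})" for E using w by (subst gball_touch) auto
  qed
  then show "mean (?B w) = p v w * mean (?H w)"
   using w Suc.prems by (subst (asm) mean_edge) auto
 qed
 also have "(\<Sum>w\<in>W - {v}. p v w * mean (?H w)) \<le> (\<Sum>w\<in>W - {v}. p v w * (\<Sum>k\<le>d. pw p W k w u))"
 proof (intro sum_mono mult_left_mono)
  fix w assume w: "w \<in> W - {v}"
  have "mean (?H w) \<le> (\<Sum>k\<le>d. pw p (W - {v}) k w u)"
   using w Suc.prems by (intro Suc.IH) auto
  also have "... \<le> (\<Sum>k\<le>d. pw p W k w u)"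
   using w Suc.prems by (intro sum_mono pw_mono) auto
  finally show "mean (?H w) \<le> (\<Sum>k\<le>d. pw p W k w u)" .
  show "0 \<le> p v w" using w Suc.prems by (auto intro!: p_nonneg)
 qed
 also have "(\<Sum>w\<in>W - {v}. p v w * (\<Sum>k\<le>d. pw p W k w u)) \<le> (\<Sum>w\<in>W. p v w * (\<Sum>k\<le>d. pw p W k w u))"
  using fin Suc.prems by (intro sum_mono2) (auto intro!: mult_nonneg_nonneg p_nonneg sum_nonneg pw_nonneg)
 also have "... = (\<Sum>k\<le>d. pw p W (Suc k) v u)"
  by (simp add: sum_distrib_left) (rule sum.swap)
 also have "of_bool (u = v) + ... = (\<Sum>k\<le>Suc d. pw p W k v u)"
  by (subst sum.atMost_Suc_shift) auto
 finally show ?case by simp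
qed auto

section \<open>Moments of s raised to the size of a ball\<close>

context
 fixes s :: real
 assumes s0: "0 \<le> s" and s1: "s \<le> 1"
begin

abbreviation X :: "nat set => nat => nat => edges => real" where
 "X W d v E \<equiv> s ^ card (gball E W d v)"

lemma X_bounds: "0 \<le> X W d v E" "X W d v E \<le> 1"
 using s0 s1 by (auto intro: power_le_one)

lemma mean_X_bounds: "0 \<le> mean (X W d v)" "mean (X W d v) \<le> 1"
 using X_bounds mean_mono[of "X W d v" "\<lambda>_. 1"] by (auto intro: B_integral_nonneg simp del: gball.simps)

text \<open>If the balls around w and w' meet, then w' is within 2 d of w. Otherwise the product is
  split according to the value S of the first ball, and the second ball may be computed in W -
  S.\<close>

lemma X_covariance_pointwise:
 assumes W: "W \<subseteq> {..<N}" and w: "w \<in> W" "w' \<in> W"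
 shows "X W d w E * X W d w' E \<le> of_bool (w' \<in> gball E W (2 * d) w) +
  (\<Sum>S\<in>Pow W. (of_bool (gball E W d w = S) * s ^ card S) * (if w' \<in> S then 0 else X (W - S) d w' E))"
  (is "_ \<le> _ + (\<Sum>S\<in>Pow W. ?t S)")
proof -
 have fin: "finite W" using W finite_subset by blast
 have t: "0 \<le> ?t S" for S using s0 by auto
 then have nn: "0 \<le> (\<Sum>S\<in>Pow W. ?t S)" by (intro sum_nonneg)
 show ?thesis
 proof (cases "gball E W d w' \<inter> gball E W d w = {}")
  case True
  let ?S = "gball E W d w"
  have "w' \<notin> ?S" using True gball_refl by blast
  then have "X W d w E * X W d w' E = ?t ?S"
   using gball_avoid[OF True] by simp
  also have "... \<le> (\<Sum>S\<in>Pow W. ?t S)"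
   using fin t gball_subset[of E W d w] w by (intro member_le_sum) auto
  finally show ?thesis by simp
 next
  case False
  then have "w' \<in> gball E W (2 * d) w" using gball_meet w by blast
  moreover have "X W d w E * X W d w' E \<le> 1"
   using X_bounds by (intro mult_le_one) auto
  ultimately show ?thesis using nn by simp
 qed
qed

text \<open>Given that the first ball is S, the second factor computed in W - S is independent of
  it. Going back from W - S to W costs the probability that the ball around w' hits S, so the error
  counts pairs of walks from w and from w' to a common vertex; joined together they are walks from w
  to w'.\<close>

lemma mean_covariance:
 assumes W: "W \<subseteq> {..<N}" and w: "w \<in> W" "w' \<in> W"
 shows "mean (\<lambda>E. X W d w E * X W d w' E) \<le> mean (X W d w) * mean (X W d w')
  + (d + 2) * (\<Sum>k\<le>2 * d. pw p W k w w')"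
proof -
 have fin: "finite W" using W finite_subset by blast
 define F where "F S E = of_bool (gball E W d w = S) * s ^ card S" for S E
 define Y where "Y S E = (if w' \<in> S then 0 else X (W - S) d w' E)" for S E
 define r where "r u = mean (\<lambda>E. of_bool (u \<in> gball E W d w'))" for u
 define R where "R x y = (\<Sum>k\<le>d. pw p W k x y)" for x y
 have F0: "0 \<le> F S E" for S E using s0 by (simp add: F_def)
 have r0: "0 \<le> r u" for u unfolding r_def by (intro B_integral_nonneg) auto
 have r: "r u \<le> R w' u" for u unfolding r_def R_def using W w by (intro mean_reach) auto
 have sub: "gball E W d w \<in> Pow W" for E using gball_subset[of E W d w] w by auto
 have "mean (\<lambda>E. X W d w E * X W d w' E) \<le> mean (\<lambda>E. of_bool (w' \<in> gball E W (2 * d) w) + (\<Sum>S\<in>Pow W. F S E * Y S E))"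
  unfolding F_def Y_def by (intro mean_mono X_covariance_pointwise W w)
 also have "... = mean (\<lambda>E. of_bool (w' \<in> gball E W (2 * d) w)) + (\<Sum>S\<in>Pow W. mean (\<lambda>E. F S E * Y S E))"
  by simp
 also have "... \<le> (\<Sum>k\<le>2 * d. pw p W k w w') + (\<Sum>S\<in>Pow W. mean (F S) * (mean (X W d w') + (\<Sum>u\<in>S. r u)))"
 proof (intro add_mono mean_reach W sum_mono)
  show "w < N" using w W by auto
  fix S assume S: "S \<in> Pow W"
  \<comment> \<open>The event that the ball of w is S depends on the edges touching S, whereas a
    ball around w' explored in W - S uses none of them.\<close>
  have "mean (\<lambda>E. F S E * Y S E) = mean (F S) * mean (Y S)"
  proof (rule mean_indep[where A = "touch S"])
   have inside: "gball (E \<inter> touch S) W d w = S \<longleftrightarrow> gball E W d w = S" for E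
    using gball_cong_inside[of S E "E \<inter> touch S" W d w] gball_cong_inside[of S "E \<inter> touch S" E W d w]
    by (auto simp: touch_def joined_def)
   show "F S E = F S (E \<inter> touch S)" for E unfolding F_def inside ..
   show "Y S E = Y S (E - touch S)" for E
   proof (cases "w' \<in> S")
    case False
    then have "gball (E - touch S) (W - S) d w' = gball E (W - S) d w'" by (intro gball_touch) auto
    then show ?thesis by (simp add: Y_def)
   qed (simp add: Y_def)
  qed
  also have "... \<le> mean (F S) * (mean (X W d w') + (\<Sum>u\<in>S. r u))"
  proof (rule mult_left_mono)
   have "mean (Y S) \<le> mean (\<lambda>E. X W d w' E + (\<Sum>u\<in>S. of_bool (u \<in> gball E W d w')))"
   proof (rule mean_mono)
    fix E
    have nn: "0 \<le> (\<Sum>u\<in>S. of_bool (u \<in> gball E W d w') :: real)" by (intro sum_nonneg) auto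
    show "Y S E \<le> X W d w' E + (\<Sum>u\<in>S. of_bool (u \<in> gball E W d w'))"
    proof (cases "gball E W d w' \<inter> S = {}")
     case True
     then show ?thesis using nn X_bounds by (auto simp: Y_def gball_avoid)
    next
     case False
     then obtain u where u: "u \<in> S" "u \<in> gball E W d w'" by blast
     have "of_bool (u \<in> gball E W d w') \<le> (\<Sum>u\<in>S. of_bool (u \<in> gball E W d w') :: real)"
      using u S fin finite_subset by (intro member_le_sum) auto
     moreover have "Y S E \<le> 1" using X_bounds by (auto simp: Y_def)
     ultimately show ?thesis using u X_bounds(1)[of E W d w'] by simp
    qed
   qed
   then show "mean (Y S) \<le> mean (X W d w') + (\<Sum>u\<in>S. r u)" by (simp add: r_def)
   show "0 \<le> mean (F S)" using F0 by (intro B_integral_nonneg)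
  qed
  finally show "mean (\<lambda>E. F S E * Y S E) \<le> mean (F S) * (mean (X W d w') + (\<Sum>u\<in>S. r u))" .
 qed
 also have "(\<Sum>S\<in>Pow W. mean (F S) * (mean (X W d w') + (\<Sum>u\<in>S. r u))) =
   mean (\<lambda>E. \<Sum>S\<in>Pow W. F S E * (mean (X W d w') + (\<Sum>u\<in>S. r u)))"
  by simp
 also have "... = mean (\<lambda>E. X W d w E * (mean (X W d w') + (\<Sum>u\<in>gball E W d w. r u)))"
 proof (intro B_integral_cong refl)
  fix E
  have "(\<Sum>S\<in>Pow W. F S E * (mean (X W d w') + (\<Sum>u\<in>S. r u))) =
   (\<Sum>S\<in>Pow W. if S = gball E W d w then s ^ card S * (mean (X W d w') + (\<Sum>u\<in>S. r u)) else 0)"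
   by (intro sum.cong) (auto simp: F_def)
  then show "(\<Sum>S\<in>Pow W. F S E * (mean (X W d w') + (\<Sum>u\<in>S. r u))) =
   X W d w E * (mean (X W d w') + (\<Sum>u\<in>gball E W d w. r u))"
   using sub[of E] fin by (simp add: sum.delta')
 qed
 also have "... \<le> mean (\<lambda>E. X W d w E * mean (X W d w') + (\<Sum>u\<in>W. of_bool (u \<in> gball E W d w) * r u))"
 proof (rule mean_mono)
  fix E
  have "(\<Sum>u\<in>gball E W d w. r u) = (\<Sum>u\<in>W. of_bool (u \<in> gball E W d w) * r u)"
   using sub[of E] fin by (intro sum.mono_neutral_cong_left) auto
  moreover have "X W d w E * (\<Sum>u\<in>gball E W d w. r u) \<le> 1 * (\<Sum>u\<in>gball E W d w. r u)"
   using r0 X_bounds by (intro mult_right_mono sum_nonneg) auto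
  ultimately show "X W d w E * (mean (X W d w') + (\<Sum>u\<in>gball E W d w. r u)) \<le>
   X W d w E * mean (X W d w') + (\<Sum>u\<in>W. of_bool (u \<in> gball E W d w) * r u)"
   by (simp add: distrib_left)
 qed
 also have "... = mean (X W d w) * mean (X W d w') + (\<Sum>u\<in>W. mean (\<lambda>E. of_bool (u \<in> gball E W d w)) * r u)"
  by simp
 also have "(\<Sum>u\<in>W. mean (\<lambda>E. of_bool (u \<in> gball E W d w)) * r u) \<le> (\<Sum>u\<in>W. R w u * R w' u)"
  using W w r r0 unfolding R_def
  by (intro sum_mono mult_mono mean_reach) (auto intro!: sum_nonneg pw_nonneg)
 also have "... = (\<Sum>k\<le>d. \<Sum>l\<le>d. pw p W (k + l) w w')"
 proof -
  have "(\<Sum>u\<in>W. R w u * R w' u) = (\<Sum>u\<in>W. \<Sum>k\<le>d. \<Sum>l\<le>d. pw p W k w u * pw p W l u w')"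
   using w by (simp add: R_def sum_product pw_sym[OF W, of w'])
  also have "... = (\<Sum>k\<le>d. \<Sum>l\<le>d. \<Sum>u\<in>W. pw p W k w u * pw p W l u w')"
   by (subst sum.swap) (rule sum.cong[OF refl], rule sum.swap)
  finally show ?thesis using w fin by (simp add: pw_add)
 qed
 \<comment> \<open>The joined walks have length k + l at most 2 d. Each of the d + 1 inner sums is
   bounded by the sum over all lengths up to 2 d; together with the meeting term this gives the
   factor d + 2.\<close>
 also have "... \<le> (\<Sum>k\<le>d. \<Sum>j\<le>2 * d. pw p W j w w')"
 proof (rule sum_mono)
  fix k assume "k \<in> {..d}"
  have "(\<Sum>l\<le>d. pw p W (k + l) w w') = (\<Sum>j\<in>(+) k ` {..d}. pw p W j w w')"
   by (simp add: sum.reindex)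
  also have "... \<le> (\<Sum>j\<le>2 * d. pw p W j w w')"
   using \<open>k \<in> {..d}\<close> w W by (intro sum_mono2 pw_nonneg) auto
  finally show "(\<Sum>l\<le>d. pw p W (k + l) w w') \<le> (\<Sum>j\<le>2 * d. pw p W j w w')" .
 qed
 finally show ?thesis by (simp add: algebra_simps)
qed

text \<open>Every factor is affine in its own edge indicator, and Y and Z do not see the edges at v.
  Taking the expectation over one edge at a time therefore replaces each indicator by its
  probability exactly.\<close>

lemma mean_thin:
 assumes "finite A" "A \<subseteq> {..<N} - {v}" "v < N"
  and "\<And>w E. w \<in> A ==> Y w E = Y w (E - touch {v})"
  and "\<And>E. Z E = Z (E - touch {v})"
 shows "mean (\<lambda>E. Z E * (\<Prod>w\<in>A. 1 - of_bool (joined E v w) * Y w E)) =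
  mean (\<lambda>E. Z E * (\<Prod>w\<in>A. 1 - p v w * Y w E))"
 using assms(1,2,4,5)
proof (induction A arbitrary: Z)
 case (insert a A)
 define P where "P E = (\<Prod>w\<in>A. 1 - of_bool (joined E v w) * Y w E)" for E
 define T where "T = {(v, a), (a, v)}"
 have T: "T \<subseteq> touch {v}" by (auto simp: T_def touch_def)
 then have T': "E - T - touch {v} = E - touch {v}" for E by auto
 have YT: "Y w (E - T) = Y w E" if "w \<in> insert a A" for w E
  using insert.prems(2)[OF that, of E] insert.prems(2)[OF that, of "E - T"] by (simp only: T')
 have ZT: "Z (E - T) = Z E" for E
  using insert.prems(3)[of E] insert.prems(3)[of "E - T"] by (simp only: T')
 have "joined (E - T) v w = joined E v w" if "w \<in> A" for w E
  using that insert.hyps insert.prems(1) by (auto simp: joined_def T_def)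
 then have PT: "P (E - T) = P E" for E
  unfolding P_def using YT by (intro prod.cong) auto
 have "mean (\<lambda>E. Z E * (\<Prod>w\<in>insert a A. 1 - of_bool (joined E v w) * Y w E)) =
   mean (\<lambda>E. Z E * P E - of_bool (joined E v a) * (Y a E * Z E * P E))"
  using insert.hyps by (simp add: P_def algebra_simps)
 also have "... = mean (\<lambda>E. Z E * P E) - mean (\<lambda>E. of_bool (joined E v a) * (Y a E * Z E * P E))"
  by simp
 also have "mean (\<lambda>E. of_bool (joined E v a) * (Y a E * Z E * P E)) =
   mean (\<lambda>E. of_bool (joined E v a)) * mean (\<lambda>E. Y a E * Z E * P E)"
 proof (rule mean_indep[where A = T])
  show "of_bool (joined E v a) = of_bool (joined (E \<inter> T) v a)" for E
   by (auto simp: joined_def T_def)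
  show "Y a E * Z E * P E = Y a (E - T) * Z (E - T) * P (E - T)" for E
   by (simp add: YT ZT PT)
 qed
 also have "... = p v a * mean (\<lambda>E. Y a E * Z E * P E)"
  using insert.prems(1) assms(3) by (subst mean_edge) auto
 also have "... = mean (\<lambda>E. p v a * (Y a E * Z E * P E))"
  by (rule integral_mult_right_zero[symmetric])
 also have "mean (\<lambda>E. Z E * P E) - ... = mean (\<lambda>E. Z E * P E - p v a * (Y a E * Z E * P E))"
  by (rule B_integral_diff[symmetric]) auto
 also have "... = mean (\<lambda>E. (Z E * (1 - p v a * Y a E)) * P E)"
  by (simp add: algebra_simps)
 also have "... = mean (\<lambda>E. (Z E * (1 - p v a * Y a E)) * (\<Prod>w\<in>A. 1 - p v w * Y w E))"
  unfolding P_def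
 proof (rule insert.IH)
  show "Z E * (1 - p v a * Y a E) = Z (E - touch {v}) * (1 - p v a * Y a (E - touch {v}))" for E
   using insert.prems(2)[of a E] insert.prems(3)[of E] by simp
  show "Y w E = Y w (E - touch {v})" if "w \<in> A" for w E
   using that by (intro insert.prems(2)) auto
 qed (use insert.prems(1) in auto)
 finally show ?case using insert.hyps by (simp add: mult.assoc)
qed simp

text \<open>If the balls around the neighbours of v are disjoint, the ball of v has one vertex more
  than all of them together and the two terms agree. Otherwise two neighbours w and x lie within 2 d
  of each other, the right side is at least 1, and both terms lie in [0, 1].\<close>

lemma X_Suc_pointwise:
 assumes W: "W \<subseteq> {..<N}" and v: "v \<in> W"
 shows "\<bar>X W (Suc d) v E - s * (\<Prod>w\<in>W - {v}. 1 - of_bool (joined E v w) * (1 - X (W - {v}) d w E))\<bar> \<le>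
  (\<Sum>w\<in>W - {v}. \<Sum>x\<in>W - {v} - {w}. of_bool (joined E v w) * of_bool (joined E v x) *
   of_bool (x \<in> gball E (W - {v}) (2 * d) w))" (is "_ \<le> (\<Sum>w\<in>_. \<Sum>x\<in>_. ?t w x)")
proof -
 let ?W = "W - {v}" and ?B = "\<lambda>w. gball E (W - {v}) d w"
 define A where "A = {w \<in> ?W. joined E v w}"
 have fin: "finite W" using W finite_subset by blast
 then have finA: "finite A" by (simp add: A_def)
 have "(\<Prod>w\<in>?W. 1 - of_bool (joined E v w) * (1 - X ?W d w E)) = (\<Prod>w\<in>A. X ?W d w E)"
  using fin finA by (intro prod.mono_neutral_cong_right) (auto simp: A_def)
 also have "... = s ^ (\<Sum>w\<in>A. card (?B w))" by (simp add: power_sum)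
 finally have prod: "(\<Prod>w\<in>?W. 1 - of_bool (joined E v w) * (1 - X ?W d w E)) = s ^ (\<Sum>w\<in>A. card (?B w))" .
 have ball: "gball E W (Suc d) v = insert v (\<Union>w\<in>A. ?B w)"
  unfolding gball_Suc_remove A_def ..
 have sub: "?B w \<subseteq> ?W" if "w \<in> A" for w
  using gball_subset[of E ?W d w] that by (auto simp: A_def)
 show ?thesis
 proof (cases "\<exists>w\<in>A. \<exists>x\<in>A. w \<noteq> x \<and> ?B w \<inter> ?B x \<noteq> {}")
  case False
  have "card (gball E W (Suc d) v) = Suc (card (\<Union>w\<in>A. ?B w))"
   unfolding ball using fin finA sub by (subst card_insert_disjoint) auto
  also have "card (\<Union>w\<in>A. ?B w) = (\<Sum>w\<in>A. card (?B w))"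
   using fin finA False by (intro card_UN_disjoint) auto
  finally have "X W (Suc d) v E = s * s ^ (\<Sum>w\<in>A. card (?B w))" by (simp del: gball.simps)
  then show ?thesis by (simp only: prod diff_self abs_zero) (intro sum_nonneg, auto)
 next
  case True
  then obtain w x u where wx: "w \<in> A" "x \<in> A" "w \<noteq> x" "u \<in> ?B w" "u \<in> ?B x" by blast
  then have "x \<in> gball E ?W (2 * d) w" by (intro gball_meet) (auto simp: A_def)
  then have "1 = ?t w x" using wx by (simp add: A_def)
  also have "... \<le> (\<Sum>x\<in>?W - {w}. ?t w x)"
   using fin finA wx by (intro member_le_sum) (auto simp: A_def)
  also have "... \<le> (\<Sum>w\<in>?W. \<Sum>x\<in>?W - {w}. ?t w x)"
   using fin finA wx by (intro member_le_sum[of w ?W "\<lambda>w. \<Sum>x\<in>?W - {w}. ?t w x"]) (auto simp: A_def intro!: sum_nonneg)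
  finally have *: "1 \<le> (\<Sum>w\<in>?W. \<Sum>x\<in>?W - {w}. ?t w x)" .
  have "0 \<le> s * s ^ (\<Sum>w\<in>A. card (?B w))" "s * s ^ (\<Sum>w\<in>A. card (?B w)) \<le> 1"
   using s0 s1 by (auto intro!: mult_le_one power_le_one)
  then have "\<bar>X W (Suc d) v E - s * s ^ (\<Sum>w\<in>A. card (?B w))\<bar> \<le> 1"
   using X_bounds[of E W "Suc d" v] by linarith
  with * show ?thesis unfolding prod by linarith
 qed
qed

lemma mean_pair_meet:
 assumes W: "W \<subseteq> {..<N}" and v: "v < N" "v \<notin> W" and wx: "w \<in> W" "x \<in> W" "w \<noteq> x"
 shows "mean (\<lambda>E. of_bool (joined E v w) * of_bool (joined E v x) * of_bool (x \<in> gball E W k w))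
  = p v w * p v x * mean (\<lambda>E. of_bool (x \<in> gball E W k w))"
proof -
 let ?H = "\<lambda>E. of_bool (x \<in> gball E W k w) :: real"
 have 1: "mean (\<lambda>E. (of_bool (joined E v w) * of_bool (joined E v x)) * ?H E) =
  mean (\<lambda>E. of_bool (joined E v w) * of_bool (joined E v x)) * mean ?H"
 proof (rule mean_indep[where A = "touch {v}"])
  show "of_bool (joined E v w) * of_bool (joined E v x) =
   of_bool (joined (E \<inter> touch {v}) v w) * of_bool (joined (E \<inter> touch {v}) v x)" for E
   by (simp only: joined_touch)
  show "?H E = ?H (E - touch {v})" for E using v wx by (subst gball_touch) auto
 qed
 have 2: "mean (\<lambda>E. of_bool (joined E v w) * of_bool (joined E v x)) =
  mean (\<lambda>E. of_bool (joined E v w)) * mean (\<lambda>E. of_bool (joined E v x))"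
 proof (rule mean_indep[where A = "{(v, w), (w, v)}"])
  show "of_bool (joined E v w) = of_bool (joined (E \<inter> {(v, w), (w, v)}) v w)" for E
   by (auto simp: joined_def)
  show "of_bool (joined E v x) = of_bool (joined (E - {(v, w), (w, v)}) v x)" for E
   using v wx by (auto simp: joined_def)
 qed
 have "v \<noteq> w" "v \<noteq> x" "w < N" "x < N" using v wx W by auto
 with 1 2 v show ?thesis by (simp add: mean_edge)
qed

text \<open>The expectations obey the branching recursion up to closed walks at v, whose total
  weight is \<open>T\<close>. The factor d + 5 collects 1 for neighbours with meeting balls, 1 for
  passing from the product to the exponential, d + 2 for the fluctuation of the exponent, and 1 for
  putting v back into the vertex set.\<close>

lemma mean_X_Suc:
 assumes W: "W \<subseteq> {..<N}" and v: "v \<in> W"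
 shows "\<bar>mean (X W (Suc d) v) - s * exp (- (\<Sum>w\<in>W. p v w * (1 - mean (X W d w))))\<bar> \<le>
  (d + 5) * (\<Sum>k\<le>2 * d. pw p W (Suc (Suc k)) v v)"
proof -
 let ?W = "W - {v}"
 let ?J = "\<lambda>E. \<Prod>w\<in>?W. 1 - of_bool (joined E v w) * (1 - X ?W d w E)"
 let ?P = "\<lambda>E. \<Prod>w\<in>?W. 1 - p v w * (1 - X ?W d w E)"
 define R where "R w x = (\<Sum>k\<le>2 * d. pw p W k w x)" for w x
 let ?Z = "\<Sum>w\<in>?W. \<Sum>x\<in>?W. p v w * p v x * R w x"
 define T where "T = (\<Sum>k\<le>2 * d. pw p W (Suc (Suc k)) v v)"
 define r where "r w = mean (X ?W d w)" for w
 define q where "q w = mean (X W d w)" for w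
 let ?Q = "\<Sum>w\<in>?W. p v w * (1 - q w)"
 define Y where "Y E = (\<Sum>w\<in>?W. p v w * (1 - X ?W d w E))" for E
 define m where "m = (\<Sum>w\<in>?W. p v w * (1 - r w))"
 have fin: "finite W" using W finite_subset by blast
 have vN: "v < N" and W': "?W \<subseteq> {..<N}" using v W by auto
 have pv: "0 \<le> p v w" "p v w \<le> 1" if "w \<in> W" for w
  using that vN W by (auto intro: p_nonneg p_le1)
 have R0: "0 \<le> R w x" if "w \<in> W" for w x unfolding R_def using that W by (intro sum_nonneg pw_nonneg) auto
 have r01: "0 \<le> r w" "r w \<le> 1" for w unfolding r_def by (rule mean_X_bounds)+
 have q01: "0 \<le> q w" "q w \<le> 1" for w unfolding q_def by (rule mean_X_bounds)+
 have T_eq: "T = (\<Sum>w\<in>W. \<Sum>x\<in>W. p v w * p v x * R w x)"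
 proof -
  have "T = (\<Sum>k\<le>2 * d. \<Sum>w\<in>W. \<Sum>x\<in>W. p v w * p v x * pw p W k w x)"
   unfolding T_def by (simp only: pw_walk[OF W v])
  also have "... = (\<Sum>w\<in>W. \<Sum>x\<in>W. \<Sum>k\<le>2 * d. p v w * p v x * pw p W k w x)"
   by (subst sum.swap) (rule sum.cong[OF refl], rule sum.swap)
  finally show ?thesis by (simp add: R_def sum_distrib_left)
 qed
 have RW: "(\<Sum>k\<le>2 * d. pw p ?W k w x) \<le> R w x" if "w \<in> ?W" for w x
  unfolding R_def using that W by (intro sum_mono pw_mono) auto
 have T_W': "?Z \<le> T"
 proof -
  have "?Z \<le> (\<Sum>w\<in>?W. \<Sum>x\<in>W. p v w * p v x * R w x)"
   using fin pv R0 by (intro sum_mono sum_mono2) auto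
  also have "... \<le> T" unfolding T_eq
   using fin pv R0 by (intro sum_mono2) (auto intro!: sum_nonneg)
  finally show ?thesis .
 qed
 have 1: "\<bar>mean (X W (Suc d) v) - mean (\<lambda>E. s * (?J E))\<bar> \<le> T"
 proof -
  have "\<bar>mean (X W (Suc d) v) - mean (\<lambda>E. s * (?J E))\<bar> \<le>
   mean (\<lambda>E. \<bar>X W (Suc d) v E - s * (?J E)\<bar>)"
   by (rule mean_diff_abs)
  also have "... \<le> mean (\<lambda>E. \<Sum>w\<in>?W. \<Sum>x\<in>?W - {w}. of_bool (joined E v w) * of_bool (joined E v x) *
   of_bool (x \<in> gball E ?W (2 * d) w))"
   by (intro mean_mono X_Suc_pointwise W v)
  also have "... = (\<Sum>w\<in>?W. \<Sum>x\<in>?W - {w}. mean (\<lambda>E. of_bool (joined E v w) * of_bool (joined E v x) *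
   of_bool (x \<in> gball E ?W (2 * d) w)))" by simp
  also have "... = (\<Sum>w\<in>?W. \<Sum>x\<in>?W - {w}. p v w * p v x * mean (\<lambda>E. of_bool (x \<in> gball E ?W (2 * d) w)))"
   using W' vN by (intro sum.cong refl mean_pair_meet) auto
  also have "... \<le> (\<Sum>w\<in>?W. \<Sum>x\<in>?W - {w}. p v w * p v x * R w x)"
   using pv W' by (intro sum_mono mult_left_mono order_trans[OF mean_reach RW]) auto
  also have "... \<le> ?Z"
   using fin pv R0 by (intro sum_mono sum_mono2) auto
  finally show ?thesis using T_W' by linarith
 qed
 have 2: "mean (\<lambda>E. s * (?J E)) =
   mean (\<lambda>E. s * (?P E))"
 proof (rule mean_thin)
  show "1 - X ?W d w E = 1 - X ?W d w (E - touch {v})" if "w \<in> ?W" for w E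
   using that by (subst gball_touch) auto
 qed (use fin W vN in auto)
 have p2: "(\<Sum>w\<in>?W. (p v w)\<^sup>2) \<le> T"
 proof -
  have "(\<Sum>w\<in>?W. (p v w)\<^sup>2) \<le> ?Z"
  proof (rule sum_mono)
   fix w assume w: "w \<in> ?W"
   have "pw p W 0 w w \<le> R w w" unfolding R_def
    using w W by (intro member_le_sum pw_nonneg) auto
   then have "p v w * p v w * 1 \<le> p v w * p v w * R w w"
    using pv w by (intro mult_left_mono) auto
   also have "... \<le> (\<Sum>x\<in>?W. p v w * p v x * R w x)"
    using w fin pv R0 by (intro member_le_sum) auto
   finally show "(p v w)\<^sup>2 \<le> (\<Sum>x\<in>?W. p v w * p v x * R w x)" by (simp add: power2_eq_square)
  qed
  with T_W' show ?thesis by linarith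
 qed
 have 3: "\<bar>mean (\<lambda>E. s * (?P E)) - mean (\<lambda>E. s * exp (- Y E))\<bar> \<le> T"
 proof -
  have "\<bar>mean (\<lambda>E. s * (?P E)) - mean (\<lambda>E. s * exp (- Y E))\<bar> \<le>
   mean (\<lambda>E. \<bar>s * (?P E) - s * exp (- Y E)\<bar>)"
   by (rule mean_diff_abs)
  also have "... \<le> mean (\<lambda>E. T)"
  proof (rule mean_mono)
   fix E
   have b: "0 \<le> p v w * (1 - X ?W d w E) \<and> p v w * (1 - X ?W d w E) \<le> p v w" if "w \<in> ?W" for w
    using that pv[of w] X_bounds[of E ?W d w] by (auto intro!: mult_left_le)
   have "\<bar>(?P E) - exp (- Y E)\<bar> \<le> (\<Sum>w\<in>?W. (p v w * (1 - X ?W d w E))\<^sup>2)"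
    unfolding Y_def using fin b pv by (intro abs_prod_one_minus_exp) force+
   also have "... \<le> (\<Sum>w\<in>?W. (p v w)\<^sup>2)"
    using b by (intro sum_mono power_mono) auto
   finally have *: "\<bar>(?P E) - exp (- Y E)\<bar> \<le> T" using p2 by linarith
   have "\<bar>s * (?P E) - s * exp (- Y E)\<bar> =
    s * \<bar>(?P E) - exp (- Y E)\<bar>"
    using s0 by (simp add: abs_mult flip: right_diff_distrib)
   also have "... \<le> 1 * T" using s0 s1 * by (intro mult_mono) auto
   finally show "\<bar>s * (?P E) - s * exp (- Y E)\<bar> \<le> T" by simp
  qed
  finally show ?thesis by simp
 qed
 have m0: "0 \<le> m" unfolding m_def using pv r01 by (intro sum_nonneg mult_nonneg_nonneg) auto
 have Y0: "0 \<le> Y E" for E unfolding Y_def using pv X_bounds by (intro sum_nonneg mult_nonneg_nonneg) auto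
 have mY: "mean Y = m" unfolding Y_def m_def r_def by simp
 \<comment> \<open>The exponent \<open>Y\<close> has mean m, so the linear term of the expansion
   disappears and only the variance of \<open>Y\<close> is left; \<open>mean_covariance\<close>
   bounds it by walks between two neighbours of v.\<close>
 have 4: "\<bar>mean (\<lambda>E. s * exp (- Y E)) - s * exp (- m)\<bar> \<le> (d + 2) * T"
 proof -
  have "mean (\<lambda>E. exp (- Y E) - exp (- m) + exp (- m) * (Y E - m)) = mean (\<lambda>E. exp (- Y E)) - exp (- m)"
   by (simp add: mY)
  then have "\<bar>mean (\<lambda>E. exp (- Y E)) - exp (- m)\<bar> = \<bar>mean (\<lambda>E. exp (- Y E) - exp (- m) + exp (- m) * (Y E - m))\<bar>"
   by simp
  also have "... \<le> mean (\<lambda>E. \<bar>exp (- Y E) - exp (- m) + exp (- m) * (Y E - m)\<bar>)"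
   by (rule integral_abs_bound)
  also have "... \<le> mean (\<lambda>E. (Y E - m)\<^sup>2)"
   using m0 Y0 by (intro mean_mono exp_minus_second_order)
  also have "... = mean (\<lambda>E. \<Sum>w\<in>?W. \<Sum>x\<in>?W. p v w * p v x * ((r w - X ?W d w E) * (r x - X ?W d x E)))"
  proof (rule B_integral_cong[OF refl])
   fix E
   have "Y E - m = (\<Sum>w\<in>?W. p v w * (r w - X ?W d w E))"
    unfolding Y_def m_def by (simp add: sum_subtractf[symmetric] algebra_simps)
   then show "(Y E - m)\<^sup>2 = (\<Sum>w\<in>?W. \<Sum>x\<in>?W. p v w * p v x * ((r w - X ?W d w E) * (r x - X ?W d x E)))"
    by (simp add: power2_eq_square sum_product mult_ac)
  qed
  also have "... = (\<Sum>w\<in>?W. \<Sum>x\<in>?W. p v w * p v x * mean (\<lambda>E. (r w - X ?W d w E) * (r x - X ?W d x E)))"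
   by simp
  also have "... \<le> (\<Sum>w\<in>?W. \<Sum>x\<in>?W. p v w * p v x * ((d + 2) * R w x))"
  proof (intro sum_mono mult_left_mono)
   fix w x assume wx: "w \<in> ?W" "x \<in> ?W"
   have "mean (\<lambda>E. (r w - X ?W d w E) * (r x - X ?W d x E)) =
    mean (\<lambda>E. r w * r x - r w * X ?W d x E - r x * X ?W d w E + X ?W d w E * X ?W d x E)"
    by (simp add: algebra_simps)
   also have "... = r w * r x - r w * r x - r x * r w + mean (\<lambda>E. X ?W d w E * X ?W d x E)"
    by (simp add: r_def)
   also have "... \<le> (d + 2) * (\<Sum>k\<le>2 * d. pw p ?W k w x)"
    using mean_covariance[OF W' wx, of d] by (simp add: r_def algebra_simps)
   also have "... \<le> (d + 2) * R w x" using RW wx by (intro mult_left_mono) auto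
   finally show "mean (\<lambda>E. (r w - X ?W d w E) * (r x - X ?W d x E)) \<le> (d + 2) * R w x" .
   show "0 \<le> p v w * p v x" using wx pv by auto
  qed
  also have "... = (d + 2) * ?Z"
   unfolding sum_distrib_left by (intro sum.cong refl) (simp only: mult_ac)
  also have "... \<le> (d + 2) * T" using T_W' by (intro mult_left_mono) auto
  finally have *: "\<bar>mean (\<lambda>E. exp (- Y E)) - exp (- m)\<bar> \<le> (d + 2) * T" .
  have "\<bar>mean (\<lambda>E. s * exp (- Y E)) - s * exp (- m)\<bar> = s * \<bar>mean (\<lambda>E. exp (- Y E)) - exp (- m)\<bar>"
   using s0 by (simp add: abs_mult flip: right_diff_distrib)
  also have "... \<le> 1 * ((d + 2) * T)" using s0 s1 * by (intro mult_mono) auto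
  finally show ?thesis by simp
 qed
 have q_sum: "(\<Sum>w\<in>W. p v w * (1 - q w)) = ?Q"
  using fin p_diag[OF vN] by (intro sum.mono_neutral_right) auto
 \<comment> \<open>Deleting v changes the ball of a neighbour w only if that ball contains v, and
   then the edge from v to w closes a walk at v.\<close>
 have 5: "\<bar>s * exp (- m) - s * exp (- (\<Sum>w\<in>W. p v w * (1 - q w)))\<bar> \<le> T"
 proof -
  have rq: "\<bar>r w - q w\<bar> \<le> (\<Sum>k\<le>d. pw p W k w v)" if w: "w \<in> ?W" for w
  proof -
   have "\<bar>r w - q w\<bar> \<le> mean (\<lambda>E. \<bar>X ?W d w E - X W d w E\<bar>)"
    unfolding r_def q_def by (rule mean_diff_abs)
   also have "... \<le> mean (\<lambda>E. of_bool (v \<in> gball E W d w))"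
   proof (rule mean_mono)
    fix E show "\<bar>X ?W d w E - X W d w E\<bar> \<le> of_bool (v \<in> gball E W d w)"
    proof (cases "v \<in> gball E W d w")
     case True
     then show ?thesis using X_bounds[of E W d w] X_bounds[of E ?W d w] by auto
    next
     case False
     then have "gball E ?W d w = gball E W d w" by (intro gball_avoid) auto
     then show ?thesis by simp
    qed
   qed
   also have "... \<le> (\<Sum>k\<le>d. pw p W k w v)" using w W by (intro mean_reach) auto
   finally show ?thesis .
  qed
  have "\<bar>exp (- m) - exp (- ?Q)\<bar> \<le> \<bar>m - ?Q\<bar>"
   using m0 pv q01 by (intro exp_minus_Lipschitz sum_nonneg mult_nonneg_nonneg) auto
  also have "... = \<bar>\<Sum>w\<in>?W. p v w * (q w - r w)\<bar>"
   unfolding m_def by (simp add: sum_subtractf[symmetric] algebra_simps)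
  also have "... \<le> (\<Sum>w\<in>?W. \<bar>p v w * (q w - r w)\<bar>)" by (rule sum_abs)
  also have "... \<le> (\<Sum>w\<in>?W. p v w * (\<Sum>k\<le>d. pw p W k w v))"
   using pv rq by (intro sum_mono) (auto simp: abs_mult abs_minus_commute intro!: mult_left_mono)
  also have "... = (\<Sum>w\<in>W. p v w * (\<Sum>k\<le>d. pw p W k w v))"
   using fin p_diag[OF vN] by (intro sum.mono_neutral_left) auto
  also have "... = (\<Sum>k\<le>d. pw p W (Suc k) v v)"
   by (simp add: sum_distrib_left) (rule sum.swap)
  \<comment> \<open>There is no closed walk of length 1 because the diagonal is 0; all remaining
    lengths are at least 2 and occur in \<open>T\<close>.\<close>
  also have "... \<le> T"
  proof (cases d)
   case 0
   have "pw p W (Suc 0) v v = 0"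
    using pw_Suc_right[OF fin v v, of 0] v fin p_diag[OF vN] by (simp add: sum.neutral)
   moreover have "0 \<le> T" unfolding T_def using vN W by (intro sum_nonneg pw_nonneg) auto
   ultimately show ?thesis using 0 by simp
  next
   case (Suc e)
   have "pw p W (Suc 0) v v = 0"
    using pw_Suc_right[OF fin v v, of 0] v fin p_diag[OF vN] by (simp add: sum.neutral)
   then have "(\<Sum>k\<le>d. pw p W (Suc k) v v) = (\<Sum>k\<le>e. pw p W (Suc (Suc k)) v v)"
    unfolding Suc by (subst sum.atMost_Suc_shift) (simp del: pw.simps)
   also have "... \<le> T" unfolding T_def
    using vN W Suc by (intro sum_mono2 pw_nonneg) auto
   finally show ?thesis .
  qed
  finally have *: "\<bar>exp (- m) - exp (- ?Q)\<bar> \<le> T" .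
  have "\<bar>s * exp (- m) - s * exp (- ?Q)\<bar> =
    s * \<bar>exp (- m) - exp (- ?Q)\<bar>"
   using s0 by (simp add: abs_mult flip: right_diff_distrib)
  also have "... \<le> 1 * T" using s0 s1 * by (intro mult_mono) auto
  finally show ?thesis unfolding q_sum by simp
 qed
 have "\<bar>mean (X W (Suc d) v) - s * exp (- (\<Sum>w\<in>W. p v w * (1 - q w)))\<bar> \<le> T + T + (d + 2) * T + T"
  using 1 3 4 5 unfolding 2 by linarith
 then show ?thesis unfolding T_def q_def by (simp add: algebra_simps)
qed

end

end

section \<open>Averages over neighbourhoods\<close>

text \<open>The recursion of \<open>bp_pgf\<close> with the matrix p summed over W in place of the
  kernel integrated against \<mu>.\<close>

primrec mgf :: "(nat => nat => real) => nat set => real => nat => nat => real" where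
 "mgf p W s 0 v = s"
| "mgf p W s (Suc d) v = s * exp (- (\<Sum>w\<in>W. p v w * (1 - mgf p W s d w)))"

text \<open>An upper bound, defined by recursion, for the probability that the ball of radius d
  around v leaves W. The cut at 1 keeps it bounded although row sums are not.\<close>

primrec hit :: "(nat => nat => real) => nat => nat set => nat => nat => real" where
 "hit p N W 0 v = of_bool (v \<notin> W)"
| "hit p N W (Suc d) v = min 1 (of_bool (v \<notin> W) + (\<Sum>w<N. p v w * hit p N W d w))"

text \<open>The coefficient of the sum of squares of p in the accumulated error: each generation
  adds the error of \<open>mean_X_Suc\<close> and multiplies the old error by the row bound
  K.\<close>

primrec local_error :: "real => nat => real" where
 "local_error K 0 = 0"
| "local_error K (Suc d) = (real d + 5) * (\<Sum>k\<le>2 * d. K ^ k) + K * local_error K d"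

section \<open>Restriction to vertices of bounded expected degree\<close>

context edge_prob
begin

lemma mgf_bounds:
 assumes "0 \<le> s" "s \<le> 1" "W \<subseteq> {..<N}" "v < N"
 shows "0 \<le> mgf p W s d v \<and> mgf p W s d v \<le> 1"
 using assms(4)
proof (induction d arbitrary: v)
 case (Suc d)
 have "0 \<le> (\<Sum>w\<in>W. p v w * (1 - mgf p W s d w))"
  using Suc assms by (intro sum_nonneg mult_nonneg_nonneg) (auto intro!: p_nonneg)
 then show ?case using assms by (auto intro!: mult_le_one)
qed (use assms in auto)

lemma hit_bounds: "v < N ==> 0 \<le> hit p N W d v \<and> hit p N W d v \<le> 1"
proof (induction d arbitrary: v)
 case (Suc d)
 then show ?case by (auto intro!: add_nonneg_nonneg sum_nonneg mult_nonneg_nonneg p_nonneg)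
qed auto

lemma hit_outside: "v < N ==> v \<notin> W ==> hit p N W d v = 1"
proof (cases d)
 case (Suc e)
 assume v: "v < N" "v \<notin> W"
 then have "0 \<le> (\<Sum>w<N. p v w * hit p N W e w)"
  using hit_bounds[of _ W e] by (intro sum_nonneg mult_nonneg_nonneg p_nonneg) auto
 with v Suc show ?thesis by simp
qed auto

text \<open>The exploration of \<open>mean_reach\<close> again: after deletion of v the edges at v
  are independent of what follows. V shrinks along the induction while the bound keeps the full
  vertex set.\<close>

lemma mean_hit:
 assumes "V \<subseteq> {..<N}" "v < N"
 shows "mean (\<lambda>E. of_bool (\<not> gball E V d v \<subseteq> W)) \<le> hit p N W d v"
 using assms
proof (induction d arbitrary: v V)
 case (Suc d)
 have fin: "finite V" using Suc.prems finite_subset by blast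
 let ?H = "\<lambda>w E. of_bool (\<not> gball E (V - {v}) d w \<subseteq> W) :: real"
 let ?B = "\<lambda>w. \<lambda>E. of_bool (joined E v w) * ?H w E"
 let ?T = "\<lambda>E. \<Sum>w\<in>V - {v}. of_bool (joined E v w) * ?H w E"
 have "mean (\<lambda>E. of_bool (\<not> gball E V (Suc d) v \<subseteq> W)) \<le>
   mean (\<lambda>E. of_bool (v \<notin> W) + (?T E))"
 proof (rule mean_mono)
  fix E
  have nn: "0 \<le> (?T E)" by (intro sum_nonneg) auto
  show "of_bool (\<not> gball E V (Suc d) v \<subseteq> W) \<le> of_bool (v \<notin> W) + (?T E)"
  proof (cases "\<not> gball E V (Suc d) v \<subseteq> W \<and> v \<in> W")
   case True
   then obtain w where w: "w \<in> V - {v}" "joined E v w" "\<not> gball E (V - {v}) d w \<subseteq> W"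
    unfolding gball_Suc_remove by blast
   have "of_bool (joined E v w) * ?H w E \<le> (?T E)"
    using w fin by (intro member_le_sum) auto
   with w have "1 \<le> (?T E)" by simp
   with True show ?thesis by (simp del: gball.simps)
  qed (use nn in \<open>auto simp del: gball.simps\<close>)
 qed
 also have "... = of_bool (v \<notin> W) + (\<Sum>w\<in>V - {v}. mean (?B w))"
  by simp
 also have "(\<Sum>w\<in>V - {v}. mean (?B w)) = (\<Sum>w\<in>V - {v}. p v w * mean (?H w))"
 proof (intro sum.cong refl)
  fix w assume w: "w \<in> V - {v}"
  have "mean (?B w) = mean (\<lambda>E. of_bool (joined E v w)) * mean (?H w)"
  proof (rule mean_indep[where A = "touch {v}"])
   show "of_bool (joined E v w) = of_bool (joined (E \<inter> touch {v}) v w)" for E by (simp only: joined_touch)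
   show "?H w E = ?H w (E - touch {v})" for E using w by (subst gball_touch) auto
  qed
  then show "mean (?B w) = p v w * mean (?H w)"
   using w Suc.prems by (subst (asm) mean_edge) auto
 qed
 also have "... \<le> (\<Sum>w\<in>V - {v}. p v w * hit p N W d w)"
  using Suc.prems by (intro sum_mono mult_left_mono Suc.IH) (auto intro!: p_nonneg)
 also have "... \<le> (\<Sum>w<N. p v w * hit p N W d w)"
  using Suc.prems hit_bounds by (intro sum_mono2) (auto intro!: p_nonneg mult_nonneg_nonneg)
 finally have "mean (\<lambda>E. of_bool (\<not> gball E V (Suc d) v \<subseteq> W)) \<le> of_bool (v \<notin> W) + (\<Sum>w<N. p v w * hit p N W d w)"
  by simp
 moreover have "mean (\<lambda>E. of_bool (\<not> gball E V (Suc d) v \<subseteq> W)) \<le> mean (\<lambda>E. 1)"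
  by (intro mean_mono) (auto simp del: gball.simps)
 ultimately show ?case by (simp del: gball.simps)
qed auto

text \<open>The bound that controls balls leaving W also controls the recursion: a vertex outside W
  has \<open>hit\<close> equal to 1, which pays for its missing summand.\<close>

lemma mgf_hit:
 assumes s: "0 \<le> s" "s \<le> 1" and W: "W \<subseteq> {..<N}" and "v \<in> W"
 shows "\<bar>mgf p {..<N} s d v - mgf p W s d v\<bar> \<le> hit p N W d v"
 using assms(4)
proof (induction d arbitrary: v)
 case (Suc d)
 let ?g = "mgf p {..<N} s d" and ?h = "mgf p W s d"
 have v: "v < N" using Suc.prems W by auto
 have b: "0 \<le> ?g w \<and> ?g w \<le> 1" "0 \<le> ?h w \<and> ?h w \<le> 1" if "w < N" for w
  using mgf_bounds[OF s _ that] W by auto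
 have pv: "0 \<le> p v w" if "w < N" for w using that v by (intro p_nonneg)
 have "\<bar>mgf p {..<N} s (Suc d) v - mgf p W s (Suc d) v\<bar> =
   s * \<bar>exp (- (\<Sum>w<N. p v w * (1 - ?g w))) - exp (- (\<Sum>w\<in>W. p v w * (1 - ?h w)))\<bar>"
  using s by (simp add: abs_mult flip: right_diff_distrib)
 also have "... \<le> 1 * \<bar>(\<Sum>w<N. p v w * (1 - ?g w)) - (\<Sum>w\<in>W. p v w * (1 - ?h w))\<bar>"
  using s b pv W by (intro mult_mono exp_minus_Lipschitz sum_nonneg mult_nonneg_nonneg) auto
 also have "(\<Sum>w<N. p v w * (1 - ?g w)) - (\<Sum>w\<in>W. p v w * (1 - ?h w)) =
   (\<Sum>w<N. p v w * ((1 - ?g w) - (if w \<in> W then 1 - ?h w else 0)))"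
 proof -
  have "(\<Sum>w\<in>W. p v w * (1 - ?h w)) = (\<Sum>w<N. p v w * (if w \<in> W then 1 - ?h w else 0))"
   using W by (intro sum.mono_neutral_cong_left) auto
  then show ?thesis by (simp add: right_diff_distrib sum_subtractf)
 qed
 also have "1 * \<bar>...\<bar> \<le> (\<Sum>w<N. p v w * hit p N W d w)"
 proof -
  have "\<bar>(1 - ?g w) - (if w \<in> W then 1 - ?h w else 0)\<bar> \<le> hit p N W d w" if "w < N" for w
   using Suc.IH[of w] hit_outside[OF that, of W d] b[OF that] by (auto simp: abs_minus_commute)
  then have "\<bar>p v w * ((1 - ?g w) - (if w \<in> W then 1 - ?h w else 0))\<bar> \<le> p v w * hit p N W d w" if "w < N" for w
   unfolding abs_mult using pv[OF that] that by (simp only: abs_of_nonneg mult_left_mono)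
  then have "(\<Sum>w<N. \<bar>p v w * ((1 - ?g w) - (if w \<in> W then 1 - ?h w else 0))\<bar>) \<le> (\<Sum>w<N. p v w * hit p N W d w)"
   by (intro sum_mono) simp
  then show ?thesis unfolding mult_1 by (rule order_trans[OF sum_abs])
 qed
 finally have "\<bar>mgf p {..<N} s (Suc d) v - mgf p W s (Suc d) v\<bar> \<le> (\<Sum>w<N. p v w * hit p N W d w)" .
 moreover have "\<bar>mgf p {..<N} s (Suc d) v - mgf p W s (Suc d) v\<bar> \<le> 1"
  using mgf_bounds[OF s order_refl v, of "Suc d"] mgf_bounds[OF s W v, of "Suc d"] by linarith
 ultimately show ?case using Suc.prems by simp
qed simp

context
 fixes s K :: real and W :: "nat set"
 assumes s0: "0 \<le> s" and s1: "s \<le> 1" and W: "W \<subseteq> {..<N}" and K0: "0 \<le> K"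
  and K: "\<And>v. v \<in> W ==> (\<Sum>w\<in>W. p v w) \<le> K"
begin

text \<open>The error is summed over all starting vertices, since closed walks are small only on
  average. By symmetry the column sums are at most K as well, so a generation multiplies the summed
  error by at most K.\<close>

lemma sum_mean_mgf:
 "(\<Sum>v\<in>W. \<bar>mean (X s W d v) - mgf p W s d v\<bar>) \<le> local_error K d * (\<Sum>v\<in>W. \<Sum>w\<in>W. (p v w)\<^sup>2)"
proof (induction d)
 case (Suc d)
 let ?S = "\<Sum>v\<in>W. \<Sum>w\<in>W. (p v w)\<^sup>2"
 let ?q = "\<lambda>w. mean (X s W d w)" and ?g = "mgf p W s d"
 have pv: "0 \<le> p v w" if "v \<in> W" "w \<in> W" for v w using that W by (intro p_nonneg) auto
 have q: "0 \<le> ?q w" "?q w \<le> 1" for w using mean_X_bounds[OF s0 s1] by auto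
 have g: "0 \<le> ?g w \<and> ?g w \<le> 1" if "w \<in> W" for w using mgf_bounds[OF s0 s1 W] that W by auto
 have "(\<Sum>v\<in>W. \<bar>mean (X s W (Suc d) v) - mgf p W s (Suc d) v\<bar>) \<le>
  (\<Sum>v\<in>W. (real d + 5) * (\<Sum>k\<le>2 * d. pw p W (Suc (Suc k)) v v) + (\<Sum>w\<in>W. p v w * \<bar>?q w - ?g w\<bar>))"
 proof (rule sum_mono)
  fix v assume v: "v \<in> W"
  have "\<bar>s * exp (- (\<Sum>w\<in>W. p v w * (1 - ?q w))) - mgf p W s (Suc d) v\<bar> =
   s * \<bar>exp (- (\<Sum>w\<in>W. p v w * (1 - ?q w))) - exp (- (\<Sum>w\<in>W. p v w * (1 - ?g w)))\<bar>"
   using s0 by (simp add: abs_mult flip: right_diff_distrib)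
  also have "... \<le> 1 * \<bar>(\<Sum>w\<in>W. p v w * (1 - ?q w)) - (\<Sum>w\<in>W. p v w * (1 - ?g w))\<bar>"
   using s0 s1 q g pv v by (intro mult_mono exp_minus_Lipschitz sum_nonneg mult_nonneg_nonneg) auto
  also have "... = \<bar>\<Sum>w\<in>W. p v w * (?g w - ?q w)\<bar>"
   by (simp add: sum_subtractf[symmetric] algebra_simps)
  also have "... \<le> (\<Sum>w\<in>W. p v w * \<bar>?q w - ?g w\<bar>)"
   using pv v by (auto intro!: order_trans[OF sum_abs] sum_mono simp: abs_mult abs_minus_commute)
  finally show "\<bar>mean (X s W (Suc d) v) - mgf p W s (Suc d) v\<bar> \<le>
    (real d + 5) * (\<Sum>k\<le>2 * d. pw p W (Suc (Suc k)) v v) + (\<Sum>w\<in>W. p v w * \<bar>?q w - ?g w\<bar>)"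
   using mean_X_Suc[OF s0 s1 W v, of d] by linarith
 qed
 also have "... = (real d + 5) * (\<Sum>k\<le>2 * d. \<Sum>v\<in>W. pw p W (Suc (Suc k)) v v) + (\<Sum>w\<in>W. (\<Sum>v\<in>W. p v w) * \<bar>?q w - ?g w\<bar>)"
  unfolding sum.distrib sum_distrib_right sum_distrib_left[symmetric]
  by (intro arg_cong2[where f = "(+)"] arg_cong2[where f = "(*)"] refl sum.swap)
 also have "... \<le> (real d + 5) * (\<Sum>k\<le>2 * d. K ^ k * ?S) + (\<Sum>w\<in>W. K * \<bar>?q w - ?g w\<bar>)"
 proof (intro add_mono mult_left_mono sum_mono mult_right_mono)
  show "(\<Sum>v\<in>W. pw p W (Suc (Suc k)) v v) \<le> K ^ k * ?S" for k
   by (rule pw_closed_walks[OF W K])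
  fix w assume w: "w \<in> W"
  have "(\<Sum>v\<in>W. p v w) = (\<Sum>v\<in>W. p w v)" using w W by (intro sum.cong refl p_sym) auto
  then show "(\<Sum>v\<in>W. p v w) \<le> K" using K[OF w] by simp
 qed auto
 also have "(\<Sum>w\<in>W. K * \<bar>?q w - ?g w\<bar>) \<le> K * (local_error K d * ?S)"
  unfolding sum_distrib_left[symmetric] using K0 Suc.IH by (intro mult_left_mono) auto
 also have "(\<Sum>k\<le>2 * d. K ^ k * ?S) = (\<Sum>k\<le>2 * d. K ^ k) * ?S"
  by (rule sum_distrib_right[symmetric])
 finally show ?case by (simp only: local_error.simps distrib_right mult.assoc)
qed simp

text \<open>Covariances are bounded by weights of walks, and these have row sums at most K^k; the
  variance of the sum is therefore linear in N.\<close>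

lemma sum_X_variance:
 "mean (\<lambda>E. (\<Sum>v\<in>W. X s W d v E - mean (X s W d v))\<^sup>2) \<le> (real d + 2) * real N * (\<Sum>k\<le>2 * d. K ^ k)"
proof -
 let ?q = "\<lambda>w. mean (X s W d w)"
 have "mean (\<lambda>E. (\<Sum>v\<in>W. X s W d v E - ?q v)\<^sup>2) =
  mean (\<lambda>E. \<Sum>v\<in>W. \<Sum>w\<in>W. (X s W d v E - ?q v) * (X s W d w E - ?q w))"
  by (simp add: power2_eq_square sum_product)
 also have "... = (\<Sum>v\<in>W. \<Sum>w\<in>W. mean (\<lambda>E. (X s W d v E - ?q v) * (X s W d w E - ?q w)))"
  by simp
 also have "... \<le> (\<Sum>v\<in>W. \<Sum>w\<in>W. (real d + 2) * (\<Sum>k\<le>2 * d. pw p W k v w))"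
 proof (intro sum_mono)
  fix v w assume vw: "v \<in> W" "w \<in> W"
  have "mean (\<lambda>E. (X s W d v E - ?q v) * (X s W d w E - ?q w)) =
   mean (\<lambda>E. X s W d v E * X s W d w E - ?q w * X s W d v E - ?q v * X s W d w E + ?q v * ?q w)"
   by (simp add: algebra_simps)
  also have "... = mean (\<lambda>E. X s W d v E * X s W d w E) - ?q v * ?q w" by simp
  finally show "mean (\<lambda>E. (X s W d v E - ?q v) * (X s W d w E - ?q w)) \<le> (real d + 2) * (\<Sum>k\<le>2 * d. pw p W k v w)"
   using mean_covariance[OF s0 s1 W vw, of d] by linarith
 qed
 also have "... = (\<Sum>v\<in>W. (real d + 2) * (\<Sum>k\<le>2 * d. \<Sum>w\<in>W. pw p W k v w))"
  unfolding sum_distrib_left[symmetric] by (intro sum.cong arg_cong2[where f = "(*)"] refl sum.swap)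
 also have "... \<le> (\<Sum>v\<in>W. (real d + 2) * (\<Sum>k\<le>2 * d. K ^ k))"
  by (intro sum_mono mult_left_mono pw_row_sum[OF W K]) auto
 also have "... = real (card W) * ((real d + 2) * (\<Sum>k\<le>2 * d. K ^ k))" by simp
 also have "... \<le> real N * ((real d + 2) * (\<Sum>k\<le>2 * d. K ^ k))"
  using K0 W card_mono[of "{..<N}" W] by (intro mult_right_mono mult_nonneg_nonneg sum_nonneg) auto
 finally show ?thesis by (simp add: mult_ac)
qed

text \<open>The difference is split into four parts: restricting the graph to W, replacing
  expectations by the recursion on W, extending that recursion to all vertices, and the centred
  fluctuation. The first and third part are both paid by \<open>hit\<close>.\<close>

lemma mean_local_average:
 fixes c :: real
 assumes c: "c > 0"
 shows "mean (\<lambda>E. \<bar>(\<Sum>v<N. X s {..<N} d v E) - (\<Sum>v<N. mgf p {..<N} s d v)\<bar>) \<le>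
  2 * (\<Sum>v<N. hit p N W d v) + local_error K d * (\<Sum>v<N. \<Sum>w<N. (p v w)\<^sup>2)
   + c + (real d + 2) * real N * (\<Sum>k\<le>2 * d. K ^ k) / c"
proof -
 let ?S = "\<Sum>v<N. \<Sum>w<N. (p v w)\<^sup>2"
 let ?V = "{..<N}"
 let ?Z = "\<lambda>E. \<Sum>v\<in>W. X s W d v E - mean (X s W d v)"
 define A where "A E = (\<Sum>v<N. X s ?V d v E) - (\<Sum>v\<in>W. X s W d v E)" for E
 define B where "B = (\<Sum>v\<in>W. mean (X s W d v)) - (\<Sum>v\<in>W. mgf p W s d v)"
 define D where "D = (\<Sum>v\<in>W. mgf p W s d v) - (\<Sum>v<N. mgf p ?V s d v)"
 have split: "(\<Sum>v<N. f v) - (\<Sum>v\<in>W. g v) = (\<Sum>v<N. f v - (if v \<in> W then g v else 0))" for f g :: "nat => real"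
 proof -
  have "(\<Sum>v\<in>W. g v) = (\<Sum>v<N. if v \<in> W then g v else 0)"
   using W by (intro sum.mono_neutral_cong_left) auto
  then show ?thesis by (simp add: sum_subtractf)
 qed
 have 1: "mean (\<lambda>E. \<bar>A E\<bar>) \<le> (\<Sum>v<N. hit p N W d v)"
 proof -
  have "mean (\<lambda>E. \<bar>A E\<bar>) \<le> mean (\<lambda>E. \<Sum>v<N. of_bool (\<not> gball E ?V d v \<subseteq> W))"
  proof (rule mean_mono)
   fix E
   have "\<bar>A E\<bar> \<le> (\<Sum>v<N. \<bar>X s ?V d v E - (if v \<in> W then X s W d v E else 0)\<bar>)"
    unfolding A_def split by (rule sum_abs)
   also have "... \<le> (\<Sum>v<N. of_bool (\<not> gball E ?V d v \<subseteq> W))"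
   proof (rule sum_mono)
    fix v assume v: "v \<in> ?V"
    show "\<bar>X s ?V d v E - (if v \<in> W then X s W d v E else 0)\<bar> \<le> of_bool (\<not> gball E ?V d v \<subseteq> W)"
    proof (cases "gball E ?V d v \<subseteq> W")
     case True
     then have "gball E ?V d v \<inter> (?V - W) = {}" by auto
     from gball_avoid[OF this] W have "gball E W d v = gball E ?V d v"
      by (simp add: double_diff)
     moreover have "v \<in> W" using True gball_refl by blast
     ultimately show ?thesis by simp
    next
     case False
     then show ?thesis
      using X_bounds[OF s0 s1, of E ?V d v] X_bounds[OF s0 s1, of E W d v] by auto
    qed
   qed
   finally show "\<bar>A E\<bar> \<le> (\<Sum>v<N. of_bool (\<not> gball E ?V d v \<subseteq> W))" .
  qed
  also have "... = (\<Sum>v<N. mean (\<lambda>E. of_bool (\<not> gball E ?V d v \<subseteq> W)))"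
   by (rule B_integral_sum) simp
  also have "... \<le> (\<Sum>v<N. hit p N W d v)" by (intro sum_mono mean_hit) auto
  finally show ?thesis .
 qed
 have 2: "\<bar>B\<bar> \<le> local_error K d * ?S"
 proof -
  have "\<bar>B\<bar> \<le> (\<Sum>v\<in>W. \<bar>mean (X s W d v) - mgf p W s d v\<bar>)"
   unfolding B_def by (subst sum_subtractf[symmetric]) (rule sum_abs)
  also have "... \<le> local_error K d * (\<Sum>v\<in>W. \<Sum>w\<in>W. (p v w)\<^sup>2)" by (rule sum_mean_mgf)
  also have "... \<le> local_error K d * ?S"
  proof (rule mult_left_mono)
   have "(\<Sum>v\<in>W. \<Sum>w\<in>W. (p v w)\<^sup>2) \<le> (\<Sum>v\<in>W. \<Sum>w<N. (p v w)\<^sup>2)"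
    using W by (intro sum_mono sum_mono2) auto
   also have "... \<le> ?S" using W by (intro sum_mono2) (auto intro: sum_nonneg)
   finally show "(\<Sum>v\<in>W. \<Sum>w\<in>W. (p v w)\<^sup>2) \<le> ?S" .
   show "0 \<le> local_error K d" using K0 by (induction d) (auto intro!: add_nonneg_nonneg mult_nonneg_nonneg sum_nonneg)
  qed
  finally show ?thesis .
 qed
 have 3: "\<bar>D\<bar> \<le> (\<Sum>v<N. hit p N W d v)"
 proof -
  have "\<bar>D\<bar> = \<bar>(\<Sum>v<N. mgf p ?V s d v) - (\<Sum>v\<in>W. mgf p W s d v)\<bar>" by (simp add: D_def)
  also have "... \<le> (\<Sum>v<N. \<bar>mgf p ?V s d v - (if v \<in> W then mgf p W s d v else 0)\<bar>)"
   unfolding split by (rule sum_abs)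
  also have "... \<le> (\<Sum>v<N. hit p N W d v)"
  proof (rule sum_mono)
   fix v assume v: "v \<in> ?V"
   show "\<bar>mgf p ?V s d v - (if v \<in> W then mgf p W s d v else 0)\<bar> \<le> hit p N W d v"
    using mgf_hit[OF s0 s1 W, of v d] mgf_bounds[OF s0 s1, of ?V v d] hit_outside[of v W d] v by auto
  qed
  finally show ?thesis .
 qed
 have 4: "mean (\<lambda>E. \<bar>?Z E\<bar>) \<le> c + (real d + 2) * real N * (\<Sum>k\<le>2 * d. K ^ k) / c"
 proof -
  \<comment> \<open>A substitute for the Cauchy-Schwarz inequality with a free parameter c, which is
    chosen only once n is known.\<close>
  have am: "\<bar>z\<bar> \<le> c + z\<^sup>2 / c" for z :: real
  proof (cases "\<bar>z\<bar> \<le> c")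
   case False
   then have "\<bar>z\<bar> * c \<le> \<bar>z\<bar> * \<bar>z\<bar>" using c by (intro mult_left_mono) auto
   then have "\<bar>z\<bar> \<le> z\<^sup>2 / c" using c by (simp add: field_simps power2_eq_square)
   with c show ?thesis by linarith
  qed (use c in \<open>auto intro!: add_increasing2\<close>)
  have "mean (\<lambda>E. \<bar>?Z E\<bar>) \<le> mean (\<lambda>E. c + (?Z E)\<^sup>2 / c)"
   by (intro mean_mono am)
  also have "... = c + mean (\<lambda>E. (?Z E)\<^sup>2) / c" by simp
  also have "... \<le> c + (real d + 2) * real N * (\<Sum>k\<le>2 * d. K ^ k) / c"
   using c sum_X_variance by (intro add_left_mono divide_right_mono) auto
  finally show ?thesis .
 qed
 have "mean (\<lambda>E. \<bar>(\<Sum>v<N. X s ?V d v E) - (\<Sum>v<N. mgf p ?V s d v)\<bar>) \<le> mean (\<lambda>E. \<bar>A E\<bar> + \<bar>B\<bar> + \<bar>D\<bar> + \<bar>?Z E\<bar>)"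
 proof (rule mean_mono)
  fix E
  have "(\<Sum>v<N. X s ?V d v E) - (\<Sum>v<N. mgf p ?V s d v) = A E + B + D + ?Z E"
   by (simp add: A_def B_def D_def sum_subtractf)
  then show "\<bar>(\<Sum>v<N. X s ?V d v E) - (\<Sum>v<N. mgf p ?V s d v)\<bar> \<le> \<bar>A E\<bar> + \<bar>B\<bar> + \<bar>D\<bar> + \<bar>?Z E\<bar>" by linarith
 qed
 also have "... = mean (\<lambda>E. \<bar>A E\<bar>) + \<bar>B\<bar> + \<bar>D\<bar> + mean (\<lambda>E. \<bar>?Z E\<bar>)"
  by (simp del: sum_subtractf)
 finally show ?thesis using 1 2 3 4 by linarith
qed

end

end

section \<open>Concentration for random edge probabilities\<close>

context prob_space
begin

context
 fixes N :: "nat => 'a => nat" and p :: "nat => 'a => nat => nat => real"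
 assumes ep: "\<And>n w. w \<in> space M ==> edge_prob (N n w) (p n w)"
  and tail: "\<And>e. e > 0 ==> \<exists>K\<ge>0. whp M (\<lambda>n w. row_excess n (N n w) (p n w) K \<le> e)"
begin

abbreviation low :: "nat => 'a => real => nat set" where
 "low n w K \<equiv> {i. i < N n w \<and> (\<Sum>j<N n w. p n w i j) \<le> K}"

text \<open>Summing the recursion of \<open>hit\<close> over v and using symmetry gives the sum of
  row sum times \<open>hit\<close>. A row sum is at most K1 plus its excess over K1, so one
  generation costs a factor K1 and one small excess; the level K of \<open>low\<close> may be chosen
  afterwards.\<close>

lemma whp_hit:
 "e > 0 ==> \<exists>K0\<ge>0. \<forall>K\<ge>K0. whp M (\<lambda>n z. (\<Sum>v<N n z. hit (p n z) (N n z) (low n z K) d v) / n \<le> e)"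
proof (induction d arbitrary: e)
 case 0
 from tail[OF 0] obtain K where K: "K \<ge> 0"
  "whp M (\<lambda>n z. row_excess n (N n z) (p n z) K \<le> e)" by blast
 show ?case
 \<comment> \<open>The vertices outside \<open>low\<close> at level K + 1 or higher have excess at
   least 1 over K, so their number is bounded by the excess.\<close>
 proof (intro exI[of _ "K + 1"] conjI allI impI)
  fix K' assume K': "K' \<ge> K + 1"
  show "whp M (\<lambda>n z. (\<Sum>v<N n z. hit (p n z) (N n z) (low n z K') 0 v) / n \<le> e)"
  proof (rule whp_mono[OF K(2)], intro always_eventually allI ballI impI)
   fix n z assume a: "row_excess n (N n z) (p n z) K \<le> e"
   have "(\<Sum>v<N n z. hit (p n z) (N n z) (low n z K') 0 v) \<le> (\<Sum>i<N n z. max 0 ((\<Sum>j<N n z. p n z i j) - K))"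
    using K' by (intro sum_mono) auto
   then have "(\<Sum>v<N n z. hit (p n z) (N n z) (low n z K') 0 v) / n \<le> row_excess n (N n z) (p n z) K"
    by (rule divide_right_mono) simp
   with a show "(\<Sum>v<N n z. hit (p n z) (N n z) (low n z K') 0 v) / n \<le> e" by linarith
  qed
 qed (use K in auto)
next
 case (Suc d)
 then have e3: "e / 3 > 0" by simp
 from tail[OF e3] obtain K1 where K1: "K1 \<ge> 0"
  "whp M (\<lambda>n z. row_excess n (N n z) (p n z) K1 \<le> e / 3)" by blast
 have e: "e / (3 * (K1 + 1)) > 0" using K1 Suc.prems by simp
 from Suc.IH[OF e] obtain K0 where K0: "K0 \<ge> 0"
  "\<And>K. K \<ge> K0 ==> whp M (\<lambda>n z. (\<Sum>v<N n z. hit (p n z) (N n z) (low n z K) d v) / n \<le> e / (3 * (K1 + 1)))" by blast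
 from tail[OF e3] obtain K2 where K2: "K2 \<ge> 0"
  "whp M (\<lambda>n z. row_excess n (N n z) (p n z) K2 \<le> e / 3)" by blast
 show ?case
 proof (intro exI[of _ "max K0 (K2 + 1)"] conjI allI impI)
  fix K assume K: "K \<ge> max K0 (K2 + 1)"
  then have "K \<ge> K0" by simp
  show "whp M (\<lambda>n z. (\<Sum>v<N n z. hit (p n z) (N n z) (low n z K) (Suc d) v) / n \<le> e)"
  proof (rule whp_mono[OF whp_conj[OF K1(2) whp_conj[OF K2(2) K0(2)[OF \<open>K \<ge> K0\<close>]]]], intro always_eventually allI ballI impI)
   fix n z assume om: "z \<in> space M"
   let ?N = "N n z" and ?p = "p n z"
   let ?l = "\<lambda>i. \<Sum>j<?N. ?p i j" and ?h = "hit ?p ?N (low n z K) d"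
   assume a: "(\<Sum>i<?N. max 0 (?l i - K1)) / n \<le> e / 3 \<and> (\<Sum>i<?N. max 0 (?l i - K2)) / n \<le> e / 3 \<and>
    (\<Sum>v<?N. ?h v) / n \<le> e / (3 * (K1 + 1))"
   interpret edge_prob ?N ?p by (rule ep[OF om])
   have "(\<Sum>v<?N. hit ?p ?N (low n z K) (Suc d) v) \<le> (\<Sum>v<?N. max 0 (?l v - K2) + (\<Sum>w<?N. ?p v w * ?h w))"
    using K by (intro sum_mono) (auto simp: min_def)
   also have "... = (\<Sum>v<?N. max 0 (?l v - K2)) + (\<Sum>w<?N. \<Sum>v<?N. ?p v w * ?h w)"
    unfolding sum.distrib by (intro arg_cong2[where f = "(+)"] refl sum.swap)
   also have "(\<Sum>w<?N. \<Sum>v<?N. ?p v w * ?h w) = (\<Sum>w<?N. ?l w * ?h w)"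
    unfolding sum_distrib_right by (intro sum.cong refl) (auto simp: p_sym)
   also have "... \<le> (\<Sum>w<?N. K1 * ?h w + max 0 (?l w - K1))"
   proof (rule sum_mono)
    fix w assume "w \<in> {..<?N}"
    then have h: "0 \<le> ?h w" "?h w \<le> 1" using hit_bounds by auto
    have "(?l w - K1) * ?h w \<le> max 0 (?l w - K1) * ?h w" using h by (intro mult_right_mono) auto
    moreover have "max 0 (?l w - K1) * ?h w \<le> max 0 (?l w - K1)" by (rule mult_left_le[OF h(2)]) simp
    ultimately show "?l w * ?h w \<le> K1 * ?h w + max 0 (?l w - K1)" by (simp add: left_diff_distrib)
   qed
   finally have "(\<Sum>v<?N. hit ?p ?N (low n z K) (Suc d) v) \<le>
    (\<Sum>v<?N. max 0 (?l v - K2)) + (K1 * (\<Sum>w<?N. ?h w) + (\<Sum>v<?N. max 0 (?l v - K1)))"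
    by (simp add: sum.distrib sum_distrib_left)
   then have "(\<Sum>v<?N. hit ?p ?N (low n z K) (Suc d) v) / n \<le>
    ((\<Sum>v<?N. max 0 (?l v - K2)) + (K1 * (\<Sum>w<?N. ?h w) + (\<Sum>v<?N. max 0 (?l v - K1)))) / n"
    by (rule divide_right_mono) simp
   also have "... = (\<Sum>v<?N. max 0 (?l v - K2)) / n + K1 * ((\<Sum>w<?N. ?h w) / n) + (\<Sum>v<?N. max 0 (?l v - K1)) / n"
    by (simp add: add_divide_distrib)
   also have "... \<le> e / 3 + K1 * (e / (3 * (K1 + 1))) + e / 3"
    using a K1 by (intro add_mono mult_left_mono) auto
   also have "K1 * (e / (3 * (K1 + 1))) \<le> e / 3" using K1 Suc.prems by (simp add: field_simps)
   finally show "(\<Sum>v<?N. hit ?p ?N (low n z K) (Suc d) v) / n \<le> e" by simp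
  qed
 qed (use K0 K2 in auto)
qed

text \<open>K is fixed by \<open>whp_hit\<close> before n grows, so \<open>local_error K d\<close>
  and the powers of K are constants and only the sum of squares and the variance have to
  vanish.\<close>

theorem local_average:
 fixes C s :: real
 assumes N: "whp M (\<lambda>n z. N n z \<le> C * n)"
  and sq: "conv0 M (\<lambda>n z. (\<Sum>i<N n z. \<Sum>j<N n z. (p n z i j)\<^sup>2) / n)"
  and s: "0 \<le> s" "s \<le> 1"
 shows "conv0 M (\<lambda>n z. measure_pmf.expectation (rg (N n z) (p n z))
  (\<lambda>E. \<bar>(\<Sum>v<N n z. s ^ card (gball E {..<N n z} d v)) - (\<Sum>v<N n z. mgf (p n z) {..<N n z} s d v)\<bar>) / n)"
 unfolding conv0_def
proof (intro allI impI)
 fix e :: real assume e: "e > 0"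
 then have e8: "e / 8 > 0" by simp
 from whp_hit[OF e8] obtain K where K: "K \<ge> 0"
  "whp M (\<lambda>n z. (\<Sum>v<N n z. hit (p n z) (N n z) (low n z K) d v) / n \<le> e / 8)" by blast
 define L where "L = local_error K d"
 define Q where "Q = (real d + 2) * (\<Sum>k\<le>2 * d. K ^ k)"
 have L0: "L \<ge> 0" unfolding L_def using K(1)
  by (induction d) (auto intro!: add_nonneg_nonneg mult_nonneg_nonneg sum_nonneg)
 have Q0: "Q \<ge> 0" unfolding Q_def using K(1) by (intro mult_nonneg_nonneg sum_nonneg) auto
 have e4L: "e / (4 * (L + 1)) > 0" using L0 e by simp
 have "(\<lambda>n. (4 / e) * Q * C / real n) \<longlonglongrightarrow> 0"
  by (rule tendsto_divide_0[OF tendsto_const]) (auto intro: filterlim_at_top_imp_at_infinity filterlim_real_sequentially)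
 then have "\<forall>\<^sub>F n in sequentially. (4 / e) * Q * C / real n < e / 4"
  using e by (intro order_tendstoD(2)) auto
 then have ev: "\<forall>\<^sub>F n in sequentially. n > 0 \<and> (4 / e) * Q * C / real n < e / 4"
  using eventually_gt_at_top[of 0] by eventually_elim auto
 show "whp M (\<lambda>n z. measure_pmf.expectation (rg (N n z) (p n z))
  (\<lambda>E. \<bar>(\<Sum>v<N n z. s ^ card (gball E {..<N n z} d v)) - (\<Sum>v<N n z. mgf (p n z) {..<N n z} s d v)\<bar>) / n \<le> e)"
 proof (rule whp_mono[OF whp_conj[OF K(2) whp_conj[OF N conv0D[OF sq e4L]]]], rule eventually_mono[OF ev], intro ballI impI)
  fix n z assume n: "n > 0 \<and> (4 / e) * Q * C / real n < e / 4" and om: "z \<in> space M"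
  let ?N = "N n z" and ?p = "p n z" and ?W = "low n z K"
  let ?S = "\<Sum>i<?N. \<Sum>j<?N. (?p i j)\<^sup>2"
  assume a: "(\<Sum>v<?N. hit ?p ?N ?W d v) / n \<le> e / 8 \<and> real ?N \<le> C * n \<and> ?S / n \<le> e / (4 * (L + 1))"
  interpret edge_prob ?N ?p by (rule ep[OF om])
  \<comment> \<open>With c proportional to n, the variance term of order N / c stays bounded and
    vanishes after division by n, while c / n is one quarter of the tolerance.\<close>
  let ?c = "e / 4 * n"
  have c: "?c > 0" using e n by simp
  have eq: "(2 * H + L * S + e / 4 * n + (real d + 2) * x * R / (e / 4 * n)) / n =
    2 * (H / n) + L * (S / n) + e / 4 + ((real d + 2) * R) * (4 / e) * (x / n) / n" for H S x R :: real
   using n e by (simp add: field_simps)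
  have rows: "(\<Sum>w\<in>?W. ?p v w) \<le> K" if "v \<in> ?W" for v
  proof -
   have "(\<Sum>w\<in>?W. ?p v w) \<le> (\<Sum>w<?N. ?p v w)"
    using that by (intro sum_mono2) (auto intro!: p_nonneg)
   then show ?thesis using that by auto
  qed
  have "mean (\<lambda>E. \<bar>(\<Sum>v<?N. s ^ card (gball E {..<?N} d v)) - (\<Sum>v<?N. mgf ?p {..<?N} s d v)\<bar>) \<le>
   2 * (\<Sum>v<?N. hit ?p ?N ?W d v) + L * ?S + ?c + (real d + 2) * real ?N * (\<Sum>k\<le>2 * d. K ^ k) / ?c"
   unfolding L_def by (rule mean_local_average[OF s _ K(1) rows c]) auto
  then have "mean (\<lambda>E. \<bar>(\<Sum>v<?N. s ^ card (gball E {..<?N} d v)) - (\<Sum>v<?N. mgf ?p {..<?N} s d v)\<bar>) / n \<le>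
   (2 * (\<Sum>v<?N. hit ?p ?N ?W d v) + L * ?S + ?c + (real d + 2) * real ?N * (\<Sum>k\<le>2 * d. K ^ k) / ?c) / n"
   by (rule divide_right_mono) simp
  also have "... = 2 * ((\<Sum>v<?N. hit ?p ?N ?W d v) / n) + L * (?S / n) + e / 4 + Q * (4 / e) * (?N / n) / n"
   unfolding Q_def by (rule eq)
  also have "... \<le> 2 * (e / 8) + L * (e / (4 * (L + 1))) + e / 4 + Q * (4 / e) * C / n"
   using a L0 Q0 n e by (intro add_mono mult_left_mono divide_right_mono) (auto simp: field_simps)
  also have "L * (e / (4 * (L + 1))) \<le> e / 4" using L0 e by (simp add: field_simps)
  also have "Q * (4 / e) * C / n \<le> e / 4" using n by (simp add: mult_ac)
  finally show "mean (\<lambda>E. \<bar>(\<Sum>v<?N. s ^ card (gball E {..<?N} d v)) - (\<Sum>v<?N. mgf ?p {..<?N} s d v)\<bar>) / n \<le> e"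
   by simp
 qed
qed

end

end

section \<open>Susceptibility and generating functions\<close>

lemma one_minus_power_sum: "(1 - s) * (\<Sum>i<k. s ^ i) + s ^ k = (1::real)"
 using one_diff_power_eq[of s k] by linarith

lemma power_diff_le:
 fixes s t :: real
 assumes "0 \<le> s" "s \<le> t" "t \<le> 1"
 shows "t ^ k - s ^ k \<le> real k * (t - s)"
proof (induction k)
 case (Suc k)
 have "t ^ Suc k - s ^ Suc k = t * (t ^ k - s ^ k) + s ^ k * (t - s)" by (simp add: algebra_simps)
 also have "... \<le> 1 * (t ^ k - s ^ k) + 1 * (t - s)"
  using assms by (intro add_mono mult_right_mono) (auto intro: power_mono power_le_one)
 finally show ?case using Suc by (simp add: algebra_simps)
qed simp

lemma power_diff_ge:
 fixes s t :: real
 assumes "0 \<le> s" "s \<le> t"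
 shows "real k * s ^ (k - 1) * (t - s) \<le> t ^ k - s ^ k"
proof (induction k)
 case (Suc k)
 show ?case
 proof (cases k)
  case (Suc j)
  have "t ^ Suc k - s ^ Suc k = t * (t ^ k - s ^ k) + s ^ k * (t - s)" by (simp add: algebra_simps)
  also have "... \<ge> s * (real k * s ^ (k - 1) * (t - s)) + s ^ k * (t - s)"
   using assms Suc.IH by (intro add_mono mult_mono) auto
  finally show ?thesis using Suc by (simp add: algebra_simps)
 qed simp
qed simp

context ker
begin

abbreviation total :: real where "total \<equiv> measure \<mu> (space \<mu>)"

lemma total_pos: "total > 0"
 using kernel by (simp add: kernel_def type_space_def emeasure_eq_measure)

lemma bp_pgf_integrable: "0 \<le> s ==> s \<le> 1 ==> integrable \<mu> (bp_pgf \<mu> \<kappa> s d)"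
proof (rule integrable_const_bound[of _ s])
 assume "0 \<le> s" "s \<le> 1"
 then show "AE x in \<mu>. norm (bp_pgf \<mu> \<kappa> s d x) \<le> s"
  using bp_pgf_bounds by (intro AE_I2) auto
qed simp

lemma top_if_ratio_top:
 assumes "(\<integral>\<^sup>+x. f x \<partial>\<mu>) / emeasure \<mu> (space \<mu>) = top"
 shows "(\<integral>\<^sup>+x. f x \<partial>\<mu>) = top"
 using assms total_pos by (auto simp: ennreal_divide_eq_top_iff emeasure_eq_measure)

lemma bp_trunc_mean_measurable [measurable]: "bp_trunc_mean d \<in> borel_measurable \<mu>"
 by (simp add: nn_integral_pmf_nat)

text \<open>The geometric sum is the quotient (1 - s^k) / (1 - s) written without subtraction; it
  increases to k as s increases to 1.\<close>

lemma nn_integral_geometric: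
 assumes "0 \<le> s" "s < 1" "x \<in> space \<mu>"
 shows "(\<integral>\<^sup>+k. ennreal (\<Sum>i<k. s ^ i) \<partial>measure_pmf (bp_trunc \<mu> \<kappa> d x)) = ennreal ((1 - bp_pgf \<mu> \<kappa> s d x) / (1 - s))"
proof -
 let ?p = "bp_trunc \<mu> \<kappa> d x" and ?G = "bp_pgf \<mu> \<kappa> s d x"
 let ?F = "\<integral>\<^sup>+k. ennreal (\<Sum>i<k. s ^ i) \<partial>measure_pmf ?p"
 have G: "0 \<le> ?G" "?G \<le> 1" using bp_pgf_bounds[of s x d] assms by auto
 have "1 = (\<integral>\<^sup>+k. 1 \<partial>measure_pmf ?p)" by (simp add: measure_pmf.emeasure_space_1)
 also have "... = (\<integral>\<^sup>+k. ennreal (1 - s) * ennreal (\<Sum>i<k. s ^ i) + ennreal (s ^ k) \<partial>measure_pmf ?p)"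
 proof (intro nn_integral_cong)
  fix k :: nat
  have "ennreal (1 - s) * ennreal (\<Sum>i<k. s ^ i) + ennreal (s ^ k) = ennreal ((1 - s) * (\<Sum>i<k. s ^ i) + s ^ k)"
   using assms by (subst ennreal_plus) (auto simp: ennreal_mult sum_nonneg)
  then show "1 = ennreal (1 - s) * ennreal (\<Sum>i<k. s ^ i) + ennreal (s ^ k)"
   by (simp add: one_minus_power_sum)
 qed
 also have "... = ennreal (1 - s) * ?F + ennreal ?G"
  using assms nn_integral_bp_trunc_power[of s x d] by (simp add: nn_integral_add nn_integral_cmult)
 finally have eq: "ennreal (1 - s) * ?F + ennreal ?G = 1" ..
 have "ennreal (1 - s) * ?F = (ennreal (1 - s) * ?F + ennreal ?G) - ennreal ?G" by simp
 also have "... = ennreal (1 - ?G)" unfolding eq using G by (simp add: ennreal_minus flip: ennreal_1)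
 finally have "ennreal (1 - s) * ?F = ennreal (1 - ?G)" .
 then have "?F = ennreal (1 - ?G) / ennreal (1 - s)"
  using assms by (metis ennreal_mult_divide_eq mult.commute diff_gt_0_iff_gt ennreal_eq_0_iff ennreal_neq_top not_le)
 then show ?thesis using assms G by (simp add: divide_ennreal)
qed

text \<open>Two monotone limits are undone in turn: the number of generations tending to infinity,
  and then s tending to 1 in the geometric sums.\<close>

lemma chi_top:
 assumes "(\<integral>\<^sup>+x. bp_mean \<mu> \<kappa> x \<partial>\<mu>) = top"
 obtains d s where "0 < s" "s < 1" "K < (total - mean_pgf s d) / (1 - s)"
proof -
 have "(\<integral>\<^sup>+x. bp_mean \<mu> \<kappa> x \<partial>\<mu>) = (\<integral>\<^sup>+x. (SUP d. bp_trunc_mean d x) \<partial>\<mu>)"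
  by (simp add: bp_mean_def ennreal_of_nat_eq_real_of_nat)
 also have "... = (SUP d. \<integral>\<^sup>+x. bp_trunc_mean d x \<partial>\<mu>)"
  using bp_trunc_mean_mono by (intro nn_integral_monotone_convergence_SUP_AE) auto
 finally have "ennreal K < (SUP d. \<integral>\<^sup>+x. bp_trunc_mean d x \<partial>\<mu>)" using assms by simp
 then obtain d where d: "ennreal K < (\<integral>\<^sup>+x. bp_trunc_mean d x \<partial>\<mu>)" by (auto simp: less_SUP_iff)
 define t where "t j = 1 - 1 / (real j + 2)" for j :: nat
 have t: "0 < t j" "t j < 1" "t j \<le> t (Suc j)" for j by (auto simp: t_def field_simps)
 have tlim: "t \<longlonglongrightarrow> 1"
  unfolding t_def[abs_def] by real_asymp
 define F where "F j k = ennreal (\<Sum>i<k. t j ^ i)" for j k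
 have Fmono: "F j k \<le> F (Suc j) k" for j k
  unfolding F_def using t by (intro ennreal_leI sum_mono power_mono) (auto intro: less_imp_le)
 have FSUP: "(SUP j. F j k) = of_nat k" for k
 proof -
  have "(\<lambda>j. \<Sum>i<k. t j ^ i) \<longlonglongrightarrow> (\<Sum>i<k. 1 ^ i)"
   using tlim by (intro tendsto_intros)
  then have "(\<lambda>j. F j k) \<longlonglongrightarrow> ennreal (real k)"
   unfolding F_def by (intro tendsto_ennrealI) simp
  moreover have "(\<lambda>j. F j k) \<longlonglongrightarrow> (SUP j. F j k)"
   using Fmono by (intro LIMSEQ_SUP incseq_SucI)
  ultimately show ?thesis by (simp add: LIMSEQ_unique ennreal_of_nat_eq_real_of_nat)
 qed
 have "(\<integral>\<^sup>+x. bp_trunc_mean d x \<partial>\<mu>) = (\<integral>\<^sup>+x. (\<integral>\<^sup>+k. (SUP j. F j k) \<partial>measure_pmf (bp_trunc \<mu> \<kappa> d x)) \<partial>\<mu>)"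
  by (simp add: FSUP)
 also have "... = (\<integral>\<^sup>+x. (SUP j. \<integral>\<^sup>+k. F j k \<partial>measure_pmf (bp_trunc \<mu> \<kappa> d x)) \<partial>\<mu>)"
  using Fmono by (intro nn_integral_cong nn_integral_monotone_convergence_SUP) (auto simp: incseq_Suc_iff le_fun_def)
 also have "... = (SUP j. \<integral>\<^sup>+x. (\<integral>\<^sup>+k. F j k \<partial>measure_pmf (bp_trunc \<mu> \<kappa> d x)) \<partial>\<mu>)"
 proof (rule nn_integral_monotone_convergence_SUP)
  show "incseq (\<lambda>j x. \<integral>\<^sup>+k. F j k \<partial>measure_pmf (bp_trunc \<mu> \<kappa> d x))"
   using Fmono by (auto simp: incseq_Suc_iff le_fun_def intro!: nn_integral_mono)
 qed (simp add: nn_integral_pmf_nat)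
 finally obtain j where j: "ennreal K < (\<integral>\<^sup>+x. (\<integral>\<^sup>+k. F j k \<partial>measure_pmf (bp_trunc \<mu> \<kappa> d x)) \<partial>\<mu>)"
  using d by (auto simp: less_SUP_iff)
 let ?s = "t j"
 let ?h = "\<lambda>x. (1 - bp_pgf \<mu> \<kappa> ?s d x) / (1 - ?s)"
 have "(\<integral>\<^sup>+x. (\<integral>\<^sup>+k. F j k \<partial>measure_pmf (bp_trunc \<mu> \<kappa> d x)) \<partial>\<mu>) = (\<integral>\<^sup>+x. ennreal (?h x) \<partial>\<mu>)"
  unfolding F_def using t[of j] by (intro nn_integral_cong nn_integral_geometric) auto
 also have "... = ennreal (\<integral>x. ?h x \<partial>\<mu>)"
 proof (rule nn_integral_eq_integral)
  show "integrable \<mu> ?h" using t[of j] bp_pgf_integrable[of ?s d] by auto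
  show "AE x in \<mu>. 0 \<le> ?h x" using t[of j] bp_pgf_bounds[of ?s _ d] by (intro AE_I2) (force intro!: divide_nonneg_pos)
 qed
 also have "(\<integral>x. ?h x \<partial>\<mu>) = (total - mean_pgf ?s d) / (1 - ?s)"
  using t[of j] bp_pgf_integrable[of ?s d] by simp
 finally have *: "ennreal K < ennreal ((total - mean_pgf ?s d) / (1 - ?s))" using j by simp
 have "K < (total - mean_pgf ?s d) / (1 - ?s)"
  using * by (metis ennreal_leI not_le)
 then show ?thesis using that t by blast
qed

section \<open>The finite part of the total size\<close>

lemma bp_cdf_lim:
 assumes "x \<in> space \<mu>"
 shows "(\<lambda>d. measure_pmf.prob (bp_trunc \<mu> \<kappa> d x) {..k}) \<longlonglongrightarrow> bp_cdf \<mu> \<kappa> x k"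
 unfolding bp_cdf_def
proof (rule LIMSEQ_decseq_INF)
 show "bdd_below (range (\<lambda>d. measure_pmf.prob (bp_trunc \<mu> \<kappa> d x) {..k}))"
  by (rule bdd_belowI[of _ 0]) auto
 show "decseq (\<lambda>d. measure_pmf.prob (bp_trunc \<mu> \<kappa> d x) {..k})"
 proof (rule decseq_SucI)
  fix d
  have "antimono (indicator {..k} :: nat => ennreal)"
   by (auto simp: antimono_def indicator_def)
  from bp_trunc_antimono[OF assms this, of d]
  have "emeasure (measure_pmf (bp_trunc \<mu> \<kappa> (Suc d) x)) {..k} \<le> emeasure (measure_pmf (bp_trunc \<mu> \<kappa> d x)) {..k}"
   by (simp del: bp_trunc.simps)
  then show "measure_pmf.prob (bp_trunc \<mu> \<kappa> (Suc d) x) {..k} \<le> measure_pmf.prob (bp_trunc \<mu> \<kappa> d x) {..k}"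
   by (simp add: measure_pmf.emeasure_eq_measure del: bp_trunc.simps)
 qed
qed

lemma bp_point_lim:
 assumes "x \<in> space \<mu>"
 shows "(\<lambda>d. pmf (bp_trunc \<mu> \<kappa> d x) k) \<longlonglongrightarrow> bp_point \<mu> \<kappa> x k"
proof (cases k)
 case 0
 have "measure_pmf.prob (bp_trunc \<mu> \<kappa> d x) {..k} = pmf (bp_trunc \<mu> \<kappa> d x) k" for d
  using 0 by (simp add: measure_pmf_single)
 with bp_cdf_lim[OF assms, of k] 0 show ?thesis by (simp add: bp_point_def)
next
 case (Suc l)
 have "measure_pmf.prob (bp_trunc \<mu> \<kappa> d x) {..k} - measure_pmf.prob (bp_trunc \<mu> \<kappa> d x) {..l} = pmf (bp_trunc \<mu> \<kappa> d x) k" for d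
 proof -
  have "{..k} = {..l} \<union> {k}" using Suc by auto
  then have "measure_pmf.prob (bp_trunc \<mu> \<kappa> d x) {..k} = measure_pmf.prob (bp_trunc \<mu> \<kappa> d x) {..l} + pmf (bp_trunc \<mu> \<kappa> d x) k"
   using Suc by (simp only:, subst measure_pmf.finite_measure_Union) (auto simp: measure_pmf_single)
  then show ?thesis by simp
 qed
 with tendsto_diff[OF bp_cdf_lim[OF assms, of k] bp_cdf_lim[OF assms, of l]] Suc
 show ?thesis by (simp add: bp_point_def)
qed

lemma bp_point_nonneg: "x \<in> space \<mu> ==> 0 \<le> bp_point \<mu> \<kappa> x k"
 by (rule LIMSEQ_le_const[OF bp_point_lim]) auto

lemma bp_point_measurable [measurable]: "(\<lambda>x. bp_point \<mu> \<kappa> x k) \<in> borel_measurable \<mu>"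
 by (rule borel_measurable_LIMSEQ_real[OF bp_point_lim]) auto

lemma bp_pgf_diff_ge:
 assumes "0 \<le> s" "s \<le> t" "t \<le> 1" "x \<in> space \<mu>"
 shows "(\<Sum>k<J. (t ^ k - s ^ k) * pmf (bp_trunc \<mu> \<kappa> d x) k) \<le> bp_pgf \<mu> \<kappa> t d x - bp_pgf \<mu> \<kappa> s d x"
proof -
 let ?p = "bp_trunc \<mu> \<kappa> d x"
 have E: "measure_pmf.expectation ?p (\<lambda>k. r ^ k) = bp_pgf \<mu> \<kappa> r d x" if "0 \<le> r" "r \<le> 1" for r
  using nn_integral_bp_trunc_power[OF that assms(4), of d] bp_pgf_bounds[OF that assms(4), of d] that
  by (subst integral_eq_nn_integral) auto
 have int: "integrable (measure_pmf ?p) (\<lambda>k. r ^ k)" if "0 \<le> r" "r \<le> 1" for r :: real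
  using that by (intro measure_pmf.integrable_const_bound[of _ 1]) (auto intro!: AE_I2 power_le_one)
 have "(\<Sum>k<J. (t ^ k - s ^ k) * pmf ?p k) = measure_pmf.expectation ?p (\<lambda>k. if k < J then t ^ k - s ^ k else 0)"
  by (subst integral_measure_pmf[of "{..<J}"]) (auto split: if_splits simp: mult.commute)
 also have "... \<le> measure_pmf.expectation ?p (\<lambda>k. t ^ k - s ^ k)"
 proof (rule integral_mono)
  show "integrable (measure_pmf ?p) (\<lambda>k. if k < J then t ^ k - s ^ k else 0)"
  proof (intro measure_pmf.integrable_const_bound[of _ 1] AE_I2)
   fix k
   have "0 \<le> s ^ k" "s ^ k \<le> t ^ k" "t ^ k \<le> 1"
    using assms by (auto intro: power_mono power_le_one)
   then show "norm (if k < J then t ^ k - s ^ k else 0) \<le> 1" by simp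
  qed simp
  show "integrable (measure_pmf ?p) (\<lambda>k. t ^ k - s ^ k)" using assms int by auto
 qed (use assms in \<open>auto intro: power_mono\<close>)
 also have "... = bp_pgf \<mu> \<kappa> t d x - bp_pgf \<mu> \<kappa> s d x"
  using assms int E by simp
 finally show ?thesis .
qed

text \<open>Only sizes k < J are kept, so that letting d grow is a limit of bounded functions. With
  s^J > 1 / 2 the quotient (t^k - s^k) / (t - s) is at least k / 2 for these k. The bound is claimed
  for all large d because d must later be raised until t^d is small.\<close>

lemma chi_hat_top:
 assumes "(\<integral>\<^sup>+x. bp_mean_fin \<mu> \<kappa> x \<partial>\<mu>) = top"
 obtains s t where "0 < s" "s < t" "t < 1"
  "\<forall>\<^sub>F d in sequentially. K < (mean_pgf t d - mean_pgf s d) / (t - s)"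
proof -
 define f where "f J x = (\<Sum>k<J. real k * bp_point \<mu> \<kappa> x k)" for J x
 have f[measurable]: "f J \<in> borel_measurable \<mu>" for J unfolding f_def by measurable
 have fmono: "f J x \<le> f (Suc J) x" if "x \<in> space \<mu>" for J x
  using bp_point_nonneg[OF that] by (simp add: f_def)
 have "bp_mean_fin \<mu> \<kappa> x = (SUP J. ennreal (f J x))" if x: "x \<in> space \<mu>" for x
 proof -
  have "bp_mean_fin \<mu> \<kappa> x = (SUP J. \<Sum>k<J. ennreal (real k * bp_point \<mu> \<kappa> x k))"
   by (simp add: bp_mean_fin_def nn_integral_count_space_nat suminf_eq_SUP)
  also have "... = (SUP J. ennreal (f J x))"
   unfolding f_def using bp_point_nonneg[OF x] by (intro SUP_cong refl sum_ennreal) auto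
  finally show ?thesis .
 qed
 then have "(\<integral>\<^sup>+x. bp_mean_fin \<mu> \<kappa> x \<partial>\<mu>) = (\<integral>\<^sup>+x. (SUP J. ennreal (f J x)) \<partial>\<mu>)"
  by (intro nn_integral_cong)
 also have "... = (SUP J. \<integral>\<^sup>+x. ennreal (f J x) \<partial>\<mu>)"
  using fmono by (intro nn_integral_monotone_convergence_SUP_AE) (auto intro!: AE_I2 ennreal_leI)
 \<comment> \<open>The factor 2 anticipates the loss of one half in the comparison of
   \<open>f J\<close> with \<open>g'\<close>.\<close>
 finally have "ennreal (2 * max K 0) < (SUP J. \<integral>\<^sup>+x. ennreal (f J x) \<partial>\<mu>)" using assms by simp
 then obtain J where J: "ennreal (2 * max K 0) < (\<integral>\<^sup>+x. ennreal (f J x) \<partial>\<mu>)" by (auto simp: less_SUP_iff)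
 have "((\<lambda>s::real. s ^ J) \<longlongrightarrow> 1 ^ J) (at_left 1)"
  by (intro tendsto_intros)
 then have "\<forall>\<^sub>F s in at_left (1::real). s ^ J > 1 / 2" by (intro order_tendstoD(1)) auto
 moreover have "\<forall>\<^sub>F s in at_left (1::real). s \<in> {0<..<1}" by (rule eventually_at_leftI[of 0]) auto
 ultimately have "\<forall>\<^sub>F s in at_left (1::real). s ^ J > 1 / 2 \<and> s \<in> {0<..<1}" by eventually_elim auto
 then obtain s :: real where s: "s ^ J > 1 / 2" "0 < s" "s < 1"
  using eventually_happens[of _ "at_left (1::real)"] trivial_limit_at_left_real by auto
 \<comment> \<open>Any point strictly between s and 1 serves; t < 1 is what damps large
   components.\<close>
 define t where "t = (s + 1) / 2"
 have t: "s < t" "t < 1" using s by (auto simp: t_def)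
 define g where "g d x = (\<Sum>k<J. (t ^ k - s ^ k) * pmf (bp_trunc \<mu> \<kappa> d x) k)" for d x
 define g' where "g' x = (\<Sum>k<J. (t ^ k - s ^ k) * bp_point \<mu> \<kappa> x k)" for x
 have [measurable]: "g d \<in> borel_measurable \<mu>" "g' \<in> borel_measurable \<mu>" for d
  unfolding g_def g'_def by measurable
 have gb: "0 \<le> g d x" "g d x \<le> J" for d x
 proof -
  show "0 \<le> g d x" unfolding g_def using s t by (intro sum_nonneg mult_nonneg_nonneg) (auto intro: power_mono)
  have "t ^ k - s ^ k \<le> 1" for k using s t power_le_one[of t k] zero_le_power[of s k] by linarith
  then have "g d x \<le> (\<Sum>k<J. 1 * 1)" unfolding g_def
   using s t by (intro sum_mono mult_mono) (auto simp: pmf_le_1)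
  then show "g d x \<le> J" by simp
 qed
 have glim: "(\<lambda>d. g d x) \<longlonglongrightarrow> g' x" if "x \<in> space \<mu>" for x
  unfolding g_def g'_def by (intro tendsto_intros bp_point_lim that)
 have g'b: "0 \<le> g' x" "g' x \<le> J" if "x \<in> space \<mu>" for x
  using gb by (auto intro: LIMSEQ_le_const[OF glim[OF that]] LIMSEQ_le_const2[OF glim[OF that]])
 have int: "integrable \<mu> (g d)" "integrable \<mu> g'" for d
  using gb g'b by (auto intro!: integrable_const_bound[of _ "real J"] AE_I2)
 have lim: "(\<lambda>d. \<integral>x. g d x \<partial>\<mu>) \<longlonglongrightarrow> (\<integral>x. g' x \<partial>\<mu>)"
  using gb glim by (intro integral_dominated_convergence[where w = "\<lambda>_. real J"]) auto
 have "(t - s) / 2 * f J x \<le> g' x" if x: "x \<in> space \<mu>" for x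
 proof -
  have "(t - s) / 2 * real k \<le> t ^ k - s ^ k" if "k < J" for k
  proof -
   have "s ^ J \<le> s ^ (k - 1)" using that s by (intro power_decreasing) auto
   then have "1 / 2 \<le> s ^ (k - 1)" using s by linarith
   then have "real k * (1 / 2) * (t - s) \<le> real k * s ^ (k - 1) * (t - s)"
    using t by (intro mult_right_mono mult_left_mono) auto
   also have "... \<le> t ^ k - s ^ k" using s t by (intro power_diff_ge) auto
   finally show ?thesis by (simp add: mult_ac)
  qed
  then show ?thesis unfolding f_def g'_def sum_distrib_left mult.assoc[symmetric]
   using bp_point_nonneg[OF x] by (intro sum_mono mult_right_mono) auto
 qed
 then have "ennreal ((t - s) / 2) * ennreal (f J x) \<le> ennreal (g' x)" if "x \<in> space \<mu>" for x
  using t that bp_point_nonneg[OF that] unfolding f_def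
  by (subst ennreal_mult[symmetric]) (auto intro!: ennreal_leI sum_nonneg)
 then have "(\<integral>\<^sup>+x. ennreal ((t - s) / 2) * ennreal (f J x) \<partial>\<mu>) \<le> (\<integral>\<^sup>+x. ennreal (g' x) \<partial>\<mu>)"
  by (intro nn_integral_mono)
 also have "... = ennreal (\<integral>x. g' x \<partial>\<mu>)"
  using int g'b by (intro nn_integral_eq_integral) (auto intro!: AE_I2)
 finally have "ennreal ((t - s) / 2) * (\<integral>\<^sup>+x. ennreal (f J x) \<partial>\<mu>) \<le> ennreal (\<integral>x. g' x \<partial>\<mu>)"
  by (simp add: nn_integral_cmult)
 moreover have "ennreal ((t - s) / 2) * ennreal (2 * max K 0) < ennreal ((t - s) / 2) * (\<integral>\<^sup>+x. ennreal (f J x) \<partial>\<mu>)"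
  using t J by (intro ennreal_mult_strict_left_mono) auto
 ultimately have "ennreal ((t - s) / 2 * (2 * max K 0)) < ennreal (\<integral>x. g' x \<partial>\<mu>)"
  using t by (subst ennreal_mult) auto
 then have "(t - s) / 2 * (2 * max K 0) < (\<integral>x. g' x \<partial>\<mu>)" using t by (simp add: ennreal_less_iff)
 then have "(t - s) * max K 0 < (\<integral>x. g' x \<partial>\<mu>)" by simp
 then have "\<forall>\<^sub>F d in sequentially. (t - s) * max K 0 < (\<integral>x. g d x \<partial>\<mu>)"
  using lim by (rule order_tendstoD(1)[rotated])
 then have "\<forall>\<^sub>F d in sequentially. K < (mean_pgf t d - mean_pgf s d) / (t - s)"
 proof eventually_elim
  case (elim d)
  have i: "integrable \<mu> (bp_pgf \<mu> \<kappa> t d)" "integrable \<mu> (bp_pgf \<mu> \<kappa> s d)"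
   using s t by (auto intro!: bp_pgf_integrable)
  have "(\<integral>x. g d x \<partial>\<mu>) \<le> (\<integral>x. bp_pgf \<mu> \<kappa> t d x - bp_pgf \<mu> \<kappa> s d x \<partial>\<mu>)"
   unfolding g_def using s t i int[unfolded g_def] by (intro integral_mono bp_pgf_diff_ge) auto
  with elim i have "(t - s) * max K 0 < mean_pgf t d - mean_pgf s d" by simp
  then have "max K 0 < (mean_pgf t d - mean_pgf s d) / (t - s)"
   using t by (subst pos_less_divide_eq) (auto simp: mult.commute)
  then show ?case by simp
 qed
 with that s t show ?thesis by blast
qed

end

section \<open>Critical and supercritical kernels\<close>

context ker
begin

definition opT :: "('s => ennreal) => 's => ennreal" where
 "opT f x = (\<integral>\<^sup>+y. ennreal (\<kappa> x y) * f y \<partial>\<mu>)"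

abbreviation nsq :: "('s => ennreal) => ennreal" where
 "nsq f \<equiv> (\<integral>\<^sup>+x. f x ^ 2 \<partial>\<mu>)"

lemma opT_measurable [measurable]:
 assumes [measurable]: "f \<in> borel_measurable \<mu>"
 shows "opT f \<in> borel_measurable \<mu>"
 unfolding opT_def[abs_def] by measurable

lemma opT_pow_measurable [measurable]: "f \<in> borel_measurable \<mu> ==> (opT ^^ j) f \<in> borel_measurable \<mu>"
 by (induction j) auto

lemma opT_mono_AE:
 assumes "AE x in \<mu>. f x \<le> g x"
 shows "opT f x \<le> opT g x"
 unfolding opT_def
proof (rule nn_integral_mono_AE)
 show "AE y in \<mu>. ennreal (\<kappa> x y) * f y \<le> ennreal (\<kappa> x y) * g y"
  using assms by eventually_elim (simp add: mult_left_mono)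
qed

lemma opT_pow_mono_AE:
 assumes "AE x in \<mu>. f x \<le> g x"
 shows "AE x in \<mu>. (opT ^^ j) f x \<le> (opT ^^ j) g x"
proof (induction j)
 case (Suc j)
 then show ?case using opT_mono_AE by auto
qed (use assms in simp)

lemma opT_cmult:
 "f \<in> borel_measurable \<mu> ==> x \<in> space \<mu> ==> opT (\<lambda>y. c * f y) x = c * opT f x"
 unfolding opT_def by (subst nn_integral_cmult[symmetric]) (auto simp: mult_ac)

lemma opT_add:
 "f \<in> borel_measurable \<mu> ==> g \<in> borel_measurable \<mu> ==> x \<in> space \<mu> ==>
  opT (\<lambda>y. f y + g y) x = opT f x + opT g x"
 unfolding opT_def by (subst nn_integral_add[symmetric]) (auto simp: distrib_left)

lemma opT_cong: "(\<And>y. y \<in> space \<mu> ==> f y = g y) ==> opT f x = opT g x"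
 unfolding opT_def by (intro nn_integral_cong) auto

lemma opT_pow_cmult:
 assumes [measurable]: "f \<in> borel_measurable \<mu>"
 shows "x \<in> space \<mu> ==> (opT ^^ j) (\<lambda>y. c * f y) x = c * (opT ^^ j) f x"
proof (induction j arbitrary: x)
 case (Suc j)
 have "opT ((opT ^^ j) (\<lambda>y. c * f y)) x = opT (\<lambda>y. c * (opT ^^ j) f y) x"
  by (rule opT_cong) (rule Suc.IH)
 then show ?case using Suc.prems by (simp add: opT_cmult)
qed simp

lemma opT_pow_add:
 assumes [measurable]: "f \<in> borel_measurable \<mu>" "g \<in> borel_measurable \<mu>"
 shows "x \<in> space \<mu> ==> (opT ^^ j) (\<lambda>y. f y + g y) x = (opT ^^ j) f x + (opT ^^ j) g x"
proof (induction j arbitrary: x)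
 case (Suc j)
 have "opT ((opT ^^ j) (\<lambda>y. f y + g y)) x = opT (\<lambda>y. (opT ^^ j) f y + (opT ^^ j) g y) x"
  by (rule opT_cong) (rule Suc.IH)
 then show ?case using Suc.prems by (simp add: opT_add)
qed simp

lemma opT_selfadjoint:
 assumes [measurable]: "f \<in> borel_measurable \<mu>" "g \<in> borel_measurable \<mu>"
 shows "(\<integral>\<^sup>+x. opT f x * g x \<partial>\<mu>) = (\<integral>\<^sup>+x. f x * opT g x \<partial>\<mu>)"
proof -
 interpret pair_sigma_finite \<mu> \<mu> by unfold_locales
 have "(\<integral>\<^sup>+x. opT f x * g x \<partial>\<mu>) = (\<integral>\<^sup>+x. \<integral>\<^sup>+y. ennreal (\<kappa> x y) * f y * g x \<partial>\<mu> \<partial>\<mu>)"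
  unfolding opT_def by (intro nn_integral_cong nn_integral_multc[symmetric]) measurable
 also have "... = (\<integral>\<^sup>+y. \<integral>\<^sup>+x. ennreal (\<kappa> x y) * f y * g x \<partial>\<mu> \<partial>\<mu>)"
  by (rule Fubini'[symmetric]) measurable
 also have "... = (\<integral>\<^sup>+y. \<integral>\<^sup>+x. f y * (ennreal (\<kappa> y x) * g x) \<partial>\<mu> \<partial>\<mu>)"
  by (intro nn_integral_cong) (simp add: kernel_sym mult_ac)
 also have "... = (\<integral>\<^sup>+x. f x * opT g x \<partial>\<mu>)"
  unfolding opT_def by (intro nn_integral_cong nn_integral_cmult) measurable
 finally show ?thesis .
qed

lemma opT_pow_selfadjoint:
 assumes [measurable]: "f \<in> borel_measurable \<mu>" "g \<in> borel_measurable \<mu>"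
 shows "(\<integral>\<^sup>+x. (opT ^^ j) f x * g x \<partial>\<mu>) = (\<integral>\<^sup>+x. f x * (opT ^^ j) g x \<partial>\<mu>)"
 using assms(2)
proof (induction j arbitrary: g)
 case (Suc j)
 note [measurable] = Suc.prems
 have "(\<integral>\<^sup>+x. (opT ^^ Suc j) f x * g x \<partial>\<mu>) = (\<integral>\<^sup>+x. (opT ^^ j) f x * opT g x \<partial>\<mu>)"
  by (simp add: opT_selfadjoint)
 also have "... = (\<integral>\<^sup>+x. f x * (opT ^^ j) (opT g) x \<partial>\<mu>)" by (rule Suc.IH) measurable
 finally show ?case by (simp add: funpow_swap1)
qed simp

text \<open>By self-adjointness the squared norm of T^(j+1) f is the inner product of T^j f and
  T^(j+2) f, to which Cauchy-Schwarz applies.\<close>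

lemma nsq_log_convex:
 assumes [measurable]: "f \<in> borel_measurable \<mu>"
 shows "(nsq ((opT ^^ Suc j) f))\<^sup>2 \<le> nsq ((opT ^^ j) f) * nsq ((opT ^^ Suc (Suc j)) f)"
proof -
 have "nsq ((opT ^^ Suc j) f) = (\<integral>\<^sup>+x. opT ((opT ^^ j) f) x * (opT ^^ Suc j) f x \<partial>\<mu>)"
  by (simp add: power2_eq_square)
 also have "... = (\<integral>\<^sup>+x. (opT ^^ j) f x * (opT ^^ Suc (Suc j)) f x \<partial>\<mu>)"
  by (subst opT_selfadjoint) auto
 finally show ?thesis by (simp only:) (rule Cauchy_Schwarz_nn_integral, measurable)
qed

text \<open>Log-convexity keeps an increase going: once a step goes up from a positive value, so
  does the next, and the sequence stays away from 0.\<close>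

lemma log_convex_null:
 fixes a :: "nat => real"
 assumes "\<And>j. 0 \<le> a j" "\<And>j. (a (Suc j))\<^sup>2 \<le> a j * a (Suc (Suc j))" "a \<longlonglongrightarrow> 0"
 shows "a 1 \<le> a 0"
proof (rule ccontr)
 assume c: "\<not> a 1 \<le> a 0"
 have "a j \<le> a (Suc j) \<and> a 1 \<le> a (Suc j)" for j
 proof (induction j)
  case (Suc j)
  have pos: "0 < a (Suc j)" using Suc c assms(1)[of 0] by linarith
  have "a (Suc j) * a (Suc j) \<le> a j * a (Suc (Suc j))" using assms(2)[of j] by (simp add: power2_eq_square)
  also have "... \<le> a (Suc j) * a (Suc (Suc j))" using Suc assms(1) by (intro mult_right_mono) auto
  finally have "a (Suc j) \<le> a (Suc (Suc j))" using pos by simp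
  with Suc show ?case by linarith
 qed (use c in auto)
 then have "a 1 \<le> 0" by (intro LIMSEQ_le_const[OF LIMSEQ_Suc[OF assms(3)]]) auto
 then show False using c assms(1)[of 0] by linarith
qed

text \<open>From 2 x y \<le> t x^2 + y^2 / t. It replaces the triangle inequality for the norm
  without leaving \<open>ennreal\<close> or taking roots; t is kept free so that the factor of f can
  be brought close to 1 when g is negligible.\<close>

lemma nsq_add_le:
 assumes [measurable]: "f \<in> borel_measurable \<mu>" "g \<in> borel_measurable \<mu>" and t: "t > 0"
 shows "nsq (\<lambda>x. f x + g x) \<le> ennreal (1 + t) * nsq f + ennreal (1 + 1 / t) * nsq g"
proof -
 have pt: "(a + b)\<^sup>2 \<le> ennreal (1 + t) * a\<^sup>2 + ennreal (1 + 1 / t) * b\<^sup>2" for a b :: ennreal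
 proof (cases "a = top \<or> b = top")
  case True
  then show ?thesis using t by (auto simp: power2_eq_square ennreal_mult_top ennreal_top_mult)
 next
  case False
  then obtain x y where xy: "a = ennreal x" "b = ennreal y" "0 \<le> x" "0 \<le> y"
   by (cases a; cases b) auto
  have "0 \<le> (sqrt t * x - y / sqrt t)\<^sup>2" by simp
  also have "... = t * x\<^sup>2 - 2 * x * y + y\<^sup>2 / t"
   using t by (simp add: power2_diff power_mult_distrib power_divide)
  finally have "(x + y)\<^sup>2 \<le> (1 + t) * x\<^sup>2 + (1 + 1 / t) * y\<^sup>2"
   by (simp add: power2_sum algebra_simps)
  then have "ennreal ((x + y)\<^sup>2) \<le> ennreal ((1 + t) * x\<^sup>2 + (1 + 1 / t) * y\<^sup>2)" by (rule ennreal_leI)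
  also have "... = ennreal (1 + t) * ennreal (x\<^sup>2) + ennreal (1 + 1 / t) * ennreal (y\<^sup>2)"
   using t xy by (subst ennreal_plus) (auto simp: ennreal_mult)
  finally show ?thesis using xy by (simp add: ennreal_power flip: ennreal_plus)
 qed
 have "nsq (\<lambda>x. f x + g x) \<le> (\<integral>\<^sup>+x. ennreal (1 + t) * (f x)\<^sup>2 + ennreal (1 + 1 / t) * (g x)\<^sup>2 \<partial>\<mu>)"
  by (intro nn_integral_mono pt)
 also have "... = ennreal (1 + t) * nsq f + ennreal (1 + 1 / t) * nsq g"
  by (simp add: nn_integral_add nn_integral_cmult)
 finally show ?thesis .
qed

text \<open>The function T^j 1 is the expected size of generation j.\<close>

lemma bp_trunc_mean_eq_sum:
 "x \<in> space \<mu> ==> bp_trunc_mean d x = (\<Sum>j\<le>d. (opT ^^ j) (\<lambda>_. 1) x)"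
proof (induction d arbitrary: x)
 case (Suc d)
 have "bp_trunc_mean (Suc d) x = 1 + (\<integral>\<^sup>+y. ennreal (\<kappa> x y) * (\<Sum>j\<le>d. (opT ^^ j) (\<lambda>_. 1) y) \<partial>\<mu>)"
  using Suc by (subst bp_trunc_mean_Suc) (auto intro!: nn_integral_cong)
 also have "... = 1 + (\<Sum>j\<le>d. (opT ^^ Suc j) (\<lambda>_. 1) x)"
  using Suc.prems by (simp add: opT_def sum_distrib_left nn_integral_sum)
 also have "... = (\<Sum>j\<le>Suc d. (opT ^^ j) (\<lambda>_. 1) x)"
  by (subst sum.atMost_Suc_shift) simp
 finally show ?case .
qed (simp add: measure_pmf.emeasure_space_1)

section \<open>Consequences of a finite mean total size\<close>

context
 assumes fin: "(\<integral>\<^sup>+x. bp_mean \<mu> \<kappa> x \<partial>\<mu>) \<noteq> top"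
begin

text \<open>The integrals of T^j 1 are summable, as their sum is bounded by the integrated mean
  total size. The terms of even index 2 j are the squared norms of T^j 1 by
  self-adjointness.\<close>

lemma walks_null: "(\<lambda>j. nsq ((opT ^^ j) (\<lambda>_. 1))) \<longlonglongrightarrow> 0"
 and walks_finite: "nsq ((opT ^^ j) (\<lambda>_. 1)) \<noteq> top"
proof -
 let ?o = "\<lambda>j. (opT ^^ j) (\<lambda>_. 1)"
 define a where "a j = (\<integral>\<^sup>+x. (opT ^^ j) (\<lambda>_. 1) x \<partial>\<mu>)" for j
 have "(\<Sum>j<d. a j) \<le> (\<integral>\<^sup>+x. bp_mean \<mu> \<kappa> x \<partial>\<mu>)" for d
 proof -
  have "(\<Sum>j<d. a j) \<le> (\<Sum>j\<le>d. a j)" by (intro sum_mono2) auto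
  also have "... = (\<integral>\<^sup>+x. (\<Sum>j\<le>d. (opT ^^ j) (\<lambda>_. 1) x) \<partial>\<mu>)"
   unfolding a_def by (rule nn_integral_sum[symmetric]) auto
  also have "... \<le> (\<integral>\<^sup>+x. bp_mean \<mu> \<kappa> x \<partial>\<mu>)"
   by (intro nn_integral_mono) (auto simp: bp_mean_def bp_trunc_mean_eq_sum[symmetric] ennreal_of_nat_eq_real_of_nat intro!: SUP_upper)
  finally show ?thesis .
 qed
 then have "(\<Sum>j. a j) \<le> (\<integral>\<^sup>+x. bp_mean \<mu> \<kappa> x \<partial>\<mu>)"
  by (simp add: suminf_eq_SUP SUP_least)
 then have s: "(\<Sum>j. a j) \<noteq> top" using fin by (auto simp: top_unique)
 then have afin: "a j \<noteq> top" for j using ennreal_suminf_lessD less_top by metis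
 have "summable (\<lambda>j. enn2real (a j))"
  using s afin by (intro summable_suminf_not_top) (auto simp: less_top)
 then have "(\<lambda>j. enn2real (a j)) \<longlonglongrightarrow> 0" by (rule summable_LIMSEQ_zero)
 then have "(\<lambda>j. ennreal (enn2real (a j))) \<longlonglongrightarrow> ennreal 0" by (rule tendsto_ennrealI)
 then have "a \<longlonglongrightarrow> 0" using afin by (simp add: less_top)
 from LIMSEQ_subseq_LIMSEQ[OF this, of "\<lambda>j. 2 * j"] have "(\<lambda>j. a (2 * j)) \<longlonglongrightarrow> 0"
  by (simp add: strict_mono_def o_def)
 moreover have a2: "a (2 * j) = nsq (?o j)" for j
 proof -
  have "a (2 * j) = (\<integral>\<^sup>+x. (opT ^^ j) (?o j) x * 1 \<partial>\<mu>)"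
   by (simp add: a_def mult_2 funpow_add)
  also have "... = nsq (?o j)"
   by (subst opT_pow_selfadjoint) (auto simp: power2_eq_square)
  finally show ?thesis .
 qed
 ultimately show "(\<lambda>j. nsq (?o j)) \<longlonglongrightarrow> 0" by simp
 show "nsq (?o j) \<noteq> top" using afin[of "2 * j"] by (simp add: a2)
qed

lemma nsq_bounded_le:
 assumes [measurable]: "f \<in> borel_measurable \<mu>" and b: "AE x in \<mu>. f x \<le> of_nat B"
 shows "nsq ((opT ^^ j) f) \<le> (of_nat B)\<^sup>2 * nsq ((opT ^^ j) (\<lambda>_. 1))"
proof -
 have "AE x in \<mu>. (opT ^^ j) f x \<le> (opT ^^ j) (\<lambda>_. of_nat B * 1) x"
  using b by (intro opT_pow_mono_AE) simp
 then have "AE x in \<mu>. ((opT ^^ j) f x)\<^sup>2 \<le> (of_nat B)\<^sup>2 * ((opT ^^ j) (\<lambda>_. 1) x)\<^sup>2"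
  using AE_space
 proof eventually_elim
  case (elim x)
  then have "(opT ^^ j) f x \<le> of_nat B * (opT ^^ j) (\<lambda>_. 1) x"
   using opT_pow_cmult[of "\<lambda>_. 1" x j "of_nat B"] by simp
  then have "((opT ^^ j) f x)\<^sup>2 \<le> (of_nat B * (opT ^^ j) (\<lambda>_. 1) x)\<^sup>2" by (rule power_mono) simp
  then show ?case by (simp add: power_mult_distrib)
 qed
 then have "nsq ((opT ^^ j) f) \<le> (\<integral>\<^sup>+x. (of_nat B)\<^sup>2 * ((opT ^^ j) (\<lambda>_. 1) x)\<^sup>2 \<partial>\<mu>)"
  by (rule nn_integral_mono_AE)
 then show ?thesis by (simp add: nn_integral_cmult)
qed

lemma bounded_null:
 assumes [measurable]: "f \<in> borel_measurable \<mu>" and b: "AE x in \<mu>. f x \<le> of_nat B"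
 shows "(\<lambda>j. nsq ((opT ^^ j) f)) \<longlonglongrightarrow> 0"
proof (rule tendsto_sandwich[OF _ _ tendsto_const])
 show "\<forall>\<^sub>F j in sequentially. nsq ((opT ^^ j) f) \<le> (of_nat B)\<^sup>2 * nsq ((opT ^^ j) (\<lambda>_. 1))"
  using nsq_bounded_le[OF assms] by simp
 have "(\<lambda>j. (of_nat B)\<^sup>2 * nsq ((opT ^^ j) (\<lambda>_. 1))) \<longlonglongrightarrow> (of_nat B)\<^sup>2 * (0 :: ennreal)"
  by (intro ennreal_tendsto_cmult walks_null) (simp add: power_less_top_ennreal ennreal_of_nat_eq_real_of_nat)
 then show "(\<lambda>j. (of_nat B)\<^sup>2 * nsq ((opT ^^ j) (\<lambda>_. 1))) \<longlonglongrightarrow> 0" by simp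
qed simp

text \<open>A bounded f is dominated by a multiple of 1, so the squared norms of T^j f tend to 0,
  and a log-convex null sequence cannot start with an increase.\<close>

lemma bounded_contraction:
 assumes [measurable]: "f \<in> borel_measurable \<mu>" and b: "AE x in \<mu>. f x \<le> of_nat B"
 shows "nsq (opT f) \<le> nsq f"
proof -
 define r where "r j = enn2real (nsq ((opT ^^ j) f))" for j
 have "nsq ((opT ^^ j) f) < top" for j
 proof -
  have "nsq ((opT ^^ j) f) \<le> (of_nat B)\<^sup>2 * nsq ((opT ^^ j) (\<lambda>_. 1))" by (rule nsq_bounded_le[OF assms])
  also have "... < top" using walks_finite[of j] by (intro ennreal_mult_less_top[THEN iffD2]) (simp add: power_less_top_ennreal less_top ennreal_of_nat_eq_real_of_nat)
  finally show ?thesis .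
 qed
 then have r: "nsq ((opT ^^ j) f) = ennreal (r j)" for j by (simp add: r_def)
 have r0: "0 \<le> r j" for j by (simp add: r_def)
 have "r 1 \<le> r 0"
 proof (rule log_convex_null[of r])
  show "(r (Suc j))\<^sup>2 \<le> r j * r (Suc (Suc j))" for j
   using nsq_log_convex[OF assms(1), of j] r0
   by (simp only: r ennreal_power flip: ennreal_mult) (simp add: r0)
  have "(\<lambda>j. ennreal (r j)) \<longlonglongrightarrow> ennreal 0" using bounded_null[OF assms] by (simp add: r)
  then show "r \<longlonglongrightarrow> 0" by (rule tendsto_ennrealD) (auto simp: r0)
 qed (rule r0)
 then have "nsq ((opT ^^ 1) f) \<le> nsq ((opT ^^ 0) f)" unfolding r by (rule ennreal_leI)
 then show ?thesis by simp
qed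

lemma SUP_power2:
 fixes a :: "nat => ennreal"
 assumes "incseq a"
 shows "(SUP k. a k)\<^sup>2 = (SUP k. (a k)\<^sup>2)"
proof (rule antisym)
 have "(SUP k. a k)\<^sup>2 = (SUP k. SUP l. a l * a k)"
  by (simp add: power2_eq_square SUP_mult_right_ennreal SUP_mult_left_ennreal)
 also have "... \<le> (SUP k. (a k)\<^sup>2)"
 proof (intro SUP_least)
  fix k l
  have "a l * a k \<le> (a (max k l))\<^sup>2"
   unfolding power2_eq_square using assms by (intro mult_mono) (auto simp: incseq_def)
  also have "... \<le> (SUP k. (a k)\<^sup>2)" by (rule SUP_upper) simp
  finally show "a l * a k \<le> (SUP k. (a k)\<^sup>2)" .
 qed
 finally show "(SUP k. a k)\<^sup>2 \<le> (SUP k. (a k)\<^sup>2)" .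
 show "(SUP k. (a k)\<^sup>2) \<le> (SUP k. a k)\<^sup>2"
  by (intro SUP_least power_mono SUP_upper) auto
qed

lemma opT_SUP:
 assumes "incseq g" and [measurable]: "\<And>k::nat. g k \<in> borel_measurable \<mu>" and "x \<in> space \<mu>"
 shows "opT (\<lambda>y. SUP k. g k y) x = (SUP k. opT (g k) x)"
proof -
 have "opT (\<lambda>y. SUP k. g k y) x = (\<integral>\<^sup>+y. (SUP k. ennreal (\<kappa> x y) * g k y) \<partial>\<mu>)"
  unfolding opT_def by (intro nn_integral_cong SUP_mult_left_ennreal)
 also have "... = (SUP k. opT (g k) x)"
  unfolding opT_def using assms
  by (intro nn_integral_monotone_convergence_SUP) (auto simp: incseq_def le_fun_def intro!: mult_left_mono)
 finally show ?thesis .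
qed

lemma min_of_nat_SUP: "(SUP k. min a (of_nat k)) = (a :: ennreal)"
proof (rule antisym)
 show "(SUP k. min a (of_nat k)) \<le> a" by (rule SUP_least) simp
 show "a \<le> (SUP k. min a (of_nat k))"
 proof (cases "a = top")
  case True
  then have "(\<lambda>k. min a (of_nat k)) = of_nat" by (auto simp: min_def top_unique)
  then show ?thesis by (simp only: ennreal_SUP_of_nat_eq_top top_greatest)
 next
  case False
  then obtain r where r: "a = ennreal r" "0 \<le> r" by (cases a) auto
  obtain k where "r \<le> real k" using real_arch_simple by blast
  then have "min a (of_nat k) = a" using r by (simp add: min_def ennreal_of_nat_eq_real_of_nat)
  then show ?thesis by (metis SUP_upper UNIV_I)
 qed
qed

lemma contraction:
 assumes [measurable]: "f \<in> borel_measurable \<mu>"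
 shows "nsq (opT f) \<le> nsq f"
proof -
 define g where "g k x = min (f x) (of_nat k)" for k :: nat and x
 have [measurable]: "g k \<in> borel_measurable \<mu>" for k unfolding g_def by measurable
 have g: "incseq g" by (auto simp: incseq_def le_fun_def g_def min_def intro: order_trans)
 have sup: "f = (\<lambda>x. SUP k. g k x)" by (simp add: g_def min_of_nat_SUP)
 have Tinc: "opT (g k) x \<le> opT (g (Suc k)) x" for k x
  using g by (intro opT_mono_AE AE_I2) (auto simp: incseq_Suc_iff le_fun_def)
 have "nsq (opT f) = (\<integral>\<^sup>+x. (SUP k. opT (g k) x)\<^sup>2 \<partial>\<mu>)"
  by (intro nn_integral_cong) (subst sup, simp add: opT_SUP[OF g])
 also have "... = (\<integral>\<^sup>+x. (SUP k. (opT (g k) x)\<^sup>2) \<partial>\<mu>)"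
 proof (intro nn_integral_cong)
  fix x
  have i: "incseq (\<lambda>k. opT (g k) x)" using Tinc by (rule incseq_SucI)
  show "(SUP k. opT (g k) x)\<^sup>2 = (SUP k. (opT (g k) x)\<^sup>2)" by (rule SUP_power2[OF i])
 qed
 also have "... = (SUP k. nsq (opT (g k)))"
  using Tinc by (intro nn_integral_monotone_convergence_SUP) (auto simp: incseq_Suc_iff le_fun_def intro: power_mono)
 also have "... \<le> nsq f"
 proof (rule SUP_least)
  fix k
  have "nsq (opT (g k)) \<le> nsq (g k)"
   by (rule bounded_contraction[of _ k]) (auto simp: g_def)
  also have "... \<le> nsq f" by (intro nn_integral_mono power_mono) (auto simp: g_def)
  finally show "nsq (opT (g k)) \<le> nsq f" .
 qed
 finally show ?thesis .
qed

lemma op_norm_le_1: "op_norm_sq \<mu> \<kappa> \<le> 1"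
 unfolding op_norm_sq_def
proof (rule SUP_least, clarsimp)
 fix f :: "'s => real"
 assume [measurable]: "f \<in> borel_measurable \<mu>" and f: "\<forall>x\<in>space \<mu>. 0 \<le> f x" "(\<integral>\<^sup>+x. ennreal ((f x)\<^sup>2) \<partial>\<mu>) \<le> 1"
 have "(\<integral>\<^sup>+x. (\<integral>\<^sup>+y. ennreal (\<kappa> x y * f y) \<partial>\<mu>)\<^sup>2 \<partial>\<mu>) = nsq (opT (\<lambda>y. ennreal (f y)))"
  using f unfolding opT_def
  by (intro nn_integral_cong arg_cong[where f = "\<lambda>z. z\<^sup>2"]) (simp add: ennreal_mult kernel_nonneg)
 also have "... \<le> nsq (\<lambda>y. ennreal (f y))" by (rule contraction) simp
 also have "... = (\<integral>\<^sup>+x. ennreal ((f x)\<^sup>2) \<partial>\<mu>)"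
  using f by (intro nn_integral_cong) (simp add: ennreal_power)
 finally show "(\<integral>\<^sup>+x. (\<integral>\<^sup>+y. ennreal (\<kappa> x y * f y) \<partial>\<mu>)\<^sup>2 \<partial>\<mu>) \<le> 1" using f by simp
qed

lemma nsq_iterate_le: "f \<in> borel_measurable \<mu> ==> nsq ((opT ^^ j) f) \<le> nsq f"
proof (induction j)
 case (Suc j)
 have "nsq ((opT ^^ Suc j) f) \<le> nsq ((opT ^^ j) f)" using Suc.prems by (simp add: contraction)
 with Suc show ?case by simp
qed simp

text \<open>Log-convexity and contraction would keep the norm of T^j h at least 1 for all j. But h
  is a bounded function plus a remainder of small norm: the bounded part dies out under T^j, and the
  remainder stays small because T is a contraction.\<close>

lemma no_norm_preserving:
 assumes [measurable]: "h \<in> borel_measurable \<mu>" and h: "nsq h \<le> 1" "1 \<le> nsq (opT h)"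
 shows False
proof -
 have ge1: "1 \<le> nsq ((opT ^^ j) h) \<and> 1 \<le> nsq ((opT ^^ Suc j) h)" for j
 proof (induction j)
  case 0
  show ?case using h contraction[of h] by (auto intro: order_trans)
 next
  case (Suc j)
  have "1 \<le> (nsq ((opT ^^ Suc j) h))\<^sup>2" using Suc by (metis one_le_power)
  also have "... \<le> nsq ((opT ^^ j) h) * nsq ((opT ^^ Suc (Suc j)) h)" by (rule nsq_log_convex) simp
  also have "... \<le> 1 * nsq ((opT ^^ Suc (Suc j)) h)"
   using nsq_iterate_le[of h j] h by (intro mult_right_mono) (auto intro: order_trans)
  finally show ?case using Suc by simp
 qed
 have "AE x in \<mu>. (h x)\<^sup>2 \<noteq> \<infinity>"
  using h by (intro nn_integral_noteq_infinite) (auto simp: top_unique)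
 then have fin: "AE x in \<mu>. h x \<noteq> top" by eventually_elim (auto simp: power2_eq_square)
 have "(\<lambda>k. \<integral>\<^sup>+x. (h x - min (h x) (of_nat k))\<^sup>2 \<partial>\<mu>) \<longlonglongrightarrow> (\<integral>\<^sup>+x. 0 \<partial>\<mu>)"
 proof (rule nn_integral_dominated_convergence[where w = "\<lambda>x. (h x)\<^sup>2"])
  show "AE x in \<mu>. (h x - min (h x) (of_nat k))\<^sup>2 \<le> (h x)\<^sup>2" for k
   by (intro AE_I2 power_mono diff_le_self_ennreal) auto
  show "nsq h < \<infinity>" using h by (auto intro: le_less_trans)
  show "AE x in \<mu>. (\<lambda>k. (h x - min (h x) (of_nat k))\<^sup>2) \<longlonglongrightarrow> 0"
   using fin
  proof eventually_elim
   case (elim x)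
   then obtain r where r: "h x = ennreal r" "0 \<le> r" by (cases "h x") auto
   obtain K where "r \<le> real K" using real_arch_simple by blast
   then have "h x - min (h x) (of_nat k) = 0" if "K \<le> k" for k
    using that r by (simp add: min_def ennreal_of_nat_eq_real_of_nat)
   then have "\<forall>\<^sub>F k in sequentially. (h x - min (h x) (of_nat k))\<^sup>2 = 0"
    by (intro eventually_sequentiallyI[of K]) simp
   then show ?case by (rule tendsto_eventually)
  qed
 qed auto
 \<comment> \<open>1 / 8 is small enough: both parts enter \<open>nsq_add_le\<close> with factor 2,
   and the resulting bound 1 / 2 lies below 1.\<close>
 then have "\<forall>\<^sub>F k in sequentially. (\<integral>\<^sup>+x. (h x - min (h x) (of_nat k))\<^sup>2 \<partial>\<mu>) < ennreal (1 / 8)"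
  by (intro order_tendstoD(2)) auto
 then obtain B :: nat where B: "(\<integral>\<^sup>+x. (h x - min (h x) (of_nat B))\<^sup>2 \<partial>\<mu>) < ennreal (1 / 8)"
  using eventually_happens[of _ sequentially] by auto
 define f where "f x = min (h x) (of_nat B)" for x
 define g where "g x = h x - min (h x) (of_nat B)" for x
 have [measurable]: "f \<in> borel_measurable \<mu>" "g \<in> borel_measurable \<mu>"
  unfolding f_def g_def by measurable
 have hfg: "h = (\<lambda>x. f x + g x)"
 proof
  fix x show "h x = f x + g x"
   unfolding f_def g_def by (subst add.commute, rule diff_add_cancel_ennreal[symmetric]) simp
 qed
 have "(\<lambda>j. nsq ((opT ^^ j) f)) \<longlonglongrightarrow> 0" by (rule bounded_null[of _ B]) (auto simp: f_def)
 then have "\<forall>\<^sub>F j in sequentially. nsq ((opT ^^ j) f) < ennreal (1 / 8)"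
  by (intro order_tendstoD(2)) auto
 then obtain j where j: "nsq ((opT ^^ j) f) < ennreal (1 / 8)"
  using eventually_happens[of _ sequentially] by auto
 have "1 \<le> nsq ((opT ^^ j) h)" using ge1 by blast
 also have "... = nsq (\<lambda>x. (opT ^^ j) f x + (opT ^^ j) g x)"
  by (intro nn_integral_cong) (subst hfg, simp add: opT_pow_add)
 also have "... \<le> ennreal (1 + 1) * nsq ((opT ^^ j) f) + ennreal (1 + 1 / 1) * nsq ((opT ^^ j) g)"
  by (rule nsq_add_le) auto
 also have "... \<le> ennreal (1 + 1) * ennreal (1 / 8) + ennreal (1 + 1 / 1) * ennreal (1 / 8)"
  using j B nsq_iterate_le[of g j] unfolding g_def
  by (intro add_mono mult_left_mono) (auto intro: less_imp_le order_trans)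
 also have "... = ennreal (1 / 4) + ennreal (1 / 4)"
  by (subst (1 2) ennreal_mult[symmetric]) auto
 also have "... = ennreal (1 / 2)"
  by (subst ennreal_plus[symmetric]) auto
 finally have "ennreal 1 \<le> ennreal (1 / 2)" by (simp only: ennreal_1)
 then show False by (subst (asm) ennreal_le_iff) auto
qed

text \<open>Compactness makes the images T F of near-maximisers converge along a subsequence. The
  limit has norm at most 1 and its image under T has norm at least 1, which
  \<open>no_norm_preserving\<close> excludes.\<close>

lemma not_critical_compact:
 assumes crit: "op_norm_sq \<mu> \<kappa> = 1" and cpt: "compact_T \<mu> \<kappa>"
 shows False
proof -
 define A where "A = {f. f \<in> borel_measurable \<mu> \<and> (\<forall>x\<in>space \<mu>. 0 \<le> f x) \<and> (\<integral>\<^sup>+x. ennreal ((f x)\<^sup>2) \<partial>\<mu>) \<le> 1}"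
 define U where "U f = opT (\<lambda>y. ennreal (f y))" for f :: "'s => real"
 have U: "(\<integral>\<^sup>+y. ennreal (\<kappa> x y * f y) \<partial>\<mu>) = U f x" if "f \<in> A" "x \<in> space \<mu>" for f x
  using that unfolding U_def opT_def A_def by (intro nn_integral_cong) (simp add: ennreal_mult kernel_nonneg)
 have "op_norm_sq \<mu> \<kappa> = (SUP f\<in>A. nsq (U f))"
  unfolding op_norm_sq_def A_def[symmetric] using U by (intro SUP_cong refl nn_integral_cong) auto
 with crit have S: "(SUP f\<in>A. nsq (U f)) = 1" by simp
 \<comment> \<open>The offset 2 keeps the lower bounds positive for every k, so that they can be
   squared in \<open>ennreal\<close>.\<close>
 have "\<exists>f\<in>A. ennreal (1 - 1 / (real k + 2)) < nsq (U f)" for k :: nat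
 proof -
  have "ennreal (1 - 1 / (real k + 2)) < ennreal 1" by (intro ennreal_lessI) auto
  then show ?thesis using S by (simp add: less_SUP_iff[symmetric])
 qed
 then obtain F where F: "\<And>k. F k \<in> A" "\<And>k. ennreal (1 - 1 / (real k + 2)) < nsq (U (F k))" by metis
 have FA: "F k \<in> borel_measurable \<mu>" "\<And>x. x \<in> space \<mu> ==> 0 \<le> F k x" "(\<integral>\<^sup>+x. ennreal ((F k x)\<^sup>2) \<partial>\<mu>) \<le> 1" for k
  using F(1)[of k] by (auto simp: A_def)
 note [measurable] = FA(1)
 have nF: "nsq (\<lambda>x. ennreal (F k x)) \<le> 1" for k
 proof -
  have "nsq (\<lambda>x. ennreal (F k x)) = (\<integral>\<^sup>+x. ennreal ((F k x)\<^sup>2) \<partial>\<mu>)"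
   using FA(2) by (intro nn_integral_cong) (simp add: ennreal_power)
  then show ?thesis using FA(3)[of k] by simp
 qed
 have L2F: "L2 \<mu> (F k)" for k
  using FA(1)[of k] FA(3)[of k] by (auto simp: L2_def intro: le_less_trans)
 from cpt L2F FA(3) obtain r g where r: "strict_mono r" and g: "L2 \<mu> g"
  and lim: "(\<lambda>k. \<integral>\<^sup>+x. ennreal ((Top \<mu> \<kappa> (F (r k)) x - g x)\<^sup>2) \<partial>\<mu>) \<longlonglongrightarrow> 0"
  unfolding compact_T_def by blast
 have TopL2: "AE x in \<mu>. integrable \<mu> (\<lambda>y. \<kappa> x y * F k y)" "L2 \<mu> (Top \<mu> \<kappa> (F k))" for k
  using cpt L2F unfolding compact_T_def by blast+
 have Top_eq: "AE x in \<mu>. U (F k) x = ennreal (Top \<mu> \<kappa> (F k) x)" for k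
  using TopL2(1)[of k] AE_space
 proof eventually_elim
  case (elim x)
  then have "(\<integral>\<^sup>+y. ennreal (\<kappa> x y * F k y) \<partial>\<mu>) = ennreal (Top \<mu> \<kappa> (F k) x)"
   unfolding Top_def by (intro nn_integral_eq_integral) (auto intro!: AE_I2 mult_nonneg_nonneg kernel_nonneg FA(2))
  then show ?case using U[OF F(1)] elim by simp
 qed
 \<comment> \<open>Conversion to \<open>ennreal\<close> replaces g by its positive part, which is at
   least as close to the non-negative functions T F as g itself.\<close>
 define h where "h x = ennreal (g x)" for x
 define e where "e k x = ennreal \<bar>Top \<mu> \<kappa> (F (r k)) x - g x\<bar>" for k x
 have [measurable]: "g \<in> borel_measurable \<mu>" "Top \<mu> \<kappa> (F k) \<in> borel_measurable \<mu>" for k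
  using g TopL2(2)[of k] by (auto simp: L2_def)
 have [measurable]: "h \<in> borel_measurable \<mu>" "e k \<in> borel_measurable \<mu>" "U (F k) \<in> borel_measurable \<mu>" for k
  unfolding h_def e_def U_def by measurable
 have e0: "(\<lambda>k. nsq (e k)) \<longlonglongrightarrow> 0"
  using lim unfolding e_def by (simp add: ennreal_power)
 have tri: "ennreal a \<le> ennreal b + ennreal \<bar>a - b\<bar>" "ennreal b \<le> ennreal a + ennreal \<bar>a - b\<bar>" for a b :: real
  by (cases "0 \<le> b"; cases "0 \<le> a"; simp add: ennreal_neg flip: ennreal_plus; simp add: ennreal_leI)+
 have uh: "AE x in \<mu>. U (F (r k)) x \<le> h x + e k x" and hu: "AE x in \<mu>. h x \<le> U (F (r k)) x + e k x" for k
  using Top_eq[of "r k"] by (eventually_elim, simp add: h_def e_def tri)+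
 have nU: "nsq (U (F k)) \<le> 1" for k
  unfolding U_def using contraction[of "\<lambda>y. ennreal (F k y)"] nF[of k] by (auto intro: order_trans)
 have lim_t: "(\<lambda>k. c * a + ennreal (1 + 1 / t) * nsq (e k)) \<longlonglongrightarrow> c * a" for c a :: ennreal and t :: real
 proof -
  have "(\<lambda>k. c * a + ennreal (1 + 1 / t) * nsq (e k)) \<longlonglongrightarrow> c * a + ennreal (1 + 1 / t) * 0"
   by (intro tendsto_add tendsto_const ennreal_tendsto_cmult e0) auto
  then show ?thesis by simp
 qed
 have h1: "nsq h \<le> ennreal (1 + t) * 1" if t: "t > 0" for t
 proof (rule LIMSEQ_le_const[OF lim_t[of "ennreal (1 + t)" 1 t]], intro exI allI impI)
  fix k
  have "nsq h \<le> nsq (\<lambda>x. U (F (r k)) x + e k x)"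
  proof (rule nn_integral_mono_AE)
   show "AE x in \<mu>. (h x)\<^sup>2 \<le> (U (F (r k)) x + e k x)\<^sup>2"
    using hu[of k] by eventually_elim (simp add: power_mono)
  qed
  also have "... \<le> ennreal (1 + t) * nsq (U (F (r k))) + ennreal (1 + 1 / t) * nsq (e k)"
   using t by (intro nsq_add_le) auto
  also have "... \<le> ennreal (1 + t) * 1 + ennreal (1 + 1 / t) * nsq (e k)"
   by (intro add_right_mono mult_left_mono nU) auto
  finally show "nsq h \<le> ennreal (1 + t) * 1 + ennreal (1 + 1 / t) * nsq (e k)" .
 qed
 \<comment> \<open>Compactness gives convergence of T F but not of F, so the norm of T h is compared
   with that of T (T F); \<open>nsq_log_convex\<close> bounds the latter below by the square of
   \<open>nsq (U (F (r k)))\<close>, because F has norm at most 1.\<close>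
 have h2: "1 \<le> ennreal (1 + t) * nsq (opT h)" if t: "t > 0" for t
 proof (rule LIMSEQ_le[OF _ lim_t[of "ennreal (1 + t)" "nsq (opT h)" t]])
  have "(\<lambda>k. (1 - 1 / (real (r k) + 2))\<^sup>2) \<longlonglongrightarrow> (1 - 0)\<^sup>2"
  proof (intro tendsto_intros)
   have "filterlim (\<lambda>k. real (r k) + 2) at_top sequentially"
    by (intro filterlim_tendsto_add_at_top[OF tendsto_const, of _ _ 2, simplified add.commute]
      filterlim_compose[OF filterlim_real_sequentially] filterlim_subseq r)
   then show "(\<lambda>k. 1 / (real (r k) + 2)) \<longlonglongrightarrow> 0"
    by (intro tendsto_divide_0[OF tendsto_const] filterlim_at_top_imp_at_infinity)
  qed
  then show "(\<lambda>k. ennreal ((1 - 1 / (real (r k) + 2))\<^sup>2)) \<longlonglongrightarrow> 1"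
   using tendsto_ennrealI by fastforce
  show "\<exists>N. \<forall>k\<ge>N. ennreal ((1 - 1 / (real (r k) + 2))\<^sup>2) \<le> ennreal (1 + t) * nsq (opT h) + ennreal (1 + 1 / t) * nsq (e k)"
  proof (intro exI allI impI)
   fix k
   let ?f = "\<lambda>x. ennreal (F (r k) x)"
   have "ennreal ((1 - 1 / (real (r k) + 2))\<^sup>2) = (ennreal (1 - 1 / (real (r k) + 2)))\<^sup>2"
    by (simp add: ennreal_power)
   also have "... \<le> (nsq (U (F (r k))))\<^sup>2" using F(2)[of "r k"] by (intro power_mono) auto
   also have "... \<le> nsq ?f * nsq (opT (U (F (r k))))"
    using nsq_log_convex[of ?f 0] by (simp add: U_def)
   also have "... \<le> 1 * nsq (opT (U (F (r k))))" by (intro mult_right_mono nF) simp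
   also have "... = nsq (opT (U (F (r k))))" by simp
   also have "... \<le> nsq (opT (\<lambda>x. h x + e k x))"
    using uh[of k] by (intro nn_integral_mono power_mono opT_mono_AE) auto
   also have "... = nsq (\<lambda>x. opT h x + opT (e k) x)"
    by (intro nn_integral_cong) (simp add: opT_add)
   also have "... \<le> ennreal (1 + t) * nsq (opT h) + ennreal (1 + 1 / t) * nsq (opT (e k))"
    using t by (intro nsq_add_le) auto
   also have "... \<le> ennreal (1 + t) * nsq (opT h) + ennreal (1 + 1 / t) * nsq (e k)"
    by (intro add_left_mono mult_left_mono contraction) auto
   finally show "ennreal ((1 - 1 / (real (r k) + 2))\<^sup>2) \<le> ennreal (1 + t) * nsq (opT h) + ennreal (1 + 1 / t) * nsq (e k)" .
  qed
 qed
 have "nsq h \<noteq> top" using h1[of 1] by (auto simp: top_unique)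
 then obtain a where a: "nsq h = ennreal a" "0 \<le> a" by (cases "nsq h") auto
 have "nsq (opT h) \<noteq> top" using contraction[of h] a by (auto simp: top_unique)
 then obtain b where b: "nsq (opT h) = ennreal b" "0 \<le> b" by (cases "nsq (opT h)") auto
 have "a \<le> 1"
 proof (rule field_le_epsilon)
  fix t :: real assume t: "0 < t"
  then have "ennreal a \<le> ennreal (1 + t)" using h1[of t] a by (simp only: mult_1_right)
  then show "a \<le> 1 + t" using t by (subst (asm) ennreal_le_iff) auto
 qed
 have "1 \<le> b"
 proof (rule ccontr)
  assume "\<not> 1 \<le> b"
  define t where "t = (1 - b) / 2"
  have t: "t > 0" using \<open>\<not> 1 \<le> b\<close> by (simp add: t_def)
  have "1 \<le> ennreal ((1 + t) * b)" using h2[OF t] t b by (simp add: ennreal_mult)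
  then have "1 \<le> (1 + t) * b" by (metis ennreal_1 ennreal_le_iff2 not_one_le_zero)
  also have "... \<le> b + t" using \<open>\<not> 1 \<le> b\<close> t b by (simp add: algebra_simps mult_left_le)
  finally have "1 \<le> b + t" .
  then show False using \<open>\<not> 1 \<le> b\<close> unfolding t_def by (simp add: field_simps)
 qed
 show False
  by (rule no_norm_preserving[of h]) (use \<open>a \<le> 1\<close> \<open>1 \<le> b\<close> a b in \<open>auto intro: ennreal_leI simp flip: ennreal_1\<close>)
qed

end

lemma chi_infinite:
 assumes "chi_k \<mu> \<kappa> = top \<or> (critical \<mu> \<kappa> \<and> compact_T \<mu> \<kappa>) \<or> supercritical \<mu> \<kappa>"
 shows "(\<integral>\<^sup>+x. bp_mean \<mu> \<kappa> x \<partial>\<mu>) = top"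
proof (rule ccontr)
 assume fin: "(\<integral>\<^sup>+x. bp_mean \<mu> \<kappa> x \<partial>\<mu>) \<noteq> top"
 have "emeasure \<mu> (space \<mu>) \<noteq> 0" using kernel by (auto simp only: kernel_def type_space_def)
 then have "chi_k \<mu> \<kappa> \<noteq> top" using fin by (auto simp: chi_k_def ennreal_divide_eq_top_iff)
 with assms not_critical_compact[OF fin] op_norm_le_1[OF fin] show False
  by (auto simp: critical_def supercritical_def)
qed

end

section \<open>Components and neighbourhoods\<close>

text \<open>A measurable set of good vertex data is combined with a conditional probability under
  \<open>rg\<close>. The integral over the data is bounded below on that set alone, and 1 - 2 e
  \<le> (1 - e)^2 joins the two failure probabilities.\<close>

lemma (in prob_space) to_inftyI:
 assumes "\<And>K e. e > 0 ==> whp M (\<lambda>n w. 1 - e \<le> measure_pmf.prob (rg (N n w) (p n w)) {E. K < F (N n w) E})"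
 shows "to_infty M N p F"
proof -
 have S: "\<forall>\<^sub>F n in sequentially. \<exists>S\<in>events. 1 - e \<le> prob S \<and>
   (\<forall>w\<in>S. 1 - e \<le> measure_pmf.prob (rg (N n w) (p n w)) {E. K < F (N n w) E})" if "e > 0" for e K
  using assms[OF that, of K] that unfolding whp_def by blast
 have prod: "1 - 2 * e \<le> (1 - e) * (1 - e)" for e :: real by (simp add: algebra_simps)
 have le1: "gprob M N p P n \<le> 1" for P n
 proof -
  have "gprob M N p P n \<le> (\<integral>\<^sup>+w. 1 \<partial>M)"
   unfolding gprob_def by (intro nn_integral_mono) simp
  then show ?thesis by (simp add: emeasure_space_1)
 qed
 have gp: "\<forall>\<^sub>F n in sequentially. ennreal (1 - 2 * e) \<le> gprob M N p (\<lambda>m E. K < F m E) n"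
  if e: "0 < e" "e < 1" for e K
  using S[OF e(1), of K]
 proof eventually_elim
  case (elim n)
  then obtain S where S: "S \<in> events" "1 - e \<le> prob S"
   "\<And>w. w \<in> S ==> 1 - e \<le> measure_pmf.prob (rg (N n w) (p n w)) {E. K < F (N n w) E}" by blast
  have "ennreal (1 - 2 * e) \<le> ennreal ((1 - e) * (1 - e))" by (intro ennreal_leI prod)
  also have "... = ennreal (1 - e) * ennreal (1 - e)" using e by (intro ennreal_mult) auto
  also have "... \<le> ennreal (1 - e) * emeasure M S"
   using S(2) by (intro mult_left_mono) (auto simp: emeasure_eq_measure intro: ennreal_leI)
  also have "... = (\<integral>\<^sup>+w. ennreal (1 - e) * indicator S w \<partial>M)"
   by (rule nn_integral_cmult_indicator[OF S(1), symmetric])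
  also have "... \<le> gprob M N p (\<lambda>m E. K < F m E) n"
   unfolding gprob_def using S(3) by (intro nn_integral_mono) (auto simp: indicator_def intro: ennreal_leI)
  finally show ?case .
 qed
 have "(\<lambda>n. gprob M N p (\<lambda>m E. K < F m E) n) \<longlonglongrightarrow> 1" for K
 proof (rule order_tendstoI)
  fix a :: ennreal assume a: "a < 1"
  then obtain r where r: "a = ennreal r" "0 \<le> r" by (cases a) auto
  with a have r1: "r < 1" by (simp flip: ennreal_1 add: ennreal_less_iff)
  define e where "e = (1 - r) / 4"
  have e: "0 < e" "e < 1" "r < 1 - 2 * e" using r r1 by (auto simp: e_def field_simps)
  have "a < ennreal (1 - 2 * e)" unfolding r(1) using e r by (intro ennreal_lessI) auto
  then show "\<forall>\<^sub>F n in sequentially. a < gprob M N p (\<lambda>m E. K < F m E) n"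
   using less_le_trans by (intro eventually_mono[OF gp[OF e(1,2), of K]]) blast
 next
  fix a :: ennreal assume "1 < a"
  then show "\<forall>\<^sub>F n in sequentially. gprob M N p (\<lambda>m E. K < F m E) n < a"
   using le1 le_less_trans by (intro always_eventually) blast
 qed
 moreover have "(\<lambda>n. gexp M N p F n) \<longlonglongrightarrow> top"
  unfolding tendsto_top_iff_ennreal
 proof (intro allI impI)
  fix l :: real assume l: "0 \<le> l"
  \<comment> \<open>Exceeding K with conditional probability 1 / 2, on data of probability 1 / 2,
    gives an expectation of at least K / 4 > l.\<close>
  define K where "K = 4 * (l + 1)"
  have "(1 / 2 :: real) > 0" by simp
  from S[OF this, of K] show "\<forall>\<^sub>F n in sequentially. ennreal l < gexp M N p F n"
  proof eventually_elim
   case (elim n)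
   then obtain S where S: "S \<in> events" "1 - 1 / 2 \<le> prob S"
    "\<And>w. w \<in> S ==> 1 - 1 / 2 \<le> measure_pmf.prob (rg (N n w) (p n w)) {E. K < F (N n w) E}" by blast
   have inner: "ennreal (K / 2) \<le> (\<integral>\<^sup>+E. ennreal (F (N n w) E) \<partial>measure_pmf (rg (N n w) (p n w)))" if "w \<in> S" for w
   proof -
    let ?G = "rg (N n w) (p n w)" and ?A = "{E. K < F (N n w) E}"
    have "ennreal (K / 2) = ennreal K * ennreal (1 / 2)"
     using l unfolding K_def by (subst ennreal_mult[symmetric]) auto
    also have "... \<le> ennreal K * emeasure (measure_pmf ?G) ?A"
     using S(3)[OF that] unfolding measure_pmf.emeasure_eq_measure
     by (intro mult_left_mono ennreal_leI) auto
    also have "... = (\<integral>\<^sup>+E. ennreal K * indicator ?A E \<partial>measure_pmf ?G)"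
     by (rule nn_integral_cmult_indicator[symmetric]) simp
    also have "... \<le> (\<integral>\<^sup>+E. ennreal (F (N n w) E) \<partial>measure_pmf ?G)"
     by (intro nn_integral_mono) (auto simp: indicator_def intro: ennreal_leI)
    finally show ?thesis .
   qed
   have "ennreal l < ennreal (K / 4)" using l by (intro ennreal_lessI) (auto simp: K_def)
   also have "... = ennreal (K / 2) * ennreal (1 / 2)"
    using l unfolding K_def by (subst ennreal_mult[symmetric]) auto
   also have "... \<le> ennreal (K / 2) * emeasure M S"
    using S(2) unfolding emeasure_eq_measure by (intro mult_left_mono ennreal_leI) auto
   also have "... = (\<integral>\<^sup>+w. ennreal (K / 2) * indicator S w \<partial>M)"
    by (rule nn_integral_cmult_indicator[OF S(1), symmetric])
   also have "... \<le> gexp M N p F n"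
    unfolding gexp_def using inner by (intro nn_integral_mono) (auto simp: indicator_def)
   finally show ?case .
  qed
 qed
 ultimately show ?thesis by (simp add: to_infty_def)
qed

section \<open>Components and balls in a fixed graph\<close>

lemma comp_subset: "v < N ==> comp N E v \<subseteq> {..<N}"
proof
 fix u assume "v < N" "u \<in> comp N E v"
 then have "(v, u) \<in> (adj N E)\<^sup>*" by (simp add: comp_def)
 then show "u \<in> {..<N}" using \<open>v < N\<close> by (induction rule: rtrancl_induct) (auto simp: adj_def)
qed

lemma finite_comp: "v < N ==> finite (comp N E v)"
 by (rule finite_subset[OF comp_subset]) auto

lemma comp_refl: "v \<in> comp N E v"
 by (simp add: comp_def)

lemma comp_eq: "u \<in> comp N E v \<longleftrightarrow> comp N E u = comp N E v"
proof
 have "sym (adj N E)" by (auto simp: sym_def adj_def)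
 then have sym: "sym ((adj N E)\<^sup>*)" by (rule sym_rtrancl)
 assume "u \<in> comp N E v"
 then have "(v, u) \<in> (adj N E)\<^sup>*" "(u, v) \<in> (adj N E)\<^sup>*" using sym by (auto simp: comp_def sym_def)
 then show "comp N E u = comp N E v" by (auto simp: comp_def intro: rtrancl_trans)
qed (use comp_refl in blast)

lemma finite_comps: "finite (comps N E)"
 by (simp add: comps_def)

lemma sum_comps: "(\<Sum>C\<in>comps N E. real (card C) * f C) = (\<Sum>v<N. f (comp N E v))"
proof -
 have fiber: "{v \<in> {..<N}. comp N E v = C} = C" if "C \<in> comps N E" for C
  using that comp_eq[of _ N E] comp_subset[of _ N E] by (auto simp: comps_def) blast+
 have "(\<Sum>v<N. f (comp N E v)) = (\<Sum>C\<in>comps N E. \<Sum>v\<in>{v \<in> {..<N}. comp N E v = C}. f (comp N E v))"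
  unfolding comps_def by (rule sum.image_gen) simp
 also have "... = (\<Sum>C\<in>comps N E. \<Sum>v\<in>{v \<in> {..<N}. comp N E v = C}. f C)"
  by (intro sum.cong) auto
 also have "... = (\<Sum>C\<in>comps N E. real (card C) * f C)"
  by (intro sum.cong refl) (simp only: sum_constant fiber)
 finally show ?thesis ..
qed

lemma comp_closed: "u \<in> comp N E v ==> v < N ==> w < N ==> joined E u w ==> w \<in> comp N E v"
 using comp_subset[of v N E] unfolding comp_def
 by (auto simp: joined_def adj_def intro: rtrancl_into_rtrancl)

lemma gball_comp: "v < N ==> gball E {..<N} d v \<subseteq> comp N E v"
proof (induction d arbitrary: v)
 case (Suc d)
 have "gball E {..<N} d w \<subseteq> comp N E v" if "w < N" "joined E v w" for w
  using Suc.IH[OF that(1)] comp_closed[OF comp_refl Suc.prems that] comp_eq by auto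
 then show ?case using comp_refl by auto
qed (simp add: comp_refl)

text \<open>Each increase of the radius either adds a vertex or leaves the ball unchanged; in the
  latter case the ball is closed under adjacency and is the whole component.\<close>

lemma gball_card:
 assumes v: "v < N"
 shows "gball E {..<N} d v = comp N E v \<or> Suc d \<le> card (gball E {..<N} d v)"
proof (induction d)
 case (Suc d)
 let ?B = "\<lambda>d. gball E {..<N} d v"
 have mono: "?B d \<subseteq> ?B (Suc d)" by (rule gball_mono_radius) simp
 from Suc show ?case
 proof
  assume "?B d = comp N E v"
  then show ?thesis using mono gball_comp[OF v, of E "Suc d"] by auto
 next
  assume c: "Suc d \<le> card (?B d)"
  show ?thesis
  proof (cases "?B (Suc d) = ?B d")
   case True
   have "u \<in> ?B d" if "(v, u) \<in> (adj N E)\<^sup>*" for u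
    using that
   proof (induction rule: rtrancl_induct)
    case (step y z)
    then have "z \<in> gball E {..<N} (Suc 0) y" by (auto simp: adj_def joined_def)
    then have "z \<in> gball E {..<N} (d + Suc 0) v" by (rule gball_trans[OF step.IH])
    then show ?case using True by (simp del: gball.simps)
   qed simp
   then have "comp N E v \<subseteq> ?B d" by (auto simp: comp_def)
   then show ?thesis using True gball_comp[OF v, of E "Suc d"] by blast
  next
   case False
   then have "?B d \<subset> ?B (Suc d)" using mono by blast
   then have "card (?B d) < card (?B (Suc d))"
    by (intro psubset_card_mono finite_gball) auto
   then show ?thesis using c by linarith
  qed
 qed
qed simp

text \<open>The ball lies in the component, and it is either all of it or has more than d vertices,
  which is what the summand s^(d+1) pays for.\<close>

lemma power_card_comp:
 fixes s :: real
 assumes "v < N" "0 \<le> s" "s \<le> 1"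
 shows "s ^ card (comp N E v) \<le> s ^ card (gball E {..<N} d v)"
  and "s ^ card (gball E {..<N} d v) \<le> s ^ card (comp N E v) + s ^ Suc d"
proof -
 show "s ^ card (comp N E v) \<le> s ^ card (gball E {..<N} d v)"
  using assms by (intro power_decreasing card_mono finite_comp gball_comp)
 show "s ^ card (gball E {..<N} d v) \<le> s ^ card (comp N E v) + s ^ Suc d"
  using gball_card[OF assms(1), of E d]
 proof
  assume "Suc d \<le> card (gball E {..<N} d v)"
  then have "s ^ card (gball E {..<N} d v) \<le> s ^ Suc d" using assms by (intro power_decreasing) auto
  then show ?thesis using assms by (simp add: add_increasing)
 qed (use assms in simp)
qed

text \<open>Balls lie in components, which points the inequality the right way for every d, and 1 -
  s^k \<le> k (1 - s).\<close>

lemma chi_ge: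
 fixes s :: real
 assumes "0 < N" "0 \<le> s" "s < 1"
 shows "(real N - (\<Sum>v<N. s ^ card (gball E {..<N} d v))) / (1 - s) / real N \<le> chi N E"
proof -
 have "real N - (\<Sum>v<N. s ^ card (gball E {..<N} d v)) \<le> (\<Sum>v<N. 1 - s ^ card (comp N E v))"
  using assms by (auto simp: sum_subtractf intro!: sum_mono power_card_comp(1))
 also have "... \<le> (\<Sum>v<N. real (card (comp N E v)) * (1 - s))"
  using power_diff_le[of s 1] assms by (intro sum_mono) auto
 also have "... = (1 - s) * (\<Sum>C\<in>comps N E. real (card C) ^ 2)"
  using sum_comps[where N = N and E = E and f = "\<lambda>C. real (card C)"] by (simp only: power2_eq_square sum_distrib_left mult.commute)
 finally show ?thesis unfolding chi_def using assms
  by (intro divide_right_mono) (auto simp: pos_divide_le_eq mult.commute)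
qed

lemma power_times_le:
 fixes t :: real
 assumes "0 \<le> t" "t < 1"
 shows "real k * t ^ k \<le> 1 / (1 - t)"
proof -
 have "0 \<le> t ^ k" using assms by simp
 then have "(1 - t) * (\<Sum>i<k. t ^ i) \<le> 1" using one_minus_power_sum[of t k] by linarith
 then have *: "(\<Sum>i<k. t ^ i) \<le> 1 / (1 - t)" using assms by (subst pos_le_divide_eq) (auto simp: mult.commute)
 have "real k * t ^ k = (\<Sum>i<k. t ^ k)" by simp
 also have "... \<le> (\<Sum>i<k. t ^ i)" using assms by (intro sum_mono power_decreasing) auto
 also have "... \<le> 1 / (1 - t)"
  by (rule *)
 finally show ?thesis .
qed

text \<open>For a component of size k the contribution k (t^k - s^k) / (t - s) is at most k^2, which
  is used for all components but a largest one. For that one k t^k \<le> 1 / (1 - t) gives a bound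
  independent of its size. The term with t^(d+1) pays for balls that are not whole
  components.\<close>

lemma chi_hat_ge:
 fixes s t :: real
 assumes N: "0 < N" and st: "0 \<le> s" "s < t" "t < 1"
 shows "(((\<Sum>v<N. t ^ card (gball E {..<N} d v)) - real N * t ^ Suc d - (\<Sum>v<N. s ^ card (gball E {..<N} d v))) / (t - s)
  - 1 / ((1 - t) * (t - s))) / real N \<le> chi_hat N E"
proof -
 let ?f = "\<lambda>k. (t ^ k - s ^ k) / (t - s)"
 have "Max (card ` comps N E) \<in> card ` comps N E"
  using N by (intro Max_in) (auto simp: finite_comps, auto simp: comps_def)
 then obtain C0 where C0: "C0 \<in> comps N E" "Max (card ` comps N E) = card C0" by auto
 have f0: "0 \<le> ?f k" "?f k \<le> real k" for k
  using st power_diff_le[of s t k] by (auto simp: pos_divide_le_eq intro!: divide_nonneg_pos power_mono)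
 have "(\<Sum>v<N. t ^ card (gball E {..<N} d v)) \<le> (\<Sum>v<N. t ^ card (comp N E v) + t ^ Suc d)"
  using st by (intro sum_mono power_card_comp(2)) auto
 moreover have "(\<Sum>v<N. s ^ card (comp N E v)) \<le> (\<Sum>v<N. s ^ card (gball E {..<N} d v))"
  using st by (intro sum_mono power_card_comp(1)) auto
 ultimately have "((\<Sum>v<N. t ^ card (gball E {..<N} d v)) - real N * t ^ Suc d - (\<Sum>v<N. s ^ card (gball E {..<N} d v)))
  \<le> (\<Sum>v<N. t ^ card (comp N E v) - s ^ card (comp N E v))"
  by (simp add: sum.distrib sum_subtractf)
 then have "((\<Sum>v<N. t ^ card (gball E {..<N} d v)) - real N * t ^ Suc d - (\<Sum>v<N. s ^ card (gball E {..<N} d v))) / (t - s)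
  \<le> (\<Sum>v<N. t ^ card (comp N E v) - s ^ card (comp N E v)) / (t - s)"
  using st by (intro divide_right_mono) auto
 also have "... = (\<Sum>C\<in>comps N E. real (card C) * ?f (card C))"
  by (simp only: sum_comps[where N = N and E = E and f = "\<lambda>C. ?f (card C)"] sum_divide_distrib)
 also have "... = (\<Sum>C\<in>comps N E - {C0}. real (card C) * ?f (card C)) + real (card C0) * ?f (card C0)"
  using C0 by (simp add: sum.remove finite_comps)
 also have "... \<le> (\<Sum>C\<in>comps N E - {C0}. real (card C) ^ 2) + 1 / ((1 - t) * (t - s))"
 proof (intro add_mono sum_mono)
  show "real (card C) * ?f (card C) \<le> real (card C) ^ 2" for C
   unfolding power2_eq_square using f0 by (intro mult_left_mono) auto
  have "real (card C0) * (t ^ card C0 - s ^ card C0) \<le> real (card C0) * t ^ card C0"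
   using st by (intro mult_left_mono) auto
  also have "... \<le> 1 / (1 - t)" using st by (intro power_times_le) auto
  finally have "real (card C0) * (t ^ card C0 - s ^ card C0) / (t - s) \<le> 1 / (1 - t) / (t - s)"
   using st by (intro divide_right_mono) auto
  then show "real (card C0) * ?f (card C0) \<le> 1 / ((1 - t) * (t - s))" by simp
 qed
 also have "(\<Sum>C\<in>comps N E - {C0}. real (card C) ^ 2) = (\<Sum>C\<in>comps N E. real (card C) ^ 2) - real (card C0) ^ 2"
  using C0 by (simp add: sum_diff1 finite_comps)
 finally show ?thesis unfolding chi_hat_def C0(2) using N
  by (intro divide_right_mono) auto
qed

section \<open>From averages over balls to divergence in probability\<close>

lemma rg_cong:
 assumes "\<And>i j. i < j ==> j < N ==> p i j = q i j"
 shows "rg N p = rg N q"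
 unfolding rg_def
 by (intro arg_cong2[where f = map_pmf] refl Pi_pmf_cong) (use assms in auto)

lemma (in edge_prob) prob_deviation:
 assumes "mean (\<lambda>E. \<bar>Z E - c\<bar>) \<le> e * d" "e > 0"
 shows "measure_pmf.prob G {E. \<not> \<bar>Z E - c\<bar> \<le> e} \<le> d"
proof -
 have "e * measure_pmf.prob G {E. \<not> \<bar>Z E - c\<bar> \<le> e} = mean (\<lambda>E. e * indicator {E. \<not> \<bar>Z E - c\<bar> \<le> e} E)"
  by simp
 also have "... \<le> mean (\<lambda>E. \<bar>Z E - c\<bar>)"
  using assms(2) by (intro mean_mono) (auto simp: indicator_def)
 also have "... \<le> e * d" by (rule assms)
 finally show ?thesis using assms(2) by simp
qed

lemma (in prob_space) to_infty_chi:
 fixes N :: "nat => 'a => nat" and p :: "nat => 'a => nat => nat => real" and \<Gamma> :: "real => nat => real"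
 assumes ep: "\<And>n w. w \<in> space M ==> edge_prob (N n w) (p n w)"
  and N: "conv0 M (\<lambda>n w. \<bar>real (N n w) / n - m\<bar>)" and m: "m > 0"
  and av: "\<And>s d. 0 < s ==> s < 1 ==> conv0 M (\<lambda>n w. measure_pmf.expectation (rg (N n w) (p n w))
   (\<lambda>E. \<bar>(\<Sum>v<N n w. s ^ card (gball E {..<N n w} d v)) / n - \<Gamma> s d\<bar>))"
  and big: "\<And>K. \<exists>d s. 0 < s \<and> s < 1 \<and> K < (m - \<Gamma> s d) / (1 - s)"
 shows "to_infty M N p chi"
proof (rule to_inftyI)
 fix K e :: real assume e: "e > 0"
 define K' where "K' = max K 0"
 from big[of "K' * m + 1"] obtain d s where s: "0 < s" "s < 1"
  and g: "K' * m + 1 < (m - \<Gamma> s d) / (1 - s)" by blast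
 \<comment> \<open>c bounds both the error of the vertex count and that of the average. The second
   entry makes c (2 / (1 - s) + K') smaller than 1, the margin reserved in
   \<open>K' * m + 1\<close>; the first keeps the vertex density positive.\<close>
 define c where "c = min (m / 2) (1 / (2 / (1 - s) + K' + 1))"
 have q: "2 / (1 - s) + K' + 1 > 0" using s by (auto simp: K'_def intro!: add_pos_nonneg add_nonneg_pos)
 then have c: "c > 0" "c \<le> m / 2" using m by (auto simp: c_def)
 have "c * (2 / (1 - s) + K') \<le> 1 / (2 / (1 - s) + K' + 1) * (2 / (1 - s) + K')"
  using s by (intro mult_right_mono) (auto simp: c_def K'_def)
 also have "... < 1" using q by (simp add: divide_less_eq)
 finally have \<delta>1: "c * (2 / (1 - s) + K') < 1" .
 have "c * e > 0" using c e by simp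
 show "whp M (\<lambda>n w. 1 - e \<le> measure_pmf.prob (rg (N n w) (p n w)) {E. K < chi (N n w) E})"
 proof (rule whp_mono[OF whp_conj[OF conv0D[OF N c(1)] conv0D[OF av[OF s, of d] \<open>c * e > 0\<close>]]],
   rule eventually_mono[OF eventually_gt_at_top[of 0]], intro ballI impI)
  fix n :: nat and w assume n: "0 < n" and om: "w \<in> space M"
  let ?N = "N n w" and ?p = "p n w"
  let ?\<Phi> = "\<lambda>E. (\<Sum>v<?N. s ^ card (gball E {..<?N} d v)) / n"
  interpret edge_prob ?N ?p by (rule ep[OF om])
  assume a: "\<bar>real ?N / n - m\<bar> \<le> c \<and> mean (\<lambda>E. \<bar>?\<Phi> E - \<Gamma> s d\<bar>) \<le> c * e"
  define \<nu> where "\<nu> = real ?N / n"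
  have \<nu>: "\<nu> > 0" "\<nu> \<le> m + c" "m - c \<le> \<nu>" using a m c by (auto simp: \<nu>_def[symmetric])
  then have N0: "?N > 0" by (cases ?N) (auto simp: \<nu>_def)
  have chi: "K < chi ?N E" if E: "\<bar>?\<Phi> E - \<Gamma> s d\<bar> \<le> c" for E
  proof -
   have "K * \<nu> \<le> K' * (m + c)" using \<nu> m c by (intro mult_mono) (auto simp: K'_def)
   also have "... < (m - \<Gamma> s d) / (1 - s) - 2 * c / (1 - s)"
    using g \<delta>1 by (simp add: algebra_simps)
   also have "... = (m - \<Gamma> s d - 2 * c) / (1 - s)" by (simp add: diff_divide_distrib)
   also have "... \<le> (\<nu> - ?\<Phi> E) / (1 - s)" using s E \<nu> by (intro divide_right_mono) auto
   finally have "K < (\<nu> - ?\<Phi> E) / (1 - s) / \<nu>" using \<nu> by (simp only: pos_less_divide_eq)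
   also have "... = (real ?N - (\<Sum>v<?N. s ^ card (gball E {..<?N} d v))) / (1 - s) / real ?N"
    using n N0 s by (simp add: \<nu>_def field_simps)
   also have "... \<le> chi ?N E" using N0 s by (intro chi_ge) auto
   finally show ?thesis .
  qed
  have "measure_pmf.prob G {E. \<not> \<bar>?\<Phi> E - \<Gamma> s d\<bar> \<le> c} \<le> e"
   using a c by (intro prob_deviation) auto
  then have "1 - e \<le> 1 - measure_pmf.prob G {E. \<not> \<bar>?\<Phi> E - \<Gamma> s d\<bar> \<le> c}" by simp
  also have "... = measure_pmf.prob G (UNIV - {E. \<not> \<bar>?\<Phi> E - \<Gamma> s d\<bar> \<le> c})"
   using measure_pmf.prob_compl[of "{E. \<not> \<bar>?\<Phi> E - \<Gamma> s d\<bar> \<le> c}" G] by simp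
  also have "... \<le> measure_pmf.prob G {E. K < chi ?N E}"
   using chi by (intro measure_pmf.finite_measure_mono) auto
  finally show "1 - e \<le> measure_pmf.prob G {E. K < chi ?N E}" .
 qed
qed

lemma (in prob_space) to_infty_chi_hat:
 fixes N :: "nat => 'a => nat" and p :: "nat => 'a => nat => nat => real" and \<Gamma> :: "real => nat => real"
 assumes ep: "\<And>n w. w \<in> space M ==> edge_prob (N n w) (p n w)"
  and N: "conv0 M (\<lambda>n w. \<bar>real (N n w) / n - m\<bar>)" and m: "m > 0"
  and av: "\<And>s d. 0 < s ==> s < 1 ==> conv0 M (\<lambda>n w. measure_pmf.expectation (rg (N n w) (p n w))
   (\<lambda>E. \<bar>(\<Sum>v<N n w. s ^ card (gball E {..<N n w} d v)) / n - \<Gamma> s d\<bar>))"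
  and big: "\<And>K. \<exists>s t. 0 < s \<and> s < t \<and> t < 1 \<and> (\<forall>\<^sub>F d in sequentially. K < (\<Gamma> t d - \<Gamma> s d) / (t - s))"
 shows "to_infty M N p chi_hat"
proof (rule to_inftyI)
 fix K e :: real assume e: "e > 0"
 define K' where "K' = max K 0"
 \<comment> \<open>The margin 3 is spent on three errors below 1 each: the deviations of the
   averages and the vertex count, the balls that are not whole components, and the largest
   component.\<close>
 from big[of "K' * m + 3"] obtain s t where st: "0 < s" "s < t" "t < 1"
  and g: "\<forall>\<^sub>F d in sequentially. K' * m + 3 < (\<Gamma> t d - \<Gamma> s d) / (t - s)" by blast
 have t: "0 < t" "s < 1" using st by auto
 have "(\<lambda>d. (2 * m) / (t - s) * t ^ Suc d) \<longlonglongrightarrow> (2 * m) / (t - s) * 0"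
  using st by (intro tendsto_intros LIMSEQ_Suc LIMSEQ_power_zero) auto
 then have "\<forall>\<^sub>F d in sequentially. (2 * m) / (t - s) * t ^ Suc d < 1" by (intro order_tendstoD(2)) auto
 with g have "\<forall>\<^sub>F d in sequentially. K' * m + 3 < (\<Gamma> t d - \<Gamma> s d) / (t - s) \<and> (2 * m) / (t - s) * t ^ Suc d < 1"
  by eventually_elim auto
 then obtain d where d: "K' * m + 3 < (\<Gamma> t d - \<Gamma> s d) / (t - s)" "(2 * m) / (t - s) * t ^ Suc d < 1"
  using eventually_happens[of _ sequentially] by auto
 define c where "c = 1 / ((1 - t) * (t - s))"
 define \<delta> where "\<delta> = min (m / 2) (1 / (2 / (t - s) + K' + 1))"
 have q: "2 / (t - s) + K' + 1 > 0" using st by (auto simp: K'_def intro!: add_pos_nonneg add_nonneg_pos)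
 then have \<delta>: "\<delta> > 0" "\<delta> \<le> m / 2" using m by (auto simp: \<delta>_def)
 have "\<delta> * (2 / (t - s) + K') \<le> 1 / (2 / (t - s) + K' + 1) * (2 / (t - s) + K')"
  using st by (intro mult_right_mono) (auto simp: \<delta>_def K'_def)
 also have "... < 1" using q by (simp add: divide_less_eq)
 finally have \<delta>1: "\<delta> * (2 / (t - s) + K') < 1" .
 have \<delta>e: "\<delta> * (e / 2) > 0" using \<delta> e by simp
 have "(\<lambda>n. c / real n) \<longlonglongrightarrow> 0"
  by (rule tendsto_divide_0[OF tendsto_const]) (auto intro: filterlim_at_top_imp_at_infinity filterlim_real_sequentially)
 then have "\<forall>\<^sub>F n in sequentially. c / real n < 1" by (intro order_tendstoD(2)) auto
 then have ev: "\<forall>\<^sub>F n in sequentially. 0 < n \<and> c / real n < 1"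
  using eventually_gt_at_top[of 0] by eventually_elim auto
 show "whp M (\<lambda>n w. 1 - e \<le> measure_pmf.prob (rg (N n w) (p n w)) {E. K < chi_hat (N n w) E})"
 proof (rule whp_mono[OF whp_conj[OF conv0D[OF N \<delta>(1)] whp_conj[OF conv0D[OF av[OF st(1) t(2), of d] \<delta>e] conv0D[OF av[OF t(1) st(3), of d] \<delta>e]]]],
   rule eventually_mono[OF ev], intro ballI impI)
  fix n :: nat and w assume n: "0 < n \<and> c / real n < 1" and om: "w \<in> space M"
  let ?N = "N n w" and ?p = "p n w"
  let ?S = "\<lambda>s E. (\<Sum>v<?N. s ^ card (gball E {..<?N} d v))"
  interpret edge_prob ?N ?p by (rule ep[OF om])
  assume a: "\<bar>real ?N / n - m\<bar> \<le> \<delta> \<and> mean (\<lambda>E. \<bar>?S s E / n - \<Gamma> s d\<bar>) \<le> \<delta> * (e / 2) \<and> mean (\<lambda>E. \<bar>?S t E / n - \<Gamma> t d\<bar>) \<le> \<delta> * (e / 2)"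
  define \<nu> where "\<nu> = real ?N / n"
  have \<nu>: "\<nu> > 0" "\<nu> \<le> m + \<delta>" using a m \<delta> by (auto simp: \<nu>_def[symmetric])
  then have N0: "?N > 0" by (cases ?N) (auto simp: \<nu>_def)
  have chi: "K < chi_hat ?N E" if E: "\<bar>?S s E / n - \<Gamma> s d\<bar> \<le> \<delta>" "\<bar>?S t E / n - \<Gamma> t d\<bar> \<le> \<delta>" for E
  proof -
   have eq: "(x / n - y / n - \<nu> * t ^ Suc d) / (t - s) - c / n = ((x - real ?N * t ^ Suc d - y) / (t - s) - c) / n" for x y
    using n st by (simp add: \<nu>_def field_simps)
   have "\<nu> * t ^ Suc d \<le> 2 * m * t ^ Suc d" using \<nu> \<delta> m t by (intro mult_right_mono) auto
   then have "\<nu> * t ^ Suc d / (t - s) \<le> 2 * m * t ^ Suc d / (t - s)" using st by (intro divide_right_mono) auto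
   then have nt: "\<nu> * t ^ Suc d / (t - s) < 1" using d(2) by simp
   have "K * \<nu> \<le> K' * (m + \<delta>)" using \<nu> m \<delta> by (intro mult_mono) (auto simp: K'_def)
   also have "... < (\<Gamma> t d - \<Gamma> s d) / (t - s) - 2 * \<delta> / (t - s) - 1 - 1"
    using d(1) \<delta>1 by (simp add: algebra_simps)
   also have "... \<le> (\<Gamma> t d - \<Gamma> s d) / (t - s) - 2 * \<delta> / (t - s) - \<nu> * t ^ Suc d / (t - s) - c / n"
    using nt n by linarith
   also have "... = (\<Gamma> t d - \<Gamma> s d - 2 * \<delta> - \<nu> * t ^ Suc d) / (t - s) - c / n" by (simp add: diff_divide_distrib)
   also have "... \<le> (?S t E / n - ?S s E / n - \<nu> * t ^ Suc d) / (t - s) - c / n"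
    using st E by (intro diff_right_mono divide_right_mono) auto
   also have "... = ((?S t E - real ?N * t ^ Suc d - ?S s E) / (t - s) - c) / n"
    by (rule eq)
   finally have "K < ((?S t E - real ?N * t ^ Suc d - ?S s E) / (t - s) - c) / n / \<nu>" using \<nu> by (simp only: pos_less_divide_eq)
   also have "... = ((?S t E - real ?N * t ^ Suc d - ?S s E) / (t - s) - c) / real ?N"
    using n N0 by (simp add: \<nu>_def)
   also have "... \<le> chi_hat ?N E" unfolding c_def using N0 st by (intro chi_hat_ge) auto
   finally show ?thesis .
  qed
  let ?B = "\<lambda>r. {E. \<not> \<bar>?S r E / n - \<Gamma> r d\<bar> \<le> \<delta>}"
  have "measure_pmf.prob G (?B s) \<le> e / 2" using a \<delta> by (intro prob_deviation) auto
  moreover have "measure_pmf.prob G (?B t) \<le> e / 2" using a \<delta> by (intro prob_deviation) auto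
  ultimately have "measure_pmf.prob G (?B s \<union> ?B t) \<le> e"
   using measure_Un_le[of "?B s" "measure_pmf G" "?B t"] by simp
  then have "1 - e \<le> 1 - measure_pmf.prob G (?B s \<union> ?B t)" by simp
  also have "... = measure_pmf.prob G (UNIV - (?B s \<union> ?B t))"
   using measure_pmf.prob_compl[of "?B s \<union> ?B t" G] by simp
  also have "... \<le> measure_pmf.prob G {E. K < chi_hat ?N E}"
   using chi by (intro measure_pmf.finite_measure_mono) auto
  finally show "1 - e \<le> measure_pmf.prob G {E. K < chi_hat ?N E}" .
 qed
qed

section \<open>Convergence of generating functions\<close>

lemma to_infty_rg_cong:
 assumes "\<And>n w. rg (N n w) (p n w) = rg (N n w) (q n w)"
 shows "to_infty M N p F = to_infty M N q F"
 by (simp add: to_infty_def gprob_def[abs_def] gexp_def[abs_def] assms)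

text \<open>\<open>rg\<close> reads only pairs with i < j, so the diagonal may be set to 0, as
  \<open>edge_prob\<close> demands.\<close>

lemma suscept_concl_diag:
 "suscept_concl \<mu> \<kappa> M N p \<longleftrightarrow> suscept_concl \<mu> \<kappa> M N (\<lambda>n w i j. if i = j then 0 else p n w i j)"
proof -
 have "rg (N n w) (p n w) = rg (N n w) (\<lambda>i j. if i = j then 0 else p n w i j)" for n w
  by (rule rg_cong) auto
 then show ?thesis unfolding suscept_concl_def
  using to_infty_rg_cong[of N p "\<lambda>n w i j. if i = j then 0 else p n w i j" M] by simp
qed

text \<open>The point where the three models meet: each has only to supply the vertex count,
  uniformly integrable row sums, a small sum of squares, and convergence of the matrix recursion to
  the kernel recursion.\<close>

lemma (in ker) suscept_conclI:
 fixes N :: "nat => 'w => nat" and p :: "nat => 'w => nat => nat => real"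
 assumes M: "prob_space M"
  and ep: "\<And>n w. w \<in> space M ==> edge_prob (N n w) (p n w)"
  and N: "conv0 M (\<lambda>n w. \<bar>real (N n w) / n - total\<bar>)"
  and tail: "\<And>e. e > 0 ==> \<exists>K\<ge>0. whp M (\<lambda>n w. row_excess n (N n w) (p n w) K \<le> e)"
  and sq: "conv0 M (\<lambda>n w. (\<Sum>i<N n w. \<Sum>j<N n w. (p n w i j)\<^sup>2) / n)"
  and lim: "\<And>s d. 0 < s ==> s < 1 ==>
   conv0 M (\<lambda>n w. \<bar>(\<Sum>v<N n w. mgf (p n w) {..<N n w} s d v) / n - mean_pgf s d\<bar>)"
 shows "suscept_concl \<mu> \<kappa> M N p"
proof -
 interpret M: prob_space M by (rule M)
 have "whp M (\<lambda>n w. \<bar>real (N n w) / n - total\<bar> \<le> 1)" by (rule conv0D[OF N]) simp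
 then have Nle: "whp M (\<lambda>n w. real (N n w) \<le> (total + 1) * n)"
 proof (rule whp_mono, intro eventually_mono[OF eventually_gt_at_top[of 0]] ballI impI)
  fix n :: nat and w assume "0 < n" "\<bar>real (N n w) / n - total\<bar> \<le> 1"
  then have "real (N n w) / n \<le> total + 1" by linarith
  then show "real (N n w) \<le> (total + 1) * n" using \<open>0 < n\<close> by (simp add: pos_divide_le_eq)
 qed
 have av: "conv0 M (\<lambda>n w. measure_pmf.expectation (rg (N n w) (p n w))
   (\<lambda>E. \<bar>(\<Sum>v<N n w. s ^ card (gball E {..<N n w} d v)) / n - mean_pgf s d\<bar>))"
  if s: "0 < s" "s < 1" for s d
 proof (rule conv0_mono[OF M.conv0_add[OF M.local_average[OF ep tail Nle sq, of s d] lim[OF s, of d]]])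
  show "\<forall>\<^sub>F n in sequentially. \<forall>w\<in>space M. measure_pmf.expectation (rg (N n w) (p n w))
   (\<lambda>E. \<bar>(\<Sum>v<N n w. s ^ card (gball E {..<N n w} d v)) / n - mean_pgf s d\<bar>) \<le>
   measure_pmf.expectation (rg (N n w) (p n w)) (\<lambda>E. \<bar>(\<Sum>v<N n w. s ^ card (gball E {..<N n w} d v)) -
    (\<Sum>v<N n w. mgf (p n w) {..<N n w} s d v)\<bar>) / n
   + \<bar>(\<Sum>v<N n w. mgf (p n w) {..<N n w} s d v) / n - mean_pgf s d\<bar>"
  proof (intro always_eventually allI ballI)
   fix n :: nat and w assume om: "w \<in> space M"
   interpret edge_prob "N n w" "p n w" by (rule ep[OF om])
   let ?S = "\<lambda>E. \<Sum>v<N n w. s ^ card (gball E {..<N n w} d v)"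
   let ?g = "\<Sum>v<N n w. mgf (p n w) {..<N n w} s d v" and ?I = "\<integral>x. bp_pgf \<mu> \<kappa> s d x \<partial>\<mu>"
   have "mean (\<lambda>E. \<bar>?S E / n - ?I\<bar>) \<le> mean (\<lambda>E. \<bar>?S E - ?g\<bar> / n + \<bar>?g / n - ?I\<bar>)"
   proof (rule mean_mono)
    fix E
    have "\<bar>?S E - ?g\<bar> / n = \<bar>?S E / n - ?g / n\<bar>" by (simp add: abs_divide flip: diff_divide_distrib)
    then show "\<bar>?S E / n - ?I\<bar> \<le> \<bar>?S E - ?g\<bar> / n + \<bar>?g / n - ?I\<bar>" by linarith
   qed
   also have "... = mean (\<lambda>E. \<bar>?S E - ?g\<bar>) / n + \<bar>?g / n - ?I\<bar>" by simp
   finally show "mean (\<lambda>E. \<bar>?S E / n - ?I\<bar>) \<le> mean (\<lambda>E. \<bar>?S E - ?g\<bar>) / n + \<bar>?g / n - ?I\<bar>" .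
  qed
 qed (use s in auto)
 let ?\<Gamma> = "\<lambda>s d. \<integral>x. bp_pgf \<mu> \<kappa> s d x \<partial>\<mu>"
 show ?thesis unfolding suscept_concl_def
 proof (intro conjI impI)
  assume "chi_k \<mu> \<kappa> = top \<or> critical \<mu> \<kappa> \<and> compact_T \<mu> \<kappa> \<or> supercritical \<mu> \<kappa>"
  then have inf: "(\<integral>\<^sup>+x. bp_mean \<mu> \<kappa> x \<partial>\<mu>) = top" by (rule chi_infinite)
  show "to_infty M N p chi"
  proof (rule M.to_infty_chi[OF ep N total_pos av])
   fix K :: real
   show "\<exists>d s. 0 < s \<and> s < 1 \<and> K < (total - ?\<Gamma> s d) / (1 - s)"
    using chi_top[OF inf, of K] by blast
  qed
 next
  assume "chi_hat_k \<mu> \<kappa> = top"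
  then have inf: "(\<integral>\<^sup>+x. bp_mean_fin \<mu> \<kappa> x \<partial>\<mu>) = top"
   unfolding chi_hat_k_def by (rule top_if_ratio_top)
  show "to_infty M N p chi_hat"
  proof (rule M.to_infty_chi_hat[OF ep N total_pos av])
   fix K :: real
   show "\<exists>s t. 0 < s \<and> s < t \<and> t < 1 \<and> (\<forall>\<^sub>F d in sequentially. K < (?\<Gamma> t d - ?\<Gamma> s d) / (t - s))"
    using chi_hat_top[OF inf, of K] by blast
  qed
 qed
qed

section \<open>Dependence of the generating functions on the kernel\<close>

context ker
begin

lemma offmass_tail:
 assumes "e > 0"
 shows "\<exists>K\<ge>0. excess K \<le> e"
proof -
 have "(\<lambda>k. \<integral>x. max 0 (offmass \<mu> \<kappa> x - real k) \<partial>\<mu>) \<longlonglongrightarrow> (\<integral>x. 0 \<partial>\<mu>)"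
 proof (rule integral_dominated_convergence[where w = "offmass \<mu> \<kappa>"])
  show "AE x in \<mu>. (\<lambda>k. max 0 (offmass \<mu> \<kappa> x - real k)) \<longlonglongrightarrow> 0"
  proof (rule AE_I2)
   fix x
   obtain K where "offmass \<mu> \<kappa> x \<le> real K" using real_arch_simple by blast
   then have "\<forall>\<^sub>F k in sequentially. max 0 (offmass \<mu> \<kappa> x - real k) = 0"
    by (intro eventually_sequentiallyI[of K]) auto
   then show "(\<lambda>k. max 0 (offmass \<mu> \<kappa> x - real k)) \<longlonglongrightarrow> 0" by (rule tendsto_eventually)
  qed
  show "AE x in \<mu>. norm (max 0 (offmass \<mu> \<kappa> x - real k)) \<le> offmass \<mu> \<kappa> x" for k
   using offmass_nonneg by (intro AE_I2) auto
 qed (auto simp: offmass_integrable)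
 then have "\<forall>\<^sub>F k in sequentially. (\<integral>x. max 0 (offmass \<mu> \<kappa> x - real k) \<partial>\<mu>) < e"
  using assms by (intro order_tendstoD(2)) auto
 then obtain k where "(\<integral>x. max 0 (offmass \<mu> \<kappa> x - real k) \<partial>\<mu>) < e"
  using eventually_happens[of _ sequentially] by auto
 then show ?thesis by (intro exI[of _ "real k"]) auto
qed

lemma offmass_tail_integrable: "integrable \<mu> (\<lambda>x. max 0 (offmass \<mu> \<kappa> x - K))"
 by (intro integrable_max B_integrable_diff offmass_integrable) auto

text \<open>By symmetry of \<kappa> the double integral is the integral of \<open>offmass\<close>
  times f. The part of \<open>offmass\<close> above K is paid in full, which f \<le> 1 allows, and
  the rest costs a factor K.\<close>

lemma kernel_weight_integral:
 assumes [measurable]: "f \<in> borel_measurable \<mu>" and f: "\<And>x. x \<in> space \<mu> ==> 0 \<le> f x \<and> f x \<le> 1" and K: "K \<ge> 0"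
 shows "integrable \<mu> (\<lambda>x. \<integral>y. \<kappa> x y * f y \<partial>\<mu>)"
  and "(\<integral>x. \<integral>y. \<kappa> x y * f y \<partial>\<mu> \<partial>\<mu>) \<le> K * (\<integral>x. f x \<partial>\<mu>) + excess K"
proof -
 let ?I = "\<integral>x. \<integral>y. \<kappa> x y * f y \<partial>\<mu> \<partial>\<mu>"
 interpret pair_sigma_finite \<mu> \<mu> by unfold_locales
 have int: "integrable (sqm \<mu>) (\<lambda>(x, y). \<kappa> x y * f y)"
  using f by (intro B_integrable_bound[OF kernel_integrable2])
   (auto simp: space_pair_measure abs_mult case_prod_unfold intro!: AE_I2 mult_left_le)
 show "integrable \<mu> (\<lambda>x. \<integral>y. \<kappa> x y * f y \<partial>\<mu>)"
  using integrable_fst[OF int] by simp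
 have f_int: "integrable \<mu> f" using f by (intro integrable_const_bound[of _ 1]) auto
 have lf: "integrable \<mu> (\<lambda>y. offmass \<mu> \<kappa> y * f y)"
  using f by (intro B_integrable_bound[OF offmass_integrable])
   (auto simp: abs_mult intro!: AE_I2 mult_left_le)
 have "?I = (\<integral>y. \<integral>x. \<kappa> x y * f y \<partial>\<mu> \<partial>\<mu>)"
  by (rule Fubini_integral[OF int, symmetric])
 also have "... = (\<integral>y. offmass \<mu> \<kappa> y * f y \<partial>\<mu>)"
 proof (intro B_integral_cong refl)
  fix y assume y: "y \<in> space \<mu>"
  have "(\<integral>x. \<kappa> x y * f y \<partial>\<mu>) = (\<integral>x. \<kappa> x y \<partial>\<mu>) * f y" by simp
  also have "(\<integral>x. \<kappa> x y \<partial>\<mu>) = (\<integral>x. \<kappa> y x \<partial>\<mu>)"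
   using y by (intro B_integral_cong refl) (rule kernel_sym)
  finally show "(\<integral>x. \<kappa> x y * f y \<partial>\<mu>) = offmass \<mu> \<kappa> y * f y" using y by (simp add: offmass_eq_integral)
 qed
 also have "... \<le> (\<integral>y. K * f y + max 0 (offmass \<mu> \<kappa> y - K) \<partial>\<mu>)"
 proof (rule integral_mono[OF lf])
  show "integrable \<mu> (\<lambda>y. K * f y + max 0 (offmass \<mu> \<kappa> y - K))"
   using f_int offmass_tail_integrable by auto
  fix y assume y: "y \<in> space \<mu>"
  have "(offmass \<mu> \<kappa> y - K) * f y \<le> max 0 (offmass \<mu> \<kappa> y - K) * f y" using f[OF y] by (intro mult_right_mono) auto
  moreover have "max 0 (offmass \<mu> \<kappa> y - K) * f y \<le> max 0 (offmass \<mu> \<kappa> y - K)" using f[OF y] by (intro mult_left_le) auto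
  ultimately show "offmass \<mu> \<kappa> y * f y \<le> K * f y + max 0 (offmass \<mu> \<kappa> y - K)" by (simp add: left_diff_distrib)
 qed
 also have "... = K * (\<integral>x. f x \<partial>\<mu>) + excess K"
  using f_int offmass_tail_integrable by simp
 finally show "?I \<le> K * (\<integral>x. f x \<partial>\<mu>) + excess K" .
qed

lemma bp_pgf_bounds1: "0 \<le> s ==> s \<le> 1 ==> x \<in> space \<mu> ==> 0 \<le> bp_pgf \<mu> \<kappa> s d x \<and> bp_pgf \<mu> \<kappa> s d x \<le> 1"
 using bp_pgf_bounds[of s x d] by auto

abbreviation kdist :: "('s => 's => real) => real" where
 "kdist k' \<equiv> \<integral>z. \<bar>\<kappa> (fst z) (snd z) - k' (fst z) (snd z)\<bar> \<partial>(sqm \<mu>)"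

text \<open>One generation of the Gronwall recursion. Only the tail of \<kappa> occurs and not that
  of k', so the resulting continuity is uniform over k'.\<close>

lemma bp_pgf_kernel_step:
 assumes k': "ker \<mu> k'" and s: "0 \<le> s" "s \<le> 1" and K: "K \<ge> 0"
 shows "(\<integral>x. \<bar>bp_pgf \<mu> \<kappa> s (Suc d) x - bp_pgf \<mu> k' s (Suc d) x\<bar> \<partial>\<mu>) \<le>
  kdist k' + K * (\<integral>x. \<bar>bp_pgf \<mu> \<kappa> s d x - bp_pgf \<mu> k' s d x\<bar> \<partial>\<mu>) + excess K"
proof -
 interpret k': ker \<mu> k' by (rule k')
 interpret pair_sigma_finite \<mu> \<mu> by unfold_locales
 let ?G = "bp_pgf \<mu> \<kappa> s d" and ?H = "bp_pgf \<mu> k' s d"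
 let ?f = "\<lambda>y. \<bar>?G y - ?H y\<bar>"
 have G: "0 \<le> ?G y \<and> ?G y \<le> 1" "0 \<le> ?H y \<and> ?H y \<le> 1" if "y \<in> space \<mu>" for y
  using bp_pgf_bounds1[OF s that] k'.bp_pgf_bounds1[OF s that] by blast+
 have f: "0 \<le> ?f y \<and> ?f y \<le> 1" if "y \<in> space \<mu>" for y using G[OF that] by linarith
 have dint: "integrable (sqm \<mu>) (\<lambda>(x, y). \<bar>\<kappa> x y - k' x y\<bar>)"
  using kernel_integrable2 k'.kernel_integrable2 by (simp add: case_prod_unfold)
 let ?D = "\<lambda>x. \<integral>y. \<bar>\<kappa> x y - k' x y\<bar> \<partial>\<mu>"
 have D_int: "integrable \<mu> ?D" using integrable_fst[OF dint] by simp
 have "(\<integral>x. ?D x \<partial>\<mu>) = (\<integral>(x, y). \<bar>\<kappa> x y - k' x y\<bar> \<partial>(sqm \<mu>))" by (rule integral_fst[OF dint])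
 then have D: "(\<integral>x. ?D x \<partial>\<mu>) = kdist k'" by (simp add: case_prod_unfold)
 have fm: "?f \<in> borel_measurable \<mu>" by measurable
 have W1: "integrable \<mu> (\<lambda>x. \<integral>y. \<kappa> x y * ?f y \<partial>\<mu>)"
  by (rule kernel_weight_integral(1)[OF fm _ K]) (rule f)
 have W2: "(\<integral>x. \<integral>y. \<kappa> x y * ?f y \<partial>\<mu> \<partial>\<mu>) \<le> K * (\<integral>x. ?f x \<partial>\<mu>) + excess K"
  by (rule kernel_weight_integral(2)[OF fm _ K]) (rule f)
 have "(\<integral>x. \<bar>bp_pgf \<mu> \<kappa> s (Suc d) x - bp_pgf \<mu> k' s (Suc d) x\<bar> \<partial>\<mu>) \<le>
  (\<integral>x. ?D x + (\<integral>y. \<kappa> x y * ?f y \<partial>\<mu>) \<partial>\<mu>)"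
 proof (rule integral_mono)
  show "integrable \<mu> (\<lambda>x. \<bar>bp_pgf \<mu> \<kappa> s (Suc d) x - bp_pgf \<mu> k' s (Suc d) x\<bar>)"
   using s by (intro integrable_abs B_integrable_diff bp_pgf_integrable k'.bp_pgf_integrable)
  show "integrable \<mu> (\<lambda>x. ?D x + (\<integral>y. \<kappa> x y * ?f y \<partial>\<mu>))"
   using D_int W1 by (rule B_integrable_add)
  fix x assume x: "x \<in> space \<mu>"
  have i1: "integrable \<mu> (\<lambda>y. \<kappa> x y * (1 - ?G y))" using G x by (intro kernel_mult_integrable) force+
  have i2: "integrable \<mu> (\<lambda>y. k' x y * (1 - ?H y))" using G x by (intro k'.kernel_mult_integrable) force+
  have i3: "integrable \<mu> (\<lambda>y. \<kappa> x y * ?f y)" using f x by (intro kernel_mult_integrable) auto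
  have i4: "integrable \<mu> (\<lambda>y. \<bar>\<kappa> x y - k' x y\<bar>)" using x kernel_integrable k'.kernel_integrable by auto
  have "\<bar>bp_pgf \<mu> \<kappa> s (Suc d) x - bp_pgf \<mu> k' s (Suc d) x\<bar> =
   s * \<bar>exp (- (\<integral>y. \<kappa> x y * (1 - ?G y) \<partial>\<mu>)) - exp (- (\<integral>y. k' x y * (1 - ?H y) \<partial>\<mu>))\<bar>"
   using s by (simp add: abs_mult flip: right_diff_distrib)
  also have "... \<le> 1 * \<bar>(\<integral>y. \<kappa> x y * (1 - ?G y) \<partial>\<mu>) - (\<integral>y. k' x y * (1 - ?H y) \<partial>\<mu>)\<bar>"
   using s G x by (intro mult_mono exp_minus_Lipschitz B_integral_nonneg mult_nonneg_nonneg kernel_nonneg k'.kernel_nonneg) auto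
  also have "... = \<bar>\<integral>y. \<kappa> x y * (1 - ?G y) - k' x y * (1 - ?H y) \<partial>\<mu>\<bar>"
   using i1 i2 by simp
  also have "... \<le> (\<integral>y. \<bar>\<kappa> x y * (1 - ?G y) - k' x y * (1 - ?H y)\<bar> \<partial>\<mu>)" by (rule integral_abs_bound)
  also have "... \<le> (\<integral>y. \<bar>\<kappa> x y - k' x y\<bar> + \<kappa> x y * ?f y \<partial>\<mu>)"
  proof (rule integral_mono)
   fix y assume y: "y \<in> space \<mu>"
   \<comment> \<open>Split so that \<kappa> multiplies the error of the previous generation, while
     the difference of the kernels meets a factor in [0, 1].\<close>
   have "\<kappa> x y * (1 - ?G y) - k' x y * (1 - ?H y) = (\<kappa> x y - k' x y) * (1 - ?H y) + \<kappa> x y * (?H y - ?G y)"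
    by (simp add: algebra_simps)
   then have "\<bar>\<kappa> x y * (1 - ?G y) - k' x y * (1 - ?H y)\<bar> \<le> \<bar>\<kappa> x y - k' x y\<bar> * \<bar>1 - ?H y\<bar> + \<bar>\<kappa> x y\<bar> * \<bar>?H y - ?G y\<bar>"
    by (simp only: abs_mult[symmetric] abs_triangle_ineq)
   also have "... \<le> \<bar>\<kappa> x y - k' x y\<bar> * 1 + \<kappa> x y * ?f y"
    using G[OF y] kernel_nonneg[OF x y] by (intro add_mono mult_mono) auto
   finally show "\<bar>\<kappa> x y * (1 - ?G y) - k' x y * (1 - ?H y)\<bar> \<le> \<bar>\<kappa> x y - k' x y\<bar> + \<kappa> x y * ?f y" by simp
  qed (use i1 i2 i3 i4 in auto)
  also have "... = ?D x + (\<integral>y. \<kappa> x y * ?f y \<partial>\<mu>)" using i3 i4 by simp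
  finally show "\<bar>bp_pgf \<mu> \<kappa> s (Suc d) x - bp_pgf \<mu> k' s (Suc d) x\<bar> \<le> ?D x + (\<integral>y. \<kappa> x y * ?f y \<partial>\<mu>)" .
 qed
 also have "... = kdist k' + (\<integral>x. \<integral>y. \<kappa> x y * ?f y \<partial>\<mu> \<partial>\<mu>)"
  using D_int W1 D by simp
 finally show ?thesis using W2 by linarith
qed

lemma bp_pgf_kernel_continuous:
 assumes "r > 0"
 obtains \<eta> where "\<eta> > 0" "\<And>k' s. ker \<mu> k' ==> 0 \<le> s ==> s \<le> 1 ==> kdist k' \<le> \<eta> ==>
  (\<integral>x. \<bar>bp_pgf \<mu> \<kappa> s d x - bp_pgf \<mu> k' s d x\<bar> \<partial>\<mu>) \<le> r"
proof -
 from gronwall_truncated[of "\<lambda>K. \<integral>x. max 0 (offmass \<mu> \<kappa> x - K) \<partial>\<mu>", OF offmass_tail assms, of d]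
 obtain \<eta> where "\<eta> > 0" and *: "\<And>D e. D 0 \<le> (0::real) ==> e \<le> \<eta> ==>
  (\<forall>d K. K \<ge> 0 \<longrightarrow> D (Suc d) \<le> e + K * D d + excess K) ==> D d \<le> r" by blast
 show ?thesis
 proof (rule that[OF \<open>\<eta> > 0\<close>])
  fix k' s assume a: "ker \<mu> k'" "0 \<le> s" "s \<le> (1::real)" "kdist k' \<le> \<eta>"
  show "(\<integral>x. \<bar>bp_pgf \<mu> \<kappa> s d x - bp_pgf \<mu> k' s d x\<bar> \<partial>\<mu>) \<le> r"
   by (rule *[of "\<lambda>d. \<integral>x. \<bar>bp_pgf \<mu> \<kappa> s d x - bp_pgf \<mu> k' s d x\<bar> \<partial>\<mu>", OF _ a(4)])
    (use bp_pgf_kernel_step[OF a(1-3)] in auto)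
 qed
qed

end

section \<open>Graphs on sampled vertices\<close>

definition off_diag :: "('s => 's => real) => nat => (nat => 's) => nat => nat => real" where
 "off_diag h n x i j = (if i = j then 0 else h (x i) (x j) / n)"

text \<open>The interface shared by generalized and independent vertex spaces. The members of \<K>
  are bounded kernels for which laws of large numbers hold along the sampled vertices;
  \<open>approx\<close> says that they come close to \<kappa> in L1 and, sampled at the vertices,
  close to the edge probabilities in mean.\<close>

locale vertex_approx = M: prob_space M + ker \<mu> \<kappa>
 for M :: "'w measure" and \<mu> :: "'s measure" and \<kappa> +
 fixes N :: "nat => 'w => nat" and x :: "nat => 'w => nat => 's"
  and p :: "nat => 'w => nat => nat => real" and \<K> :: "('s => 's => real) set"
 assumes ep: "\<And>n w. w \<in> space M ==> edge_prob (N n w) (p n w)"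
  and x: "\<And>n w i. w \<in> space M ==> i < N n w ==> x n w i \<in> space \<mu>"
  and N_lim: "conv0 M (\<lambda>n w. \<bar>real (N n w) / n - total\<bar>)"
  and \<K>_ker: "\<And>k'. k' \<in> \<K> ==> ker \<mu> k'"
  and \<K>_bounded: "\<And>k'. k' \<in> \<K> ==> \<exists>B\<ge>0. \<forall>x\<in>space \<mu>. \<forall>y\<in>space \<mu>. k' x y \<le> B"
  and lln_row: "\<And>k' s d. k' \<in> \<K> ==> 0 < s ==> s < 1 ==> conv0 M (\<lambda>n w. (\<Sum>i<N n w.
    \<bar>(\<Sum>j<N n w. off_diag (\<lambda>a b. k' a b * (1 - bp_pgf \<mu> k' s d b)) n (x n w) i j)
    - (\<integral>y. k' (x n w i) y * (1 - bp_pgf \<mu> k' s d y) \<partial>\<mu>)\<bar>) / n)"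
  and lln_pgf: "\<And>k' s d. k' \<in> \<K> ==> 0 < s ==> s < 1 ==>
    conv0 M (\<lambda>n w. \<bar>(\<Sum>i<N n w. bp_pgf \<mu> k' s d (x n w i)) / n - (\<integral>y. bp_pgf \<mu> k' s d y \<partial>\<mu>)\<bar>)"
  and approx: "\<And>e. e > 0 ==> \<exists>k'\<in>\<K>. kdist k' \<le> e \<and>
    whp M (\<lambda>n w. mdist n (N n w) (p n w) (off_diag k' n (x n w)) \<le> e)"
begin

lemma N_le: "whp M (\<lambda>n w. real (N n w) / n \<le> total + 1)"
proof (rule whp_mono[OF conv0D[OF N_lim, of 1]])
 show "\<forall>\<^sub>F n in sequentially. \<forall>w\<in>space M. \<bar>real (N n w) / n - total\<bar> \<le> 1 \<longrightarrow> real (N n w) / n \<le> total + 1"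
  by (intro always_eventually) force
qed simp

lemma off_diag_bounds:
 assumes "k' \<in> \<K>" "\<forall>x\<in>space \<mu>. \<forall>y\<in>space \<mu>. k' x y \<le> B" "B \<ge> 0" "w \<in> space M" "i < N n w" "j < N n w"
 shows "0 \<le> off_diag k' n (x n w) i j" "off_diag k' n (x n w) i j \<le> B / n"
proof -
 interpret k': ker \<mu> k' by (rule \<K>_ker[OF assms(1)])
 note xi = x[OF assms(4,5)] and xj = x[OF assms(4,6)]
 show "0 \<le> off_diag k' n (x n w) i j" using k'.kernel_nonneg[OF xi xj] by (simp add: off_diag_def)
 show "off_diag k' n (x n w) i j \<le> B / n"
  using assms(2,3) xi xj by (auto simp: off_diag_def intro!: divide_right_mono)
qed

text \<open>Row sums of a sampled kernel bounded by B are at most B times the vertex density, so any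
  excess above B (total + 1) must come from the distance between p and the sampled kernel.\<close>

lemma tail:
 assumes "e > 0"
 shows "\<exists>K\<ge>0. whp M (\<lambda>n w. row_excess n (N n w) (p n w) K \<le> e)"
proof -
 from approx[OF assms] obtain k' where k: "k' \<in> \<K>"
  and close: "whp M (\<lambda>n w. mdist n (N n w) (p n w) (off_diag k' n (x n w)) \<le> e)" by blast
 from \<K>_bounded[OF k] obtain B where B: "B \<ge> 0" "\<forall>x\<in>space \<mu>. \<forall>y\<in>space \<mu>. k' x y \<le> B" by blast
 show ?thesis
 proof (intro exI[of _ "B * (total + 1)"] conjI)
  show "0 \<le> B * (total + 1)" using B total_pos by auto
  show "whp M (\<lambda>n w. (\<Sum>i<N n w. max 0 ((\<Sum>j<N n w. p n w i j) - B * (total + 1))) / n \<le> e)"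
  proof (rule whp_mono[OF M.whp_conj[OF N_le close]], intro always_eventually allI ballI impI)
   fix n w assume om: "w \<in> space M"
   let ?N = "N n w" and ?p = "p n w" and ?q = "off_diag k' n (x n w)"
   assume a: "real ?N / n \<le> total + 1 \<and> mdist n ?N ?p ?q \<le> e"
   have "(\<Sum>i<?N. max 0 ((\<Sum>j<?N. ?p i j) - B * (total + 1))) \<le> (\<Sum>i<?N. \<Sum>j<?N. \<bar>?p i j - ?q i j\<bar>)"
   proof (rule sum_mono)
    fix i assume i: "i \<in> {..<?N}"
    have "(\<Sum>j<?N. ?q i j) \<le> (\<Sum>j<?N. B / n)" using i B om k by (intro sum_mono off_diag_bounds(2)) auto
    also have "... = B * (real ?N / n)" by simp
    also have "... \<le> B * (total + 1)" using a B by (intro mult_left_mono) auto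
    finally have "(\<Sum>j<?N. ?p i j) - B * (total + 1) \<le> (\<Sum>j<?N. ?p i j - ?q i j)" by (simp add: sum_subtractf)
    also have "... \<le> (\<Sum>j<?N. \<bar>?p i j - ?q i j\<bar>)" by (intro sum_mono) auto
    finally show "max 0 ((\<Sum>j<?N. ?p i j) - B * (total + 1)) \<le> (\<Sum>j<?N. \<bar>?p i j - ?q i j\<bar>)"
     by (auto intro: sum_nonneg)
   qed
   then have "(\<Sum>i<?N. max 0 ((\<Sum>j<?N. ?p i j) - B * (total + 1))) / n \<le> mdist n ?N ?p ?q"
    by (rule divide_right_mono) simp
   with a show "(\<Sum>i<?N. max 0 ((\<Sum>j<?N. ?p i j) - B * (total + 1))) / n \<le> e" by linarith
  qed
 qed
qed

text \<open>For 0 \<le> p \<le> 1 and 0 \<le> q \<le> B / n the square of p is at most (1 + B / n)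
  \<bar>p - q\<bar> + (B / n)^2. The first part is controlled by the distance to the sampled kernel,
  the second contributes order 1 / n.\<close>

lemma squares: "conv0 M (\<lambda>n w. (\<Sum>i<N n w. \<Sum>j<N n w. (p n w i j)\<^sup>2) / n)"
 unfolding conv0_def
proof (intro allI impI)
 fix e :: real assume e: "e > 0"
 then have "e / 3 > 0" by simp
 from approx[OF this] obtain k' where k: "k' \<in> \<K>"
  and close: "whp M (\<lambda>n w. mdist n (N n w) (p n w) (off_diag k' n (x n w)) \<le> e / 3)" by blast
 from \<K>_bounded[OF k] obtain B where B: "B \<ge> 0" "\<forall>x\<in>space \<mu>. \<forall>y\<in>space \<mu>. k' x y \<le> B" by blast
 \<comment> \<open>C / n collects the two terms containing B: the distance weighted with B / n, and
   (B N / n)^2 / n.\<close>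
 define C where "C = B * (e / 3) + (B * (total + 1))\<^sup>2"
 have "(\<lambda>n. C / real n) \<longlonglongrightarrow> 0"
  by (rule tendsto_divide_0[OF tendsto_const]) (auto intro: filterlim_at_top_imp_at_infinity filterlim_real_sequentially)
 then have "\<forall>\<^sub>F n in sequentially. C / real n < e / 3" using e by (intro order_tendstoD(2)) auto
 then have ev: "\<forall>\<^sub>F n in sequentially. 0 < n \<and> C / real n < e / 3"
  using eventually_gt_at_top[of 0] by eventually_elim auto
 show "whp M (\<lambda>n w. (\<Sum>i<N n w. \<Sum>j<N n w. (p n w i j)\<^sup>2) / n \<le> e)"
 proof (rule whp_mono[OF M.whp_conj[OF N_le close]], intro eventually_mono[OF ev] ballI impI)
  fix n :: nat and w assume n: "0 < n \<and> C / real n < e / 3" and om: "w \<in> space M"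
  let ?N = "N n w" and ?p = "p n w" and ?q = "off_diag k' n (x n w)"
  let ?D = "\<Sum>i<?N. \<Sum>j<?N. \<bar>?p i j - ?q i j\<bar>"
  assume a: "real ?N / n \<le> total + 1 \<and> ?D / n \<le> e / 3"
  interpret edge_prob ?N ?p by (rule ep[OF om])
  have "(\<Sum>i<?N. \<Sum>j<?N. (?p i j)\<^sup>2) \<le> (\<Sum>i<?N. \<Sum>j<?N. (1 + B / n) * \<bar>?p i j - ?q i j\<bar> + (B / n)\<^sup>2)"
  proof (intro sum_mono)
   fix i j assume ij: "i \<in> {..<?N}" "j \<in> {..<?N}"
   have pb: "0 \<le> ?p i j" "?p i j \<le> 1" using ij p_nonneg p_le1 by auto
   have qb: "0 \<le> ?q i j" "?q i j \<le> B / n" using ij off_diag_bounds[OF k B(2,1) om] by auto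
   have "(?p i j)\<^sup>2 = ?p i j * (?p i j - ?q i j) + ?q i j * (?p i j - ?q i j) + ?q i j * ?q i j"
    by (simp add: power2_eq_square algebra_simps)
   also have "... \<le> 1 * \<bar>?p i j - ?q i j\<bar> + B / n * \<bar>?p i j - ?q i j\<bar> + B / n * (B / n)"
   proof (intro add_mono)
    show "?p i j * (?p i j - ?q i j) \<le> 1 * \<bar>?p i j - ?q i j\<bar>"
     using pb by (intro order_trans[OF mult_left_mono[OF abs_ge_self] mult_right_mono]) auto
    show "?q i j * (?p i j - ?q i j) \<le> B / n * \<bar>?p i j - ?q i j\<bar>"
     using qb by (intro order_trans[OF mult_left_mono[OF abs_ge_self] mult_right_mono]) auto
    show "?q i j * ?q i j \<le> B / n * (B / n)" using qb by (intro mult_mono) auto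
   qed
   finally show "(?p i j)\<^sup>2 \<le> (1 + B / n) * \<bar>?p i j - ?q i j\<bar> + (B / n)\<^sup>2"
    by (simp add: power2_eq_square distrib_right)
  qed
  also have "... = (1 + B / n) * ?D + real ?N * (real ?N * (B / n)\<^sup>2)"
   by (simp add: sum.distrib sum_distrib_left)
  finally have "(\<Sum>i<?N. \<Sum>j<?N. (?p i j)\<^sup>2) / n \<le> ((1 + B / n) * ?D + real ?N * (real ?N * (B / n)\<^sup>2)) / n"
   by (rule divide_right_mono) simp
  also have "... = ?D / n + (B * (?D / n) + (B * (real ?N / n))\<^sup>2) / n"
   by (simp add: add_divide_distrib distrib_right power2_eq_square)
  also have "... \<le> e / 3 + C / n"
   unfolding C_def using a B by (intro add_mono divide_right_mono mult_left_mono power_mono) auto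
  also have "... \<le> e" using n e by linarith
  finally show "(\<Sum>i<?N. \<Sum>j<?N. (?p i j)\<^sup>2) / n \<le> e" .
 qed
qed

text \<open>The tolerance e is chosen before k': the factor K of a generation comes from the row
  sums of p, through \<open>tail\<close>, and not from the bound of k'. The approximating kernel can
  therefore be selected afterwards, as close as required.\<close>

lemma mgf_vertices:
 assumes s: "0 < s" "s < 1"
 shows "c > 0 ==> \<exists>e>0. \<forall>k'\<in>\<K>.
   whp M (\<lambda>n w. mdist n (N n w) (p n w) (off_diag k' n (x n w)) \<le> e) \<longrightarrow>
   whp M (\<lambda>n w. (\<Sum>i<N n w. \<bar>mgf (p n w) {..<N n w} s d i - bp_pgf \<mu> k' s d (x n w i)\<bar>) / n \<le> c)"
proof (induction d arbitrary: c)
 case 0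
 then show ?case by (intro exI[of _ 1]) (auto intro!: M.whp_always always_eventually)
next
 case (Suc d)
 then have d4: "c / 4 > 0" by simp
 from tail[OF d4] obtain K where K: "K \<ge> 0"
  "whp M (\<lambda>n w. row_excess n (N n w) (p n w) K \<le> c / 4)" by blast
 have "c / (4 * (K + 1)) > 0" using K Suc.prems by simp
 from Suc.IH[OF this] obtain e where e: "e > 0" and
  IH: "\<And>k'. k' \<in> \<K> ==>
   whp M (\<lambda>n w. mdist n (N n w) (p n w) (off_diag k' n (x n w)) \<le> e) ==>
   whp M (\<lambda>n w. (\<Sum>i<N n w. \<bar>mgf (p n w) {..<N n w} s d i - bp_pgf \<mu> k' s d (x n w i)\<bar>) / n \<le> c / (4 * (K + 1)))"
  by blast
 show ?case
 proof (intro exI[of _ "min e (c / 4)"] conjI ballI impI)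
  fix k' assume k: "k' \<in> \<K>"
   and close: "whp M (\<lambda>n w. mdist n (N n w) (p n w) (off_diag k' n (x n w)) \<le> min e (c / 4))"
  interpret k': ker \<mu> k' by (rule \<K>_ker[OF k])
  have c1: "whp M (\<lambda>n w. mdist n (N n w) (p n w) (off_diag k' n (x n w)) \<le> e)"
   by (rule whp_mono[OF close]) (auto intro!: always_eventually)
  show "whp M (\<lambda>n w. (\<Sum>i<N n w. \<bar>mgf (p n w) {..<N n w} s (Suc d) i - bp_pgf \<mu> k' s (Suc d) (x n w i)\<bar>) / n \<le> c)"
  proof (rule whp_mono[OF M.whp_conj[OF close M.whp_conj[OF IH[OF k c1] M.whp_conj[OF K(2) conv0D[OF lln_row[OF k s, of d] d4]]]]],
    intro always_eventually allI ballI impI)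
   fix n w assume om: "w \<in> space M"
   let ?N = "N n w" and ?p = "p n w" and ?q = "off_diag k' n (x n w)" and ?X = "x n w"
   let ?g = "mgf ?p {..<?N} s d" and ?h = "\<lambda>i. bp_pgf \<mu> k' s d (?X i)" and ?l = "\<lambda>i. \<Sum>j<?N. ?p i j"
   let ?I = "\<lambda>i. \<integral>y. k' (?X i) y * (1 - bp_pgf \<mu> k' s d y) \<partial>\<mu>"
   let ?S = "\<lambda>i. \<Sum>j<?N. off_diag (\<lambda>a b. k' a b * (1 - bp_pgf \<mu> k' s d b)) n ?X i j"
   let ?R = "(\<Sum>i<?N. \<Sum>j<?N. \<bar>?p i j - ?q i j\<bar>) + (\<Sum>i<?N. \<bar>?S i - ?I i\<bar>)"
   let ?L = "\<Sum>i<?N. \<bar>mgf ?p {..<?N} s (Suc d) i - bp_pgf \<mu> k' s (Suc d) (?X i)\<bar>"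
   assume a: "mdist n ?N ?p ?q \<le> min e (c / 4) \<and>
    (\<Sum>i<?N. \<bar>?g i - ?h i\<bar>) / n \<le> c / (4 * (K + 1)) \<and> (\<Sum>i<?N. max 0 (?l i - K)) / n \<le> c / 4 \<and>
    (\<Sum>i<?N. \<bar>?S i - ?I i\<bar>) / n \<le> c / 4"
   interpret edge_prob ?N ?p by (rule ep[OF om])
   have g: "0 \<le> ?g i \<and> ?g i \<le> 1" if "i < ?N" for i using mgf_bounds[OF _ _ order_refl that] s by auto
   have h: "0 \<le> bp_pgf \<mu> k' s d y \<and> bp_pgf \<mu> k' s d y \<le> 1" if "y \<in> space \<mu>" for y
    using k'.bp_pgf_bounds1[OF _ _ that] s by auto
   have X: "?X i \<in> space \<mu>" if "i < ?N" for i using x[OF om that] .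
   have "?L \<le>
    (\<Sum>i<?N. ((\<Sum>j<?N. \<bar>?p i j - ?q i j\<bar>) + \<bar>?S i - ?I i\<bar>) + (\<Sum>j<?N. ?p i j * \<bar>?g j - ?h j\<bar>))"
   proof (rule sum_mono)
    fix i assume i: "i \<in> {..<?N}"
    have "\<bar>mgf ?p {..<?N} s (Suc d) i - bp_pgf \<mu> k' s (Suc d) (?X i)\<bar> =
     s * \<bar>exp (- (\<Sum>j<?N. ?p i j * (1 - ?g j))) - exp (- ?I i)\<bar>"
     using s by (simp add: abs_mult flip: right_diff_distrib)
    also have "... \<le> 1 * \<bar>(\<Sum>j<?N. ?p i j * (1 - ?g j)) - ?I i\<bar>"
     using s g h i X
     by (intro mult_mono exp_minus_Lipschitz sum_nonneg mult_nonneg_nonneg p_nonneg B_integral_nonneg k'.kernel_nonneg) auto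
    finally have 0: "\<bar>mgf ?p {..<?N} s (Suc d) i - bp_pgf \<mu> k' s (Suc d) (?X i)\<bar> \<le> \<bar>(\<Sum>j<?N. ?p i j * (1 - ?g j)) - ?I i\<bar>" by simp
    have "(\<Sum>j<?N. ?p i j * (1 - ?g j)) - ?S i = (\<Sum>j<?N. ?p i j * (1 - ?g j) - ?q i j * (1 - ?h j))"
     unfolding sum_subtractf by (auto simp: off_diag_def intro!: sum.cong)
    then have "\<bar>(\<Sum>j<?N. ?p i j * (1 - ?g j)) - ?S i\<bar> \<le> (\<Sum>j<?N. \<bar>?p i j * (1 - ?g j) - ?q i j * (1 - ?h j)\<bar>)" by (simp only: sum_abs)
    also have "... \<le> (\<Sum>j<?N. \<bar>?p i j - ?q i j\<bar> + ?p i j * \<bar>?g j - ?h j\<bar>)"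
    proof (rule sum_mono)
     fix j assume j: "j \<in> {..<?N}"
     have "?p i j * (1 - ?g j) - ?q i j * (1 - ?h j) = (?p i j - ?q i j) * (1 - ?h j) + ?p i j * (?h j - ?g j)"
      by (simp add: algebra_simps)
     then have "\<bar>?p i j * (1 - ?g j) - ?q i j * (1 - ?h j)\<bar> \<le> \<bar>?p i j - ?q i j\<bar> * \<bar>1 - ?h j\<bar> + \<bar>?p i j\<bar> * \<bar>?h j - ?g j\<bar>"
      by (simp only: abs_mult[symmetric] abs_triangle_ineq)
     also have "... \<le> \<bar>?p i j - ?q i j\<bar> * 1 + ?p i j * \<bar>?g j - ?h j\<bar>"
      using h[of "?X j"] X[of j] i j p_nonneg[of i j] by (intro add_mono mult_mono) auto
     finally show "\<bar>?p i j * (1 - ?g j) - ?q i j * (1 - ?h j)\<bar> \<le> \<bar>?p i j - ?q i j\<bar> + ?p i j * \<bar>?g j - ?h j\<bar>" by simp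
    qed
    also have "... = (\<Sum>j<?N. \<bar>?p i j - ?q i j\<bar>) + (\<Sum>j<?N. ?p i j * \<bar>?g j - ?h j\<bar>)" by (rule sum.distrib)
    finally show "\<bar>mgf ?p {..<?N} s (Suc d) i - bp_pgf \<mu> k' s (Suc d) (?X i)\<bar> \<le>
     ((\<Sum>j<?N. \<bar>?p i j - ?q i j\<bar>) + \<bar>?S i - ?I i\<bar>) + (\<Sum>j<?N. ?p i j * \<bar>?g j - ?h j\<bar>)" using 0 by linarith
   qed
   also have "... = ?R + (\<Sum>j<?N. ?l j * \<bar>?g j - ?h j\<bar>)"
   proof -
    have "(\<Sum>i<?N. \<Sum>j<?N. ?p i j * \<bar>?g j - ?h j\<bar>) = (\<Sum>j<?N. \<Sum>i<?N. ?p i j * \<bar>?g j - ?h j\<bar>)" by (rule sum.swap)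
    also have "... = (\<Sum>j<?N. ?l j * \<bar>?g j - ?h j\<bar>)"
     unfolding sum_distrib_right by (intro sum.cong refl) (auto simp: p_sym)
    finally show ?thesis by (simp only: sum.distrib)
   qed
   also have "... \<le> ?R +
    (\<Sum>j<?N. K * \<bar>?g j - ?h j\<bar> + max 0 (?l j - K))"
   proof (intro add_left_mono sum_mono)
    fix j assume j: "j \<in> {..<?N}"
    have le1: "\<bar>?g j - ?h j\<bar> \<le> 1" using g[of j] h[OF X[of j]] j by auto
    have "(?l j - K) * \<bar>?g j - ?h j\<bar> \<le> max 0 (?l j - K) * \<bar>?g j - ?h j\<bar>" by (intro mult_right_mono) auto
    moreover have "max 0 (?l j - K) * \<bar>?g j - ?h j\<bar> \<le> max 0 (?l j - K)" by (rule mult_left_le[OF le1]) simp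
    ultimately show "?l j * \<bar>?g j - ?h j\<bar> \<le> K * \<bar>?g j - ?h j\<bar> + max 0 (?l j - K)" by (simp add: left_diff_distrib)
   qed
   finally have "?L / n \<le>
    (?R + (\<Sum>j<?N. K * \<bar>?g j - ?h j\<bar> + max 0 (?l j - K))) / n"
    by (rule divide_right_mono) simp
   also have "... = mdist n ?N ?p ?q + (\<Sum>i<?N. \<bar>?S i - ?I i\<bar>) / n
    + K * ((\<Sum>j<?N. \<bar>?g j - ?h j\<bar>) / n) + (\<Sum>j<?N. max 0 (?l j - K)) / n"
    by (simp only: add_divide_distrib sum.distrib sum_distrib_left[symmetric] times_divide_eq_right add.assoc)
   also have "... \<le> c / 4 + c / 4 + K * (c / (4 * (K + 1))) + c / 4"
    using a K by (intro add_mono mult_left_mono) auto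
   also have "K * (c / (4 * (K + 1))) \<le> c / 4" using K Suc.prems by (simp add: field_simps)
   finally show "?L / n \<le> c" by simp
  qed
 qed (use e Suc.prems in auto)
qed

theorem conclusion: "suscept_concl \<mu> \<kappa> M N p"
proof (rule suscept_conclI[OF M.prob_space_axioms ep N_lim tail squares])
 fix s d assume s: "0 < s" "s < (1::real)"
 show "conv0 M (\<lambda>n w. \<bar>(\<Sum>v<N n w. mgf (p n w) {..<N n w} s d v) / n - mean_pgf s d\<bar>)"
  unfolding conv0_def
 proof (intro allI impI)
  fix e :: real assume e: "e > 0"
  then have e4: "e / 4 > 0" by simp
  from mgf_vertices[OF s e4, of d] obtain \<epsilon>1 where \<epsilon>1: "\<epsilon>1 > 0" and
   vert: "\<And>k'. k' \<in> \<K> ==> whp M (\<lambda>n w. mdist n (N n w) (p n w) (off_diag k' n (x n w)) \<le> \<epsilon>1) ==>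
   whp M (\<lambda>n w. (\<Sum>i<N n w. \<bar>mgf (p n w) {..<N n w} s d i - bp_pgf \<mu> k' s d (x n w i)\<bar>) / n \<le> e / 4)"
   by blast
  from bp_pgf_kernel_continuous[OF e4, of d] obtain \<eta> where \<eta>: "\<eta> > 0" and
   cont: "\<And>k' s. ker \<mu> k' ==> 0 \<le> s ==> s \<le> 1 ==> kdist k' \<le> \<eta> ==>
    (\<integral>x. \<bar>bp_pgf \<mu> \<kappa> s d x - bp_pgf \<mu> k' s d x\<bar> \<partial>\<mu>) \<le> e / 4" by blast
  from approx[of "min \<epsilon>1 \<eta>"] \<epsilon>1 \<eta> obtain k' where k: "k' \<in> \<K>" "kdist k' \<le> min \<epsilon>1 \<eta>"
   and close: "whp M (\<lambda>n w. mdist n (N n w) (p n w) (off_diag k' n (x n w)) \<le> min \<epsilon>1 \<eta>)" by auto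
  interpret k': ker \<mu> k' by (rule \<K>_ker[OF k(1)])
  have "\<bar>(\<integral>x. bp_pgf \<mu> k' s d x \<partial>\<mu>) - mean_pgf s d\<bar> = \<bar>\<integral>x. bp_pgf \<mu> \<kappa> s d x - bp_pgf \<mu> k' s d x \<partial>\<mu>\<bar>"
   using s by (subst B_integral_diff) (auto intro!: bp_pgf_integrable k'.bp_pgf_integrable)
  also have "... \<le> (\<integral>x. \<bar>bp_pgf \<mu> \<kappa> s d x - bp_pgf \<mu> k' s d x\<bar> \<partial>\<mu>)" by (rule integral_abs_bound)
  also have "... \<le> e / 4" using k s by (intro cont \<K>_ker) auto
  finally have 4: "\<bar>(\<integral>x. bp_pgf \<mu> k' s d x \<partial>\<mu>) - mean_pgf s d\<bar> \<le> e / 4" .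
  have w1: "whp M (\<lambda>n w. (\<Sum>i<N n w. \<bar>mgf (p n w) {..<N n w} s d i - bp_pgf \<mu> k' s d (x n w i)\<bar>) / n \<le> e / 4)"
   by (rule vert[OF k(1) whp_mono[OF close]]) (auto intro!: always_eventually)
  show "whp M (\<lambda>n w. \<bar>(\<Sum>v<N n w. mgf (p n w) {..<N n w} s d v) / n - mean_pgf s d\<bar> \<le> e)"
  proof (rule whp_mono[OF M.whp_conj[OF w1 conv0D[OF lln_pgf[OF k(1) s, of d] e4]]], intro always_eventually allI ballI impI)
   fix n w
   let ?N = "N n w"
   let ?a = "\<lambda>i. mgf (p n w) {..<?N} s d i" and ?c = "\<lambda>i. bp_pgf \<mu> k' s d (x n w i)"
   assume a: "(\<Sum>i<?N. \<bar>?a i - ?c i\<bar>) / n \<le> e / 4 \<and>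
    \<bar>(\<Sum>i<?N. ?c i) / n - (\<integral>y. bp_pgf \<mu> k' s d y \<partial>\<mu>)\<bar> \<le> e / 4"
   have "\<bar>(\<Sum>i<?N. ?a i) / n - (\<Sum>i<?N. ?c i) / n\<bar> = \<bar>\<Sum>i<?N. ?a i - ?c i\<bar> / n"
    by (simp add: sum_subtractf abs_divide flip: diff_divide_distrib)
   also have "... \<le> (\<Sum>i<?N. \<bar>?a i - ?c i\<bar>) / n" by (intro divide_right_mono sum_abs) simp
   finally show "\<bar>(\<Sum>v<?N. ?a v) / n - mean_pgf s d\<bar> \<le> e"
    using a 4 e by linarith
  qed
 qed
qed auto

end

section \<open>Independent vertices\<close>

text \<open>Hypothesis \<open>E\<close> supplies a kernel that may depend on the failure probability
  d, whereas one kernel is wanted for all d. So \<kappa>' is fixed once, and for each d an auxiliary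
  \<kappa>'' is taken; both are close to \<kappa>, hence to each other in L1, and \<open>lln\<close>
  carries this over to the sampled matrices.\<close>

lemma (in ker) approx_whp:
 fixes N :: "nat => 'w => nat" and p :: "nat => 'w => nat => nat => real" and x :: "nat => 'w => nat => 's"
 assumes M: "prob_space M" and K: "\<And>\<kappa>'. \<kappa>' \<in> \<K> ==> ker \<mu> \<kappa>'"
  and lln: "\<And>\<kappa>' \<kappa>'' e. \<kappa>' \<in> \<K> ==> \<kappa>'' \<in> \<K> ==> e > 0 ==>
   whp M (\<lambda>n w. (\<Sum>i<N n w. \<Sum>j<N n w. off_diag (\<lambda>a b. \<bar>\<kappa>'' a b - \<kappa>' a b\<bar>) n (x n w) i j) / n
    \<le> (\<integral>z. \<bar>\<kappa>'' (fst z) (snd z) - \<kappa>' (fst z) (snd z)\<bar> \<partial>(sqm \<mu>)) + e)"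
  and E: "\<And>e d. e > 0 ==> d > 0 ==> \<exists>\<kappa>'\<in>\<K>. kdist \<kappa>' \<le> e \<and> (\<forall>\<^sub>F n in sequentially. \<exists>S\<in>sets M. 1 - d \<le> measure M S \<and>
   (\<forall>w\<in>S. mdist n (N n w) (p n w) (off_diag \<kappa>' n (x n w)) \<le> e))"
  and e: "e > 0"
 shows "\<exists>\<kappa>'\<in>\<K>. kdist \<kappa>' \<le> e \<and>
    whp M (\<lambda>n w. mdist n (N n w) (p n w) (off_diag \<kappa>' n (x n w)) \<le> e)"
proof -
 interpret M: prob_space M by (rule M)
 have e4: "e / 4 > 0" using e by simp
 \<comment> \<open>With failure probability 1 the statement about the graph is void; only the bound
   on \<open>kdist\<close> is wanted here.\<close>
 from E[OF e4, of 1] obtain \<kappa>' where k': "\<kappa>' \<in> \<K>" "kdist \<kappa>' \<le> e / 4" by auto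
 interpret k': ker \<mu> \<kappa>' by (rule K[OF k'(1)])
 show ?thesis
 proof (intro bexI[of _ \<kappa>'] conjI)
  show "kdist \<kappa>' \<le> e" using k' e by linarith
  show "whp M (\<lambda>n w. mdist n (N n w) (p n w) (off_diag \<kappa>' n (x n w)) \<le> e)"
   unfolding whp_def
  proof (intro allI impI)
   fix d :: real assume d: "d > 0"
   then have d2: "d / 2 > 0" by simp
   from E[OF e4 d2] obtain \<kappa>'' where k'': "\<kappa>'' \<in> \<K>" "kdist \<kappa>'' \<le> e / 4"
    and ev: "\<forall>\<^sub>F n in sequentially. \<exists>S\<in>sets M. 1 - d / 2 \<le> measure M S \<and>
     (\<forall>w\<in>S. mdist n (N n w) (p n w) (off_diag \<kappa>'' n (x n w)) \<le> e / 4)" by blast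
   interpret k'': ker \<mu> \<kappa>'' by (rule K[OF k''(1)])
   let ?D = "\<lambda>a b. \<bar>\<kappa>'' a b - \<kappa>' a b\<bar>"
   let ?I = "\<integral>z. \<bar>\<kappa>'' (fst z) (snd z) - \<kappa>' (fst z) (snd z)\<bar> \<partial>(sqm \<mu>)"
   have "?I \<le> (\<integral>z. \<bar>\<kappa> (fst z) (snd z) - \<kappa>' (fst z) (snd z)\<bar> + \<bar>\<kappa> (fst z) (snd z) - \<kappa>'' (fst z) (snd z)\<bar> \<partial>(sqm \<mu>))"
    by (rule integral_mono) (auto intro!: B_integrable_add integrable_abs B_integrable_diff
     kernel_integrable2 k'.kernel_integrable2 k''.kernel_integrable2)
   also have "... = kdist \<kappa>' + kdist \<kappa>''"
    by (rule B_integral_add) (auto intro!: integrable_abs B_integrable_diff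
     kernel_integrable2 k'.kernel_integrable2 k''.kernel_integrable2)
   finally have I: "?I \<le> e / 2" using k' k'' by linarith
   have "\<forall>\<^sub>F n in sequentially. \<exists>S\<in>sets M. 1 - d / 2 \<le> measure M S \<and> (\<forall>w\<in>S.
     (\<Sum>i<N n w. \<Sum>j<N n w. off_diag ?D n (x n w) i j) / n \<le> ?I + e / 4)"
    using lln[OF k'(1) k''(1) e4] d2 unfolding whp_def by blast
   with ev show "\<forall>\<^sub>F n in sequentially. \<exists>S\<in>sets M. 1 - d \<le> measure M S \<and>
     (\<forall>w\<in>S. mdist n (N n w) (p n w) (off_diag \<kappa>' n (x n w)) \<le> e)"
   proof eventually_elim
    case (elim n)
    then obtain S T where S: "S \<in> sets M" "1 - d / 2 \<le> measure M S"
      "\<And>w. w \<in> S ==> mdist n (N n w) (p n w) (off_diag \<kappa>'' n (x n w)) \<le> e / 4"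
     and T: "T \<in> sets M" "1 - d / 2 \<le> measure M T"
      "\<And>w. w \<in> T ==> (\<Sum>i<N n w. \<Sum>j<N n w. off_diag ?D n (x n w) i j) / n \<le> ?I + e / 4"
     by blast
    have "1 - d \<le> M.prob (S \<inter> T)" using S(1,2) T(1,2) by (rule M.prob_Int_ge)
    moreover have "mdist n (N n w) (p n w) (off_diag \<kappa>' n (x n w)) \<le> e" if "w \<in> S \<inter> T" for w
    proof -
     let ?A = "\<Sum>i<N n w. \<Sum>j<N n w. \<bar>p n w i j - off_diag \<kappa>'' n (x n w) i j\<bar>"
     let ?B = "\<Sum>i<N n w. \<Sum>j<N n w. off_diag ?D n (x n w) i j"
     have "(\<Sum>i<N n w. \<Sum>j<N n w. \<bar>p n w i j - off_diag \<kappa>' n (x n w) i j\<bar>) \<le>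
      (\<Sum>i<N n w. \<Sum>j<N n w. \<bar>p n w i j - off_diag \<kappa>'' n (x n w) i j\<bar> + off_diag ?D n (x n w) i j)"
     proof (intro sum_mono)
      fix i j
      have "\<bar>off_diag \<kappa>'' n (x n w) i j - off_diag \<kappa>' n (x n w) i j\<bar> = off_diag ?D n (x n w) i j"
       by (simp add: off_diag_def abs_divide flip: diff_divide_distrib)
      then show "\<bar>p n w i j - off_diag \<kappa>' n (x n w) i j\<bar> \<le>
       \<bar>p n w i j - off_diag \<kappa>'' n (x n w) i j\<bar> + off_diag ?D n (x n w) i j" by linarith
     qed
     also have "... = ?A + ?B" by (simp add: sum.distrib)
     finally have "mdist n (N n w) (p n w) (off_diag \<kappa>' n (x n w)) \<le> (?A + ?B) / n"
      by (rule divide_right_mono) simp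
     also have "... = ?A / n + ?B / n" by (rule add_divide_distrib)
     also have "... \<le> e / 4 + (?I + e / 4)"
      using that by (intro add_mono S(3) T(3)) auto
     also have "... \<le> e" using I by linarith
     finally show ?thesis .
    qed
    ultimately show ?case using S T by (intro bexI[of _ "S \<inter> T"]) auto
   qed
  qed
 qed (rule k')
qed

lemma (in prob_space) double_sum_lln:
 assumes row: "conv0 M (\<lambda>n w. (\<Sum>i<N n w. \<bar>(\<Sum>j<N n w. off_diag h n (x n w) i j) - H (x n w i)\<bar>) / n)"
  and av: "conv0 M (\<lambda>n w. \<bar>(\<Sum>i<N n w. H (x n w i)) / n - c\<bar>)"
 shows "conv0 M (\<lambda>n w. \<bar>(\<Sum>i<N n w. \<Sum>j<N n w. off_diag h n (x n w) i j) / n - c\<bar>)"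
proof (rule conv0_mono[OF conv0_add[OF row av]], intro always_eventually allI ballI)
 fix n :: nat and w
 let ?r = "\<lambda>i. \<Sum>j<N n w. off_diag h n (x n w) i j"
 have "\<bar>(\<Sum>i<N n w. ?r i) / n - (\<Sum>i<N n w. H (x n w i)) / n\<bar> = \<bar>\<Sum>i<N n w. ?r i - H (x n w i)\<bar> / n"
  by (simp only: sum_subtractf abs_divide diff_divide_distrib[symmetric] abs_of_nat)
 also have "... \<le> (\<Sum>i<N n w. \<bar>?r i - H (x n w i)\<bar>) / n" by (intro divide_right_mono sum_abs) simp
 finally show "\<bar>(\<Sum>i<N n w. ?r i) / n - c\<bar> \<le> (\<Sum>i<N n w. \<bar>?r i - H (x n w i)\<bar>) / n + \<bar>(\<Sum>i<N n w. H (x n w i)) / n - c\<bar>"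
  by linarith
qed

lemma (in prob_space) indep_pair_distr:
 assumes ind: "indep_vars (\<lambda>_. \<mu>) X I" and ij: "i \<in> I" "j \<in> I" "i \<noteq> j"
  and d: "\<And>i. i \<in> I ==> distr M \<mu> (X i) = \<mu>"
 shows "distr M (sqm \<mu>) (\<lambda>w. (X i w, X j w)) = sqm \<mu>"
proof -
 have "indep_var \<mu> ((\<lambda>f. f i) \<circ> (\<lambda>w. restrict (\<lambda>i. X i w) {i})) \<mu> ((\<lambda>f. f j) \<circ> (\<lambda>w. restrict (\<lambda>i. X i w) {j}))"
  using ij by (intro indep_var_compose[OF indep_var_restrict[OF ind]]) auto
 then have "indep_var \<mu> (X i) \<mu> (X j)" by (simp add: o_def)
 then show ?thesis using d[OF ij(1)] d[OF ij(2)] by (simp add: indep_var_distribution_eq)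
qed

lemma (in prob_space) indep_triple_distr:
 assumes ind: "indep_vars (\<lambda>_. \<mu>) X I" and ijk: "i \<in> I" "j \<in> I" "k \<in> I" "i \<noteq> j" "i \<noteq> k" "j \<noteq> k"
  and d: "\<And>i. i \<in> I ==> distr M \<mu> (X i) = \<mu>"
 shows "distr M ((sqm \<mu>) \<Otimes>\<^sub>M \<mu>) (\<lambda>y. ((X i y, X j y), X k y)) = (sqm \<mu>) \<Otimes>\<^sub>M \<mu>"
proof -
 let ?P = "sqm \<mu>"
 have X [measurable]: "X i \<in> M \<rightarrow>\<^sub>M \<mu>" "X j \<in> M \<rightarrow>\<^sub>M \<mu>" "X k \<in> M \<rightarrow>\<^sub>M \<mu>" using ind ijk by (auto simp: indep_vars_def)
 interpret S: prob_space \<mu> using prob_space_distr[OF X(1)] d[OF ijk(1)] by simp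
 interpret SS: pair_prob_space \<mu> \<mu> ..
 \<comment> \<open>\<open>indep_var\<close> relates variables of one common type, so the third point
   is doubled here and the copy is projected away below.\<close>
 have "indep_var ?P ((\<lambda>f. (f i, f j)) \<circ> (\<lambda>y. restrict (\<lambda>i. X i y) {i, j})) ?P ((\<lambda>f. (f k, f k)) \<circ> (\<lambda>y. restrict (\<lambda>i. X i y) {k}))"
  using ijk by (intro indep_var_compose[OF indep_var_restrict[OF ind]]) auto
 then have "indep_var ?P (\<lambda>y. (X i y, X j y)) ?P (\<lambda>y. (X k y, X k y))" by (simp add: o_def)
 then have D: "distr M (?P \<Otimes>\<^sub>M ?P) (\<lambda>y. ((X i y, X j y), (X k y, X k y))) = ?P \<Otimes>\<^sub>M distr M ?P (\<lambda>y. (X k y, X k y))"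
  using indep_pair_distr[OF ind ijk(1,2,4) d] by (simp add: indep_var_distribution_eq)
 let ?D = "distr M ?P (\<lambda>y. (X k y, X k y))"
 have k: "distr ?D \<mu> fst = \<mu>" using d[OF ijk(3)] by (subst distr_distr) (auto simp: o_def)
 have "distr M (?P \<Otimes>\<^sub>M \<mu>) (\<lambda>y. ((X i y, X j y), X k y)) =
  distr (distr M (?P \<Otimes>\<^sub>M ?P) (\<lambda>y. ((X i y, X j y), (X k y, X k y)))) (?P \<Otimes>\<^sub>M \<mu>) (\<lambda>(z, w). (z, fst w))"
  by (subst distr_distr) (auto simp: o_def)
 also have "... = distr (?P \<Otimes>\<^sub>M ?D) (?P \<Otimes>\<^sub>M \<mu>) (\<lambda>(z, w). (z, fst w))" by (simp only: D)
 also have "... = distr ?P ?P (\<lambda>z. z) \<Otimes>\<^sub>M distr ?D \<mu> fst"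
  by (rule pair_measure_distr[symmetric]) (auto simp: k S.sigma_finite_measure_axioms)
 also have "... = ?P \<Otimes>\<^sub>M \<mu>" by (simp add: k distr_id2)
 finally show ?thesis .
qed

section \<open>Laws of large numbers for independent points\<close>

locale iid_points = M: prob_space M + S: prob_space \<mu>
 for M :: "'w measure" and \<mu> :: "'s measure" +
 fixes x :: "nat => 'w => nat => 's"
 assumes x_measurable [measurable]: "i < n ==> (\<lambda>w. x n w i) \<in> M \<rightarrow>\<^sub>M \<mu>"
  and x_indep: "M.indep_vars (\<lambda>_. \<mu>) (\<lambda>i w. x n w i) {..<n}"
  and x_distr: "i < n ==> distr M \<mu> (\<lambda>w. x n w i) = \<mu>"
begin

lemma x_space: "w \<in> space M ==> i < n ==> x n w i \<in> space \<mu>"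
 using measurable_space[OF x_measurable] by blast

text \<open>Given the point i, the factors containing the points j and k are independent and
  centred; integrating out the point k alone already gives 0.\<close>

lemma expectation_pair_product:
 fixes u :: "'s => 's => real"
 assumes u [measurable]: "(\<lambda>z. u (fst z) (snd z)) \<in> borel_measurable (sqm \<mu>)"
  and b: "\<And>a b. a \<in> space \<mu> ==> b \<in> space \<mu> ==> \<bar>u a b\<bar> \<le> C" and C: "C \<ge> 0"
  and null: "\<And>a. a \<in> space \<mu> ==> (\<integral>b. u a b \<partial>\<mu>) = 0"
  and ijk: "i < n" "j < n" "k < n" "i \<noteq> j" "i \<noteq> k" "j \<noteq> k"
 shows "M.expectation (\<lambda>w. u (x n w i) (x n w j) * u (x n w i) (x n w k)) = 0"
proof -
 let ?P = "(sqm \<mu>) \<Otimes>\<^sub>M \<mu>"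
 let ?f = "\<lambda>z. u (fst (fst z)) (snd (fst z)) * u (fst (fst z)) (snd z)"
 interpret SS: pair_prob_space \<mu> \<mu> ..
 interpret SSS: pair_prob_space "sqm \<mu>" \<mu> ..
 have m1: "(\<lambda>z. u (fst (fst z)) (snd (fst z))) \<in> borel_measurable ?P"
  using measurable_compose[OF measurable_fst u] by simp
 have m2: "(\<lambda>z. u (fst (fst z)) (snd z)) \<in> borel_measurable ?P"
 proof -
  have "(\<lambda>z. (fst (fst z), snd z)) \<in> ?P \<rightarrow>\<^sub>M sqm \<mu>" by measurable
  from measurable_compose[OF this u] show ?thesis by simp
 qed
 have m: "?f \<in> borel_measurable ?P" using m1 m2 by (rule borel_measurable_times)
 have t: "(\<lambda>w. ((x n w i, x n w j), x n w k)) \<in> M \<rightarrow>\<^sub>M ?P" using ijk by measurable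
 have D: "distr M ?P (\<lambda>w. ((x n w i, x n w j), x n w k)) = ?P"
  using ijk by (intro M.indep_triple_distr[OF x_indep]) (auto simp: x_distr)
 have int: "integrable ?P ?f"
 proof (rule SSS.P.integrable_const_bound[where B = "C * C"])
  show "AE z in ?P. norm (?f z) \<le> C * C"
  proof (rule AE_I2)
   fix z assume "z \<in> space ?P"
   then have "fst (fst z) \<in> space \<mu>" "snd (fst z) \<in> space \<mu>" "snd z \<in> space \<mu>" by (auto simp: space_pair_measure)
   then have "\<bar>u (fst (fst z)) (snd (fst z))\<bar> * \<bar>u (fst (fst z)) (snd z)\<bar> \<le> C * C" using C by (intro mult_mono b) auto
   then show "norm (?f z) \<le> C * C" by (simp add: abs_mult)
  qed
 qed (rule m)
 have "M.expectation (\<lambda>w. u (x n w i) (x n w j) * u (x n w i) (x n w k)) =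
   (\<integral>z. ?f z \<partial>(distr M ?P (\<lambda>w. ((x n w i, x n w j), x n w k))))"
  by (subst integral_distr[OF t m]) simp
 also have "... = (\<integral>z. ?f z \<partial>?P)" by (simp only: D)
 also have "... = (\<integral>y. \<integral>c. ?f (y, c) \<partial>\<mu> \<partial>(sqm \<mu>))" by (rule SSS.integral_fst'[OF int, symmetric])
 also have "... = (\<integral>y. 0 \<partial>(sqm \<mu>))"
 proof (intro B_integral_cong refl)
  fix y assume "y \<in> space (sqm \<mu>)"
  then have "fst y \<in> space \<mu>" by (auto simp: space_pair_measure)
  from null[OF this] show "(\<integral>c. ?f (y, c) \<partial>\<mu>) = 0" by simp
 qed
 finally show ?thesis by simp
qed

text \<open>After subtraction of its conditional mean, row i is a sum of terms that are uncorrelated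
  by \<open>expectation_pair_product\<close>, with second moment of order n. The missing diagonal
  term shows up as \<open>H\<close> divided by n.\<close>

lemma row_lln:
 fixes h :: "'s => 's => real"
 assumes h [measurable]: "(\<lambda>z. h (fst z) (snd z)) \<in> borel_measurable (sqm \<mu>)"
  and b: "\<And>a b. a \<in> space \<mu> ==> b \<in> space \<mu> ==> \<bar>h a b\<bar> \<le> B" and B: "B \<ge> 0"
 shows "conv0 M (\<lambda>n w. (\<Sum>i<n. \<bar>(\<Sum>j<n. off_diag h n (x n w) i j) - (\<integral>y. h (x n w i) y \<partial>\<mu>)\<bar>) / n)"
proof -
 define H where "H a = (\<integral>y. h a y \<partial>\<mu>)" for a
 define u where "u a b = h a b - H a" for a b
 let ?Y = "\<lambda>n i j. \<lambda>w. u (x n w i) (x n w j) * u (x n w i) (x n w j)"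
 let ?U = "\<lambda>n i j k. \<lambda>w. u (x n w i) (x n w j) * u (x n w i) (x n w k)"
 have [measurable]: "H \<in> borel_measurable \<mu>"
 proof -
  have "(\<lambda>(a, y). h a y) \<in> borel_measurable (sqm \<mu>)" using h by (simp add: case_prod_unfold)
  then show ?thesis unfolding H_def by (rule S.borel_measurable_lebesgue_integral)
 qed
 have hs [measurable]: "h a \<in> borel_measurable \<mu>" if "a \<in> space \<mu>" for a
  using measurable_compose[OF measurable_Pair1'[OF that] h] by simp
 have hint: "integrable \<mu> (h a)" if "a \<in> space \<mu>" for a
  using b that by (intro S.integrable_const_bound[of _ B]) auto
 have Hb: "\<bar>H a\<bar> \<le> B" if a: "a \<in> space \<mu>" for a
 proof -
  have "\<bar>H a\<bar> \<le> (\<integral>y. \<bar>h a y\<bar> \<partial>\<mu>)" unfolding H_def by (rule integral_abs_bound)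
  also have "... \<le> (\<integral>y. B \<partial>\<mu>)" using a b hint by (intro integral_mono) auto
  finally show ?thesis by (simp add: S.prob_space)
 qed
 have u [measurable]: "(\<lambda>z. u (fst z) (snd z)) \<in> borel_measurable (sqm \<mu>)"
  unfolding u_def by measurable
 have ub: "\<bar>u a b\<bar> \<le> 2 * B" if "a \<in> space \<mu>" "b \<in> space \<mu>" for a b
  using b[OF that] Hb[OF that(1)] by (simp add: u_def)
 have null: "(\<integral>b. u a b \<partial>\<mu>) = 0" if "a \<in> space \<mu>" for a
  using hint[OF that] by (simp add: u_def H_def S.prob_space)
 have um [measurable]: "(\<lambda>w. u (x n w i) (x n w j)) \<in> borel_measurable M" if "i < n" "j < n" for n i j
 proof -
  have "(\<lambda>w. (x n w i, x n w j)) \<in> M \<rightarrow>\<^sub>M sqm \<mu>" using that by measurable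
  from measurable_compose[OF this u] show ?thesis by simp
 qed
 have hm [measurable]: "(\<lambda>w. h (x n w i) (x n w j)) \<in> borel_measurable M" if "i < n" "j < n" for n i j
 proof -
  have "(\<lambda>w. (x n w i, x n w j)) \<in> M \<rightarrow>\<^sub>M sqm \<mu>" using that by measurable
  from measurable_compose[OF this h] show ?thesis by simp
 qed
 have Hm [measurable]: "(\<lambda>w. H (x n w i)) \<in> borel_measurable M" if "i < n" for n i
  using that by measurable
 define R where "R n w i = (\<Sum>j<n. off_diag h n (x n w) i j) - H (x n w i)" for n w i
 let ?V = "\<lambda>n i. \<lambda>w. \<bar>R n w i\<bar>"
 let ?A = "\<lambda>n w. \<Sum>i<n. \<bar>R n w i\<bar>"
 have Rm [measurable]: "(\<lambda>w. R n w i) \<in> borel_measurable M" if "i < n" for n i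
  unfolding R_def off_diag_def using that by measurable
 define Z where "Z n w i = (\<Sum>j\<in>{..<n} - {i}. u (x n w i) (x n w j))" for n w i
 let ?Q = "\<lambda>n i. \<lambda>w. (Z n w i)\<^sup>2"
 have R_eq: "R n w i = Z n w i / n - H (x n w i) / n" if "i < n" for n w i
 proof -
  have "(\<Sum>j<n. off_diag h n (x n w) i j) = (\<Sum>j\<in>{..<n} - {i}. h (x n w i) (x n w j) / n)"
   by (intro sum.mono_neutral_cong_right) (auto simp: off_diag_def)
  moreover have "Z n w i = (\<Sum>j\<in>{..<n} - {i}. h (x n w i) (x n w j)) - (real n - 1) * H (x n w i)"
   using that by (simp add: Z_def u_def sum_subtractf of_nat_diff)
  ultimately show ?thesis using that
   by (simp add: R_def field_simps flip: sum_divide_distrib)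
 qed
 have int_uu: "integrable M (?U n i j k)" if "i < n" "j < n" "k < n" for n i j k
 proof (rule M.integrable_const_bound[where B = "2 * B * (2 * B)"])
  show "AE w in M. norm (u (x n w i) (x n w j) * u (x n w i) (x n w k)) \<le> 2 * B * (2 * B)"
  proof (rule AE_I2)
   fix w assume "w \<in> space M"
   then show "norm (u (x n w i) (x n w j) * u (x n w i) (x n w k)) \<le> 2 * B * (2 * B)"
    unfolding real_norm_def abs_mult using that B by (intro mult_mono ub x_space) auto
  qed
 qed (use that in measurable)
 have Z2: "M.expectation (?Q n i) \<le> n * (4 * B\<^sup>2)" and Z2int: "integrable M (?Q n i)" if i: "i < n" for n i
 proof -
  let ?J = "{..<n} - {i}"
  have sq: "(Z n w i)\<^sup>2 = (\<Sum>j\<in>?J. \<Sum>k\<in>?J. u (x n w i) (x n w j) * u (x n w i) (x n w k))" for w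
   by (simp add: Z_def power2_eq_square sum_product)
  show "integrable M (?Q n i)"
   unfolding sq using i by (intro B_integrable_sum int_uu) auto
  have "M.expectation (?Q n i) =
   (\<Sum>j\<in>?J. \<Sum>k\<in>?J. M.expectation (?U n i j k))"
   unfolding sq using i by (subst B_integral_sum) (auto intro!: B_integrable_sum int_uu sum.cong B_integral_sum)
  also have "... = (\<Sum>j\<in>?J. \<Sum>k\<in>?J. if k = j then M.expectation (?Y n i j) else 0)"
   using i B by (intro sum.cong refl) (auto intro!: expectation_pair_product[OF u ub _ null])
  also have "... = (\<Sum>j\<in>?J. M.expectation (?Y n i j))"
   by (intro sum.cong refl) (simp add: sum.delta')
  also have "... \<le> (\<Sum>j\<in>?J. 4 * B\<^sup>2)"
  proof (rule sum_mono)
   fix j assume j: "j \<in> ?J"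
   have "M.expectation (?Y n i j) \<le> M.expectation (\<lambda>w. 4 * B\<^sup>2)"
   proof (rule integral_mono)
    fix w assume "w \<in> space M"
    then have "\<bar>u (x n w i) (x n w j)\<bar> * \<bar>u (x n w i) (x n w j)\<bar> \<le> 2 * B * (2 * B)"
     using i j B by (intro mult_mono ub x_space) auto
    then show "u (x n w i) (x n w j) * u (x n w i) (x n w j) \<le> 4 * B\<^sup>2"
     by (simp add: power2_eq_square flip: abs_mult)
   qed (use i j int_uu in auto)
   then show "M.expectation (?Y n i j) \<le> 4 * B\<^sup>2"
    by (simp add: M.prob_space)
  qed
  also have "... \<le> n * (4 * B\<^sup>2)" using i by (simp add: mult_right_mono)
  finally show "M.expectation (?Q n i) \<le> n * (4 * B\<^sup>2)" .
 qed
 have Rint: "integrable M (?V n i)" and ER: "M.expectation (?V n i) \<le> (1 + 4 * B\<^sup>2) / sqrt n + B / n" if i: "i < n" for n i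
 proof -
  have n: "n > 0" "sqrt (real n) > 0" using i by auto
  have bd: "\<bar>R n w i\<bar> \<le> (1 / sqrt n + (Z n w i)\<^sup>2 / n / sqrt n) + B / n" if om: "w \<in> space M" for w
  proof -
   \<comment> \<open>The natural scale, as \<open>Z\<close> has second moment of order n;
     \<bar>z\<bar> \<le> 1 + z^2 replaces the Cauchy-Schwarz inequality.\<close>
   define z where "z = Z n w i / sqrt n"
   have "\<bar>z\<bar> \<le> 1 + z\<^sup>2" using sum_squares_bound[of 1 "\<bar>z\<bar>"] by (simp add: power2_eq_square) 
   then have "\<bar>z\<bar> / sqrt n \<le> (1 + z\<^sup>2) / sqrt n" by (rule divide_right_mono) simp
   moreover have "\<bar>Z n w i\<bar> / n = \<bar>z\<bar> / sqrt n" by (simp add: z_def abs_divide)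
   moreover have "z\<^sup>2 = (Z n w i)\<^sup>2 / n" by (simp add: z_def power_divide)
   ultimately have "\<bar>Z n w i\<bar> / n \<le> 1 / sqrt n + (Z n w i)\<^sup>2 / n / sqrt n" by (simp add: add_divide_distrib)
   moreover have "\<bar>R n w i\<bar> \<le> \<bar>Z n w i\<bar> / n + \<bar>H (x n w i)\<bar> / n"
    unfolding R_eq[OF i] by (rule order_trans[OF abs_triangle_ineq4]) (simp add: abs_divide)
   moreover have "\<bar>H (x n w i)\<bar> / n \<le> B / n" using Hb[OF x_space[OF om i]] by (rule divide_right_mono) simp
   ultimately show ?thesis by linarith
  qed
  have bint: "integrable M (\<lambda>w. (1 / sqrt n + (Z n w i)\<^sup>2 / n / sqrt n) + B / n)"
   using Z2int[OF i] by auto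
  show Rint: "integrable M (?V n i)"
   using bd i B by (intro B_integrable_bound[OF bint]) (auto intro!: AE_I2 order_trans[OF bd])
  have "M.expectation (?V n i) \<le> M.expectation (\<lambda>w. (1 / sqrt n + (Z n w i)\<^sup>2 / n / sqrt n) + B / n)"
   using bd Rint bint by (intro integral_mono) auto
  also have "... = (1 / sqrt n + M.expectation (?Q n i) / n / sqrt n) + B / n"
   using Z2int[OF i] by (simp add: M.prob_space)
  also have "... \<le> (1 / sqrt n + (n * (4 * B\<^sup>2)) / n / sqrt n) + B / n"
   using Z2[OF i] n by (intro add_mono divide_right_mono) auto
  also have "... = (1 + 4 * B\<^sup>2) / sqrt n + B / n" using n by (simp add: add_divide_distrib)
  finally show "M.expectation (?V n i) \<le> (1 + 4 * B\<^sup>2) / sqrt n + B / n" .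
 qed
 have "conv0 M (\<lambda>n w. (?A n w) / n)"
 proof (rule M.conv0_nn_integral)
  show "(\<lambda>w. (?A n w) / n) \<in> borel_measurable M" for n by measurable
  show "(\<lambda>n. \<integral>\<^sup>+w. ennreal ((?A n w) / n) \<partial>M) \<longlonglongrightarrow> 0"
  proof (rule tendsto_sandwich[OF _ _ tendsto_const])
   show "\<forall>\<^sub>F n in sequentially. (\<integral>\<^sup>+w. ennreal ((?A n w) / n) \<partial>M) \<le> ennreal ((1 + 4 * B\<^sup>2) / sqrt n + B / n)"
   proof (rule eventually_mono[OF eventually_gt_at_top[of 0]])
    fix n :: nat assume n: "0 < n"
    have "(\<integral>\<^sup>+w. ennreal ((?A n w) / n) \<partial>M) = ennreal (M.expectation (\<lambda>w. (?A n w) / n))"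
     by (intro nn_integral_eq_integral Bochner_Integration.integrable_divide B_integrable_sum Rint)
      (auto intro!: divide_nonneg_nonneg sum_nonneg)
    also have "M.expectation (\<lambda>w. (?A n w) / n) = (\<Sum>i<n. M.expectation (?V n i)) / n"
     using Rint by simp
    also have "... \<le> (\<Sum>i<n. (1 + 4 * B\<^sup>2) / sqrt n + B / n) / n"
     by (intro divide_right_mono sum_mono ER) auto
    also have "... = (1 + 4 * B\<^sup>2) / sqrt n + B / n" using n by simp
    finally show "(\<integral>\<^sup>+w. ennreal ((?A n w) / n) \<partial>M) \<le> ennreal ((1 + 4 * B\<^sup>2) / sqrt n + B / n)"
     by (simp add: ennreal_leI)
   qed
   have "(\<lambda>n. (1 + 4 * B\<^sup>2) / sqrt (real n) + B / real n) \<longlonglongrightarrow> 0" by real_asymp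
   then show "(\<lambda>n. ennreal ((1 + 4 * B\<^sup>2) / sqrt (real n) + B / real n)) \<longlonglongrightarrow> 0"
    using tendsto_ennrealI by fastforce
  qed simp
 qed
 then show ?thesis by (simp add: R_def H_def)
qed

text \<open>This is \<open>row_lln\<close> for a kernel that ignores its first argument; the omitted
  diagonal term costs B / n.\<close>

lemma average_lln:
 fixes f :: "'s => real"
 assumes f [measurable]: "f \<in> borel_measurable \<mu>" and b: "\<And>a. a \<in> space \<mu> ==> \<bar>f a\<bar> \<le> B" and B: "B \<ge> 0"
 shows "conv0 M (\<lambda>n w. \<bar>(\<Sum>i<n. f (x n w i)) / n - (\<integral>y. f y \<partial>\<mu>)\<bar>)"
proof -
 let ?O = "\<lambda>n w i. \<Sum>j<n. off_diag (\<lambda>_. f) n (x n w) i j"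
 have "conv0 M (\<lambda>n w. (\<Sum>i<n. \<bar>(?O n w i) - (\<integral>y. f y \<partial>\<mu>)\<bar>) / n)"
  using b B by (intro row_lln[where B = B]) auto
 moreover have "conv0 M (\<lambda>n w. B / real n)"
  by (intro M.conv0_const) real_asymp
 ultimately have "conv0 M (\<lambda>n w. (\<Sum>i<n. \<bar>(?O n w i) - (\<integral>y. f y \<partial>\<mu>)\<bar>) / n + B / real n)"
  by (rule M.conv0_add)
 then show ?thesis
 proof (rule conv0_mono, intro eventually_mono[OF eventually_gt_at_top[of 0]] ballI)
  fix n :: nat and w assume n: "0 < n" and om: "w \<in> space M"
  let ?m = "\<integral>y. f y \<partial>\<mu>" and ?A = "(\<Sum>i<n. f (x n w i)) / n"
  have "\<bar>?A - ?m\<bar> - B / n \<le> \<bar>(?O n w i) - ?m\<bar>" if i: "i < n" for i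
  proof -
   have "(?O n w i) = (\<Sum>j\<in>{..<n} - {i}. f (x n w j) / n)"
    by (intro sum.mono_neutral_cong_right) (auto simp: off_diag_def)
   also have "... = ?A - f (x n w i) / n"
    using i by (simp add: sum_diff1 sum_divide_distrib)
   finally have eq: "(?O n w i) = ?A - f (x n w i) / n" .
   have "\<bar>f (x n w i) / n\<bar> \<le> B / n"
    using b[OF x_space[OF om i]] by (simp add: abs_divide divide_right_mono)
   then show ?thesis unfolding eq by linarith
  qed
  then have "(\<Sum>i<n. \<bar>?A - ?m\<bar> - B / n) \<le> (\<Sum>i<n. \<bar>(?O n w i) - ?m\<bar>)"
   by (intro sum_mono) auto
  then have "(\<Sum>i<n. \<bar>?A - ?m\<bar> - B / n) / n \<le> (\<Sum>i<n. \<bar>(?O n w i) - ?m\<bar>) / n"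
   by (rule divide_right_mono) simp
  moreover have "(\<Sum>i<n. \<bar>?A - ?m\<bar> - B / n) / n = \<bar>?A - ?m\<bar> - B / n" using n by simp
  ultimately show "\<bar>?A - ?m\<bar> \<le> (\<Sum>i<n. \<bar>(?O n w i) - ?m\<bar>) / n + B / real n" by linarith
 qed
qed

text \<open>Two distinct points have the product law. There are n (n - 1) ordered pairs against the
  normalisation n^2, hence an inequality.\<close>

lemma expected_double_sum:
 fixes w :: "'s => 's => real"
 assumes w [measurable]: "(\<lambda>z. w (fst z) (snd z)) \<in> borel_measurable (sqm \<mu>)"
  and nn: "\<And>a b. 0 \<le> w a b" and n: "n > 0"
 shows "(\<lambda>\<omega>. (\<Sum>i<n. \<Sum>j<n. off_diag w n (x n \<omega>) i j) / n) \<in> borel_measurable M"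
  and "(\<integral>\<^sup>+\<omega>. ennreal ((\<Sum>i<n. \<Sum>j<n. off_diag w n (x n \<omega>) i j) / n) \<partial>M) \<le>
   (\<integral>\<^sup>+z. ennreal (w (fst z) (snd z)) \<partial>(sqm \<mu>))"
proof -
 let ?T = "\<lambda>\<omega>. \<Sum>i<n. \<Sum>j<n. ennreal (off_diag w n (x n \<omega>) i j)"
 let ?S = "\<lambda>\<omega>. \<Sum>i<n. \<Sum>j<n. off_diag w n (x n \<omega>) i j"
 have pm: "(\<lambda>\<omega>. (x n \<omega> i, x n \<omega> j)) \<in> M \<rightarrow>\<^sub>M sqm \<mu>" if "i < n" "j < n" for i j
  using that by measurable
 have om: "(\<lambda>\<omega>. off_diag w n (x n \<omega>) i j) \<in> borel_measurable M" if "i < n" "j < n" for i j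
  using measurable_compose[OF pm[OF that] w] by (simp add: off_diag_def)
 then show "(\<lambda>\<omega>. (?S \<omega>) / n) \<in> borel_measurable M"
  by (intro borel_measurable_divide borel_measurable_sum) auto
 let ?I = "\<integral>\<^sup>+z. ennreal (w (fst z) (snd z)) \<partial>(sqm \<mu>)"
 have onn: "0 \<le> off_diag w n y i j" for y i j using nn by (simp add: off_diag_def)
 have pair: "(\<integral>\<^sup>+\<omega>. ennreal (off_diag w n (x n \<omega>) i j) \<partial>M) \<le> ennreal (1 / n) * ?I" if ij: "i < n" "j < n" for i j
 proof (cases "i = j")
  case False
  have "(\<integral>\<^sup>+\<omega>. ennreal (off_diag w n (x n \<omega>) i j) \<partial>M) =
   (\<integral>\<^sup>+\<omega>. ennreal (1 / n) * ennreal (w (fst (x n \<omega> i, x n \<omega> j)) (snd (x n \<omega> i, x n \<omega> j))) \<partial>M)"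
   using False nn by (intro nn_integral_cong) (simp add: off_diag_def flip: ennreal_mult)
  also have "... = (\<integral>\<^sup>+z. ennreal (1 / n) * ennreal (w (fst z) (snd z)) \<partial>(distr M (sqm \<mu>) (\<lambda>\<omega>. (x n \<omega> i, x n \<omega> j))))"
   by (subst nn_integral_distr[OF pm[OF ij]]) auto
  also have "distr M (sqm \<mu>) (\<lambda>\<omega>. (x n \<omega> i, x n \<omega> j)) = sqm \<mu>"
   using ij False by (intro M.indep_pair_distr[OF x_indep]) (auto simp: x_distr)
  also have "(\<integral>\<^sup>+z. ennreal (1 / n) * ennreal (w (fst z) (snd z)) \<partial>(sqm \<mu>)) = ennreal (1 / n) * ?I"
   by (intro nn_integral_cmult) measurable
  finally show ?thesis by simp
 qed (simp add: off_diag_def)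
 have "(\<integral>\<^sup>+\<omega>. ennreal ((?S \<omega>) / n) \<partial>M) =
  (\<integral>\<^sup>+\<omega>. ennreal (1 / n) * (?T \<omega>) \<partial>M)"
  using onn by (intro nn_integral_cong) (simp add: sum_nonneg flip: ennreal_mult)
 also have "... = ennreal (1 / n) * (\<integral>\<^sup>+\<omega>. (?T \<omega>) \<partial>M)"
  using om by (intro nn_integral_cmult borel_measurable_sum measurable_compose[OF _ measurable_ennreal]) auto
 also have "... \<le> ennreal (1 / n) * (ennreal n * ?I)"
 proof (rule mult_left_mono)
  have "(\<integral>\<^sup>+\<omega>. (?T \<omega>) \<partial>M) =
   (\<Sum>i<n. \<Sum>j<n. (\<integral>\<^sup>+\<omega>. ennreal (off_diag w n (x n \<omega>) i j) \<partial>M))"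
   using om by (subst nn_integral_sum) (auto intro!: sum.cong nn_integral_sum borel_measurable_sum measurable_compose[OF _ measurable_ennreal])
  also have "... \<le> (\<Sum>i<n. \<Sum>j<n. ennreal (1 / n) * ?I)" by (intro sum_mono pair) auto
  also have "... = ennreal (real n) * (ennreal (real n) * ennreal (1 / n)) * ?I"
   by (simp add: mult.assoc flip: ennreal_of_nat_eq_real_of_nat)
  also have "... = ennreal n * ?I" using n by (simp flip: ennreal_mult)
  finally show "(\<integral>\<^sup>+\<omega>. (?T \<omega>) \<partial>M) \<le> ennreal n * ?I" .
 qed simp
 also have "... = ?I" using n by (simp add: mult.assoc[symmetric] flip: ennreal_mult)
 finally show "(\<integral>\<^sup>+\<omega>. ennreal ((?S \<omega>) / n) \<partial>M) \<le> ?I" .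
qed

end

section \<open>Truncated kernels and the independent vertex space\<close>

lemma (in ker) truncation_ker: "0 \<le> K ==> ker \<mu> (\<lambda>a b. min (\<kappa> a b) K)"
proof (unfold_locales, unfold kernel_def symker_def, intro conjI ballI)
 assume K: "0 \<le> K"
 show "type_space \<mu>" using kernel by (simp add: kernel_def)
 show "(\<lambda>z. min (\<kappa> (fst z) (snd z)) K) \<in> borel_measurable (sqm \<mu>)" by measurable
 show "integrable (sqm \<mu>) (\<lambda>z. min (\<kappa> (fst z) (snd z)) K)"
  using K by (intro B_integrable_bound[OF kernel_integrable2])
   (auto simp: space_pair_measure kernel_nonneg intro!: AE_I2)
 show "(\<integral>\<^sup>+y. ennreal (min (\<kappa> x y) K) \<partial>\<mu>) < \<infinity>" if "x \<in> space \<mu>" for x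
 proof -
  have "(\<integral>\<^sup>+y. ennreal (min (\<kappa> x y) K) \<partial>\<mu>) \<le> (\<integral>\<^sup>+y. ennreal (\<kappa> x y) \<partial>\<mu>)"
   by (intro nn_integral_mono ennreal_leI) auto
  also have "... < \<infinity>" using offmass_eq[OF that] by simp
  finally show ?thesis .
 qed
 show "min (\<kappa> x y) K = min (\<kappa> y x) K" if "x \<in> space \<mu>" "y \<in> space \<mu>" for x y
  using kernel_sym[OF that] by simp
 show "0 \<le> min (\<kappa> x y) K" if "x \<in> space \<mu>" "y \<in> space \<mu>" for x y
  using kernel_nonneg[OF that] K by simp
qed

lemma (in ker) truncation_kdist:
 assumes "e > 0"
 obtains K :: nat where "kdist (\<lambda>a b. min (\<kappa> a b) K) \<le> e"
proof -
 have "(\<lambda>K::nat. kdist (\<lambda>a b. min (\<kappa> a b) K)) \<longlonglongrightarrow> (\<integral>z. 0 \<partial>(sqm \<mu>))"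
 proof (rule integral_dominated_convergence[OF _ _ kernel_integrable2])
  show "AE z in sqm \<mu>. (\<lambda>K. \<bar>\<kappa> (fst z) (snd z) - min (\<kappa> (fst z) (snd z)) (real K)\<bar>) \<longlonglongrightarrow> 0"
  proof (rule AE_I2)
   fix z
   obtain K where "\<kappa> (fst z) (snd z) \<le> real K" using real_arch_simple by blast
   then have "\<forall>\<^sub>F k in sequentially. \<bar>\<kappa> (fst z) (snd z) - min (\<kappa> (fst z) (snd z)) (real k)\<bar> = 0"
    by (intro eventually_sequentiallyI[of K]) auto
   then show "(\<lambda>k. \<bar>\<kappa> (fst z) (snd z) - min (\<kappa> (fst z) (snd z)) (real k)\<bar>) \<longlonglongrightarrow> 0" by (rule tendsto_eventually)
  qed
  show "AE z in sqm \<mu>. norm \<bar>\<kappa> (fst z) (snd z) - min (\<kappa> (fst z) (snd z)) (real K)\<bar> \<le> \<kappa> (fst z) (snd z)" for K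
   by (rule AE_I2) (auto simp: space_pair_measure kernel_nonneg)
 qed auto
 then have "\<forall>\<^sub>F K in sequentially. kdist (\<lambda>a b. min (\<kappa> a b) (real K)) < e"
  using assms by (intro order_tendstoD(2)) auto
 then obtain K :: nat where "kdist (\<lambda>a b. min (\<kappa> a b) K) < e"
  using eventually_happens[of _ sequentially] by auto
 then show ?thesis by (intro that[of K]) simp
qed

theorem suscept_concl_iid:
 fixes ks :: "nat => 's => 's => real"
 assumes V: "iid_vertex_space \<mu> M x" and k: "kernel \<mu> \<kappa>" and ks: "\<And>n. symker \<mu> (ks n)"
  and L1: "(\<lambda>n. \<integral>\<^sup>+z. ennreal \<bar>ks n (fst z) (snd z) - \<kappa> (fst z) (snd z)\<bar> \<partial>(sqm \<mu>)) \<longlonglongrightarrow> 0"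
 shows "suscept_concl \<mu> \<kappa> M (\<lambda>n \<omega>. n) (\<lambda>n \<omega> i j. min (ks n (x n \<omega> i) (x n \<omega> j) / real n) 1)"
proof -
 interpret iid_points M \<mu> x using V by (simp add: iid_vertex_space_def iid_points_def iid_points_axioms_def)
 interpret ker \<mu> \<kappa> by unfold_locales (rule k)
 interpret SS: pair_prob_space \<mu> \<mu> ..
 define \<K> where "\<K> = {\<lambda>a b. min (\<kappa> a b) (real K) | K. True}"
 have Kk: "ker \<mu> \<kappa>'" if "\<kappa>' \<in> \<K>" for \<kappa>' using that truncation_ker by (auto simp: \<K>_def)
 have Kb: "\<exists>B\<ge>0. \<forall>x\<in>space \<mu>. \<forall>y\<in>space \<mu>. \<kappa>' x y \<le> B" if "\<kappa>' \<in> \<K>" for \<kappa>'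
 proof -
  from that obtain K :: nat where "\<kappa>' = (\<lambda>a b. min (\<kappa> a b) (real K))" by (auto simp: \<K>_def)
  then show ?thesis by (intro exI[of _ "real K"]) auto
 qed
 have ksm [measurable]: "(\<lambda>z. ks n (fst z) (snd z)) \<in> borel_measurable (sqm \<mu>)" for n
  using ks[of n] by (simp add: symker_def)
 have ksn: "0 \<le> ks n a b" "ks n a b = ks n b a" if "a \<in> space \<mu>" "b \<in> space \<mu>" for n a b
  using ks[of n] that unfolding symker_def by blast+
 define p where "p n \<omega> i j = (if i = j then 0 else min (ks n (x n \<omega> i) (x n \<omega> j) / real n) 1)" for n \<omega> i j
 have bounded_lln: "conv0 M (\<lambda>n \<omega>. (\<Sum>i<n. \<bar>(\<Sum>j<n. off_diag h n (x n \<omega>) i j) - (\<integral>y. h (x n \<omega> i) y \<partial>\<mu>)\<bar>) / n)"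
  if "(\<lambda>z. h (fst z) (snd z)) \<in> borel_measurable (sqm \<mu>)"
   "\<And>a b. a \<in> space \<mu> ==> b \<in> space \<mu> ==> 0 \<le> h a b \<and> h a b \<le> B" "B \<ge> 0" for h B
  using that by (intro row_lln[where B = B]) auto
 have double: "whp M (\<lambda>n \<omega>. (\<Sum>i<n. \<Sum>j<n. off_diag (\<lambda>a b. \<bar>\<kappa>2 a b - \<kappa>1 a b\<bar>) n (x n \<omega>) i j) / n
    \<le> (\<integral>z. \<bar>\<kappa>2 (fst z) (snd z) - \<kappa>1 (fst z) (snd z)\<bar> \<partial>(sqm \<mu>)) + e)"
  if k1: "\<kappa>1 \<in> \<K>" and k2: "\<kappa>2 \<in> \<K>" and e: "e > 0" for \<kappa>1 \<kappa>2 e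
 proof -
  interpret k1: ker \<mu> \<kappa>1 by (rule Kk[OF k1])
  interpret k2: ker \<mu> \<kappa>2 by (rule Kk[OF k2])
  obtain B1 B2 where B: "B1 \<ge> 0" "B2 \<ge> 0" "\<And>a b. a \<in> space \<mu> ==> b \<in> space \<mu> ==> \<kappa>1 a b \<le> B1"
    "\<And>a b. a \<in> space \<mu> ==> b \<in> space \<mu> ==> \<kappa>2 a b \<le> B2"
   using Kb[OF k1] Kb[OF k2] by blast
  let ?h = "\<lambda>a b. \<bar>\<kappa>2 a b - \<kappa>1 a b\<bar>" and ?H = "\<lambda>a. \<integral>b. \<bar>\<kappa>2 a b - \<kappa>1 a b\<bar> \<partial>\<mu>"
  have hb: "0 \<le> ?h a b \<and> ?h a b \<le> B1 + B2" if "a \<in> space \<mu>" "b \<in> space \<mu>" for a b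
   using B(3,4)[OF that] k1.kernel_nonneg[OF that] k2.kernel_nonneg[OF that] B(1,2) by linarith
  have hm: "(\<lambda>(a, b). ?h a b) \<in> borel_measurable (sqm \<mu>)" by (simp add: case_prod_unfold)
  have hi: "integrable (sqm \<mu>) (\<lambda>(a, b). ?h a b)"
   unfolding case_prod_unfold by (intro integrable_abs B_integrable_diff k1.kernel_integrable2 k2.kernel_integrable2)
  have Hb: "\<bar>?H a\<bar> \<le> B1 + B2" if a: "a \<in> space \<mu>" for a
  proof -
   have "?H a \<le> (\<integral>b. B1 + B2 \<partial>\<mu>)"
    using a hb k1.kernel_integrable[OF a] k2.kernel_integrable[OF a] by (intro integral_mono) auto
   then show ?thesis by (simp add: S.prob_space)
  qed
  have "conv0 M (\<lambda>n \<omega>. \<bar>(\<Sum>i<n. \<Sum>j<n. off_diag ?h n (x n \<omega>) i j) / n - (\<integral>a. ?H a \<partial>\<mu>)\<bar>)"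
  proof (rule M.double_sum_lln)
   show "conv0 M (\<lambda>n \<omega>. (\<Sum>i<n. \<bar>(\<Sum>j<n. off_diag ?h n (x n \<omega>) i j) - ?H (x n \<omega> i)\<bar>) / n)"
    by (rule bounded_lln[of ?h "B1 + B2"]) (use hb B in auto)
   have Hm: "?H \<in> borel_measurable \<mu>" using hm by (rule S.borel_measurable_lebesgue_integral)
   show "conv0 M (\<lambda>n \<omega>. \<bar>(\<Sum>i<n. ?H (x n \<omega> i)) / n - (\<integral>a. ?H a \<partial>\<mu>)\<bar>)"
    by (rule average_lln[OF Hm Hb]) (use B in auto)
  qed
  moreover have "(\<integral>a. ?H a \<partial>\<mu>) = (\<integral>z. ?h (fst z) (snd z) \<partial>(sqm \<mu>))"
   using SS.integral_fst[OF hi] by (simp add: case_prod_unfold)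
  ultimately have "conv0 M (\<lambda>n \<omega>. \<bar>(\<Sum>i<n. \<Sum>j<n. off_diag ?h n (x n \<omega>) i j) / n - (\<integral>z. ?h (fst z) (snd z) \<partial>(sqm \<mu>))\<bar>)"
   by (simp only:)
  from conv0D[OF this e] show ?thesis
   by (rule whp_mono) (auto intro!: always_eventually)
 qed
 have E: "\<exists>\<kappa>'\<in>\<K>. kdist \<kappa>' \<le> e \<and> (\<forall>\<^sub>F n in sequentially. \<exists>S\<in>sets M. 1 - c \<le> measure M S \<and>
   (\<forall>\<omega>\<in>S. mdist n n (p n \<omega>) (off_diag \<kappa>' n (x n \<omega>)) \<le> e))"
  if e: "e > 0" and d: "c > 0" for e c
 proof -
  have "min e (e * c / 2) > 0" using e d by simp
  then obtain K :: nat where K: "kdist (\<lambda>a b. min (\<kappa> a b) K) \<le> min e (e * c / 2)" by (rule truncation_kdist)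
  let ?k = "\<lambda>a b. min (\<kappa> a b) (real K)"
  interpret k': ker \<mu> ?k by (rule truncation_ker) simp
  have "ennreal (e * c / 2) > 0" using e d by simp
  from order_tendstoD(2)[OF L1 this]
  have "\<forall>\<^sub>F n in sequentially. \<exists>S\<in>sets M. 1 - c \<le> measure M S \<and>
   (\<forall>\<omega>\<in>S. mdist n n (p n \<omega>) (off_diag ?k n (x n \<omega>)) \<le> e)"
   using eventually_ge_at_top[of "max 1 K"]
  proof eventually_elim
   case (elim n)
   then have n: "n > 0" "K \<le> n" by auto
   \<comment> \<open>Both parts have integral at most e c / 2, so Markov's inequality at level e
     leaves failure probability c.\<close>
   let ?w = "\<lambda>a b. \<bar>ks n a b - \<kappa> a b\<bar> + \<bar>\<kappa> a b - ?k a b\<bar>"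
   have wm: "(\<lambda>z. ?w (fst z) (snd z)) \<in> borel_measurable (sqm \<mu>)" by measurable
   have "(\<integral>\<^sup>+z. ennreal (?w (fst z) (snd z)) \<partial>(sqm \<mu>)) =
    (\<integral>\<^sup>+z. ennreal \<bar>ks n (fst z) (snd z) - \<kappa> (fst z) (snd z)\<bar> \<partial>(sqm \<mu>)) +
    (\<integral>\<^sup>+z. ennreal \<bar>\<kappa> (fst z) (snd z) - ?k (fst z) (snd z)\<bar> \<partial>(sqm \<mu>))"
    by (subst nn_integral_add[symmetric]) auto
   also have "(\<integral>\<^sup>+z. ennreal \<bar>\<kappa> (fst z) (snd z) - ?k (fst z) (snd z)\<bar> \<partial>(sqm \<mu>)) = ennreal (kdist ?k)"
    by (intro nn_integral_eq_integral integrable_abs B_integrable_diff kernel_integrable2 k'.kernel_integrable2) auto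
   finally have W: "(\<integral>\<^sup>+z. ennreal (?w (fst z) (snd z)) \<partial>(sqm \<mu>)) \<le> ennreal (e * c / 2) + ennreal (e * c / 2)"
    using elim K by (auto intro!: add_mono ennreal_leI)
   have "(\<integral>\<^sup>+\<omega>. ennreal ((\<Sum>i<n. \<Sum>j<n. off_diag ?w n (x n \<omega>) i j) / n) \<partial>M) \<le> ennreal (e * c)"
   proof (rule order_trans[OF expected_double_sum(2)[OF wm _ n(1)] order_trans[OF W]])
    show "ennreal (e * c / 2) + ennreal (e * c / 2) \<le> ennreal (e * c)"
     using e d by (subst ennreal_plus[symmetric]) auto
   qed simp
   from M.markov_set[OF expected_double_sum(1)[OF wm _ n(1)] this] e d
   obtain S where S: "S \<in> sets M" "1 - c \<le> M.prob S" "\<forall>\<omega>\<in>S. (\<Sum>i<n. \<Sum>j<n. off_diag ?w n (x n \<omega>) i j) / n \<le> e"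
    by auto
   have "mdist n n (p n \<omega>) (off_diag ?k n (x n \<omega>)) \<le> e" if om: "\<omega> \<in> S" for \<omega>
   proof -
    have "\<bar>p n \<omega> i j - off_diag ?k n (x n \<omega>) i j\<bar> \<le> off_diag ?w n (x n \<omega>) i j" for i j
    proof -
     \<comment> \<open>Capping the edge probability at 1 means capping the kernel at n. Since K
       \<le> n, this cap costs no more than the truncation at K.\<close>
     have m1: "min (a / n) 1 = min a n / n" for a :: real using n by (auto simp: min_def field_simps)
     have m2: "\<bar>min a n - min b K\<bar> \<le> \<bar>a - b\<bar> + \<bar>b - min b K\<bar>" for a b :: real using n by linarith
     show ?thesis
      unfolding p_def off_diag_def m1
      using m2 by (auto simp: abs_divide divide_right_mono simp flip: diff_divide_distrib)
    qed
    then have "mdist n n (p n \<omega>) (off_diag ?k n (x n \<omega>)) \<le> (\<Sum>i<n. \<Sum>j<n. off_diag ?w n (x n \<omega>) i j) / n"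
     by (intro divide_right_mono sum_mono) auto
    also have "... \<le> e" using S(3) om by blast
    finally show ?thesis .
   qed
   with S show ?case by blast
  qed
  with K show ?thesis by (intro bexI[of _ ?k]) (auto simp: \<K>_def)
 qed
 have "vertex_approx M \<mu> \<kappa> (\<lambda>n \<omega>. n) x p \<K>"
 proof (rule vertex_approx.intro[OF M.prob_space_axioms ker_axioms vertex_approx_axioms.intro])
  fix n \<omega> assume om: "\<omega> \<in> space M"
  show "edge_prob n (p n \<omega>)"
  proof
   show "p n \<omega> i j = p n \<omega> j i" if "i < n" "j < n" for i j
    using ksn(2)[OF x_space[OF om that(1)] x_space[OF om that(2)], of n] by (simp add: p_def)
  qed (use x_space[OF om] ksn in \<open>auto simp: p_def\<close>)
 next
  have "conv0 M (\<lambda>n \<omega>. \<bar>real n / n - 1\<bar>)"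
   by (rule M.conv0_const, rule tendsto_eventually, rule eventually_mono[OF eventually_gt_at_top[of 0]]) simp
  then show "conv0 M (\<lambda>n \<omega>. \<bar>real n / n - total\<bar>)" by (simp add: S.prob_space)
 next
  fix \<kappa>' s d assume k': "\<kappa>' \<in> \<K>" and s: "0 < s" "s < (1::real)"
  interpret k': ker \<mu> \<kappa>' by (rule Kk[OF k'])
  obtain B where B: "B \<ge> 0" "\<And>a b. a \<in> space \<mu> ==> b \<in> space \<mu> ==> \<kappa>' a b \<le> B" using Kb[OF k'] by blast
  have g: "0 \<le> bp_pgf \<mu> \<kappa>' s d y" "bp_pgf \<mu> \<kappa>' s d y \<le> 1" if "y \<in> space \<mu>" for y
   using k'.bp_pgf_bounds1[OF _ _ that] s by auto
  show "conv0 M (\<lambda>n \<omega>. (\<Sum>i<n. \<bar>(\<Sum>j<n. off_diag (\<lambda>a b. \<kappa>' a b * (1 - bp_pgf \<mu> \<kappa>' s d b)) n (x n \<omega>) i j)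
    - (\<integral>y. \<kappa>' (x n \<omega> i) y * (1 - bp_pgf \<mu> \<kappa>' s d y) \<partial>\<mu>)\<bar>) / n)"
  proof (rule bounded_lln)
   fix a b assume ab: "a \<in> space \<mu>" "b \<in> space \<mu>"
   have "\<kappa>' a b * (1 - bp_pgf \<mu> \<kappa>' s d b) \<le> \<kappa>' a b" using g[OF ab(2)] k'.kernel_nonneg[OF ab] by (intro mult_left_le) auto
   then show "0 \<le> \<kappa>' a b * (1 - bp_pgf \<mu> \<kappa>' s d b) \<and> \<kappa>' a b * (1 - bp_pgf \<mu> \<kappa>' s d b) \<le> B"
    using g[OF ab(2)] k'.kernel_nonneg[OF ab] B(2)[OF ab] by auto
  qed (use B in auto)
  show "conv0 M (\<lambda>n \<omega>. \<bar>(\<Sum>i<n. bp_pgf \<mu> \<kappa>' s d (x n \<omega> i)) / n - (\<integral>y. bp_pgf \<mu> \<kappa>' s d y \<partial>\<mu>)\<bar>)"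
   by (rule average_lln[where B = 1]) (use g in auto)
 next
  fix e :: real assume "e > 0"
  show "\<exists>\<kappa>'\<in>\<K>. kdist \<kappa>' \<le> e \<and>
    whp M (\<lambda>n \<omega>. mdist n n (p n \<omega>) (off_diag \<kappa>' n (x n \<omega>)) \<le> e)"
   by (rule approx_whp[OF M.prob_space_axioms Kk double E \<open>e > 0\<close>])
 qed (rule x_space Kk Kb; assumption)+
 then have "suscept_concl \<mu> \<kappa> M (\<lambda>n \<omega>. n) p" by (rule vertex_approx.conclusion)
 then show ?thesis unfolding p_def by (rule suscept_concl_diag[THEN iffD2])
qed

section \<open>Generalized vertex spaces\<close>

lemma sum_symmetric_off_diag:
 fixes f :: "nat => nat => real"
 assumes "\<And>i j. f i j = f j i" "\<And>i. f i i = 0"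
 shows "(\<Sum>i<N. \<Sum>j<N. f i j) = 2 * (\<Sum>j<N. \<Sum>i<j. f i j)"
proof (induction N)
 case (Suc N)
 have "(\<Sum>j<N. f N j) = (\<Sum>j<N. f j N)" by (intro sum.cong refl) (rule assms(1))
 with Suc show ?case by (simp add: sum.distrib assms(2))
qed simp

text \<open>The class for which weak convergence of the empirical measure yields laws of large
  numbers for rows and double sums: the Lipschitz bound makes finitely many centres sufficient, and
  boundedness pays for the points far from all of them.\<close>

definition bounded_lipschitz :: "('s::metric_space => 's => real) => bool" where
 "bounded_lipschitz h \<longleftrightarrow> (\<exists>B\<ge>0. \<forall>a b. \<bar>h a b\<bar> \<le> B) \<and>
  (\<exists>L\<ge>0. \<forall>a b a' b'. \<bar>h a b - h a' b'\<bar> \<le> L * (dist a a' + dist b b'))"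

lemma bounded_lipschitz_continuous:
 assumes "bounded_lipschitz h"
 shows "continuous_on UNIV (\<lambda>z. h (fst z) (snd z))"
proof -
 from assms obtain L where L: "L \<ge> 0" "\<And>a b a' b'. \<bar>h a b - h a' b'\<bar> \<le> L * (dist a a' + dist b b')"
  by (auto simp: bounded_lipschitz_def)
 have "(2 * L)-lipschitz_on UNIV (\<lambda>z. h (fst z) (snd z))"
 proof (rule lipschitz_onI)
  fix z w
  have "dist (h (fst z) (snd z)) (h (fst w) (snd w)) \<le> L * (dist (fst z) (fst w) + dist (snd z) (snd w))"
   using L(2) by (simp add: dist_real_def)
  also have "... \<le> L * (dist z w + dist z w)"
   using L(1) by (intro mult_left_mono add_mono dist_fst_le dist_snd_le) auto
  finally show "dist (h (fst z) (snd z)) (h (fst w) (snd w)) \<le> 2 * L * dist z w" by simp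
 qed (use L in simp)
 then show ?thesis by (rule lipschitz_on_continuous_on)
qed

lemma bounded_lipschitz_abs_diff:
 assumes "bounded_lipschitz g" "bounded_lipschitz h"
 shows "bounded_lipschitz (\<lambda>a b. \<bar>g a b - h a b\<bar>)"
proof -
 from assms obtain B C L K where B: "B \<ge> 0" "\<And>a b. \<bar>g a b\<bar> \<le> B" and C: "C \<ge> 0" "\<And>a b. \<bar>h a b\<bar> \<le> C"
  and L: "L \<ge> 0" "\<And>a b a' b'. \<bar>g a b - g a' b'\<bar> \<le> L * (dist a a' + dist b b')"
  and K: "K \<ge> 0" "\<And>a b a' b'. \<bar>h a b - h a' b'\<bar> \<le> K * (dist a a' + dist b b')"
  unfolding bounded_lipschitz_def by metis
 have "\<bar>\<bar>g a b - h a b\<bar>\<bar> \<le> B + C" for a b using B(2)[of a b] C(2)[of a b] by linarith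
 then show ?thesis unfolding bounded_lipschitz_def
 proof (intro conjI[OF exI[of _ "B + C"] exI[of _ "L + K"]] conjI allI)
  fix a b a' b'
  show "\<bar>\<bar>g a b - h a b\<bar> - \<bar>g a' b' - h a' b'\<bar>\<bar> \<le> (L + K) * (dist a a' + dist b b')"
   using L(2)[of a b a' b'] K(2)[of a b a' b'] unfolding distrib_right[of L K] by linarith
 qed (use B C L K in auto)
qed

section \<open>Laws of large numbers under weak convergence\<close>

locale vertex_points = ker \<mu> \<kappa>
 for \<mu> :: "'s::{metric_space,second_countable_topology} measure" and \<kappa> +
 fixes M :: "'w measure" and v :: "nat => 'w => nat" and x :: "nat => 'w => nat => 's"
 assumes V: "gen_vertex_space \<mu> M v x"
begin

sublocale M: prob_space M
 using V by (simp add: gen_vertex_space_def)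

lemma sets_eq [measurable_cong]: "sets \<mu> = sets borel"
 using V by (simp add: gen_vertex_space_def)

lemma space_eq [simp]: "space \<mu> = UNIV"
 using sets_eq_imp_space_eq[OF sets_eq] by simp

lemma sets_pair_eq: "sets (sqm \<mu>) = sets borel"
 unfolding borel_prod[symmetric] by (rule sets_pair_measure_cong[OF sets_eq sets_eq])

lemma v_measurable [measurable]: "v n \<in> M \<rightarrow>\<^sub>M count_space UNIV"
 and x_measurable [measurable]: "(\<lambda>w. x n w i) \<in> M \<rightarrow>\<^sub>M borel"
 using V by (auto simp: gen_vertex_space_def)

text \<open>The number of summands is random; it takes countably many values, over which the
  function is pieced together.\<close>

lemma random_sum_measurable:
 assumes "\<And>k. (\<lambda>w. g k w) \<in> borel_measurable M"
 shows "(\<lambda>w. g (v n w) w :: real) \<in> borel_measurable M"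
 by (rule measurable_compose_countable[OF assms v_measurable])

lemma average_lln:
 fixes f :: "'s => real"
 assumes f: "continuous_on UNIV f" and b: "\<And>a. \<bar>f a\<bar> \<le> B"
 shows "conv0 M (\<lambda>n w. \<bar>(\<Sum>i<v n w. f (x n w i)) / n - (\<integral>y. f y \<partial>\<mu>)\<bar>)"
 unfolding conv0_def
proof (intro allI impI M.whp_measureI always_eventually)
 have [measurable]: "f \<in> borel_measurable borel" using f by (rule borel_measurable_continuous_onI)
 have bd: "bounded (range f)" using b by (auto simp: bounded_iff)
 fix e :: real assume "e > 0"
 then show "(\<lambda>n. measure M {w \<in> space M. \<not> \<bar>(\<Sum>i<v n w. f (x n w i)) / n - (\<integral>y. f y \<partial>\<mu>)\<bar> \<le> e}) \<longlonglongrightarrow> 0"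
  using V f bd by (simp add: gen_vertex_space_def not_le)
 have "(\<lambda>w. \<Sum>i<v n w. f (x n w i)) \<in> borel_measurable M" for n
  by (rule random_sum_measurable) measurable
 then show "{w \<in> space M. \<not> \<bar>(\<Sum>i<v n w. f (x n w i)) / n - (\<integral>y. f y \<partial>\<mu>)\<bar> \<le> e} \<in> M.events" for n
  by measurable
qed

lemma v_lim: "conv0 M (\<lambda>n w. \<bar>real (v n w) / n - total\<bar>)"
 using average_lln[of "\<lambda>_. 1" 1] by simp

lemma v_le: "whp M (\<lambda>n w. real (v n w) / n \<le> total + 1)"
proof (rule whp_mono[OF conv0D[OF v_lim, of 1]])
 show "\<forall>\<^sub>F n in sequentially. \<forall>w\<in>space M. \<bar>real (v n w) / n - total\<bar> \<le> 1 \<longrightarrow> real (v n w) / n \<le> total + 1"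
  by (intro always_eventually) force
qed simp

text \<open>The functions r A are continuous, equal to 1 outside the balls of radius delta around the first A points
 of a dense sequence, and decrease to 0: they carry the loss of tightness.\<close>
lemma row_lln:
 fixes g :: "'s => 's => real"
 assumes b: "\<And>a b. \<bar>g a b\<bar> \<le> B" and B: "B \<ge> 0"
  and lip: "\<And>a a' b. \<bar>g a b - g a' b\<bar> \<le> L * dist a a'" and L: "L \<ge> 0"
  and cont: "\<And>a. continuous_on UNIV (g a)"
 shows "conv0 M (\<lambda>n w. (\<Sum>i<v n w. \<bar>(\<Sum>j<v n w. off_diag g n (x n w) i j) - (\<integral>y. g (x n w i) y \<partial>\<mu>)\<bar>) / n)"
 unfolding conv0_def
proof (intro allI impI)
 fix e :: real assume e: "e > 0"
 define T where "T = total + 1"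
 have T: "T > 0" using total_pos by (simp add: T_def)
 define B' where "B' = B * (T + T)"
 define L' where "L' = L * (T + T)"
 have B'L': "B' \<ge> 0" "L' \<ge> 0" using B L T by (auto simp: B'_def L'_def)
 \<comment> \<open>The constants give four shares e / 4: the deviation at the centres, the Lipschitz
   error within radius \<delta>, the points far from the centres, and the diagonal. The extra
   division by 2 in \<epsilon>2 is there because both the integral of \<open>r A\<close> and the
   deviation of its average are bounded by \<epsilon>2.\<close>
 define \<epsilon>1 where "\<epsilon>1 = e / (4 * T)"
 define \<epsilon>2 where "\<epsilon>2 = e / (4 * (B' + 1)) / 2"
 define \<delta> where "\<delta> = e / (4 * T * (L' + 1))"
 let ?c = "\<epsilon>1 + L' * \<delta>"
 have pos: "\<epsilon>1 > 0" "\<epsilon>2 > 0" "\<delta> > 0" using e T B'L' by (auto simp: \<epsilon>1_def \<epsilon>2_def \<delta>_def)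
 have gm [measurable]: "g a \<in> borel_measurable borel" for a using cont by (rule borel_measurable_continuous_onI)
 have gi: "integrable \<mu> (g a)" for a using b by (intro integrable_const_bound[of _ B]) auto
 obtain C :: "'s set" where C: "countable C" "\<And>X. open X ==> X \<noteq> {} ==> \<exists>d\<in>C. d \<in> X"
  by (rule countable_dense_setE) blast
 have "C \<noteq> {}" using C(2)[of UNIV] by auto
 define c where "c = from_nat_into C"
 have c: "\<exists>k. dist a (c k) < r" if "r > 0" for a r
 proof -
  have "ball a r \<noteq> {}" using that by simp
  then obtain d where "d \<in> C" "d \<in> ball a r" using C(2)[OF open_ball] by blast
  then show ?thesis using from_nat_into_surj[OF C(1), of d] by (auto simp: c_def)
 qed
 define \<phi> where "\<phi> t = min 1 (max 0 (2 * t / \<delta> - 1))" for t :: real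
 define r where "r A a = (\<Prod>k<A. \<phi> (dist a (c k)))" for A a
 have \<phi>: "0 \<le> \<phi> t" "\<phi> t \<le> 1" for t by (auto simp: \<phi>_def)
 have \<phi>1: "\<phi> t = 1" if "t \<ge> \<delta>" for t
 proof -
  have "2 \<le> 2 * t / \<delta>" using that pos by (simp add: pos_le_divide_eq)
  then show ?thesis by (simp add: \<phi>_def)
 qed
 have \<phi>0: "\<phi> t = 0" if "t < \<delta> / 2" for t
 proof -
  have "2 * t / \<delta> \<le> 1" using that pos by (simp add: pos_divide_le_eq)
  then show ?thesis by (simp add: \<phi>_def)
 qed
 have r: "0 \<le> r A a" "r A a \<le> 1" for A a
  unfolding r_def using \<phi> by (auto intro: prod_nonneg prod_le_1)
 have rc: "continuous_on UNIV (r A)" for A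
  unfolding r_def[abs_def] \<phi>_def using pos by (intro continuous_intros) auto
 have rm [measurable]: "r A \<in> borel_measurable borel" for A using rc by (rule borel_measurable_continuous_onI)
 have "(\<lambda>A. \<integral>a. r A a \<partial>\<mu>) \<longlonglongrightarrow> (\<integral>a. 0 \<partial>\<mu>)"
 proof (rule integral_dominated_convergence[where w = "\<lambda>_. 1"])
  show "AE a in \<mu>. (\<lambda>A. r A a) \<longlonglongrightarrow> 0"
  proof (rule AE_I2)
   fix a
   obtain k where k: "dist a (c k) < \<delta> / 2" using c[of "\<delta> / 2"] pos by auto
   have "r A a = 0" if "A \<ge> Suc k" for A
    unfolding r_def using \<phi>0[OF k] that by (intro prod_zero) (auto intro!: bexI[of _ k])
   then show "(\<lambda>A. r A a) \<longlonglongrightarrow> 0"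
    by (intro tendsto_eventually eventually_sequentiallyI[of "Suc k"])
  qed
 qed (use r in auto)
 then have "\<forall>\<^sub>F A in sequentially. (\<integral>a. r A a \<partial>\<mu>) < \<epsilon>2" using pos by (intro order_tendstoD(2)) auto
 then obtain A where A: "(\<integral>a. r A a \<partial>\<mu>) < \<epsilon>2" using eventually_happens[of _ sequentially] by auto
 \<comment> \<open>The deviation as a function of the first argument. It is Lipschitz with constant
   \<open>L'\<close> whatever the sampled points are, so smallness at finitely many centres spreads
   to their \<delta>-balls.\<close>
 define \<psi> where "\<psi> n w a = (\<Sum>j<v n w. g a (x n w j)) / n - (\<integral>y. g a y \<partial>\<mu>)" for n w a
 have \<psi>0: "conv0 M (\<lambda>n w. \<Sum>k<A. \<bar>\<psi> n w (c k)\<bar>)"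
  unfolding \<psi>_def by (intro M.conv0_sum average_lln[OF cont b]) auto
 have r0: "conv0 M (\<lambda>n w. \<bar>(\<Sum>i<v n w. r A (x n w i)) / n - (\<integral>a. r A a \<partial>\<mu>)\<bar>)"
  by (rule average_lln[OF rc, where B = 1]) (use r in auto)
 have ev: "\<forall>\<^sub>F n in sequentially. B * T / real n \<le> e / 4"
 proof -
  have "(\<lambda>n. B * T / real n) \<longlonglongrightarrow> 0" by (rule lim_const_over_n)
  from order_tendstoD(2)[OF this, of "e / 4"] show ?thesis using e by (auto elim: eventually_mono)
 qed
 show "whp M (\<lambda>n w. (\<Sum>i<v n w. \<bar>(\<Sum>j<v n w. off_diag g n (x n w) i j) - (\<integral>y. g (x n w i) y \<partial>\<mu>)\<bar>) / n \<le> e)"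
 proof (rule whp_mono[OF M.whp_conj[OF v_le M.whp_conj[OF conv0D[OF \<psi>0 pos(1)] conv0D[OF r0 pos(2)]]]],
   rule eventually_mono[OF ev], intro ballI impI)
  fix n w assume n: "B * T / real n \<le> e / 4"
  assume "real (v n w) / n \<le> total + 1 \<and> (\<Sum>k<A. \<bar>\<psi> n w (c k)\<bar>) \<le> \<epsilon>1 \<and>
   \<bar>(\<Sum>i<v n w. r A (x n w i)) / n - (\<integral>a. r A a \<partial>\<mu>)\<bar> \<le> \<epsilon>2"
  then have vT: "real (v n w) / n \<le> T" and s1: "(\<Sum>k<A. \<bar>\<psi> n w (c k)\<bar>) \<le> \<epsilon>1"
   and s2: "(\<Sum>i<v n w. r A (x n w i)) / n \<le> 2 * \<epsilon>2" using A unfolding T_def by linarith+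
  let ?X = "x n w" and ?N = "v n w"
  let ?E = "\<lambda>i. \<bar>(\<Sum>j<?N. off_diag g n ?X i j) - (\<integral>y. g (?X i) y \<partial>\<mu>)\<bar>"
  have avg: "\<bar>(\<Sum>j<?N. f (?X j)) / n - (\<integral>y. f y \<partial>\<mu>)\<bar> \<le> Q * (T + T)"
   if f: "\<And>y. \<bar>f y\<bar> \<le> Q" and fm: "f \<in> borel_measurable borel" and Q: "Q \<ge> 0" for f :: "'s => real" and Q
  proof -
   have "\<bar>\<Sum>j<?N. f (?X j)\<bar> \<le> (\<Sum>j<?N. Q)" using f by (intro order_trans[OF sum_abs] sum_mono) auto
   then have "\<bar>\<Sum>j<?N. f (?X j)\<bar> / n \<le> (\<Sum>j<?N. Q) / n" by (rule divide_right_mono) simp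
   then have "\<bar>(\<Sum>j<?N. f (?X j)) / n\<bar> \<le> Q * (real ?N / n)" by (simp add: abs_divide mult.commute)
   also have "... \<le> Q * T" using vT Q by (rule mult_left_mono)
   finally have 1: "\<bar>(\<Sum>j<?N. f (?X j)) / n\<bar> \<le> Q * T" .
   have "\<bar>\<integral>y. f y \<partial>\<mu>\<bar> \<le> (\<integral>y. \<bar>f y\<bar> \<partial>\<mu>)" by (rule integral_abs_bound)
   also have "... \<le> (\<integral>y. Q \<partial>\<mu>)"
    using f fm by (intro integral_mono integrable_abs integrable_const_bound[of f Q]) auto
   also have "... = Q * total" by (simp add: mult.commute)
   also have "... \<le> Q * T" using Q by (intro mult_left_mono) (auto simp: T_def)
   finally show ?thesis using 1 unfolding distrib_left by linarith
  qed
  have \<psi>lip: "\<bar>\<psi> n w a - \<psi> n w a'\<bar> \<le> L' * dist a a'" for a a'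
  proof -
   have "\<psi> n w a - \<psi> n w a' = (\<Sum>j<?N. g a (?X j) - g a' (?X j)) / n - (\<integral>y. g a y - g a' y \<partial>\<mu>)"
    using gi by (simp add: \<psi>_def sum_subtractf diff_divide_distrib)
   then have "\<bar>\<psi> n w a - \<psi> n w a'\<bar> \<le> (L * dist a a') * (T + T)"
    using avg[of "\<lambda>y. g a y - g a' y" "L * dist a a'"] lip L by simp
   then show ?thesis by (simp add: L'_def mult_ac)
  qed
  have \<psi>b: "\<bar>\<psi> n w a\<bar> \<le> B'" for a
   unfolding \<psi>_def B'_def using b B by (intro avg) auto
  have pt: "\<bar>\<psi> n w a\<bar> \<le> ?c + B' * r A a" for a
  proof (cases "\<exists>k<A. dist a (c k) < \<delta>")
   case True
   then obtain k where k: "k < A" "dist a (c k) < \<delta>" by auto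
   have "\<bar>\<psi> n w (c k)\<bar> \<le> (\<Sum>k<A. \<bar>\<psi> n w (c k)\<bar>)" using k by (intro member_le_sum) auto
   moreover have "L' * dist a (c k) \<le> L' * \<delta>" using k B'L' by (intro mult_left_mono) auto
   moreover have "0 \<le> B' * r A a" using B'L' r by auto
   ultimately show ?thesis using \<psi>lip[of a "c k"] s1 by linarith
  next
   case False
   then have "r A a = 1" unfolding r_def by (intro prod.neutral ballI \<phi>1) (meson lessThan_iff not_less)
   moreover have "0 \<le> \<epsilon>1 + L' * \<delta>" using pos B'L' by auto
   ultimately show ?thesis using \<psi>b[of a] by simp
  qed
  have "(\<Sum>i<?N. ?E i) \<le>
   (\<Sum>i<?N. (?c + B' * r A (?X i)) + B / n)"
  proof (rule sum_mono)
   fix i assume i: "i \<in> {..<?N}"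
   have "(\<Sum>j<?N. off_diag g n ?X i j) = (\<Sum>j\<in>{..<?N} - {i}. g (?X i) (?X j) / n)"
    by (intro sum.mono_neutral_cong_right) (auto simp: off_diag_def)
   also have "... = (\<Sum>j<?N. g (?X i) (?X j)) / n - g (?X i) (?X i) / n"
    using i by (simp add: sum_diff1 sum_divide_distrib)
   finally have eq: "(\<Sum>j<?N. off_diag g n ?X i j) - (\<integral>y. g (?X i) y \<partial>\<mu>) = \<psi> n w (?X i) - g (?X i) (?X i) / n"
    by (simp add: \<psi>_def)
   have "\<bar>g (?X i) (?X i) / n\<bar> \<le> B / n" using b by (simp add: abs_divide divide_right_mono)
   then show "?E i \<le> (?c + B' * r A (?X i)) + B / n"
    unfolding eq using pt[of "?X i"] by linarith
  qed
  also have "... = real ?N * ?c + B' * (\<Sum>i<?N. r A (?X i)) + real ?N * (B / n)"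
   by (simp add: sum.distrib sum_distrib_left)
  finally have "(\<Sum>i<?N. ?E i) / n \<le>
   (real ?N * ?c + B' * (\<Sum>i<?N. r A (?X i)) + real ?N * (B / n)) / n"
   by (rule divide_right_mono) simp
  also have "... = real ?N / n * ?c + B' * ((\<Sum>i<?N. r A (?X i)) / n) + real ?N / n * (B / n)"
   by (simp add: add_divide_distrib)
  also have "... \<le> T * ?c + B' * (2 * \<epsilon>2) + T * (B / n)"
   using vT s2 pos B'L' B by (intro add_mono mult_right_mono mult_left_mono) auto
  also have "... \<le> e"
  proof -
   have "T * \<epsilon>1 = e / 4" using T by (simp add: \<epsilon>1_def)
   moreover have "T * (L' * \<delta>) \<le> e / 4"
   proof -
    have "T * \<delta> = e / (4 * (L' + 1))" using T by (simp add: \<delta>_def)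
    then have "T * (L' * \<delta>) = L' * (e / (4 * (L' + 1)))" by (metis mult.left_commute)
    also have "... = L' / (L' + 1) * (e / 4)" by simp
    also have "... \<le> 1 * (e / 4)" using B'L' e by (intro mult_right_mono) auto
    finally show ?thesis by simp
   qed
   moreover have "B' * (2 * \<epsilon>2) \<le> e / 4"
   proof -
    have dbl: "2 * (a / 2) = a" for a :: real by simp
    have "2 * \<epsilon>2 = e / (4 * (B' + 1))" unfolding \<epsilon>2_def by (rule dbl)
    then have "B' * (2 * \<epsilon>2) = B' * (e / (4 * (B' + 1)))" by simp
    also have "... = B' / (B' + 1) * (e / 4)" by simp
    also have "... \<le> 1 * (e / 4)" using B'L' e by (intro mult_right_mono) auto
    finally show ?thesis by simp
   qed
   moreover have "T * (B / n) \<le> e / 4" using n by (simp add: mult.commute)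
   ultimately show ?thesis unfolding distrib_left by linarith
  qed
  finally show "(\<Sum>i<?N. ?E i) / n \<le> e" .
 qed
qed

lemma lipschitz_integral:
 fixes g :: "'s => 's => real"
 assumes b: "\<And>a b. \<bar>g a b\<bar> \<le> B" and lip: "\<And>a a' b. \<bar>g a b - g a' b\<bar> \<le> L * dist a a'" and L: "L \<ge> 0"
  and [measurable]: "\<And>a. g a \<in> borel_measurable borel"
 shows "continuous_on UNIV (\<lambda>a. \<integral>y. g a y \<partial>\<mu>)" and "\<bar>\<integral>y. g a y \<partial>\<mu>\<bar> \<le> B * total"
proof -
 have gi: "integrable \<mu> (g a)" for a using b by (intro integrable_const_bound[of _ B]) auto
 have "(L * total)-lipschitz_on UNIV (\<lambda>a. \<integral>y. g a y \<partial>\<mu>)"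
 proof (rule lipschitz_onI)
  fix a a'
  have "\<bar>(\<integral>y. g a y \<partial>\<mu>) - (\<integral>y. g a' y \<partial>\<mu>)\<bar> = \<bar>\<integral>y. g a y - g a' y \<partial>\<mu>\<bar>" using gi by simp
  also have "... \<le> (\<integral>y. \<bar>g a y - g a' y\<bar> \<partial>\<mu>)" by (rule integral_abs_bound)
  also have "... \<le> (\<integral>y. L * dist a a' \<partial>\<mu>)" using lip gi by (intro integral_mono) auto
  finally show "dist (\<integral>y. g a y \<partial>\<mu>) (\<integral>y. g a' y \<partial>\<mu>) \<le> L * total * dist a a'"
   by (simp add: dist_real_def mult_ac)
 qed (use L in simp)
 then show "continuous_on UNIV (\<lambda>a. \<integral>y. g a y \<partial>\<mu>)" by (rule lipschitz_on_continuous_on)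
 have "\<bar>\<integral>y. g a y \<partial>\<mu>\<bar> \<le> (\<integral>y. \<bar>g a y\<bar> \<partial>\<mu>)" by (rule integral_abs_bound)
 also have "... \<le> (\<integral>y. B \<partial>\<mu>)" using b gi by (intro integral_mono) auto
 finally show "\<bar>\<integral>y. g a y \<partial>\<mu>\<bar> \<le> B * total" by (simp add: mult.commute)
qed

lemma bounded_lipschitz_ker:
 assumes h: "bounded_lipschitz h" and nn: "\<And>a b. 0 \<le> h a b" and sym: "\<And>a b. h a b = h b a"
 shows "ker \<mu> h"
proof (unfold_locales, unfold kernel_def symker_def, intro conjI ballI)
 from h obtain B where B: "\<And>a b. \<bar>h a b\<bar> \<le> B" by (auto simp: bounded_lipschitz_def)
 interpret SS: pair_sigma_finite \<mu> \<mu> by unfold_locales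
 interpret P: finite_measure "sqm \<mu>" by (rule finite_measure_pair_measure) unfold_locales
 have "(\<lambda>z. h (fst z) (snd z)) \<in> borel_measurable borel"
  using bounded_lipschitz_continuous[OF h] by (rule borel_measurable_continuous_onI)
 then show m: "(\<lambda>z. h (fst z) (snd z)) \<in> borel_measurable (sqm \<mu>)"
  by (simp cong: measurable_cong_sets add: sets_pair_eq)
 show "type_space \<mu>" using kernel by (simp add: kernel_def)
 show "integrable (sqm \<mu>) (\<lambda>z. h (fst z) (snd z))"
  by (rule P.integrable_const_bound[OF _ m, of B]) (use B in auto)
 show "(\<integral>\<^sup>+y. ennreal (h a y) \<partial>\<mu>) < \<infinity>" for a
 proof -
  have "(\<integral>\<^sup>+y. ennreal (h a y) \<partial>\<mu>) \<le> (\<integral>\<^sup>+y. ennreal B \<partial>\<mu>)"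
   using B by (intro nn_integral_mono ennreal_leI) (auto simp: abs_le_iff)
  also have "... < \<infinity>" by (simp add: ennreal_mult_less_top emeasure_eq_measure)
  finally show ?thesis .
 qed
qed (rule nn sym)+

lemma bounded_lipschitz_double_sum:
 assumes h: "bounded_lipschitz h" and nn: "\<And>a b. 0 \<le> h a b" and sym: "\<And>a b. h a b = h b a"
 shows "conv0 M (\<lambda>n w. \<bar>(\<Sum>i<v n w. \<Sum>j<v n w. off_diag h n (x n w) i j) / n - (\<integral>z. h (fst z) (snd z) \<partial>(sqm \<mu>))\<bar>)"
proof -
 interpret h: ker \<mu> h by (rule bounded_lipschitz_ker[OF assms])
 interpret SS: pair_sigma_finite \<mu> \<mu> by unfold_locales
 from h obtain B L where B: "B \<ge> 0" "\<And>a b. \<bar>h a b\<bar> \<le> B"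
  and L: "L \<ge> 0" "\<And>a b a' b'. \<bar>h a b - h a' b'\<bar> \<le> L * (dist a a' + dist b b')"
  by (auto simp: bounded_lipschitz_def)
 have lip: "\<bar>h a b - h a' b\<bar> \<le> L * dist a a'" for a a' b using L(2)[of a b a' b] by simp
 have cont: "continuous_on UNIV (h a)" for a
 proof -
  have "L-lipschitz_on UNIV (h a)" using L(2)[of a _ a] L(1) by (intro lipschitz_onI) (auto simp: dist_real_def)
  then show ?thesis by (rule lipschitz_on_continuous_on)
 qed
 have hm: "h a \<in> borel_measurable borel" for a using cont by (rule borel_measurable_continuous_onI)
 have "conv0 M (\<lambda>n w. \<bar>(\<Sum>i<v n w. \<Sum>j<v n w. off_diag h n (x n w) i j) / n - (\<integral>a. \<integral>y. h a y \<partial>\<mu> \<partial>\<mu>)\<bar>)"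
  by (rule M.double_sum_lln[OF row_lln[OF B(2,1) lip L(1) cont]
   average_lln[OF lipschitz_integral(1)[OF B(2) lip L(1) hm] lipschitz_integral(2)[OF B(2) lip L(1) hm]]])
 moreover have "(\<integral>a. \<integral>y. h a y \<partial>\<mu> \<partial>\<mu>) = (\<integral>z. h (fst z) (snd z) \<partial>(sqm \<mu>))"
  using SS.integral_fst[of h] h.kernel_integrable2 by (simp add: case_prod_unfold)
 ultimately show ?thesis by simp
qed

end

section \<open>Graphical sequences and their lower envelopes\<close>

locale graphical_points = vertex_points \<mu> \<kappa> M v x
 for \<mu> :: "'s::{metric_space,second_countable_topology} measure" and \<kappa> and M :: "'w measure" and v x +
 fixes ks :: "nat => 's => 's => real"
 assumes symker_seq: "symker \<mu> (ks n)" and graphical_seq: "graphical_seq \<mu> M v x ks \<kappa>"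
begin

lemma seq_nonneg: "0 \<le> ks n a b" and seq_sym: "ks n a b = ks n b a"
 using symker_seq[of n] unfolding symker_def by auto

lemma seq_measurable [measurable]: "(\<lambda>z. ks n (fst z) (snd z)) \<in> borel_measurable (sqm \<mu>)"
 using symker_seq[of n] unfolding symker_def by auto

abbreviation good :: "'s \<times> 's => bool" where
 "good z \<equiv> \<forall>ys zs. ys \<longlonglongrightarrow> fst z \<longrightarrow> zs \<longlonglongrightarrow> snd z \<longrightarrow> (\<lambda>n. ks n (ys n) (zs n)) \<longlonglongrightarrow> \<kappa> (fst z) (snd z)"

text \<open>The Lipschitz envelope from below of the kernels of index at least m, truncated at m.\<close>
definition lower :: "nat => 's => 's => real" where
 "lower m a b = (INF (k, a', b') \<in> {m..} \<times> UNIV. min (ks k a' b') m + m * (dist a a' + dist b b'))"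

lemma lower_le: "k \<ge> m ==> lower m a b \<le> min (ks k a' b') m + m * (dist a a' + dist b b')"
proof -
 assume k: "k \<ge> m"
 let ?f = "\<lambda>(k, a', b'). min (ks k a' b') m + m * (dist a a' + dist b b')"
 have "lower m a b \<le> ?f (k, a', b')" unfolding lower_def
  by (rule cINF_lower[OF bdd_belowI[of _ 0]]) (use k seq_nonneg in auto)
 then show ?thesis by simp
qed

lemma lower_greatest:
 assumes "\<And>k a' b'. k \<ge> m ==> c \<le> min (ks k a' b') m + m * (dist a a' + dist b b')"
 shows "c \<le> lower m a b"
 unfolding lower_def by (rule cINF_greatest) (use assms in auto)

lemma lower_nonneg: "0 \<le> lower m a b"
 using seq_nonneg by (intro lower_greatest) auto

lemma lower_le_seq: "k \<ge> m ==> lower m a b \<le> ks k a b" and lower_le_bound: "lower m a b \<le> m"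
 using lower_le[of m k a b a b] lower_le[of m m a b a b] by auto

lemma lower_sym: "lower m a b = lower m b a"
proof -
 have "lower m a b \<le> lower m b a" for a b
 proof (rule lower_greatest)
  fix k a' b' assume "k \<ge> m"
  from lower_le[OF this, of a b b' a']
  show "lower m a b \<le> min (ks k a' b') m + m * (dist b a' + dist a b')" by (simp add: seq_sym[of k a' b'] add.commute)
 qed
 then show ?thesis by (intro antisym)
qed

lemma lower_bounded_lipschitz: "bounded_lipschitz (lower m)"
proof -
 have le: "lower m a b \<le> lower m a' b' + m * (dist a a' + dist b b')" for a b a' b'
 proof -
  have "lower m a b - m * (dist a a' + dist b b') \<le> lower m a' b'"
  proof (rule lower_greatest)
   fix k c d assume "k \<ge> m"
   from lower_le[OF this, of a b c d] have "lower m a b \<le> min (ks k c d) m + m * (dist a c + dist b d)" .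
   also have "m * (dist a c + dist b d) \<le> m * ((dist a a' + dist b b') + (dist a' c + dist b' d))"
    using dist_triangle[of a c a'] dist_triangle[of b d b'] by (intro mult_left_mono) auto
   finally show "lower m a b - m * (dist a a' + dist b b') \<le> min (ks k c d) m + m * (dist a' c + dist b' d)"
    by (simp add: algebra_simps)
  qed
  then show ?thesis by simp
 qed
 have "\<bar>lower m a b - lower m a' b'\<bar> \<le> m * (dist a a' + dist b b')" for a b a' b'
  using le[of a b a' b'] le[of a' b' a b] by (simp add: dist_commute abs_le_iff)
 moreover have "\<bar>lower m a b\<bar> \<le> m" for a b using lower_nonneg[of m a b] lower_le_bound[of m a b] by simp
 ultimately show ?thesis unfolding bounded_lipschitz_def by (intro conjI exI[of _ "real m"]) auto
qed

text \<open>The sequential condition in \<open>good\<close> implies a lower bound that is uniform in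
  a neighbourhood and in the index: otherwise offending points could be collected along increasing
  indices and would converge to z.\<close>

lemma good_locally_large:
 assumes g: "good z" and \<eta>: "\<eta> > 0"
 shows "\<exists>n0 r. 0 < r \<and> (\<forall>k\<ge>n0. \<forall>a b. dist a (fst z) < r \<longrightarrow> dist b (snd z) < r \<longrightarrow> \<kappa> (fst z) (snd z) - \<eta> \<le> ks k a b)"
proof (rule ccontr)
 assume "\<not> ?thesis"
 then have bad: "\<exists>k\<ge>n0. \<exists>a b. dist a (fst z) < r \<and> dist b (snd z) < r \<and> ks k a b < \<kappa> (fst z) (snd z) - \<eta>"
  if "0 < r" for n0 r using that by (force simp: not_le)
 define P where "P N t \<longleftrightarrow> dist (fst (snd t)) (fst z) < 1 / real (Suc N) \<and> dist (snd (snd t)) (snd z) < 1 / real (Suc N) \<and>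
  ks (fst t) (fst (snd t)) (snd (snd t)) < \<kappa> (fst z) (snd z) - \<eta>" for N and t :: "nat \<times> 's \<times> 's"
 have "\<exists>f. \<forall>N. P N (f N) \<and> fst (f N) < fst (f (Suc N))"
 proof (rule dependent_nat_choice)
  show "\<exists>t. P 0 t" using bad[of "1 / real (Suc 0)" 0] unfolding P_def by auto
  fix t N assume "P N t"
  show "\<exists>t'. P (Suc N) t' \<and> fst t < fst t'"
   using bad[of "1 / real (Suc (Suc N))" "Suc (fst t)"] unfolding P_def by (auto simp: Suc_le_eq)
 qed
 then obtain f where f: "\<And>N. P N (f N)" "\<And>N. fst (f N) < fst (f (Suc N))" by blast
 define r where "r N = fst (f N)" for N
 have r: "strict_mono r" using f(2) by (simp add: strict_mono_Suc_iff r_def)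
 \<comment> \<open>The offending points occupy the indices in the range of r only; all other indices
   are filled with the limit point, so that a full convergent sequence is obtained.\<close>
 define pick where "pick w0 w n = (if n \<in> range r then w (inv r n) else w0)" for w0 :: 's and w n
 have conv: "pick w0 w \<longlonglongrightarrow> w0" if w: "\<And>N. dist (w N) w0 < 1 / real (Suc N)" for w0 w
 proof (rule metric_LIMSEQ_I)
  fix e :: real assume "e > 0"
  then obtain N0 where N0: "1 / real (Suc N0) < e" using nat_approx_posE by blast
  show "\<exists>no. \<forall>n\<ge>no. dist (pick w0 w n) w0 < e"
  proof (intro exI[of _ "r N0"] allI impI)
   fix n assume n: "r N0 \<le> n"
   show "dist (pick w0 w n) w0 < e"
   proof (cases "n \<in> range r")
    case True
    then obtain N where N: "n = r N" by auto
    then have "N0 \<le> N" using n r by (simp add: strict_mono_less_eq)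
    have "dist (w N) w0 < 1 / real (Suc N)" by (rule w)
    also have "... \<le> 1 / real (Suc N0)" using \<open>N0 \<le> N\<close> by (intro divide_left_mono) auto
    finally show ?thesis using N0 N strict_mono_imp_inj_on[OF r] by (simp add: pick_def)
   qed (use \<open>e > 0\<close> in \<open>simp add: pick_def\<close>)
  qed
 qed
 let ?y = "pick (fst z) (\<lambda>N. fst (snd (f N)))" and ?z = "pick (snd z) (\<lambda>N. snd (snd (f N)))"
 have "?y \<longlonglongrightarrow> fst z" "?z \<longlonglongrightarrow> snd z" using f(1) by (intro conv; simp add: P_def)+
 then have "(\<lambda>n. ks n (?y n) (?z n)) \<longlonglongrightarrow> \<kappa> (fst z) (snd z)" using g by blast
 from LIMSEQ_subseq_LIMSEQ[OF this r] have "(\<lambda>N. ks (r N) (?y (r N)) (?z (r N))) \<longlonglongrightarrow> \<kappa> (fst z) (snd z)" by (simp add: o_def)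
 moreover have "ks (r N) (?y (r N)) (?z (r N)) \<le> \<kappa> (fst z) (snd z) - \<eta>" for N
  using f(1)[of N] strict_mono_imp_inj_on[OF r] by (simp add: pick_def P_def r_def[symmetric])
 ultimately have "\<kappa> (fst z) (snd z) \<le> \<kappa> (fst z) (snd z) - \<eta>" by (intro LIMSEQ_le_const2) auto
 then show False using \<eta> by simp
qed

lemma lower_le_kernel: "good z ==> lower m (fst z) (snd z) \<le> \<kappa> (fst z) (snd z)"
proof -
 assume "good z"
 then have "(\<lambda>n. ks n (fst z) (snd z)) \<longlonglongrightarrow> \<kappa> (fst z) (snd z)" by (elim allE[of _ "\<lambda>_. fst z"] allE[of _ "\<lambda>_. snd z"]) auto
 then show ?thesis by (rule LIMSEQ_le_const) (use lower_le_seq in blast)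
qed

text \<open>Near z the kernels of large index are at least \<kappa> up to \<eta> / 2 by
  \<open>good_locally_large\<close>; at distance r or more from z the penalty m r alone exceeds the
  value of \<kappa> once m is large.\<close>

lemma lower_lim: 
 assumes g: "good z"
 shows "(\<lambda>m. lower m (fst z) (snd z)) \<longlonglongrightarrow> \<kappa> (fst z) (snd z)"
proof (rule LIMSEQ_I)
 fix \<eta> :: real assume "\<eta> > 0"
 then have "\<eta> / 2 > 0" by simp
 from good_locally_large[OF g this] obtain n0 r where r: "r > 0"
  and large: "\<And>k a b. k \<ge> n0 ==> dist a (fst z) < r ==> dist b (snd z) < r ==> \<kappa> (fst z) (snd z) - \<eta> / 2 \<le> ks k a b" by blast
 let ?c = "\<kappa> (fst z) (snd z)"
 have c: "?c \<ge> 0" by (rule kernel_nonneg) auto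
 obtain n1 :: nat where n1: "?c / r \<le> n1" using real_arch_simple by blast
 obtain n2 :: nat where n2: "?c \<le> n2" using real_arch_simple by blast
 show "\<exists>no. \<forall>m\<ge>no. norm (lower m (fst z) (snd z) - ?c) < \<eta>"
 proof (intro exI[of _ "max n0 (max n1 n2)"] allI impI)
  fix m assume m: "max n0 (max n1 n2) \<le> m"
  then have "?c / r \<le> m" using n1 by (meson max.boundedE of_nat_mono order_trans)
  then have mr: "?c \<le> m * r" using r by (simp add: pos_divide_le_eq)
  have mc: "?c \<le> m" using n2 m by (meson max.boundedE of_nat_mono order_trans)
  have "?c - \<eta> / 2 \<le> lower m (fst z) (snd z)"
  proof (rule lower_greatest)
   fix k a b assume k: "k \<ge> m"
   show "?c - \<eta> / 2 \<le> min (ks k a b) m + m * (dist (fst z) a + dist (snd z) b)"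
   proof (cases "dist (fst z) a < r \<and> dist (snd z) b < r")
    case True
    then have "?c - \<eta> / 2 \<le> ks k a b" using large[of k a b] k m by (simp add: dist_commute)
    then have "?c - \<eta> / 2 \<le> min (ks k a b) m" using mc \<open>\<eta> > 0\<close> by simp
    moreover have "0 \<le> m * (dist (fst z) a + dist (snd z) b)" by simp
    ultimately show ?thesis by linarith
   next
    case False
    then have "m * r \<le> m * (dist (fst z) a + dist (snd z) b)"
     by (intro mult_left_mono) (smt (verit) zero_le_dist, simp)
    moreover have "0 \<le> min (ks k a b) m" using seq_nonneg by simp
    ultimately show ?thesis using mr \<open>\<eta> > 0\<close> by linarith
   qed
  qed
  with lower_le_kernel[OF g, of m] \<open>\<eta> > 0\<close> show "norm (lower m (fst z) (snd z) - ?c) < \<eta>" by simp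
 qed
qed

lemma lower_ker: "ker \<mu> (lower m)"
 using lower_bounded_lipschitz lower_nonneg lower_sym by (rule bounded_lipschitz_ker)

lemma lower_kdist:
 assumes "e > 0"
 obtains m where "m > 0" "kdist (lower m) \<le> e"
proof -
 have good: "AE z in sqm \<mu>. good z" using graphical_seq by (simp add: graphical_seq_def)
 have "(\<lambda>m. kdist (lower m)) \<longlonglongrightarrow> (\<integral>z. 0 \<partial>(sqm \<mu>))"
 proof (rule integral_dominated_convergence[OF _ _ kernel_integrable2])
  show "AE z in sqm \<mu>. (\<lambda>m. \<bar>\<kappa> (fst z) (snd z) - lower m (fst z) (snd z)\<bar>) \<longlonglongrightarrow> 0"
   using good
  proof eventually_elim
   case (elim z)
   have "(\<lambda>m. \<bar>\<kappa> (fst z) (snd z) - lower m (fst z) (snd z)\<bar>) \<longlonglongrightarrow> \<bar>\<kappa> (fst z) (snd z) - \<kappa> (fst z) (snd z)\<bar>"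
    by (intro tendsto_intros lower_lim elim)
   then show ?case by simp
  qed
  show "AE z in sqm \<mu>. norm \<bar>\<kappa> (fst z) (snd z) - lower m (fst z) (snd z)\<bar> \<le> \<kappa> (fst z) (snd z)" for m
   using good
  proof eventually_elim
   case (elim z)
   then show ?case using lower_le_kernel[OF elim, of m] lower_nonneg[of m "fst z" "snd z"] by simp
  qed
  show "(\<lambda>z. \<bar>\<kappa> (fst z) (snd z) - lower m (fst z) (snd z)\<bar>) \<in> borel_measurable (sqm \<mu>)" for m
  proof -
   interpret l: ker \<mu> "lower m" by (rule lower_ker)
   show ?thesis by measurable
  qed
 qed auto
 then have "\<forall>\<^sub>F m in sequentially. kdist (lower m) < e"
  using assms by (intro order_tendstoD(2)) auto
 then have "\<forall>\<^sub>F m in sequentially. m > 0 \<and> kdist (lower m) < e" using eventually_gt_at_top[of 0] by eventually_elim auto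
 then obtain m where "m > 0" "kdist (lower m) < e" using eventually_happens[of _ sequentially] by auto
 then show ?thesis by (intro that[of m]) auto
qed

section \<open>Edge probabilities compared with lower envelopes\<close>

definition edge_weight :: "nat => 'w => nat => nat => real" where
 "edge_weight n w i j = (if i = j then 0 else min (ks n (x n w i) (x n w j) / n) 1)"

lemma edge_weight_sym: "edge_weight n w i j = edge_weight n w j i"
 using seq_sym[of n "x n w i" "x n w j"] by (simp add: edge_weight_def)

lemma edge_weight_edge_prob: "edge_prob N (edge_weight n w)"
proof
 show "edge_weight n w i j = edge_weight n w j i" for i j by (rule edge_weight_sym)
qed (auto simp: edge_weight_def seq_nonneg)

lemma edge_weight_sum_measurable: "(\<lambda>w. \<Sum>i<v n w. \<Sum>j<v n w. edge_weight n w i j) \<in> borel_measurable M"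
proof (rule random_sum_measurable)
 fix k
 have "(\<lambda>w. ks n (x n w i) (x n w j)) \<in> borel_measurable M" for i j
 proof -
  have "(\<lambda>w. (x n w i, x n w j)) \<in> M \<rightarrow>\<^sub>M sqm \<mu>" by measurable
  from measurable_compose[OF this seq_measurable] show ?thesis by simp
 qed
 note [measurable] = this
 show "(\<lambda>w. \<Sum>i<k. \<Sum>j<k. edge_weight n w i j) \<in> borel_measurable M"
  unfolding edge_weight_def by measurable
qed

text \<open>The double sum counts every edge twice, which turns the limit of the expected edge
  number, half the integral of \<kappa>, into the whole integral.\<close>

lemma expected_weight:
 assumes "\<eta> > 0"
 shows "\<forall>\<^sub>F n in sequentially. (\<integral>\<^sup>+w. ennreal ((\<Sum>i<v n w. \<Sum>j<v n w. edge_weight n w i j) / n) \<partial>M)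
  \<le> ennreal ((\<integral>z. \<kappa> (fst z) (snd z) \<partial>(sqm \<mu>)) + \<eta>)"
proof -
 let ?I = "\<integral>z. \<kappa> (fst z) (snd z) \<partial>(sqm \<mu>)"
 have I: "?I \<ge> 0" by (intro B_integral_nonneg) (simp add: kernel_nonneg)
 have "(\<lambda>n. exp_edges M v x (ks n) n / ennreal (real n)) \<longlonglongrightarrow> ennreal (?I / 2)"
  using graphical_seq by (simp add: graphical_seq_def)
 moreover have "ennreal (?I / 2) < ennreal ((?I + \<eta>) / 2)" using I assms by (intro ennreal_lessI) auto
 ultimately have "\<forall>\<^sub>F n in sequentially. exp_edges M v x (ks n) n / ennreal (real n) < ennreal ((?I + \<eta>) / 2)"
  by (rule order_tendstoD(2))
 then show ?thesis using eventually_gt_at_top[of 0]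
 proof eventually_elim
  case (elim n)
  let ?W = "\<lambda>w. \<Sum>i<v n w. \<Sum>j<v n w. edge_weight n w i j"
  let ?e = "\<lambda>w. \<Sum>j<v n w. \<Sum>i<j. min (ks n (x n w i) (x n w j) / n) 1"
  have W: "?W w = 2 * ?e w" for w
  proof -
   have "?W w = 2 * (\<Sum>j<v n w. \<Sum>i<j. edge_weight n w i j)"
    by (rule sum_symmetric_off_diag[OF edge_weight_sym]) (simp add: edge_weight_def)
   also have "(\<Sum>j<v n w. \<Sum>i<j. edge_weight n w i j) = ?e w" by (intro sum.cong refl) (auto simp: edge_weight_def)
   finally show ?thesis .
  qed
  have em: "?e \<in> borel_measurable M"
  proof -
   have "(\<lambda>w. ?W w / 2) \<in> borel_measurable M" using edge_weight_sum_measurable by measurable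
   then show ?thesis by (simp add: W)
  qed
  have "(\<integral>\<^sup>+w. ennreal (?W w / n) \<partial>M) = (\<integral>\<^sup>+w. ennreal (2 / n) * ennreal (?e w) \<partial>M)"
   by (intro nn_integral_cong) (simp add: W seq_nonneg sum_nonneg flip: ennreal_mult)
  also have "... = ennreal (2 / n) * exp_edges M v x (ks n) n"
   unfolding exp_edges_def by (intro nn_integral_cmult) (use em in measurable)
  also have "... = ennreal 2 * (exp_edges M v x (ks n) n / ennreal n)"
   using elim(2) by (simp add: divide_ennreal_def inverse_ennreal ennreal_mult' divide_inverse mult_ac)
  also have "... \<le> ennreal 2 * ennreal ((?I + \<eta>) / 2)" using elim(1) by (intro mult_left_mono) auto
  also have "... = ennreal (2 * ((?I + \<eta>) / 2))" using I assms by (intro ennreal_mult[symmetric]) auto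
  also have "2 * ((?I + \<eta>) / 2) = ?I + \<eta>" by simp
  finally show "(\<integral>\<^sup>+w. ennreal (?W w / n) \<partial>M) \<le> ennreal (?I + \<eta>)" .
 qed
qed

text \<open>The off-diagonal matrix of a lower envelope lies below the edge probabilities, so closeness of the total
 masses already gives closeness in the mean.\<close>
lemma approx_lower:
 assumes e: "e > 0" and d: "d > 0"
 shows "\<exists>k'\<in>range lower. kdist k' \<le> e \<and> (\<forall>\<^sub>F n in sequentially. \<exists>S\<in>sets M. 1 - d \<le> measure M S \<and>
   (\<forall>w\<in>S. mdist n (v n w) (edge_weight n w) (off_diag k' n (x n w)) \<le> e))"
proof -
 \<comment> \<open>Four errors of size \<eta> add up: the expected edge mass, the law of large
   numbers for the envelope, the difference of the two integrals, and the exceptional set. Markov's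
   inequality at level e then leaves failure probability d.\<close>
 define \<eta> where "\<eta> = min e (e * d / 4)"
 have \<eta>: "\<eta> > 0" "\<eta> \<le> e" "4 * \<eta> \<le> e * d" using e d by (auto simp: \<eta>_def)
 obtain m where m: "m > 0" "kdist (lower m) \<le> \<eta>" using lower_kdist[OF \<eta>(1)] .
 interpret l: ker \<mu> "lower m" by (rule lower_ker)
 let ?Q = "\<lambda>n w. \<Sum>i<v n w. \<Sum>j<v n w. off_diag (lower m) n (x n w) i j"
 let ?I = "\<integral>z. \<kappa> (fst z) (snd z) \<partial>(sqm \<mu>)" and ?J = "\<integral>z. lower m (fst z) (snd z) \<partial>(sqm \<mu>)"
 have J: "?J \<ge> 0" by (intro B_integral_nonneg) (simp add: lower_nonneg)
 have I: "?I \<ge> 0" by (intro B_integral_nonneg) (simp add: kernel_nonneg)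
 have IJ: "?I - ?J \<le> \<eta>"
 proof -
  have "?I - ?J = (\<integral>z. \<kappa> (fst z) (snd z) - lower m (fst z) (snd z) \<partial>(sqm \<mu>))"
   by (rule B_integral_diff[symmetric]) (rule kernel_integrable2 l.kernel_integrable2)+
  also have "... \<le> kdist (lower m)"
   by (intro integral_mono integrable_abs B_integrable_diff kernel_integrable2 l.kernel_integrable2) auto
  finally show ?thesis using m(2) by linarith
 qed
 \<comment> \<open>The probability allowed to the exceptional set, chosen such that discarding this
   set lowers the expected mass of the envelope by at most \<eta>.\<close>
 define \<gamma> where "\<gamma> = \<eta> / (?J + 1)"
 have \<gamma>: "\<gamma> > 0" using \<eta>(1) J by (simp add: \<gamma>_def)
 have "\<gamma> * ?J = \<eta> * (?J / (?J + 1))" by (simp add: \<gamma>_def)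
 also have "... \<le> \<eta> * 1" using J \<eta>(1) by (intro mult_left_mono) auto
 finally have \<gamma>J: "\<gamma> * ?J \<le> \<eta>" by simp
 have "\<forall>\<^sub>F n in sequentially. \<exists>S\<in>M.events. 1 - \<gamma> \<le> M.prob S \<and> (\<forall>w\<in>S.
   \<bar>(?Q n w) / n - ?J\<bar> \<le> \<eta>)"
  using conv0D[OF bounded_lipschitz_double_sum[OF lower_bounded_lipschitz lower_nonneg lower_sym] \<eta>(1), of m] \<gamma>
  unfolding whp_def by blast
 then have "\<forall>\<^sub>F n in sequentially. \<exists>S\<in>M.events. 1 - d \<le> M.prob S \<and>
   (\<forall>w\<in>S. mdist n (v n w) (edge_weight n w) (off_diag (lower m) n (x n w)) \<le> e)"
  using expected_weight[OF \<eta>(1)] eventually_ge_at_top[of m]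
 proof eventually_elim
  case (elim n)
  then obtain T where T: "T \<in> M.events" "1 - \<gamma> \<le> M.prob T"
   "\<And>w. w \<in> T ==> \<bar>(?Q n w) / n - ?J\<bar> \<le> \<eta>" by blast
  have n: "n > 0" using m(1) elim(3) by linarith
  define P where "P w = (\<Sum>i<v n w. \<Sum>j<v n w. edge_weight n w i j) / n" for w
  define Q where "Q w = (?Q n w) / n" for w
  have le: "0 \<le> off_diag (lower m) n (x n w) i j" "off_diag (lower m) n (x n w) i j \<le> edge_weight n w i j" for w i j
  proof -
   show "0 \<le> off_diag (lower m) n (x n w) i j" using lower_nonneg by (simp add: off_diag_def)
   \<comment> \<open>The condition m \<le> n serves twice: the envelope lies below
     \<open>ks n\<close>, and being at most m it stays below the cap when divided by n.\<close>
   have "lower m a b / n \<le> min (ks n a b / n) 1" for a b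
    using lower_le_seq[OF elim(3), of a b] lower_le_bound[of m a b] elim(3) n
    by (auto simp: divide_right_mono pos_divide_le_eq)
   then show "off_diag (lower m) n (x n w) i j \<le> edge_weight n w i j" by (simp add: off_diag_def edge_weight_def)
  qed
  have eq: "mdist n (v n w) (edge_weight n w) (off_diag (lower m) n (x n w)) = P w - Q w" for w
   using le by (simp add: P_def Q_def sum_subtractf diff_divide_distrib)
  have PQ: "0 \<le> Q w" "Q w \<le> P w" for w
   unfolding P_def Q_def using le by (auto intro!: divide_right_mono sum_mono divide_nonneg_nonneg sum_nonneg)
  have Pm [measurable]: "P \<in> borel_measurable M"
   unfolding P_def[abs_def] using edge_weight_sum_measurable by measurable
  have Qm [measurable]: "Q \<in> borel_measurable M"
  proof -
   have "(\<lambda>w. \<Sum>i<v n w. \<Sum>j<v n w. off_diag (lower m) n (x n w) i j) \<in> borel_measurable M"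
    by (rule random_sum_measurable) (unfold off_diag_def, measurable)
   then show ?thesis unfolding Q_def[abs_def] by measurable
  qed
  have P_int: "(\<integral>\<^sup>+w. ennreal (P w) \<partial>M) \<le> ennreal (?I + \<eta>)" using elim(2) by (simp add: P_def)
  have Pi: "integrable M P"
   using P_int PQ by (intro integrableI_nonneg) (auto intro: order_trans le_less_trans[OF P_int])
  have Qi: "integrable M Q"
   using PQ by (intro B_integrable_bound[OF Pi Qm]) (auto intro!: AE_I2 order_trans[OF _ abs_ge_self])
  have EP: "M.expectation P \<le> ?I + \<eta>"
  proof -
   have P0: "0 \<le> P w" for w using PQ[of w] by linarith
   have "ennreal (M.expectation P) \<le> ennreal (?I + \<eta>)"
    using P_int unfolding nn_integral_eq_integral[OF Pi AE_I2[OF P0]] .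
   moreover have "0 \<le> ?I + \<eta>" using I \<eta>(1) by simp
   ultimately show ?thesis by (simp only: ennreal_le_iff)
  qed
  have EQ: "?J * (1 - \<gamma>) - \<eta> \<le> M.expectation Q"
  proof -
   have i1: "integrable M (\<lambda>w. ?J * indicator T w)"
    by (intro integrable_mult_right integrable_real_indicator T(1)) (simp add: M.emeasure_eq_measure)
   have i2: "integrable M (\<lambda>w. \<eta>)" by simp
   have "?J * (1 - \<gamma>) - \<eta> \<le> ?J * M.prob T - \<eta>" by (intro diff_right_mono mult_left_mono T(2) J)
   also have "... = (\<integral>w. ?J * indicator T w - \<eta> \<partial>M)"
    unfolding B_integral_diff[OF i1 i2] using T(1) by (simp add: M.prob_space)
   also have "... \<le> M.expectation Q"
   proof (rule integral_mono[OF _ Qi])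
    show "integrable M (\<lambda>w. ?J * indicator T w - \<eta>)" using i1 i2 by (rule B_integrable_diff)
    show "?J * indicator T w - \<eta> \<le> Q w" for w
    proof (cases "w \<in> T")
     case True
     then show ?thesis using T(3)[OF True] unfolding Q_def[symmetric] by (simp add: abs_le_iff)
    next
     case False
     then show ?thesis using PQ(1)[of w] \<eta>(1) by simp
    qed
   qed
   finally show ?thesis .
  qed
  have "M.expectation (\<lambda>w. P w - Q w) = M.expectation P - M.expectation Q" using Pi Qi by simp
  also have "... \<le> e * d"
  proof -
   have "?J * (1 - \<gamma>) = ?J - \<gamma> * ?J" by (simp add: algebra_simps)
   then show ?thesis using EP EQ IJ \<gamma>J \<eta>(3) by linarith
  qed
  finally have "(\<integral>\<^sup>+w. ennreal (P w - Q w) \<partial>M) \<le> ennreal (e * d)"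
   using PQ Pi Qi by (subst nn_integral_eq_integral) (auto intro!: ennreal_leI)
  from M.markov_set[OF _ this e] d show ?case unfolding eq by simp
 qed
 moreover have "kdist (lower m) \<le> e" using m(2) \<eta>(2) by linarith
 ultimately show ?thesis by blast
qed

theorem conclusion: "suscept_concl \<mu> \<kappa> M v edge_weight"
proof -
 have K: "\<kappa>' \<in> range lower ==> ker \<mu> \<kappa>'" for \<kappa>' using lower_ker by auto
 have double: "whp M (\<lambda>n \<omega>. (\<Sum>i<v n \<omega>. \<Sum>j<v n \<omega>. off_diag (\<lambda>a b. \<bar>\<kappa>2 a b - \<kappa>1 a b\<bar>) n (x n \<omega>) i j) / n
    \<le> (\<integral>z. \<bar>\<kappa>2 (fst z) (snd z) - \<kappa>1 (fst z) (snd z)\<bar> \<partial>(sqm \<mu>)) + e)"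
  if k: "\<kappa>1 \<in> range lower" "\<kappa>2 \<in> range lower" and e: "e > 0" for \<kappa>1 \<kappa>2 e
 proof (rule whp_mono[OF conv0D[OF bounded_lipschitz_double_sum[OF bounded_lipschitz_abs_diff] e]])
  show "bounded_lipschitz \<kappa>2" "bounded_lipschitz \<kappa>1" using k lower_bounded_lipschitz by auto
  show "\<bar>\<kappa>2 a b - \<kappa>1 a b\<bar> = \<bar>\<kappa>2 b a - \<kappa>1 b a\<bar>" for a b using k lower_sym by (metis imageE)
 qed (auto intro!: always_eventually)
 have "vertex_approx M \<mu> \<kappa> v x edge_weight (range lower)"
 proof (rule vertex_approx.intro[OF M.prob_space_axioms ker_axioms vertex_approx_axioms.intro])
  show "edge_prob (v n \<omega>) (edge_weight n \<omega>)" for n \<omega> by (rule edge_weight_edge_prob)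
  show "\<exists>B\<ge>0. \<forall>x\<in>space \<mu>. \<forall>y\<in>space \<mu>. \<kappa>' x y \<le> B" if k': "\<kappa>' \<in> range lower" for \<kappa>'
  proof -
   from k' obtain m where "\<kappa>' = lower m" by auto
   then show ?thesis using lower_le_bound[of m] by (intro exI[of _ "real m"]) auto
  qed
 next
  fix \<kappa>' s d assume k': "\<kappa>' \<in> range lower" and s: "0 < s" "s < (1::real)"
  interpret k': ker \<mu> \<kappa>' by (rule K[OF k'])
  from k' obtain m where m: "\<kappa>' = lower m" by auto
  have "bounded_lipschitz \<kappa>'" using k' lower_bounded_lipschitz by auto
  then obtain L where L: "L \<ge> 0" "\<And>a b a' b'. \<bar>\<kappa>' a b - \<kappa>' a' b'\<bar> \<le> L * (dist a a' + dist b b')"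
   by (auto simp: bounded_lipschitz_def)
  have L1: "\<bar>\<kappa>' a b - \<kappa>' a' b\<bar> \<le> L * dist a a'" for a a' b using L(2)[of a b a' b] by simp
  have kc: "continuous_on UNIV (\<kappa>' a)" for a
  proof -
   have "L-lipschitz_on UNIV (\<kappa>' a)" using L(2)[of a _ a] L(1) by (intro lipschitz_onI) (auto simp: dist_real_def)
   then show ?thesis by (rule lipschitz_on_continuous_on)
  qed
  have g: "0 \<le> bp_pgf \<mu> \<kappa>' s d y" "bp_pgf \<mu> \<kappa>' s d y \<le> 1" for d y
   using k'.bp_pgf_bounds1[of s y d] s by auto
  have kb: "0 \<le> \<kappa>' a b" "\<kappa>' a b \<le> m" for a b using lower_nonneg lower_le_bound by (auto simp: m)
  define w where "w d a b = \<kappa>' a b * (1 - bp_pgf \<mu> \<kappa>' s d b)" for d a b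
  have wb: "\<bar>w d a b\<bar> \<le> m" for d a b
  proof -
   have "\<kappa>' a b * (1 - bp_pgf \<mu> \<kappa>' s d b) \<le> \<kappa>' a b" using g[of d b] kb[of a b] by (intro mult_left_le) auto
   moreover have "0 \<le> \<kappa>' a b * (1 - bp_pgf \<mu> \<kappa>' s d b)" using g[of d b] kb[of a b] by (intro mult_nonneg_nonneg) auto
   ultimately show ?thesis using kb[of a b] by (simp add: w_def)
  qed
  have wl: "\<bar>w d a b - w d a' b\<bar> \<le> L * dist a a'" for d a a' b
  proof -
   have "\<bar>w d a b - w d a' b\<bar> = \<bar>\<kappa>' a b - \<kappa>' a' b\<bar> * (1 - bp_pgf \<mu> \<kappa>' s d b)"
    using g[of d b] by (simp add: w_def abs_mult flip: left_diff_distrib)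
   also have "... \<le> \<bar>\<kappa>' a b - \<kappa>' a' b\<bar>" using g[of d b] by (intro mult_left_le) auto
   finally show ?thesis using L1[of a b a'] by linarith
  qed
  have wm: "w d a \<in> borel_measurable borel" for d a
  proof -
   have "bp_pgf \<mu> \<kappa>' s d \<in> borel_measurable borel"
    using k'.bp_pgf_measurable by (simp cong: measurable_cong_sets add: sets_eq)
   moreover have "\<kappa>' a \<in> borel_measurable borel" using kc by (rule borel_measurable_continuous_onI)
   ultimately show ?thesis unfolding w_def[abs_def] by measurable
  qed
  \<comment> \<open>Weak convergence is tested against continuous functions only. A Lipschitz kernel
    makes one step of the recursion continuous, whatever bounded measurable function it is applied
    to.\<close>
  have pc: "continuous_on UNIV (bp_pgf \<mu> \<kappa>' s d)" for d
  proof (cases d)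
   case 0
   then show ?thesis by (simp add: bp_pgf.simps(1)[abs_def])
  next
   case (Suc d')
   have "continuous_on UNIV (\<lambda>a. s * exp (- (\<integral>y. w d' a y \<partial>\<mu>)))"
    using lipschitz_integral(1)[OF wb wl L(1) wm] by (intro continuous_intros)
   then show ?thesis by (simp add: Suc bp_pgf.simps(2)[abs_def] w_def)
  qed
  have "conv0 M (\<lambda>n \<omega>. (\<Sum>i<v n \<omega>. \<bar>(\<Sum>j<v n \<omega>. off_diag (w d) n (x n \<omega>) i j) - (\<integral>y. w d (x n \<omega> i) y \<partial>\<mu>)\<bar>) / n)"
  proof (rule row_lln[OF wb _ wl L(1)])
   show "continuous_on UNIV (w d a)" for a unfolding w_def[abs_def] by (intro continuous_intros kc pc)
  qed simp
  then show "conv0 M (\<lambda>n \<omega>. (\<Sum>i<v n \<omega>. \<bar>(\<Sum>j<v n \<omega>. off_diag (\<lambda>a b. \<kappa>' a b * (1 - bp_pgf \<mu> \<kappa>' s d b)) n (x n \<omega>) i j)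
    - (\<integral>y. \<kappa>' (x n \<omega> i) y * (1 - bp_pgf \<mu> \<kappa>' s d y) \<partial>\<mu>)\<bar>) / n)" by (simp only: w_def[abs_def])
  show "conv0 M (\<lambda>n \<omega>. \<bar>(\<Sum>i<v n \<omega>. bp_pgf \<mu> \<kappa>' s d (x n \<omega> i)) / n - (\<integral>y. bp_pgf \<mu> \<kappa>' s d y \<partial>\<mu>)\<bar>)"
   by (rule average_lln[OF pc, where B = 1]) (use g in auto)
 next
  fix e :: real assume "e > 0"
  show "\<exists>\<kappa>'\<in>range lower. kdist \<kappa>' \<le> e \<and>
    whp M (\<lambda>n \<omega>. mdist n (v n \<omega>) (edge_weight n \<omega>) (off_diag \<kappa>' n (x n \<omega>)) \<le> e)"
   by (rule approx_whp[OF M.prob_space_axioms K double approx_lower \<open>e > 0\<close>])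
 qed (use v_lim K in auto)
 then show ?thesis by (rule vertex_approx.conclusion)
qed

end

theorem suscept_concl_graphical:
 fixes \<mu> :: "'s::{metric_space,second_countable_topology} measure"
 assumes "gen_vertex_space \<mu> M v x" "kernel \<mu> \<kappa>" "\<And>n. symker \<mu> (ks n)" "graphical_seq \<mu> M v x ks \<kappa>"
 shows "suscept_concl \<mu> \<kappa> M v (\<lambda>n w i j. min (ks n (x n w i) (x n w j) / real n) 1)"
proof -
 interpret graphical_points \<mu> \<kappa> M v x ks using assms by unfold_locales
 show ?thesis using conclusion unfolding edge_weight_def[abs_def] by (rule suscept_concl_diag[THEN iffD2])
qed

section \<open>Matrices close in cut distance\<close>

text \<open>A measure-preserving map transports a kernel together with its row masses and integrals.
  Applied to the second coordinate of a coupling, it places \<kappa> on the space that also carries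
  the step kernel.\<close>

lemma (in ker) pullback:
 assumes \<nu>: "prob_space \<nu>" and p [measurable]: "\<pi> \<in> \<nu> \<rightarrow>\<^sub>M \<mu>" and d: "distr \<nu> \<mu> \<pi> = \<mu>"
 shows "ker \<nu> (\<lambda>u v. \<kappa> (\<pi> u) (\<pi> v))"
  and "u \<in> space \<nu> ==> offmass \<nu> (\<lambda>u v. \<kappa> (\<pi> u) (\<pi> v)) u = offmass \<mu> \<kappa> (\<pi> u)"
  and "(\<lambda>z. w (fst z) (snd z) :: real) \<in> borel_measurable (sqm \<mu>) ==>
   (\<integral>z. w (\<pi> (fst z)) (\<pi> (snd z)) \<partial>(sqm \<nu>)) = (\<integral>z. w (fst z) (snd z) \<partial>(sqm \<mu>))"
proof -
 interpret \<nu>: prob_space \<nu> by (rule \<nu>)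
 interpret pair_prob_space \<nu> \<nu> ..
 have sp: "\<pi> u \<in> space \<mu>" if "u \<in> space \<nu>" for u using measurable_space[OF p that] .
 have row: "(\<integral>\<^sup>+v. ennreal (\<kappa> (\<pi> u) (\<pi> v)) \<partial>\<nu>) = (\<integral>\<^sup>+y. ennreal (\<kappa> (\<pi> u) y) \<partial>\<mu>)" if u: "u \<in> space \<nu>" for u
 proof -
  have "(\<integral>\<^sup>+y. ennreal (\<kappa> (\<pi> u) y) \<partial>(distr \<nu> \<mu> \<pi>)) = (\<integral>\<^sup>+v. ennreal (\<kappa> (\<pi> u) (\<pi> v)) \<partial>\<nu>)"
   using sp[OF u] by (subst nn_integral_distr) auto
  then show ?thesis by (simp add: d)
 qed
 then show "u \<in> space \<nu> ==> offmass \<nu> (\<lambda>u v. \<kappa> (\<pi> u) (\<pi> v)) u = offmass \<mu> \<kappa> (\<pi> u)"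
  by (simp add: offmass_def)
 have P: "(\<lambda>(u, v). (\<pi> u, \<pi> v)) \<in> sqm \<nu> \<rightarrow>\<^sub>M sqm \<mu>" by measurable
 have D: "distr (sqm \<nu>) (sqm \<mu>) (\<lambda>(u, v). (\<pi> u, \<pi> v)) = sqm \<mu>"
 proof -
  have "sigma_finite_measure \<mu>" by unfold_locales
  then show ?thesis using pair_measure_distr[OF p p] by (simp add: d)
 qed
 show "(\<integral>z. w (\<pi> (fst z)) (\<pi> (snd z)) \<partial>(sqm \<nu>)) = (\<integral>z. w (fst z) (snd z) \<partial>(sqm \<mu>))"
  if "(\<lambda>z. w (fst z) (snd z) :: real) \<in> borel_measurable (sqm \<mu>)"
  using integral_distr[OF P that] by (simp add: D[unfolded case_prod_unfold] case_prod_unfold)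
 show "ker \<nu> (\<lambda>u v. \<kappa> (\<pi> u) (\<pi> v))"
 proof (unfold_locales, unfold kernel_def symker_def, intro conjI ballI)
  show "type_space \<nu>" by (simp add: type_space_def \<nu>.emeasure_space_1)
  show "(\<lambda>z. \<kappa> (\<pi> (fst z)) (\<pi> (snd z))) \<in> borel_measurable (sqm \<nu>)" by measurable
  show "integrable (sqm \<nu>) (\<lambda>z. \<kappa> (\<pi> (fst z)) (\<pi> (snd z)))"
   using kernel_integrable2 integrable_distr_eq[OF P, of "\<lambda>z. \<kappa> (fst z) (snd z)"]
   by (simp add: D[unfolded case_prod_unfold] case_prod_unfold)
  show "(\<integral>\<^sup>+v. ennreal (\<kappa> (\<pi> u) (\<pi> v)) \<partial>\<nu>) < \<infinity>" if "u \<in> space \<nu>" for u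
   using offmass_eq[OF sp[OF that]] row[OF that] by simp
  show "\<kappa> (\<pi> u) (\<pi> v) = \<kappa> (\<pi> v) (\<pi> u)" "0 \<le> \<kappa> (\<pi> u) (\<pi> v)" if "u \<in> space \<nu>" "v \<in> space \<nu>" for u v
   using kernel_sym[OF sp[OF that(1)] sp[OF that(2)]] kernel_nonneg[OF sp[OF that(1)] sp[OF that(2)]] by auto
 qed
qed

text \<open>All blocks have length 1 / n, but the first one is closed at 0: natural-number
  subtraction sends the coordinate 0 to index 0. This is why i = 0 is treated apart.\<close>

lemma measure_step:
 assumes "n > 0" "i < n"
 shows "measure I01 {x \<in> space I01. nat \<lceil>real n * x\<rceil> - 1 = i} = 1 / n"
proof (cases i)
 case 0
 have "{x \<in> space I01. nat \<lceil>real n * x\<rceil> - 1 = i} = {0..1 / n}"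
 proof (intro set_eqI iffI)
  fix x assume "x \<in> {x \<in> space I01. nat \<lceil>real n * x\<rceil> - 1 = i}"
  then have "0 \<le> x" "nat \<lceil>real n * x\<rceil> \<le> 1" using 0 by (auto simp: I01_def space_restrict_space)
  then have "real n * x \<le> 1" by linarith
  then show "x \<in> {0..1 / n}" using assms \<open>0 \<le> x\<close> by (simp add: pos_le_divide_eq mult.commute)
 next
  fix x assume x: "x \<in> {0..1 / real n}"
  then have "real n * x \<le> 1" using assms by (simp add: pos_le_divide_eq mult.commute)
  then have "nat \<lceil>real n * x\<rceil> \<le> 1" by linarith
  moreover have "1 / real n \<le> 1" using assms by simp
  ultimately show "x \<in> {x \<in> space I01. nat \<lceil>real n * x\<rceil> - 1 = i}" using 0 x
   by (auto simp: I01_def space_restrict_space)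
 qed
 moreover have "measure I01 {0..1 / real n} = measure lborel {0..1 / real n}"
  unfolding I01_def using assms by (subst measure_restrict_space) auto
 ultimately show ?thesis by simp
next
 case (Suc k)
 have eq: "{x \<in> space I01. nat \<lceil>real n * x\<rceil> - 1 = i} = {real i / real n<..(real i + 1) / real n}"
 proof (intro set_eqI iffI)
  fix x assume "x \<in> {x \<in> space I01. nat \<lceil>real n * x\<rceil> - 1 = i}"
  then have "nat \<lceil>real n * x\<rceil> = i + 1" using Suc by auto
  then have "real i < real n * x" "real n * x \<le> real i + 1" by linarith+
  then show "x \<in> {real i / real n<..(real i + 1) / real n}" using assms by (simp add: pos_divide_less_eq pos_le_divide_eq mult.commute)
 next
  fix x assume x: "x \<in> {real i / real n<..(real i + 1) / real n}"
  then have b: "real i < real n * x" "real n * x \<le> real i + 1" using assms by (simp_all add: pos_divide_less_eq pos_le_divide_eq mult.commute)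
  then have "nat \<lceil>real n * x\<rceil> = i + 1" by linarith
  moreover have "0 \<le> x" "x \<le> 1"
  proof -
   have "0 \<le> real i / real n" by simp
   moreover have "real i / real n < x" using x by simp
   ultimately show "0 \<le> x" by linarith
   have "(real i + 1) / n \<le> 1" using assms by simp
   then show "x \<le> 1" using x by auto
  qed
  ultimately show "x \<in> {x \<in> space I01. nat \<lceil>real n * x\<rceil> - 1 = i}" by (auto simp: I01_def space_restrict_space)
 qed
 have "{real i / real n<..(real i + 1) / real n} \<subseteq> {0..1::real}"
 proof -
  have "0 \<le> real i / real n" "(real i + 1) / n \<le> 1" using assms by auto
  then have "0 \<le> x \<and> x \<le> 1" if "real i / real n < x" "x \<le> (real i + 1) / real n" for x using that by linarith
  then show ?thesis by auto
 qed
 then have "measure I01 {real i / real n<..(real i + 1) / real n} = measure lborel {real i / real n<..(real i + 1) / real n}"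
  unfolding I01_def by (subst measure_restrict_space) auto
 also have "... = 1 / n" using assms by (simp add: divide_right_mono add_divide_distrib)
 finally show ?thesis unfolding eq .
qed

lemma prob_space_I01: "prob_space I01"
 by (rule prob_spaceI) (simp add: I01_def emeasure_restrict_space space_restrict_space)

section \<open>A matrix and a kernel on one coupling space\<close>

locale coupled = ker \<mu> \<kappa> for \<mu> :: "'s measure" and \<kappa> +
 fixes n :: nat and \<nu> :: "(real \<times> 's) measure"
 assumes n: "n > 0" and coupling: "coupling I01 \<mu> \<nu>"
begin

sublocale N: prob_space \<nu>
 using coupling by (simp add: coupling_def)

sublocale NN: pair_prob_space \<nu> \<nu> ..

lemma sets_eq [measurable_cong]: "sets \<nu> = sets (I01 \<Otimes>\<^sub>M \<mu>)"
 using coupling by (simp add: coupling_def)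

lemma space_eq: "space \<nu> = space I01 \<times> space \<mu>"
 using sets_eq_imp_space_eq[OF sets_eq] by (simp add: space_pair_measure)

lemma fst_measurable [measurable]: "fst \<in> \<nu> \<rightarrow>\<^sub>M I01" and snd_measurable [measurable]: "snd \<in> \<nu> \<rightarrow>\<^sub>M \<mu>"
 by measurable

definition ix :: "real \<times> 's => nat" where "ix u = nat \<lceil>real n * fst u\<rceil> - 1"

lemma ix_measurable [measurable]: "ix \<in> \<nu> \<rightarrow>\<^sub>M count_space UNIV"
proof -
 have "(\<lambda>x. x) \<in> I01 \<rightarrow>\<^sub>M borel" unfolding I01_def by (intro measurable_restrict_space1) auto
 from measurable_compose[OF fst_measurable this] have [measurable]: "(\<lambda>u. fst u) \<in> borel_measurable \<nu>" .
 show ?thesis unfolding ix_def[abs_def] by measurable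
qed

lemma ix_less: "u \<in> space \<nu> ==> ix u < n"
proof -
 assume "u \<in> space \<nu>"
 then have "fst u \<le> 1" by (auto simp: space_eq I01_def space_restrict_space)
 then have "real n * fst u \<le> real n" using mult_left_mono[of "fst u" 1 "real n"] by simp
 then have "nat \<lceil>real n * fst u\<rceil> \<le> n" by linarith
 then show ?thesis using n unfolding ix_def by linarith
qed

lemma ix_prob: "i < n ==> N.prob {u \<in> space \<nu>. ix u = i} = 1 / n"
proof -
 assume i: "i < n"
 let ?X = "{x \<in> space I01. nat \<lceil>real n * x\<rceil> - 1 = i}"
 have "(\<lambda>x. x) \<in> I01 \<rightarrow>\<^sub>M borel" unfolding I01_def by (intro measurable_restrict_space1) auto
 then have X: "?X \<in> sets I01" by measurable
 have "1 / n = measure (distr \<nu> I01 fst) ?X" using measure_step[OF n i] coupling by (simp add: coupling_def)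
 also have "... = N.prob (fst -` ?X \<inter> space \<nu>)" by (rule measure_distr[OF fst_measurable X])
 also have "fst -` ?X \<inter> space \<nu> = {u \<in> space \<nu>. ix u = i}" by (auto simp: ix_def space_eq)
 finally show ?thesis by simp
qed

lemma ix_integral:
 fixes \<phi> :: "nat => real"
 shows "integrable \<nu> (\<lambda>u. \<phi> (ix u))" and "(\<integral>u. \<phi> (ix u) \<partial>\<nu>) = (\<Sum>i<n. \<phi> i) / n"
proof -
 have eq: "\<phi> (ix u) = (\<Sum>i<n. \<phi> i * indicator {u \<in> space \<nu>. ix u = i} u)" if "u \<in> space \<nu>" for u
 proof -
  have "(\<Sum>i<n. \<phi> i * indicator {u \<in> space \<nu>. ix u = i} u) = (\<Sum>i<n. if i = ix u then \<phi> i else 0)"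
   using that by (intro sum.cong refl) (auto simp: indicator_def)
  then show ?thesis using ix_less[OF that] by (simp add: sum.delta')
 qed
 have int: "integrable \<nu> (\<lambda>u. \<phi> i * indicator {u \<in> space \<nu>. ix u = i} u)" for i
  by (intro integrable_mult_right integrable_real_indicator) (auto simp: N.emeasure_eq_measure)
 show "integrable \<nu> (\<lambda>u. \<phi> (ix u))"
  using int by (subst Bochner_Integration.integrable_cong[OF refl eq]) (auto simp only: intro!: B_integrable_sum)
 have "(\<integral>u. \<phi> (ix u) \<partial>\<nu>) = (\<integral>u. (\<Sum>i<n. \<phi> i * indicator {u \<in> space \<nu>. ix u = i} u) \<partial>\<nu>)"
  by (rule B_integral_cong[OF refl eq])
 also have "... = (\<Sum>i<n. (\<integral>u. \<phi> i * indicator {u \<in> space \<nu>. ix u = i} u \<partial>\<nu>))"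
  by (intro B_integral_sum int)
 also have "... = (\<Sum>i<n. \<phi> i * (1 / n))" by (intro sum.cong refl) (simp add: ix_prob)
 finally show "(\<integral>u. \<phi> (ix u) \<partial>\<nu>) = (\<Sum>i<n. \<phi> i) / n" by (simp add: sum_divide_distrib)
qed

lemma distr_snd: "distr \<nu> \<mu> snd = \<mu>"
 using coupling by (simp add: coupling_def)

lemma snd_integral: "f \<in> borel_measurable \<mu> ==> (\<integral>u. f (snd u) \<partial>\<nu>) = (\<integral>x. f x \<partial>\<mu> :: real)"
 using integral_distr[OF snd_measurable, of f] by (simp add: distr_snd)

abbreviation \<kappa>\<nu> :: "real \<times> 's => real \<times> 's => real" where "\<kappa>\<nu> u v \<equiv> \<kappa> (snd u) (snd v)"

sublocale K: ker \<nu> \<kappa>\<nu>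
 by (rule pullback(1)[OF N.prob_space_axioms snd_measurable distr_snd])

lemma offmass_snd: "u \<in> space \<nu> ==> offmass \<nu> \<kappa>\<nu> u = offmass \<mu> \<kappa> (snd u)"
 by (rule pullback(2)[OF N.prob_space_axioms snd_measurable distr_snd])

lemma offmass_tail_snd: "(\<integral>u. max 0 (offmass \<nu> \<kappa>\<nu> u - K) \<partial>\<nu>) = excess K"
 using snd_integral[of "\<lambda>x. max 0 (offmass \<mu> \<kappa> x - K)"]
 by (simp add: offmass_snd cong: B_integral_cong)

definition gap :: "(nat => nat => real) => real \<times> 's => real \<times> 's => real" where
 "gap a u v = a (ix u) (ix v) - \<kappa>\<nu> u v"

definition cut_form :: "(nat => nat => real) => (real \<times> 's => real) => (real \<times> 's => real) => real" where
 "cut_form a f g = (\<integral>z. gap a (fst z) (snd z) * f (fst z) * g (snd z) \<partial>(sqm \<nu>))"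

text \<open>The bound is required on the whole type and not only on the space of the measure, in
  agreement with the supremum in \<open>cut_dist\<close>.\<close>

definition test :: "(real \<times> 's => real) => bool" where
 "test f \<longleftrightarrow> f \<in> borel_measurable \<nu> \<and> (\<forall>z. \<bar>f z\<bar> \<le> 1)"

lemma matrix_bound: "i < n ==> j < n ==> \<bar>a i j\<bar> \<le> (\<Sum>i<n. \<Sum>j<n. \<bar>a i j :: real\<bar>)"
proof -
 assume ij: "i < n" "j < n"
 have "\<bar>a i j\<bar> \<le> (\<Sum>j<n. \<bar>a i j\<bar>)" using ij by (intro member_le_sum) auto
 also have "... \<le> (\<Sum>i<n. \<Sum>j<n. \<bar>a i j\<bar>)" using ij by (intro member_le_sum[of i "{..<n}" "\<lambda>i. \<Sum>j<n. \<bar>a i j\<bar>"]) (auto intro: sum_nonneg)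
 finally show ?thesis .
qed

lemma matrix_measurable [measurable]: "(\<lambda>z. a (ix (fst z)) (ix (snd z)) :: real) \<in> borel_measurable (sqm \<nu>)"
proof -
 have "(\<lambda>z. (ix (fst z), ix (snd z))) \<in> sqm \<nu> \<rightarrow>\<^sub>M count_space UNIV \<Otimes>\<^sub>M count_space UNIV" by measurable
 then have "(\<lambda>z. (ix (fst z), ix (snd z))) \<in> sqm \<nu> \<rightarrow>\<^sub>M count_space UNIV"
  by (simp add: pair_measure_countable)
 from measurable_compose[OF this, of "\<lambda>(i, j). a i j" borel] show ?thesis by simp
qed

lemma matrix_integrable: "integrable (sqm \<nu>) (\<lambda>z. a (ix (fst z)) (ix (snd z)) :: real)"
proof (rule NN.P.integrable_const_bound[OF _ matrix_measurable])
 show "AE z in sqm \<nu>. norm (a (ix (fst z)) (ix (snd z))) \<le> (\<Sum>i<n. \<Sum>j<n. \<bar>a i j\<bar>)"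
  by (rule AE_I2) (auto simp: space_pair_measure intro!: matrix_bound ix_less)
qed

lemma gap_integrable: "integrable (sqm \<nu>) (\<lambda>z. gap a (fst z) (snd z))"
 unfolding gap_def by (intro B_integrable_diff matrix_integrable K.kernel_integrable2)

lemma test_measurable: "test f ==> f \<in> borel_measurable \<nu>" and test_le: "test f ==> \<bar>f z\<bar> \<le> 1"
 unfolding test_def by blast+

lemma weighted_integrable:
 assumes w: "integrable (sqm \<nu>) w" and f: "test f" and g: "test g"
 shows "integrable (sqm \<nu>) (\<lambda>z. w z * f (fst z) * g (snd z) :: real)"
proof (rule B_integrable_bound[OF w])
 note [measurable] = test_measurable[OF f] test_measurable[OF g] borel_measurable_integrable[OF w]
 show "(\<lambda>z. w z * f (fst z) * g (snd z)) \<in> borel_measurable (sqm \<nu>)" by measurable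
 have "\<bar>w z * f (fst z) * g (snd z)\<bar> \<le> \<bar>w z\<bar>" for z
 proof -
  have "\<bar>w z\<bar> * \<bar>f (fst z)\<bar> * \<bar>g (snd z)\<bar> \<le> \<bar>w z\<bar> * 1 * 1"
   using test_le[OF f] test_le[OF g] by (intro mult_mono) auto
  then show ?thesis by (simp add: abs_mult)
 qed
 then show "AE z in sqm \<nu>. norm (w z * f (fst z) * g (snd z)) \<le> norm (w z)" by (intro AE_I2) simp
qed

text \<open>Taking for f the sign of the inner integral turns the bound on the bilinear form into an
  L1 bound on that integral.\<close>

lemma cut_inner:
 assumes cut: "\<And>f g. test f ==> test g ==> \<bar>cut_form a f g\<bar> \<le> \<eta>" and g: "test g"
 shows "integrable \<nu> (\<lambda>u. \<integral>v. gap a u v * g v \<partial>\<nu>)" "(\<integral>u. \<bar>\<integral>v. gap a u v * g v \<partial>\<nu>\<bar> \<partial>\<nu>) \<le> \<eta>"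
proof -
 let ?H = "\<lambda>u. \<integral>v. gap a u v * g v \<partial>\<nu>"
 have one: "test (\<lambda>_. 1)" by (simp add: test_def)
 have int: "integrable (sqm \<nu>) (\<lambda>(u, v). gap a u v * g v)"
  using weighted_integrable[OF gap_integrable one g] by (simp add: case_prod_unfold)
 show Hi: "integrable \<nu> ?H" using NN.integrable_fst[OF int] by simp
 note [measurable] = borel_measurable_integrable[OF Hi]
 define f where "f u = sgn (?H u)" for u
 have f: "test f" unfolding test_def f_def by (auto simp: abs_sgn_eq)
 have "(\<integral>u. \<bar>?H u\<bar> \<partial>\<nu>) = (\<integral>u. \<integral>v. gap a u v * f u * g v \<partial>\<nu> \<partial>\<nu>)"
 proof (rule B_integral_cong[OF refl])
  fix u
  have "(\<integral>v. gap a u v * f u * g v \<partial>\<nu>) = (\<integral>v. f u * (gap a u v * g v) \<partial>\<nu>)"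
   by (rule B_integral_cong) (auto simp: mult_ac)
  also have "... = f u * ?H u" by simp
  finally show "\<bar>?H u\<bar> = (\<integral>v. gap a u v * f u * g v \<partial>\<nu>)" by (simp add: f_def abs_sgn mult.commute)
 qed
 also have "... = cut_form a f g"
  using NN.integral_fst[of "\<lambda>u v. gap a u v * f u * g v"] weighted_integrable[OF gap_integrable f g, of a]
  by (simp add: cut_form_def case_prod_unfold)
 also have "... \<le> \<eta>" using cut[OF f g] by simp
 finally show "(\<integral>u. \<bar>?H u\<bar> \<partial>\<nu>) \<le> \<eta>" .
qed

end

text \<open>Orthogonality of sign vectors indexed by subsets: for j \<noteq> k, toggling the
  membership of j is an involution that reverses the sign of every term.\<close>

lemma sum_signs:
 assumes "finite A" "j \<in> A" "k \<in> A"
 shows "(\<Sum>S\<in>Pow A. (if j \<in> S then 1 else - 1) * (if k \<in> S then 1 else - 1 :: real)) = (if j = k then 2 ^ card A else 0)"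
proof (cases "j = k")
 case True
 have "(\<Sum>S\<in>Pow A. (if j \<in> S then 1 else - 1) * (if k \<in> S then 1 else - 1 :: real)) = (\<Sum>S\<in>Pow A. 1)"
  unfolding True by (intro sum.cong refl) auto
 then show ?thesis using True assms by (simp add: card_Pow)
next
 case False
 let ?f = "\<lambda>S. (if j \<in> S then 1 else - 1) * (if k \<in> S then 1 else - 1 :: real)"
 let ?t = "\<lambda>S. if j \<in> S then S - {j} else insert j S"
 have "bij_betw ?t (Pow A) (Pow A)"
  by (rule bij_betw_byWitness[where f' = ?t]) (use assms in auto)
 then have "(\<Sum>S\<in>Pow A. ?f S) = (\<Sum>S\<in>Pow A. ?f (?t S))" by (rule sum.reindex_bij_betw[symmetric])
 also have "... = (\<Sum>S\<in>Pow A. - ?f S)" using False by (intro sum.cong refl) auto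
 also have "... = - (\<Sum>S\<in>Pow A. ?f S)" by (rule sum_negf)
 finally show ?thesis using False by simp
qed

section \<open>Estimates from a small cut norm\<close>

locale coupled_matrix = coupled \<mu> \<kappa> n \<nu> for \<mu> :: "'s measure" and \<kappa> n \<nu> +
 fixes a :: "nat => nat => real" and \<eta> :: real
 assumes a_nonneg: "i < n ==> j < n ==> 0 \<le> a i j" and a_sym: "i < n ==> j < n ==> a i j = a j i"
  and cut: "test f ==> test g ==> \<bar>cut_form a f g\<bar> \<le> \<eta>"
begin

lemma gap_integral:
 assumes u: "u \<in> space \<nu>" and g: "test (\<lambda>v. \<phi> (ix v))"
 shows "(\<integral>v. gap a u v * \<phi> (ix v) \<partial>\<nu>) = (\<Sum>j<n. a (ix u) j * \<phi> j) / n - (\<integral>v. \<kappa>\<nu> u v * \<phi> (ix v) \<partial>\<nu>)"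
proof -
 have "(\<integral>v. gap a u v * \<phi> (ix v) \<partial>\<nu>) = (\<integral>v. a (ix u) (ix v) * \<phi> (ix v) - \<kappa>\<nu> u v * \<phi> (ix v) \<partial>\<nu>)"
  by (simp add: gap_def left_diff_distrib)
 also have "... = (\<integral>v. a (ix u) (ix v) * \<phi> (ix v) \<partial>\<nu>) - (\<integral>v. \<kappa>\<nu> u v * \<phi> (ix v) \<partial>\<nu>)"
  using ix_integral(1)[of "\<lambda>j. a (ix u) j * \<phi> j"] test_measurable[OF g] test_le[OF g] u
  by (intro B_integral_diff K.kernel_mult_integrable) auto
 finally show ?thesis using ix_integral(2)[of "\<lambda>j. a (ix u) j * \<phi> j"] by simp
qed

abbreviation row :: "nat => real" where "row i \<equiv> (\<Sum>j<n. a i j) / n"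

text \<open>Testing with g = 1 shows that the row sums and the row masses of \<kappa> differ by at
  most \<eta> in L1; the excess over K is 1-Lipschitz in the row sum.\<close>

lemma row_tail: "(\<Sum>i<n. max 0 (row i - K)) / n \<le> \<eta> + excess K"
proof -
 have one: "test (\<lambda>v. (\<lambda>_. 1) (ix v))" by (simp add: test_def)
 let ?H = "\<lambda>u. \<integral>v. gap a u v * 1 \<partial>\<nu>"
 note H = cut_inner[OF cut one]
 have eq: "?H u = row (ix u) - offmass \<nu> \<kappa>\<nu> u" if "u \<in> space \<nu>" for u
  using gap_integral[OF that one] that by (simp add: K.offmass_eq_integral)
 have "(\<Sum>i<n. max 0 (row i - K)) / n = (\<integral>u. max 0 (row (ix u) - K) \<partial>\<nu>)"
  by (rule ix_integral(2)[symmetric])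
 also have "... \<le> (\<integral>u. \<bar>?H u\<bar> + max 0 (offmass \<nu> \<kappa>\<nu> u - K) \<partial>\<nu>)"
 proof (rule integral_mono)
  show "integrable \<nu> (\<lambda>u. max 0 (row (ix u) - K))" by (rule ix_integral(1))
  show "integrable \<nu> (\<lambda>u. \<bar>?H u\<bar> + max 0 (offmass \<nu> \<kappa>\<nu> u - K))"
   using H(1) K.offmass_tail_integrable by (intro B_integrable_add integrable_abs) auto
  show "max 0 (row (ix u) - K) \<le> \<bar>?H u\<bar> + max 0 (offmass \<nu> \<kappa>\<nu> u - K)" if "u \<in> space \<nu>" for u
   unfolding eq[OF that] by linarith
 qed
 also have "... = (\<integral>u. \<bar>?H u\<bar> \<partial>\<nu>) + (\<integral>u. max 0 (offmass \<nu> \<kappa>\<nu> u - K) \<partial>\<nu>)"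
  using H(1) K.offmass_tail_integrable by (intro B_integral_add integrable_abs) auto
 also have "... \<le> \<eta> + excess K"
  using H(2) by (simp add: offmass_tail_snd)
 finally show ?thesis .
qed

text \<open>Averaging the cut norm bound over random signs shows that no row can be concentrated on few entries.\<close>
lemma selector_sum:
 assumes J: "\<And>i. i < n ==> J i < n" and L: "L \<ge> 0"
 shows "(\<Sum>i<n. a i (J i) / n) / n \<le> \<eta> + kdist (\<lambda>x y. min (\<kappa> x y) L) + L / n"
proof -
 let ?P = "sqm \<nu>"
 \<comment> \<open>A subset S of the indices encodes a choice of signs. One test function reads the
   sign at the selected index J of the row, the other the sign at the column index.\<close>
 define sg where "sg S k = (if k \<in> S then 1 else - 1 :: real)" for S and k :: nat
 let ?G = "\<lambda>S z. gap a (fst z) (snd z) * sg S (J (ix (fst z))) * sg S (ix (snd z))"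
 have tf: "test (\<lambda>u. sg S (J (ix u)))" and tg: "test (\<lambda>v. sg S (ix v))" for S
  using measurable_compose[OF ix_measurable, of "\<lambda>i. sg S (J i)" borel] measurable_compose[OF ix_measurable, of "sg S" borel]
  unfolding test_def by (simp_all add: sg_def)
 define I where "I z = (if J (ix (fst z)) = ix (snd z) then 1 else 0 :: real)" for z
 have I: "0 \<le> I z" "I z \<le> 1" for z by (auto simp: I_def)
 have Im [measurable]: "I \<in> borel_measurable ?P"
  unfolding I_def[abs_def] by (rule matrix_measurable[of "\<lambda>i j. if J i = j then 1 else 0"])
 have wI: "integrable ?P (\<lambda>z. w z * I z)" if "integrable ?P w" for w
 proof (rule B_integrable_bound[OF that])
  show "(\<lambda>z. w z * I z) \<in> borel_measurable ?P" using borel_measurable_integrable[OF that] by measurable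
  show "AE z in ?P. norm (w z * I z) \<le> norm (w z)" using I by (intro AE_I2) (simp add: abs_mult mult_left_le)
 qed
 \<comment> \<open>Averaging over all sign choices leaves only the pairs whose column index is the
   one selected by J.\<close>
 have signs: "(\<Sum>S\<in>Pow {..<n}. ?G S z) = 2 ^ n * (gap a (fst z) (snd z) * I z)"
  if z: "z \<in> space ?P" for z
 proof -
  have l: "J (ix (fst z)) < n" "ix (snd z) < n" using z by (auto simp: space_pair_measure intro!: J ix_less)
  have "(\<Sum>S\<in>Pow {..<n}. ?G S z) =
   gap a (fst z) (snd z) * (\<Sum>S\<in>Pow {..<n}. sg S (J (ix (fst z))) * sg S (ix (snd z)))"
   by (simp add: sum_distrib_left mult.assoc)
  also have "(\<Sum>S\<in>Pow {..<n}. sg S (J (ix (fst z))) * sg S (ix (snd z))) = 2 ^ n * I z"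
   unfolding sg_def I_def using sum_signs[of "{..<n}" "J (ix (fst z))" "ix (snd z)"] l by simp
  finally show ?thesis by simp
 qed
 have "2 ^ n * (\<integral>z. gap a (fst z) (snd z) * I z \<partial>?P) = (\<integral>z. 2 ^ n * (gap a (fst z) (snd z) * I z) \<partial>?P)" by simp
 also have "... = (\<integral>z. (\<Sum>S\<in>Pow {..<n}. ?G S z) \<partial>?P)"
  by (rule B_integral_cong[OF refl]) (rule signs[symmetric])
 also have "... = (\<Sum>S\<in>Pow {..<n}. cut_form a (\<lambda>u. sg S (J (ix u))) (\<lambda>v. sg S (ix v)))"
  unfolding cut_form_def
  by (rule B_integral_sum) (rule weighted_integrable[OF gap_integrable tf tg])
 also have "... \<le> (\<Sum>S\<in>Pow {..<n}. \<eta>)" by (rule sum_mono) (rule order_trans[OF abs_ge_self cut[OF tf tg]])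
 also have "... = 2 ^ n * \<eta>" by (simp add: card_Pow)
 finally have gI: "(\<integral>z. gap a (fst z) (snd z) * I z \<partial>?P) \<le> \<eta>" by simp
 have J_int: "(\<integral>z. a' (ix (fst z)) (ix (snd z)) * I z \<partial>?P) = (\<Sum>i<n. a' i (J i) / n) / n" for a' :: "nat => nat => real"
 proof -
  have int: "integrable ?P (\<lambda>(u, v). a' (ix u) (ix v) * I (u, v))"
   using wI[OF matrix_integrable, of a'] by (simp add: case_prod_unfold)
  have "(\<integral>z. a' (ix (fst z)) (ix (snd z)) * I z \<partial>?P) = (\<integral>u. \<integral>v. a' (ix u) (ix v) * I (u, v) \<partial>\<nu> \<partial>\<nu>)"
   using NN.integral_fst[OF int] by (simp add: case_prod_unfold)
  also have "... = (\<integral>u. a' (ix u) (J (ix u)) / n \<partial>\<nu>)"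
  proof (rule B_integral_cong[OF refl])
   fix u assume "u \<in> space \<nu>"
   then have l: "J (ix u) < n" by (intro J ix_less)
   have "(\<integral>v. a' (ix u) (ix v) * I (u, v) \<partial>\<nu>) = (\<Sum>j<n. a' (ix u) j * (if J (ix u) = j then 1 else 0)) / n"
    using ix_integral(2)[of "\<lambda>j. a' (ix u) j * (if J (ix u) = j then 1 else 0)"] by (simp add: I_def)
   also have "(\<Sum>j<n. a' (ix u) j * (if J (ix u) = j then 1 else 0)) = (\<Sum>j<n. if J (ix u) = j then a' (ix u) j else 0)"
    by (intro sum.cong refl) auto
   also have "... = a' (ix u) (J (ix u))" using l by (simp add: sum.delta)
   finally show "(\<integral>v. a' (ix u) (ix v) * I (u, v) \<partial>\<nu>) = a' (ix u) (J (ix u)) / n" .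
  qed
  also have "... = (\<Sum>i<n. a' i (J i) / n) / n" by (rule ix_integral(2))
  finally show ?thesis .
 qed
 interpret T: ker \<mu> "\<lambda>x y. min (\<kappa> x y) L" by (rule truncation_ker[OF L])
 let ?t = "\<lambda>z. \<bar>\<kappa>\<nu> (fst z) (snd z) - min (\<kappa>\<nu> (fst z) (snd z)) L\<bar>"
 have t_int: "integrable ?P ?t"
 proof -
  interpret T': ker \<nu> "\<lambda>u v. min (\<kappa>\<nu> u v) L" by (rule K.truncation_ker[OF L])
  show ?thesis by (intro integrable_abs B_integrable_diff K.kernel_integrable2 T'.kernel_integrable2)
 qed
 have LI: "integrable ?P (\<lambda>z. L * I z)" using wI[of "\<lambda>_. L"] by simp
 \<comment> \<open>The set where I equals 1 has measure 1 / n, so the truncated kernel contributes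
   at most L / n there and the remainder is paid by \<open>kdist\<close>.\<close>
 have "(\<integral>z. \<kappa>\<nu> (fst z) (snd z) * I z \<partial>?P) \<le> (\<integral>z. ?t z + L * I z \<partial>?P)"
 proof (rule integral_mono[OF wI[OF K.kernel_integrable2]])
  show "integrable ?P (\<lambda>z. ?t z + L * I z)" using t_int LI by (rule B_integrable_add)
  show "\<kappa>\<nu> (fst z) (snd z) * I z \<le> ?t z + L * I z" for z by (auto simp: I_def)
 qed
 also have "... = (\<integral>z. ?t z \<partial>?P) + (\<integral>z. L * I z \<partial>?P)" by (rule B_integral_add[OF t_int LI])
 also have "(\<integral>z. ?t z \<partial>?P) = kdist (\<lambda>x y. min (\<kappa> x y) L)"
  by (rule pullback(3)[OF N.prob_space_axioms snd_measurable distr_snd, of "\<lambda>x y. \<bar>\<kappa> x y - min (\<kappa> x y) L\<bar>"]) measurable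
 also have "(\<integral>z. L * I z \<partial>?P) = L / n" using J_int[of "\<lambda>_ _. L"] n by simp
 finally have \<kappa>I: "(\<integral>z. \<kappa>\<nu> (fst z) (snd z) * I z \<partial>?P) \<le> kdist (\<lambda>x y. min (\<kappa> x y) L) + L / n" .
 have "(\<integral>z. gap a (fst z) (snd z) * I z \<partial>?P) = (\<integral>z. a (ix (fst z)) (ix (snd z)) * I z - \<kappa>\<nu> (fst z) (snd z) * I z \<partial>?P)"
  by (simp add: gap_def left_diff_distrib)
 also have "... = (\<integral>z. a (ix (fst z)) (ix (snd z)) * I z \<partial>?P) - (\<integral>z. \<kappa>\<nu> (fst z) (snd z) * I z \<partial>?P)"
  by (rule B_integral_diff[OF wI[OF matrix_integrable] wI[OF K.kernel_integrable2]])
 finally show ?thesis using gI \<kappa>I unfolding J_int by linarith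
qed

definition weight :: "nat => nat => real" where
 "weight i j = (if i = j then 0 else min (a i j / n) 1)"

lemma weight_edge_prob: "edge_prob n weight"
proof
 show "weight i j = weight j i" if "i < n" "j < n" for i j using a_sym[OF that] by (simp add: weight_def)
qed (auto simp: weight_def a_nonneg)

text \<open>K + 1 times the bound of \<open>selector_sum\<close> on the largest row entries, plus
  the bound of \<open>row_tail\<close>. It is K + 1 and not K because removing the diagonal costs
  one more row maximum.\<close>

definition err :: "real => real => real" where
 "err L K = (K + 1) * (\<eta> + kdist (\<lambda>x y. min (\<kappa> x y) L) + L / n) + (\<eta> + excess K)"

text \<open>With c = a / n, both the square of the capped weight and the loss from capping are at
  most c times min 1 c. Along a row this sums to at most the row sum times min 1 of the largest
  entry, hence to at most K times that entry plus the excess above K.\<close>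

lemma weight_error:
 assumes K: "K \<ge> 0" and L: "L \<ge> 0"
 shows "(\<Sum>i<n. \<Sum>j<n. (weight i j)\<^sup>2) / n \<le> err L K"
  and "(\<Sum>i<n. \<Sum>j<n. \<bar>weight i j - a i j / n\<bar>) / n \<le> err L K"
proof -
 define c where "c i j = a i j / n" for i j
 have c: "0 \<le> c i j" if "i < n" "j < n" for i j using a_nonneg[OF that] by (simp add: c_def)
 have "\<exists>J. \<forall>i<n. J i < n \<and> (\<forall>j<n. c i j \<le> c i (J i))"
 proof -
  have "\<exists>j. j < n \<and> (\<forall>k<n. c i k \<le> c i j)" for i
  proof -
   have "Max (c i ` {..<n}) \<in> c i ` {..<n}" using n by (intro Max_in) auto
   then obtain j where j: "j < n" "c i j = Max (c i ` {..<n})" by auto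
   have "c i k \<le> c i j" if "k < n" for k unfolding j(2) using that by (intro Max_ge) auto
   with j(1) show ?thesis by blast
  qed
  then show ?thesis by metis
 qed
 then obtain J where J: "\<And>i. i < n ==> J i < n" "\<And>i j. i < n ==> j < n ==> c i j \<le> c i (J i)" by metis
 let ?m = "\<lambda>i. c i (J i)"
 let ?B = "\<Sum>i<n. K * ?m i + max 0 (row i - K) + ?m i"
 have m: "(\<Sum>i<n. ?m i) / n \<le> \<eta> + kdist (\<lambda>x y. min (\<kappa> x y) L) + L / n"
  using selector_sum[of J L] J(1) L by (simp add: c_def)
 have m0: "0 \<le> ?m i" if "i < n" for i using c[OF that J(1)[OF that]] .
 have row_eq: "(\<Sum>j<n. c i j) = row i" for i by (simp add: c_def sum_divide_distrib)
 have cm: "(\<Sum>j<n. c i j * min 1 (c i j)) \<le> K * ?m i + max 0 (row i - K)" if i: "i < n" for i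
 proof -
  have mm: "0 \<le> min 1 (?m i)" "min 1 (?m i) \<le> 1" "min 1 (?m i) \<le> ?m i" using m0[OF i] by auto
  have "(\<Sum>j<n. c i j * min 1 (c i j)) \<le> (\<Sum>j<n. c i j * min 1 (?m i))"
   using c J i by (intro sum_mono mult_left_mono) (auto intro: min.coboundedI2 min.coboundedI1)
  also have "... = row i * min 1 (?m i)" by (simp only: sum_distrib_right[symmetric] row_eq)
  also have "... \<le> (K + max 0 (row i - K)) * min 1 (?m i)" using mm by (intro mult_right_mono) auto
  also have "... = K * min 1 (?m i) + max 0 (row i - K) * min 1 (?m i)" by (rule distrib_right)
  also have "... \<le> K * ?m i + max 0 (row i - K)"
   using mm K by (intro add_mono mult_left_mono mult_left_le) auto
  finally show ?thesis .
 qed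
 have tot: "?B / n \<le> err L K"
 proof -
  have "?B / n = (K + 1) * ((\<Sum>i<n. ?m i) / n) + (\<Sum>i<n. max 0 (row i - K)) / n"
   by (simp add: sum.distrib sum_distrib_left[symmetric] add_divide_distrib distrib_right)
  also have "... \<le> err L K" unfolding err_def using K by (intro add_mono mult_left_mono m row_tail) auto
  finally show ?thesis .
 qed
 have "(\<Sum>i<n. \<Sum>j<n. (weight i j)\<^sup>2) \<le> ?B"
 proof (rule sum_mono)
  fix i assume i: "i \<in> {..<n}"
  have "(\<Sum>j<n. (weight i j)\<^sup>2) \<le> (\<Sum>j<n. c i j * min 1 (c i j))"
  proof (rule sum_mono)
   fix j assume j: "j \<in> {..<n}"
   then have c0: "0 \<le> c i j" using c i by auto
   have "(min (c i j) 1)\<^sup>2 \<le> c i j * min 1 (c i j)"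
    unfolding power2_eq_square using c0 by (intro mult_mono) auto
   moreover have "0 \<le> c i j * min 1 (c i j)" using c0 by simp
   ultimately show "(weight i j)\<^sup>2 \<le> c i j * min 1 (c i j)"
    unfolding weight_def c_def[symmetric] by (cases "i = j") simp_all
  qed
  then show "(\<Sum>j<n. (weight i j)\<^sup>2) \<le> K * ?m i + max 0 (row i - K) + ?m i" using cm[of i] m0[of i] i by auto
 qed
 then have "(\<Sum>i<n. \<Sum>j<n. (weight i j)\<^sup>2) / n \<le> ?B / n"
  by (rule divide_right_mono) simp
 then show "(\<Sum>i<n. \<Sum>j<n. (weight i j)\<^sup>2) / n \<le> err L K" using tot by linarith
 have "(\<Sum>i<n. \<Sum>j<n. \<bar>weight i j - c i j\<bar>) \<le> ?B"
 proof (rule sum_mono)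
  fix i assume i: "i \<in> {..<n}"
  have "(\<Sum>j<n. \<bar>weight i j - c i j\<bar>) \<le> (\<Sum>j<n. c i j * min 1 (c i j) + (if j = i then ?m i else 0))"
  proof (rule sum_mono)
   fix j assume j: "j \<in> {..<n}"
   then have c0: "0 \<le> c i j" "c i j \<le> ?m i" using c J i by auto
   show "\<bar>weight i j - c i j\<bar> \<le> c i j * min 1 (c i j) + (if j = i then ?m i else 0)"
   proof (cases "i = j")
    case True
    have "0 \<le> c i j * min 1 (c i j)" using c0 by simp
    moreover have "\<bar>weight i j - c i j\<bar> = c i j" using True c0 by (simp add: weight_def)
    moreover have "(if j = i then ?m i else 0) = ?m i" using True by simp
    ultimately show ?thesis using c0 by linarith
   next
    case False
    have "\<bar>min (c i j) 1 - c i j\<bar> \<le> c i j * min 1 (c i j)"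
     using c0 by (cases "c i j \<le> 1") (auto simp: min_def)
    then show ?thesis using False by (simp add: weight_def c_def)
   qed
  qed
  also have "... = (\<Sum>j<n. c i j * min 1 (c i j)) + ?m i" using i by (simp add: sum.distrib)
  finally show "(\<Sum>j<n. \<bar>weight i j - c i j\<bar>) \<le> K * ?m i + max 0 (row i - K) + ?m i" using cm[of i] i by auto
 qed
 then have "mdist n n weight c \<le> ?B / n"
  by (rule divide_right_mono) simp
 then show "(\<Sum>i<n. \<Sum>j<n. \<bar>weight i j - a i j / n\<bar>) / n \<le> err L K" using tot unfolding c_def by linarith
qed

text \<open>Both recursions are compared at a point of the coupling. The errors are the passage from
  capped weights to a / n, the cut norm tested against a function of the column index, and \<kappa>
  applied to the previous error; since \<kappa> multiplies that error, only its own tail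
  enters.\<close>

lemma mgf_step:
 assumes s: "0 \<le> s" "s \<le> 1" and K: "K \<ge> 0" and KL: "K' \<ge> 0" "L \<ge> 0"
 shows "(\<integral>u. \<bar>mgf weight {..<n} s (Suc d) (ix u) - bp_pgf \<mu> \<kappa> s (Suc d) (snd u)\<bar> \<partial>\<nu>) \<le>
  (err L K' + \<eta>) + K * (\<integral>u. \<bar>mgf weight {..<n} s d (ix u) - bp_pgf \<mu> \<kappa> s d (snd u)\<bar> \<partial>\<nu>)
  + excess K"
proof -
 interpret W: edge_prob n weight by (rule weight_edge_prob)
 let ?g = "mgf weight {..<n} s d" and ?G = "bp_pgf \<mu> \<kappa> s d"
 have g: "0 \<le> mgf weight {..<n} s d i \<and> mgf weight {..<n} s d i \<le> 1" if "i < n" for i d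
  using W.mgf_bounds[OF s order_refl that] .
 have G: "0 \<le> ?G x \<and> ?G x \<le> 1" if "x \<in> space \<mu>" for x using bp_pgf_bounds1[OF s that] .
 \<comment> \<open>Set to 0 beyond the matrix, because \<open>test\<close> demands the bound
   everywhere and \<open>mgf\<close> is controlled only at indices below n.\<close>
 define \<phi> where "\<phi> j = (if j < n then 1 - ?g j else 0)" for j
 have ixm: "(\<lambda>v. f (ix v)) \<in> borel_measurable \<nu>" for f :: "nat => real"
  by (rule measurable_compose[OF ix_measurable]) simp
 have t: "test (\<lambda>v. \<phi> (ix v))" unfolding test_def using ixm[of \<phi>] g by (auto simp: \<phi>_def)
 define F where "F v = \<bar>?g (ix v) - ?G (snd v)\<bar>" for v
 let ?W = "\<lambda>u. \<integral>v. \<kappa>\<nu> u v * F v \<partial>\<nu>"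
 have sp: "ix u < n" "snd u \<in> space \<mu>" if "u \<in> space \<nu>" for u using ix_less[OF that] that by (auto simp: space_eq)
 have F: "0 \<le> F v \<and> F v \<le> 1" if "v \<in> space \<nu>" for v
  using g[OF sp(1)[OF that], of d] G[OF sp(2)[OF that]] by (auto simp: F_def)
 have Gm [measurable]: "(\<lambda>v. bp_pgf \<mu> \<kappa> s d (snd v)) \<in> borel_measurable \<nu>" for d by measurable
 have Fm [measurable]: "F \<in> borel_measurable \<nu>" unfolding F_def[abs_def] using ixm[of ?g] Gm[of d] by measurable
 let ?H = "\<lambda>u. \<integral>v. gap a u v * \<phi> (ix v) \<partial>\<nu>"
 note H = cut_inner[OF cut t]
 note KF = K.kernel_weight_integral[OF Fm F K]
 let ?e = "\<lambda>i. \<Sum>j<n. \<bar>weight i j - a i j / n\<bar>"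
 have pt: "\<bar>mgf weight {..<n} s (Suc d) (ix u) - bp_pgf \<mu> \<kappa> s (Suc d) (snd u)\<bar> \<le>
  ?e (ix u) + \<bar>?H u\<bar> + (?W u)" if u: "u \<in> space \<nu>" for u
 proof -
  let ?S = "\<Sum>j<n. weight (ix u) j * (1 - ?g j)" and ?I = "\<integral>y. \<kappa> (snd u) y * (1 - ?G y) \<partial>\<mu>"
  have S0: "0 \<le> ?S" using g sp(1)[OF u] by (intro sum_nonneg mult_nonneg_nonneg W.p_nonneg) auto
  have I0: "0 \<le> ?I" using G sp(2)[OF u] by (intro B_integral_nonneg mult_nonneg_nonneg kernel_nonneg) auto
  have "\<bar>mgf weight {..<n} s (Suc d) (ix u) - bp_pgf \<mu> \<kappa> s (Suc d) (snd u)\<bar> = s * \<bar>exp (- ?S) - exp (- ?I)\<bar>"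
   using s by (simp add: abs_mult flip: right_diff_distrib)
  also have "... \<le> 1 * \<bar>?S - ?I\<bar>" using s S0 I0 by (intro mult_mono exp_minus_Lipschitz) auto
  finally have 0: "\<bar>mgf weight {..<n} s (Suc d) (ix u) - bp_pgf \<mu> \<kappa> s (Suc d) (snd u)\<bar> \<le> \<bar>?S - ?I\<bar>" by simp
  have eq\<phi>: "?S = (\<Sum>j<n. weight (ix u) j * \<phi> j)" by (intro sum.cong refl) (simp add: \<phi>_def)
  have "\<bar>?S - (\<Sum>j<n. a (ix u) j * \<phi> j) / n\<bar> = \<bar>\<Sum>j<n. (weight (ix u) j - a (ix u) j / n) * \<phi> j\<bar>"
   unfolding eq\<phi> by (simp add: left_diff_distrib sum_subtractf sum_divide_distrib)
  also have "... \<le> (\<Sum>j<n. \<bar>weight (ix u) j - a (ix u) j / n\<bar>)"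
  proof (rule order_trans[OF sum_abs sum_mono])
   fix j assume "j \<in> {..<n}"
   then have "\<bar>\<phi> j\<bar> \<le> 1" using g by (auto simp: \<phi>_def)
   then show "\<bar>(weight (ix u) j - a (ix u) j / n) * \<phi> j\<bar> \<le> \<bar>weight (ix u) j - a (ix u) j / n\<bar>"
    by (simp add: abs_mult mult_left_le)
  qed
  finally have 1: "\<bar>?S - (\<Sum>j<n. a (ix u) j * \<phi> j) / n\<bar> \<le> ?e (ix u)" .
  have m2: "(\<lambda>y. \<kappa> (snd u) y * (1 - ?G y)) \<in> borel_measurable \<mu>" using sp(2)[OF u] by measurable
  have I_eq: "?I = (\<integral>v. \<kappa>\<nu> u v * (1 - ?G (snd v)) \<partial>\<nu>)" by (rule snd_integral[OF m2, symmetric])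
  have i1: "integrable \<nu> (\<lambda>v. \<kappa>\<nu> u v * \<phi> (ix v))"
   using test_measurable[OF t] test_le[OF t] u by (intro K.kernel_mult_integrable) auto
  have i2: "integrable \<nu> (\<lambda>v. \<kappa>\<nu> u v * (1 - ?G (snd v)))"
   using u G sp(2) by (intro K.kernel_mult_integrable) auto
  have i3: "integrable \<nu> (\<lambda>v. \<kappa>\<nu> u v * F v)"
   using u F by (intro K.kernel_mult_integrable) auto
  have "\<bar>(\<integral>v. \<kappa>\<nu> u v * \<phi> (ix v) \<partial>\<nu>) - ?I\<bar> = \<bar>\<integral>v. \<kappa>\<nu> u v * \<phi> (ix v) - \<kappa>\<nu> u v * (1 - ?G (snd v)) \<partial>\<nu>\<bar>"
   unfolding I_eq using B_integral_diff[OF i1 i2] by simp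
  also have "... \<le> (\<integral>v. \<bar>\<kappa>\<nu> u v * \<phi> (ix v) - \<kappa>\<nu> u v * (1 - ?G (snd v))\<bar> \<partial>\<nu>)" by (rule integral_abs_bound)
  also have "... \<le> (?W u)"
  proof (rule integral_mono[OF integrable_abs[OF B_integrable_diff[OF i1 i2]] i3])
   fix v assume v: "v \<in> space \<nu>"
   have "\<kappa>\<nu> u v * \<phi> (ix v) - \<kappa>\<nu> u v * (1 - ?G (snd v)) = \<kappa>\<nu> u v * (?G (snd v) - ?g (ix v))"
    using sp(1)[OF v] by (simp add: \<phi>_def algebra_simps)
   then show "\<bar>\<kappa>\<nu> u v * \<phi> (ix v) - \<kappa>\<nu> u v * (1 - ?G (snd v))\<bar> \<le> \<kappa>\<nu> u v * F v"
    using K.kernel_nonneg[OF u v] by (simp add: abs_mult F_def abs_minus_commute)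
  qed
  finally have 2: "\<bar>(\<integral>v. \<kappa>\<nu> u v * \<phi> (ix v) \<partial>\<nu>) - ?I\<bar> \<le> (?W u)" .
  have tri: "\<bar>x1 - x4\<bar> \<le> e1 + \<bar>x2 - x3\<bar> + e2" if "\<bar>x1 - x2\<bar> \<le> e1" "\<bar>x3 - x4\<bar> \<le> e2" for x1 x2 x3 x4 e1 e2 :: real
   using that by linarith
  show ?thesis by (rule order_trans[OF 0], unfold gap_integral[OF u t]) (rule tri[OF 1 2])
 qed
 have Bi: "integrable \<nu> (\<lambda>u. ?e (ix u) + \<bar>?H u\<bar> + (?W u))"
  by (intro B_integrable_add integrable_abs ix_integral(1) H(1) KF(1))
 have Ai: "integrable \<nu> (\<lambda>u. \<bar>mgf weight {..<n} s (Suc d) (ix u) - bp_pgf \<mu> \<kappa> s (Suc d) (snd u)\<bar>)"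
  using ixm[of "mgf weight {..<n} s (Suc d)"] Gm[of "Suc d"]
  by (intro B_integrable_bound[OF Bi]) (auto intro!: AE_I2 order_trans[OF pt] simp del: mgf.simps bp_pgf.simps)
 have "(\<integral>u. \<bar>mgf weight {..<n} s (Suc d) (ix u) - bp_pgf \<mu> \<kappa> s (Suc d) (snd u)\<bar> \<partial>\<nu>) \<le>
  (\<integral>u. ?e (ix u) + \<bar>?H u\<bar> + (?W u) \<partial>\<nu>)"
  by (rule integral_mono[OF Ai Bi pt])
 also have "... = (\<integral>u. ?e (ix u) \<partial>\<nu>) + (\<integral>u. \<bar>?H u\<bar> \<partial>\<nu>) + (\<integral>u. \<integral>v. \<kappa>\<nu> u v * F v \<partial>\<nu> \<partial>\<nu>)"
 proof -
  have add: "(\<integral>u. f u + g u + h u \<partial>\<nu>) = (\<integral>u. f u \<partial>\<nu>) + (\<integral>u. g u \<partial>\<nu>) + (\<integral>u. h u \<partial>\<nu>)"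
   if "integrable \<nu> f" "integrable \<nu> g" "integrable \<nu> h" for f g h :: "real \<times> 's => real"
   using that by simp
  show ?thesis by (rule add; intro ix_integral(1) integrable_abs H(1) KF(1))
 qed
 also have "... \<le> err L K' + \<eta> + (K * (\<integral>u. F u \<partial>\<nu>) + (\<integral>u. max 0 (offmass \<nu> \<kappa>\<nu> u - K) \<partial>\<nu>))"
  unfolding ix_integral(2)[of ?e] by (intro add_mono weight_error(2) H(2) KF(2) KL)
 finally show ?thesis unfolding offmass_tail_snd F_def by linarith
qed

end

text \<open>The average of \<open>mgf\<close> over the indices and \<open>mean_pgf\<close> are both
  integrals over the coupling space, so their difference is at most the L1 distance that
  \<open>mgf_step\<close> feeds into the Gronwall recursion. \<zeta> depends on the kernel, r and d
  only.\<close>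

lemma (in ker) matrix_pgf_limit:
 assumes "r > 0"
 obtains \<zeta> where "\<zeta> > 0" "\<And>n \<nu> a \<eta> K L s. coupled_matrix \<mu> \<kappa> n \<nu> a \<eta> ==> K \<ge> 0 ==> L \<ge> 0 ==>
  coupled_matrix.err \<mu> \<kappa> n \<eta> L K + \<eta> \<le> \<zeta> ==> 0 \<le> s ==> s \<le> 1 ==>
  \<bar>(\<Sum>i<n. mgf (coupled_matrix.weight n a) {..<n} s d i) / n - mean_pgf s d\<bar> \<le> r"
proof -
 from gronwall_truncated[of "\<lambda>K. \<integral>x. max 0 (offmass \<mu> \<kappa> x - K) \<partial>\<mu>", OF offmass_tail assms, of d]
 obtain \<zeta> where "\<zeta> > 0" and *: "\<And>D e. D 0 \<le> (0::real) ==> e \<le> \<zeta> ==>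
  (\<forall>d K. K \<ge> 0 \<longrightarrow> D (Suc d) \<le> e + K * D d + excess K) ==> D d \<le> r" by blast
 show ?thesis
 proof (rule that[OF \<open>\<zeta> > 0\<close>])
  fix n \<nu> a \<eta> K L s
  assume C: "coupled_matrix \<mu> \<kappa> n \<nu> a \<eta>" and KL: "K \<ge> 0" "L \<ge> 0"
   and e: "coupled_matrix.err \<mu> \<kappa> n \<eta> L K + \<eta> \<le> \<zeta>" and s: "0 \<le> s" "s \<le> (1::real)"
  interpret coupled_matrix \<mu> \<kappa> n \<nu> a \<eta> by (rule C)
  let ?g = "mgf weight {..<n} s" and ?G = "bp_pgf \<mu> \<kappa> s"
  let ?D = "\<lambda>d. \<integral>u. \<bar>?g d (ix u) - ?G d (snd u)\<bar> \<partial>\<nu>"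
  have D: "?D d \<le> r"
   by (rule *[of ?D, OF _ e]) (use mgf_step[OF s _ KL] in auto)
  have Gi: "integrable \<nu> (\<lambda>u. ?G d (snd u))"
  proof (rule N.integrable_const_bound[where B = 1])
   show "AE u in \<nu>. norm (?G d (snd u)) \<le> 1"
    using bp_pgf_bounds1[OF s] by (intro AE_I2) (auto simp: space_eq)
  qed measurable
  have "(\<Sum>i<n. ?g d i) / n - (\<integral>x. ?G d x \<partial>\<mu>) = (\<integral>u. ?g d (ix u) - ?G d (snd u) \<partial>\<nu>)"
   using ix_integral[of "?g d"] snd_integral[of "?G d"] Gi by simp
  then have "\<bar>(\<Sum>i<n. ?g d i) / n - (\<integral>x. ?G d x \<partial>\<mu>)\<bar> \<le> ?D d"
   using integral_abs_bound[of \<nu> "\<lambda>u. ?g d (ix u) - ?G d (snd u)"] by simp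
  then show "\<bar>(\<Sum>i<n. mgf (coupled_matrix.weight n a) {..<n} s d i) / n - mean_pgf s d\<bar> \<le> r"
   using D by linarith
 qed
qed

text \<open>The order of choices matters: K from the tail of the row masses, then L from the
  truncation error weighted with K + 1, then the cut tolerance, and n last, to absorb L / n.\<close>

lemma (in ker) matrix_error_small:
 assumes z: "\<zeta> > 0"
 obtains K L \<eta>0 where "K \<ge> 0" "L \<ge> 0" "\<eta>0 > 0" "\<And>\<eta>. \<eta> \<le> \<eta>0 ==> \<forall>\<^sub>F n in sequentially. \<forall>\<nu> a. coupled_matrix \<mu> \<kappa> n \<nu> a \<eta> \<longrightarrow>
  coupled_matrix.err \<mu> \<kappa> n \<eta> L K + \<eta> \<le> \<zeta>"
proof -
 have "\<zeta> / 4 > 0" using z by simp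
 from offmass_tail[OF this] obtain K where K: "K \<ge> 0" "excess K \<le> \<zeta> / 4" by blast
 have K1: "K + 1 > 0" "K + 3 > 0" using K by auto
 have "\<zeta> / 8 / (K + 1) > 0" using K1 z by simp
 then obtain L :: nat where L: "kdist (\<lambda>a b. min (\<kappa> a b) L) \<le> \<zeta> / 8 / (K + 1)" by (rule truncation_kdist)
 show ?thesis
 \<comment> \<open>\<eta> occurs in \<open>err\<close> with coefficient K + 2 and is added once
   more, which gives K + 3.\<close>
 proof (rule that[of K "real L" "\<zeta> / 8 / (K + 3)"])
  fix \<eta> assume \<eta>: "\<eta> \<le> \<zeta> / 8 / (K + 3)"
  have "(\<lambda>n. real L / real n) \<longlonglongrightarrow> 0" by (rule lim_const_over_n)
  from order_tendstoD(2)[OF this \<open>\<zeta> / 8 / (K + 1) > 0\<close>]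
  show "\<forall>\<^sub>F n in sequentially. \<forall>\<nu> a. coupled_matrix \<mu> \<kappa> n \<nu> a \<eta> \<longrightarrow> coupled_matrix.err \<mu> \<kappa> n \<eta> L K + \<eta> \<le> \<zeta>"
  proof eventually_elim
   case (elim n)
   have 1: "(K + 3) * \<eta> \<le> \<zeta> / 8" using \<eta> K1 by (simp only: pos_le_divide_eq mult.commute)
   have 2: "(K + 1) * kdist (\<lambda>a b. min (\<kappa> a b) L) \<le> \<zeta> / 8" using L K1 by (simp only: pos_le_divide_eq mult.commute)
   have 3: "(K + 1) * (real L / n) \<le> \<zeta> / 8" using elim K1 by (simp only: pos_less_divide_eq mult.commute less_imp_le)
   have "(K + 1) * (\<eta> + kdist (\<lambda>a b. min (\<kappa> a b) L) + real L / n) + (\<eta> + excess K) + \<eta> =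
    (K + 3) * \<eta> + (K + 1) * kdist (\<lambda>a b. min (\<kappa> a b) L) + (K + 1) * (real L / n) + excess K"
    by (simp only: distrib_left distrib_right)
   also have "... \<le> \<zeta>" using 1 2 3 K(2) z by linarith
   finally show ?case by (simp add: coupled_matrix.err_def)
  qed
 qed (use K K1 z in auto)
qed

section \<open>The cut distance as an infimum over couplings\<close>

context coupled
begin

definition cut_norm :: "(nat => nat => real) => real" where
 "cut_norm a = (SUP fg \<in> {(f, g). test f \<and> test g}. \<bar>cut_form a (fst fg) (snd fg)\<bar>)"

lemma cut_norm_eq:
 "(SUP fg \<in> {(f, g). f \<in> borel_measurable \<nu> \<and> g \<in> borel_measurable \<nu> \<and> (\<forall>z. \<bar>f z\<bar> \<le> 1) \<and> (\<forall>z. \<bar>g z\<bar> \<le> 1)}.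
  \<bar>\<integral>uv. (step_kernel n a (fst (fst uv)) (fst (snd uv)) - \<kappa> (snd (fst uv)) (snd (snd uv)))
   * fst fg (fst uv) * snd fg (snd uv) \<partial>(sqm \<nu>)\<bar>) = cut_norm a"
 unfolding cut_norm_def cut_form_def gap_def step_kernel_def ix_def test_def
 by (intro arg_cong[where f = Sup] image_cong) auto

lemma cut_form_bound:
 assumes "test f" "test g"
 shows "\<bar>cut_form a f g\<bar> \<le> (\<integral>z. \<bar>gap a (fst z) (snd z)\<bar> \<partial>(sqm \<nu>))"
proof -
 have "\<bar>cut_form a f g\<bar> \<le> (\<integral>z. \<bar>gap a (fst z) (snd z) * f (fst z) * g (snd z)\<bar> \<partial>(sqm \<nu>))"
  unfolding cut_form_def by (rule integral_abs_bound)
 also have "... \<le> (\<integral>z. \<bar>gap a (fst z) (snd z)\<bar> \<partial>(sqm \<nu>))"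
 proof (rule integral_mono[OF integrable_abs[OF weighted_integrable[OF gap_integrable assms]] integrable_abs[OF gap_integrable]])
  fix z
  have "\<bar>gap a (fst z) (snd z)\<bar> * \<bar>f (fst z)\<bar> * \<bar>g (snd z)\<bar> \<le> \<bar>gap a (fst z) (snd z)\<bar> * 1 * 1"
   using test_le[OF assms(1)] test_le[OF assms(2)] by (intro mult_mono) auto
  then show "\<bar>gap a (fst z) (snd z) * f (fst z) * g (snd z)\<bar> \<le> \<bar>gap a (fst z) (snd z)\<bar>" by (simp add: abs_mult)
 qed
 finally show ?thesis .
qed

lemma cut_form_le: "test f ==> test g ==> \<bar>cut_form a f g\<bar> \<le> cut_norm a"
 unfolding cut_norm_def
 by (rule cSUP_upper2[where x = "(f, g)"])
  (auto intro!: bdd_aboveI2[where M = "\<integral>z. \<bar>gap a (fst z) (snd z)\<bar> \<partial>(sqm \<nu>)"] cut_form_bound)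

lemma test_zero: "test (\<lambda>_. 0)"
 by (simp add: test_def)

lemma cut_norm_le:
 assumes "\<And>f g. test f ==> test g ==> \<bar>cut_form a f g\<bar> \<le> c"
 shows "cut_norm a \<le> c"
 unfolding cut_norm_def using test_zero by (intro cSUP_least) (auto intro: assms)

lemma cut_norm_nonneg: "0 \<le> cut_norm a"
 using cut_form_le[OF test_zero test_zero, of a] by (rule order_trans[OF abs_ge_zero])

text \<open>The matrix enters the cut form linearly and both test functions are bounded by 1 on a
  probability space.\<close>

lemma cut_norm_perturb:
 assumes r: "\<And>i j. i < n ==> j < n ==> \<bar>a i j - b i j\<bar> \<le> r"
 shows "cut_norm a \<le> cut_norm b + r"
proof (rule cut_norm_le)
 fix f g assume t: "test f" "test g"
 let ?P = "sqm \<nu>"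
 let ?d = "\<lambda>z. a (ix (fst z)) (ix (snd z)) - b (ix (fst z)) (ix (snd z))"
 have di: "integrable ?P (\<lambda>z. ?d z * f (fst z) * g (snd z))"
  using matrix_integrable[of "\<lambda>i j. a i j - b i j"] t by (rule weighted_integrable)
 have bi: "integrable ?P (\<lambda>z. gap b (fst z) (snd z) * f (fst z) * g (snd z))"
  using gap_integrable t by (rule weighted_integrable)
 have "cut_form a f g = (\<integral>z. gap b (fst z) (snd z) * f (fst z) * g (snd z) + ?d z * f (fst z) * g (snd z) \<partial>?P)"
  unfolding cut_form_def by (rule B_integral_cong) (auto simp: gap_def algebra_simps)
 also have "... = cut_form b f g + (\<integral>z. ?d z * f (fst z) * g (snd z) \<partial>?P)"
  unfolding cut_form_def by (rule B_integral_add[OF bi di])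
 finally have eq: "cut_form a f g = cut_form b f g + (\<integral>z. ?d z * f (fst z) * g (snd z) \<partial>?P)" .
 have "\<bar>\<integral>z. ?d z * f (fst z) * g (snd z) \<partial>?P\<bar> \<le> (\<integral>z. \<bar>?d z * f (fst z) * g (snd z)\<bar> \<partial>?P)"
  by (rule integral_abs_bound)
 also have "... \<le> (\<integral>z. r \<partial>?P)"
 proof (rule integral_mono[OF integrable_abs[OF di]])
  fix z assume z: "z \<in> space ?P"
  then have "\<bar>?d z\<bar> \<le> r" by (auto simp: space_pair_measure intro!: r ix_less)
  then have "\<bar>?d z\<bar> * \<bar>f (fst z)\<bar> * \<bar>g (snd z)\<bar> \<le> r * 1 * 1"
   using test_le[OF t(1)] test_le[OF t(2)] by (intro mult_mono) auto
  then show "\<bar>?d z * f (fst z) * g (snd z)\<bar> \<le> r" by (simp add: abs_mult)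
 qed simp
 also have "... = r" by (simp add: NN.P.prob_space)
 finally show "\<bar>cut_form a f g\<bar> \<le> cut_norm b + r"
  unfolding eq using cut_form_le[OF t, of b] by linarith
qed

end

context ker
begin

lemma cut_dist_eq:
 assumes n: "n > 0"
 shows "cut_dist I01 (step_kernel n a) \<mu> \<kappa> = (INF \<nu>\<in>{\<nu>. coupling I01 \<mu> \<nu>}. coupled.cut_norm \<kappa> n \<nu> a)"
 unfolding cut_dist_def
proof (intro arg_cong[where f = Inf] image_cong refl)
 fix \<nu> assume "\<nu> \<in> {\<nu>. coupling I01 \<mu> \<nu>}"
 then interpret coupled \<mu> \<kappa> n \<nu> using n by unfold_locales auto
 show "(SUP fg \<in> {(f, g). f \<in> borel_measurable \<nu> \<and> g \<in> borel_measurable \<nu> \<and> (\<forall>z. \<bar>f z\<bar> \<le> 1) \<and> (\<forall>z. \<bar>g z\<bar> \<le> 1)}.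
  \<bar>\<integral>uv. (step_kernel n a (fst (fst uv)) (fst (snd uv)) - \<kappa> (snd (fst uv)) (snd (snd uv)))
   * fst fg (fst uv) * snd fg (snd uv) \<partial>(sqm \<nu>)\<bar>) = coupled.cut_norm \<kappa> n \<nu> a" by (rule cut_norm_eq)
qed

text \<open>The product coupling. It makes the set of couplings non-empty, which the infima in the
  cut distance rely on.\<close>

lemma coupling_exists:
 assumes "prob_space \<mu>"
 shows "coupling I01 \<mu> (I01 \<Otimes>\<^sub>M \<mu>)"
proof -
 interpret I: prob_space I01 by (rule prob_space_I01)
 interpret S: prob_space \<mu> by (rule assms)
 interpret P: pair_prob_space I01 \<mu> ..
 have "distr (I01 \<Otimes>\<^sub>M \<mu>) I01 fst = I01" by (rule S.distr_pair_fst)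
 moreover have "distr (I01 \<Otimes>\<^sub>M \<mu>) \<mu> snd = \<mu>"
 proof (rule measure_eqI)
  fix A assume "A \<in> sets (distr (I01 \<Otimes>\<^sub>M \<mu>) \<mu> snd)"
  then have A: "A \<in> sets \<mu>" by simp
  have "snd -` A \<inter> space (I01 \<Otimes>\<^sub>M \<mu>) = space I01 \<times> A"
   using sets.sets_into_space[OF A] by (auto simp: space_pair_measure)
  then show "emeasure (distr (I01 \<Otimes>\<^sub>M \<mu>) \<mu> snd) A = emeasure \<mu> A"
   using A by (simp add: emeasure_distr emeasure_pair_measure_Times I.emeasure_space_1)
 qed simp
 ultimately show ?thesis by (simp add: coupling_def P.prob_space_axioms)
qed

lemma cut_dist_perturb:
 assumes S: "prob_space \<mu>" and n: "n > 0" and r: "\<And>i j. i < n ==> j < n ==> \<bar>a i j - b i j\<bar> \<le> r"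
 shows "cut_dist I01 (step_kernel n a) \<mu> \<kappa> \<le> cut_dist I01 (step_kernel n b) \<mu> \<kappa> + r"
proof -
 let ?C = "{\<nu>. coupling I01 \<mu> \<nu>}"
 have co: "coupled \<mu> \<kappa> n \<nu>" if "\<nu> \<in> ?C" for \<nu> using that n by unfold_locales auto
 have "(INF \<nu>\<in>?C. coupled.cut_norm \<kappa> n \<nu> a) - r \<le> (INF \<nu>\<in>?C. coupled.cut_norm \<kappa> n \<nu> b)"
 proof (rule cINF_greatest)
  show "?C \<noteq> {}" using coupling_exists[OF S] by auto
  fix \<nu> assume \<nu>: "\<nu> \<in> ?C"
  have "(INF \<nu>\<in>?C. coupled.cut_norm \<kappa> n \<nu> a) \<le> coupled.cut_norm \<kappa> n \<nu> a"
   using \<nu> coupled.cut_norm_nonneg[OF co] by (intro cINF_lower bdd_belowI2[where m = 0]) auto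
  also have "... \<le> coupled.cut_norm \<kappa> n \<nu> b + r" by (rule coupled.cut_norm_perturb[OF co[OF \<nu>] r])
  finally show "(INF \<nu>\<in>?C. coupled.cut_norm \<kappa> n \<nu> a) - r \<le> coupled.cut_norm \<kappa> n \<nu> b" by simp
 qed
 then show ?thesis by (simp add: cut_dist_eq[OF n])
qed

text \<open>The infimum over couplings may not be attained; the strict inequality provides one
  coupling whose cut norm is already below \<eta>.\<close>

lemma coupled_matrixI:
 assumes S: "prob_space \<mu>" and n: "n > 0" and lt: "cut_dist I01 (step_kernel n a) \<mu> \<kappa> < \<eta>"
  and a: "\<And>i j. i < n ==> j < n ==> a i j = a j i \<and> 0 \<le> a i j"
 shows "\<exists>\<nu>. coupled_matrix \<mu> \<kappa> n \<nu> a \<eta>"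
proof -
 let ?C = "{\<nu>. coupling I01 \<mu> \<nu>}"
 have "(INF \<nu>\<in>?C. coupled.cut_norm \<kappa> n \<nu> a) < \<eta>" using lt by (simp add: cut_dist_eq[OF n])
 then obtain \<nu> where \<nu>: "\<nu> \<in> ?C" "coupled.cut_norm \<kappa> n \<nu> a < \<eta>"
  using cInf_lessD[of "(\<lambda>\<nu>. coupled.cut_norm \<kappa> n \<nu> a) ` ?C" \<eta>] coupling_exists[OF S] by auto
 interpret coupled \<mu> \<kappa> n \<nu> using \<nu>(1) n by unfold_locales auto
 have "coupled_matrix \<mu> \<kappa> n \<nu> a \<eta>"
 proof
  show "\<bar>cut_form a f g\<bar> \<le> \<eta>" if "test f" "test g" for f g using cut_form_le[OF that, of a] \<nu>(2) by linarith
 qed (use a in auto)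
 then show ?thesis ..
qed

text \<open>The cut distance is Lipschitz in the matrix entries, so it suffices to test rational matrices.\<close>
lemma cut_dist_measurable:
 assumes S: "prob_space \<mu>" and n: "n > 0" and A [measurable]: "\<And>i j. (\<lambda>w. A w i j) \<in> borel_measurable M"
 shows "{w \<in> space M. e < cut_dist I01 (step_kernel n (A w)) \<mu> \<kappa>} \<in> sets M"
proof -
 let ?cd = "\<lambda>a. cut_dist I01 (step_kernel n a) \<mu> \<kappa>"
 \<comment> \<open>Rational matrices are stored row by row in lists, so that only countably many
   matrices and tolerances occur in \<open>T\<close>.\<close>
 define Q where "Q xs i j = real_of_rat (xs ! (i * n + j))" for xs :: "rat list" and i j
 define T where "T = {(xs, q :: rat). e < ?cd (Q xs) - real_of_rat q}"
 have eq: "{w \<in> space M. e < ?cd (A w)} =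
  (\<Union>(xs, q)\<in>T. {w \<in> space M. \<forall>i<n. \<forall>j<n. \<bar>A w i j - Q xs i j\<bar> \<le> real_of_rat q})"
 proof (intro set_eqI iffI)
  fix w assume "w \<in> {w \<in> space M. e < ?cd (A w)}"
  then have om: "w \<in> space M" and lt: "0 < (?cd (A w) - e) / 2" by auto
  obtain q :: rat where q: "0 < real_of_rat q" "real_of_rat q < (?cd (A w) - e) / 2"
   using of_rat_dense[OF lt] by blast
  have "\<exists>t::rat. \<bar>A w i j - real_of_rat t\<bar> \<le> real_of_rat q" for i j
  proof -
   obtain t where "A w i j < real_of_rat t" "real_of_rat t < A w i j + real_of_rat q"
    using of_rat_dense[of "A w i j" "A w i j + real_of_rat q"] q by auto
   then show ?thesis by (intro exI[of _ t]) auto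
  qed
  then obtain t where t: "\<And>i j. \<bar>A w i j - real_of_rat (t i j)\<bar> \<le> real_of_rat q" by metis
  define xs where "xs = map (\<lambda>k. t (k div n) (k mod n)) [0..<n * n]"
  have Qt: "Q xs i j = real_of_rat (t i j)" if "i < n" "j < n" for i j
  proof -
   have "i * n + j < n * n"
   proof -
    have "i * n + j < i * n + n" using that by simp
    also have "... = Suc i * n" by simp
    also have "... \<le> n * n" using that by (intro mult_le_mono1) simp
    finally show ?thesis .
   qed
   then show ?thesis using that by (simp add: Q_def xs_def)
  qed
  have c: "\<forall>i<n. \<forall>j<n. \<bar>A w i j - Q xs i j\<bar> \<le> real_of_rat q" using t Qt by simp
  then have "?cd (A w) \<le> ?cd (Q xs) + real_of_rat q" by (intro cut_dist_perturb[OF S n]) auto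
  then have "(xs, q) \<in> T" using q by (simp add: T_def)
  then show "w \<in> (\<Union>(xs, q)\<in>T. {w \<in> space M. \<forall>i<n. \<forall>j<n. \<bar>A w i j - Q xs i j\<bar> \<le> real_of_rat q})"
   using c om by blast
 next
  fix w assume "w \<in> (\<Union>(xs, q)\<in>T. {w \<in> space M. \<forall>i<n. \<forall>j<n. \<bar>A w i j - Q xs i j\<bar> \<le> real_of_rat q})"
  then obtain xs q where x: "(xs, q) \<in> T" "w \<in> space M" "\<forall>i<n. \<forall>j<n. \<bar>A w i j - Q xs i j\<bar> \<le> real_of_rat q" by blast
  then have "?cd (Q xs) \<le> ?cd (A w) + real_of_rat q"
   by (intro cut_dist_perturb[OF S n]) (auto simp: abs_minus_commute)
  then show "w \<in> {w \<in> space M. e < ?cd (A w)}" using x by (simp add: T_def)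
 qed
 have "countable T" by simp
 then show ?thesis unfolding eq
 proof (rule sets.countable_UN'')
  fix z assume "z \<in> T"
  have "{w \<in> space M. \<forall>i<n. \<forall>j<n. \<bar>A w i j - Q (fst z) i j\<bar> \<le> real_of_rat (snd z)} \<in> sets M" by measurable
  then show "(case z of (xs, q) => {w \<in> space M. \<forall>i<n. \<forall>j<n. \<bar>A w i j - Q xs i j\<bar> \<le> real_of_rat q}) \<in> sets M"
   by (simp add: case_prod_unfold)
 qed
qed

end

section \<open>Divergence for matrices converging in cut distance\<close>

theorem suscept_concl_matrix:
 fixes A :: "nat => 'w => nat => nat => real"
 assumes M: "prob_space M" and S: "prob_space \<mu>" and k: "kernel \<mu> \<kappa>"
  and A: "\<And>n w i j. w \<in> space M ==> i < n ==> j < n ==> A n w i j = A n w j i \<and> 0 \<le> A n w i j"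
  and Am: "\<And>n i j. (\<lambda>w. A n w i j) \<in> borel_measurable M"
  and lim: "\<And>r. r > 0 ==> (\<lambda>n. measure M {w\<in>space M. r < cut_dist I01 (step_kernel n (A n w)) \<mu> \<kappa>}) \<longlonglongrightarrow> 0"
 shows "suscept_concl \<mu> \<kappa> M (\<lambda>n w. n) (\<lambda>n w i j. min (A n w i j / real n) 1)"
proof -
 interpret M: prob_space M by (rule M)
 interpret S: prob_space \<mu> by (rule S)
 interpret ker \<mu> \<kappa> by unfold_locales (rule k)
 define p where "p n w i j = (if i = j then 0 else min (A n w i j / real n) 1)" for n w i j
 have p_eq: "coupled_matrix.weight n (A n w) = p n w" if "coupled_matrix \<mu> \<kappa> n \<nu> (A n w) \<eta>" for n w \<nu> \<eta>
  using coupled_matrix.weight_def[OF that] by (simp add: p_def fun_eq_iff)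
 have close: "whp M (\<lambda>n w. \<exists>\<nu>. coupled_matrix \<mu> \<kappa> n \<nu> (A n w) \<eta>)" if "\<eta> > 0" for \<eta>
 proof -
  \<comment> \<open>Half of \<eta>, because \<open>coupled_matrixI\<close> asks for a strict
    inequality.\<close>
  have "\<eta> / 2 > 0" using that by simp
  have m: "{w \<in> space M. \<eta> / 2 < cut_dist I01 (step_kernel n (A n w)) \<mu> \<kappa>} \<in> sets M" if "n > 0" for n
   by (rule cut_dist_measurable[OF S that Am])
  have "whp M (\<lambda>n w. cut_dist I01 (step_kernel n (A n w)) \<mu> \<kappa> \<le> \<eta> / 2)"
  proof (rule M.whp_measureI)
   show "\<forall>\<^sub>F n in sequentially. {w \<in> space M. \<not> cut_dist I01 (step_kernel n (A n w)) \<mu> \<kappa> \<le> \<eta> / 2} \<in> sets M"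
    unfolding not_le by (rule eventually_mono[OF eventually_gt_at_top[of 0] m])
  qed (use lim[OF \<open>\<eta> / 2 > 0\<close>] in \<open>simp add: not_le\<close>)
  then show ?thesis
  proof (rule whp_mono, intro eventually_mono[OF eventually_gt_at_top[of 0]] ballI impI)
   fix n :: nat and w assume "0 < n" "w \<in> space M" "cut_dist I01 (step_kernel n (A n w)) \<mu> \<kappa> \<le> \<eta> / 2"
   then show "\<exists>\<nu>. coupled_matrix \<mu> \<kappa> n \<nu> (A n w) \<eta>"
    using that by (intro coupled_matrixI[OF S _ _ A]) auto
  qed
 qed
 have "suscept_concl \<mu> \<kappa> M (\<lambda>n w. n) p"
 proof (rule suscept_conclI[OF M])
  show "edge_prob n (p n w)" if "w \<in> space M" for n w
  proof
   show "p n w i j = p n w j i" if "i < n" "j < n" for i j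
    using A[OF \<open>w \<in> space M\<close> that] by (simp add: p_def)
  qed (use A[OF that] in \<open>auto simp: p_def\<close>)
 next
  have "conv0 M (\<lambda>n w. \<bar>real n / n - 1\<bar>)"
   by (rule M.conv0_const, rule tendsto_eventually, rule eventually_mono[OF eventually_gt_at_top[of 0]]) simp
  then show "conv0 M (\<lambda>n w. \<bar>real n / n - total\<bar>)" by (simp add: S.prob_space)
 next
  fix r :: real assume e: "r > 0"
  then have e2: "r / 2 > 0" by simp
  from offmass_tail[OF e2] obtain K where K: "K \<ge> 0" "excess K \<le> r / 2" by blast
  show "\<exists>K\<ge>0. whp M (\<lambda>n w. row_excess n n (p n w) K \<le> r)"
  proof (intro exI[of _ K] conjI K(1) whp_mono[OF close[OF e2]] always_eventually allI ballI impI)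
   fix n w assume om: "w \<in> space M" and "\<exists>\<nu>. coupled_matrix \<mu> \<kappa> n \<nu> (A n w) (r / 2)"
   then obtain \<nu> where "coupled_matrix \<mu> \<kappa> n \<nu> (A n w) (r / 2)" by blast
   then interpret coupled_matrix \<mu> \<kappa> n \<nu> "A n w" "r / 2" .
   have "(\<Sum>j<n. p n w i j) \<le> row i" if "i < n" for i
    unfolding sum_divide_distrib using a_nonneg that by (intro sum_mono) (auto simp: p_def)
   then have "row_excess n n (p n w) K \<le> (\<Sum>i<n. max 0 (row i - K)) / n"
    by (intro divide_right_mono sum_mono max.mono) auto
   then show "row_excess n n (p n w) K \<le> r" using row_tail[of K] K(2) by linarith
  qed
 next
  show "conv0 M (\<lambda>n w. (\<Sum>i<n. \<Sum>j<n. (p n w i j)\<^sup>2) / n)"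
   unfolding conv0_def
  proof (intro allI impI)
   fix r :: real assume "r > 0"
   then obtain K L \<eta>0 where KL: "K \<ge> 0" "L \<ge> 0" "\<eta>0 > 0"
    "\<And>\<eta>. \<eta> \<le> \<eta>0 ==> \<forall>\<^sub>F n in sequentially. \<forall>\<nu> a. coupled_matrix \<mu> \<kappa> n \<nu> a \<eta> \<longrightarrow> coupled_matrix.err \<mu> \<kappa> n \<eta> L K + \<eta> \<le> r"
    by (rule matrix_error_small) blast
   show "whp M (\<lambda>n w. (\<Sum>i<n. \<Sum>j<n. (p n w i j)\<^sup>2) / n \<le> r)"
   proof (intro whp_mono[OF close[OF KL(3)]] eventually_mono[OF KL(4)[OF order_refl]] ballI impI)
    fix n w assume e: "\<forall>\<nu> a. coupled_matrix \<mu> \<kappa> n \<nu> a \<eta>0 \<longrightarrow> coupled_matrix.err \<mu> \<kappa> n \<eta>0 L K + \<eta>0 \<le> r"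
     and "\<exists>\<nu>. coupled_matrix \<mu> \<kappa> n \<nu> (A n w) \<eta>0"
    then obtain \<nu> where C: "coupled_matrix \<mu> \<kappa> n \<nu> (A n w) \<eta>0" by blast
    show "(\<Sum>i<n. \<Sum>j<n. (p n w i j)\<^sup>2) / n \<le> r"
     using coupled_matrix.weight_error(1)[OF C KL(1,2)] e C KL(3) unfolding p_eq[OF C] by fastforce
   qed
  qed
 next
  fix s d assume s: "0 < s" "s < (1::real)"
  show "conv0 M (\<lambda>n w. \<bar>(\<Sum>v<n. mgf (p n w) {..<n} s d v) / n - mean_pgf s d\<bar>)"
   unfolding conv0_def
  proof (intro allI impI)
   fix r :: real assume "r > 0"
   then obtain \<zeta> where \<zeta>: "\<zeta> > 0" "\<And>n \<nu> a \<eta> K L s. coupled_matrix \<mu> \<kappa> n \<nu> a \<eta> ==> K \<ge> 0 ==> L \<ge> 0 ==>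
    coupled_matrix.err \<mu> \<kappa> n \<eta> L K + \<eta> \<le> \<zeta> ==> 0 \<le> s ==> s \<le> 1 ==>
    \<bar>(\<Sum>i<n. mgf (coupled_matrix.weight n a) {..<n} s d i) / n - mean_pgf s d\<bar> \<le> r"
    by (rule matrix_pgf_limit) blast
   obtain K L \<eta>0 where KL: "K \<ge> 0" "L \<ge> 0" "\<eta>0 > 0"
    "\<And>\<eta>. \<eta> \<le> \<eta>0 ==> \<forall>\<^sub>F n in sequentially. \<forall>\<nu> a. coupled_matrix \<mu> \<kappa> n \<nu> a \<eta> \<longrightarrow> coupled_matrix.err \<mu> \<kappa> n \<eta> L K + \<eta> \<le> \<zeta>"
    using \<zeta>(1) by (rule matrix_error_small) blast
   show "whp M (\<lambda>n w. \<bar>(\<Sum>v<n. mgf (p n w) {..<n} s d v) / n - mean_pgf s d\<bar> \<le> r)"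
   proof (intro whp_mono[OF close[OF KL(3)]] eventually_mono[OF KL(4)[OF order_refl]] ballI impI)
    fix n w assume e: "\<forall>\<nu> a. coupled_matrix \<mu> \<kappa> n \<nu> a \<eta>0 \<longrightarrow> coupled_matrix.err \<mu> \<kappa> n \<eta>0 L K + \<eta>0 \<le> \<zeta>"
     and "\<exists>\<nu>. coupled_matrix \<mu> \<kappa> n \<nu> (A n w) \<eta>0"
    then obtain \<nu> where C: "coupled_matrix \<mu> \<kappa> n \<nu> (A n w) \<eta>0" by blast
    then have "coupled_matrix.err \<mu> \<kappa> n \<eta>0 L K + \<eta>0 \<le> \<zeta>" using e by blast
    from \<zeta>(2)[OF C KL(1,2) this] s
    show "\<bar>(\<Sum>v<n. mgf (p n w) {..<n} s d v) / n - mean_pgf s d\<bar> \<le> r"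
     unfolding p_eq[OF C] by simp
   qed
  qed
 qed
 then show ?thesis unfolding p_def by (rule suscept_concl_diag[THEN iffD2])
qed

section \<open>The three models together\<close>

theorem theorem4p5:
 shows
 "(\<forall>(M::'w1 measure) (\<mu>::'s1 measure) (\<kappa>::'s1 \<Rightarrow> 's1 \<Rightarrow> real) (A::nat \<Rightarrow> 'w1 \<Rightarrow> nat \<Rightarrow> nat \<Rightarrow> real).
   prob_space M \<and> prob_space \<mu> \<and> kernel \<mu> \<kappa> \<and>
   (\<forall>n \<omega> i j. \<omega> \<in> space M \<and> i < n \<and> j < n \<longrightarrow> A n \<omega> i j = A n \<omega> j i \<and> 0 \<le> A n \<omega> i j) \<and>
   (\<forall>n i j. (\<lambda>\<omega>. A n \<omega> i j) \<in> borel_measurable M) \<and>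
   (\<forall>\<epsilon>>0. (\<lambda>n. measure M {\<omega>\<in>space M. \<epsilon> < cut_dist I01 (step_kernel n (A n \<omega>)) \<mu> \<kappa>})
         \<longlonglongrightarrow> 0)
   \<longrightarrow> suscept_concl \<mu> \<kappa> M (\<lambda>n \<omega>. n) (\<lambda>n \<omega> i j. min (A n \<omega> i j / real n) 1))
\<and> (\<forall>(M::'w2 measure) (\<mu>::'s2::{metric_space,second_countable_topology} measure)
   (\<kappa>::'s2 \<Rightarrow> 's2 \<Rightarrow> real) (\<kappa>s::nat \<Rightarrow> 's2 \<Rightarrow> 's2 \<Rightarrow> real) v x.
   gen_vertex_space \<mu> M v x \<and> kernel \<mu> \<kappa> \<and> (\<forall>n. symker \<mu> (\<kappa>s n)) \<and>
   graphical_seq \<mu> M v x \<kappa>s \<kappa>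
   \<longrightarrow> suscept_concl \<mu> \<kappa> M v (\<lambda>n \<omega> i j. min (\<kappa>s n (x n \<omega> i) (x n \<omega> j) / real n) 1))
\<and> (\<forall>(M::'w3 measure) (\<mu>::'s3 measure) (\<kappa>::'s3 \<Rightarrow> 's3 \<Rightarrow> real) (\<kappa>s::nat \<Rightarrow> 's3 \<Rightarrow> 's3 \<Rightarrow> real) x.
   iid_vertex_space \<mu> M x \<and> kernel \<mu> \<kappa> \<and> (\<forall>n. symker \<mu> (\<kappa>s n)) \<and>
   (\<lambda>n. \<integral>\<^sup>+z. ennreal \<bar>\<kappa>s n (fst z) (snd z) - \<kappa> (fst z) (snd z)\<bar> \<partial>(\<mu> \<Otimes>\<^sub>M \<mu>)) \<longlonglongrightarrow> 0
   \<longrightarrow> suscept_concl \<mu> \<kappa> M (\<lambda>n \<omega>. n) (\<lambda>n \<omega> i j. min (\<kappa>s n (x n \<omega> i) (x n \<omega> j) / real n) 1))"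
proof (intro conjI allI impI)
 fix M :: "'w1 measure" and \<mu> :: "'s1 measure" and \<kappa> A
 assume "prob_space M \<and> prob_space \<mu> \<and> kernel \<mu> \<kappa> \<and>
   (\<forall>n \<omega> i j. \<omega> \<in> space M \<and> i < n \<and> j < n \<longrightarrow> A n \<omega> i j = A n \<omega> j i \<and> 0 \<le> A n \<omega> i j) \<and>
   (\<forall>n i j. (\<lambda>\<omega>. A n \<omega> i j) \<in> borel_measurable M) \<and>
   (\<forall>\<epsilon>>0. (\<lambda>n. measure M {\<omega>\<in>space M. \<epsilon> < cut_dist I01 (step_kernel n (A n \<omega>)) \<mu> \<kappa>}) \<longlonglongrightarrow> 0)"
 then show "suscept_concl \<mu> \<kappa> M (\<lambda>n \<omega>. n) (\<lambda>n \<omega> i j. min (A n \<omega> i j / real n) 1)"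
  by (intro suscept_concl_matrix) blast+
qed (blast intro: suscept_concl_graphical suscept_concl_iid)+

end
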